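(* Let $A=(a_{ij})$ be a $d\times n$ integer matrix of rank $d$ with $n-d=2$, whose columns lie in $\{1\}\times\mathbb{Z}^{d-1}$ and span $\mathbb{Z}^d$, such that the toric ideal $I_A$ is not Cohen–Macaulay. Let $B=(b_{ji})$ be an $n\times 2$ integer matrix whose columns $B_1,B_2$ form a $\mathbb{Z}$-basis of $\ker_{\mathbb{Z}}(A)$ (a Gale diagram of $A$) whose first four rows meet each of the four open quadrants of $\mathbb{Z}^2$, namely $b_{11},b_{12}>0$; $b_{21}<0<b_{22}$; $b_{31},b_{32}<0$; $b_{41}>0>b_{42}$; and assume moreover that, if the second and fourth rows of $B$ are linearly independent, the cone $\{z\in\mathbb{R}^2:(Bz)_2\ge0,(Bz)_4\ge0\}$ is contained in the first quadrant of $\mathbb{R}^2$. Put $v_1=b_{11}+b_{12}-1$, $v_2=b_{22}-1$, $v_4=b_{41}-1$. If $n>4$, then the $(n-4)$-dimensional affine space \[ \Big\{ A\cdot\Big(v_1e_1+v_2e_2-e_3+v_4e_4+\sum_{i=5}^n s_ie_i\Big) : (s_5,\dots,s_n)\in\mathbb{C}^{n-4}\Big\} \] is contained in the exceptional set $\mathcal{E}(A)$. In particular, $\mathcal{E}(A)$ is an infinite set.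
   Context: $D$ is the Weyl algebra over $\mathbb{C}$ in $x_1,\dots,x_n,\partial_1,\dots,\partial_n$. The toric ideal $I_A\subset\mathbb{C}[\partial_1,\dots,\partial_n]$ is generated by $\partial^u-\partial^{u'}$ for $u,u'\in\mathbb{N}^n$ with $Au=Au'$. For $\beta\in\mathbb{C}^d$, $H_A(\beta)$ is the left ideal of $D$ generated by $I_A$ and the homogeneities $\sum_{j=1}^n a_{ij}x_j\partial_j-\beta_i$, $i=1,\dots,d$; $\operatorname{rank}(H_A(\beta))$ is the dimension of its space of holomorphic solutions near a generic nonsingular point. $\operatorname{vol}(A)$ is the normalized volume of $\operatorname{conv}$ of the columns of $A$. The exceptional set is $\mathcal{E}(A)=\{\beta\in\mathbb{C}^d:\operatorname{rank}(H_A(\beta))>\operatorname{vol}(A)\}$. $e_i$ denotes the $i$-th standard basis vector. *)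

theory Defs
  imports
    "HOL-Analysis.Analysis"
    "HOL-Library.Poly_Mapping"
    "HOL-Algebra.Algebraic_Closure_Type"
begin

section \<open>Cohen--Macaulay rings\<close>

definition regular_sequence :: "('a, 'b) ring_scheme \<Rightarrow> 'a list \<Rightarrow> bool" where
  "regular_sequence R xs \<longleftrightarrow>
     set xs \<subseteq> carrier R \<and>
     (\<forall>i < length xs. \<forall>r \<in> carrier R.
        (xs ! i) \<otimes>\<^bsub>R\<^esub> r \<in> Idl\<^bsub>R\<^esub> (set (take i xs)) \<longrightarrow> r \<in> Idl\<^bsub>R\<^esub> (set (take i xs))) \<and>
     Idl\<^bsub>R\<^esub> (set xs) \<noteq> carrier R"

definition ideal_depth :: "('a, 'b) ring_scheme \<Rightarrow> 'a set \<Rightarrow> enat" where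
  "ideal_depth R I = Sup {enat (length xs) | xs. regular_sequence R xs \<and> set xs \<subseteq> I}"

definition prime_height :: "('a, 'b) ring_scheme \<Rightarrow> 'a set \<Rightarrow> enat" where
  "prime_height R P = Sup {enat k | k. \<exists>Q :: nat \<Rightarrow> 'a set.
     (\<forall>i \<le> k. primeideal (Q i) R) \<and> (\<forall>i < k. Q i \<subset> Q (Suc i)) \<and> Q k = P}"

text \<open>
  The localisation-free form of the definition (as in Eisenbud, Section 18.2):
  depth equals codimension at every maximal ideal.
\<close>
definition cohen_macaulay_ring :: "('a, 'b) ring_scheme \<Rightarrow> bool" where
  "cohen_macaulay_ring R \<longleftrightarrow> cring R \<and> noetherian_ring R \<and>
     (\<forall>P. maximalideal P R \<longrightarrow> ideal_depth R P = prime_height R P)"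


section \<open>Polynomials and toric ideals\<close>

text \<open>Polynomials over the complex numbers in variables indexed by \<open>'n\<close>; keys are exponent vectors.\<close>
type_synonym 'n cpoly = "(nat ^ 'n) \<Rightarrow>\<^sub>0 complex"

definition monom_eval :: "nat ^ 'n \<Rightarrow> complex ^ 'n \<Rightarrow> complex" where
  "monom_eval a x = (\<Prod>j\<in>UNIV. (x $ j) ^ (a $ j))"

definition cpoly_eval :: "('n::finite) cpoly \<Rightarrow> complex ^ 'n \<Rightarrow> complex" where
  "cpoly_eval q x = (\<Sum>a\<in>Poly_Mapping.keys q. Poly_Mapping.lookup q a * monom_eval a x)"

definition int_vec :: "nat ^ 'n \<Rightarrow> int ^ 'n" where
  "int_vec u = (\<chi> j. int (u $ j))"

definition toric_ideal :: "int ^ 'n ^ 'd \<Rightarrow> ('n::finite) cpoly set" where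
  "toric_ideal A = Idl\<^bsub>ring_of_type_algebra\<^esub>
     {Poly_Mapping.single u 1 - Poly_Mapping.single u' 1 | u u'. A *v int_vec u = A *v int_vec u'}"

definition cohen_macaulay_ideal :: "('n::finite) cpoly set \<Rightarrow> bool" where
  "cohen_macaulay_ideal I \<longleftrightarrow> cohen_macaulay_ring (ring_of_type_algebra Quot I)"


section \<open>The Weyl algebra\<close>

text \<open>
  Elements are stored in normal form: the coefficient at the key \<open>(a, b)\<close> is that of
  \<open>x\<^sup>a \<partial>\<^sup>b\<close>. The product of the Weyl algebra is \<open>\<star>\<close> below.
\<close>
type_synonym 'n weyl = "((nat ^ 'n) \<times> (nat ^ 'n)) \<Rightarrow>\<^sub>0 complex"

text \<open>
  Leibniz rule:
  \<open>x\<^sup>a \<partial>\<^sup>b x\<^sup>c \<partial>\<^sup>e = \<Sum>k. k! (b choose k) (c choose k) x\<^sup>a\<^sup>+\<^sup>c\<^sup>-\<^sup>k \<partial>\<^sup>b\<^sup>+\<^sup>e\<^sup>-\<^sup>k\<close> with multi-indices \<open>k \<le> b\<close>, \<open>k \<le> c\<close>.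
\<close>
definition weyl_monom_mult ::
    "(nat ^ 'n) \<times> (nat ^ 'n) \<Rightarrow> (nat ^ 'n) \<times> (nat ^ 'n) \<Rightarrow> ('n::finite) weyl" where
  "weyl_monom_mult = (\<lambda>(a, b) (c, e). \<Sum>k | k \<le> b \<and> k \<le> c.
     Poly_Mapping.single (a + (c - k), (b - k) + e)
       (\<Prod>j\<in>UNIV. of_nat (fact (k $ j) * (b $ j choose k $ j) * (c $ j choose k $ j))))"

definition weyl_scale :: "complex \<Rightarrow> ('n::finite) weyl \<Rightarrow> 'n weyl" where
  "weyl_scale z = Poly_Mapping.map ((*) z)"

definition weyl_mult :: "('n::finite) weyl \<Rightarrow> 'n weyl \<Rightarrow> 'n weyl" (infixl "\<star>" 70) where
  "P \<star> Q = (\<Sum>s\<in>Poly_Mapping.keys P. \<Sum>t\<in>Poly_Mapping.keys Q.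
     weyl_scale (Poly_Mapping.lookup P s * Poly_Mapping.lookup Q t) (weyl_monom_mult s t))"

definition weyl_const :: "complex \<Rightarrow> ('n::finite) weyl" where
  "weyl_const z = Poly_Mapping.single (0, 0) z"

definition weyl_x :: "'n \<Rightarrow> ('n::finite) weyl" where
  "weyl_x j = Poly_Mapping.single (axis j 1, 0) 1"

definition weyl_d :: "'n \<Rightarrow> ('n::finite) weyl" where
  "weyl_d j = Poly_Mapping.single (0, axis j 1) 1"

definition weyl_left_ideal :: "('n::finite) weyl set \<Rightarrow> bool" where
  "weyl_left_ideal I \<longleftrightarrow> 0 \<in> I \<and> (\<forall>P\<in>I. \<forall>Q\<in>I. P + Q \<in> I) \<and> (\<forall>P. \<forall>Q\<in>I. P \<star> Q \<in> I)"

definition weyl_left_ideal_gen :: "('n::finite) weyl set \<Rightarrow> 'n weyl set" where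
  "weyl_left_ideal_gen S = \<Inter>{I. weyl_left_ideal I \<and> S \<subseteq> I}"

lemma weyl_scale_single: "weyl_scale z (Poly_Mapping.single s w) = Poly_Mapping.single s (z * w)"
  unfolding weyl_scale_def by (rule poly_mapping_eqI) (auto simp: map.rep_eq lookup_single when_def)

lemma weyl_scale_1: "weyl_scale 1 P = P"
  unfolding weyl_scale_def by (rule poly_mapping_eqI) (auto simp: map.rep_eq when_def)

lemma weyl_scale_0: "weyl_scale 0 P = 0"
  unfolding weyl_scale_def by (rule poly_mapping_eqI) (auto simp: map.rep_eq when_def)

lemma weyl_mult_single:
  "Poly_Mapping.single s z \<star> Poly_Mapping.single t w = weyl_scale (z * w) (weyl_monom_mult s t)"
  unfolding weyl_mult_def by (cases "z = 0"; cases "w = 0") (simp_all add: weyl_scale_0)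

lemma weyl_monom_mult_trivial:
  assumes "\<And>k. k \<le> b \<and> k \<le> c \<longleftrightarrow> k = 0"
  shows "weyl_monom_mult (a, b) (c, e) = Poly_Mapping.single (a + c, b + e) 1"
proof -
  have "{k. k \<le> b \<and> k \<le> c} = {0}" using assms by auto
  then show ?thesis by (simp add: weyl_monom_mult_def)
qed

lemma nat_vec_le_axis_iff: "(k :: nat ^ 'n::finite) \<le> axis j 1 \<longleftrightarrow> k = 0 \<or> k = axis j 1"
proof
  assume h: "k \<le> axis j 1"
  then have le: "k $ i \<le> (if i = j then 1 else 0)" for i
    by (auto simp: less_eq_vec_def axis_def dest: spec[of _ i])
  show "k = 0 \<or> k = axis j 1"
  proof (cases "k $ j = 0")
    case True
    have "k $ i = 0" for i using le[of i] True by (auto split: if_splits)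
    then show ?thesis by (simp add: vec_eq_iff)
  next
    case False
    then have "k $ j = 1" using le[of j] by auto
    moreover have "k $ i = 0" if "i \<noteq> j" for i using le[of i] that by auto
    ultimately have "k = axis j 1" by (simp add: vec_eq_iff axis_def)
    then show ?thesis ..
  qed
qed (auto simp: less_eq_vec_def)

lemma nat_vec_le_0_iff: "(k :: nat ^ 'n::finite) \<le> 0 \<longleftrightarrow> k = 0"
  by (auto simp: less_eq_vec_def vec_eq_iff)

lemma weyl_relation_xx: "weyl_x i \<star> weyl_x j = weyl_x j \<star> weyl_x i"
  unfolding weyl_x_def weyl_mult_single
  by (subst (1 2) weyl_monom_mult_trivial)
     (auto simp del: One_nat_def simp: nat_vec_le_0_iff nat_vec_le_axis_iff add.commute)

lemma weyl_relation_dd: "weyl_d i \<star> weyl_d j = weyl_d j \<star> weyl_d i"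
  unfolding weyl_d_def weyl_mult_single
  by (subst (1 2) weyl_monom_mult_trivial)
     (auto simp del: One_nat_def simp: nat_vec_le_0_iff nat_vec_le_axis_iff add.commute)

lemma weyl_relation_dx:
  "weyl_d i \<star> weyl_x j = weyl_x j \<star> weyl_d i + weyl_const (if i = j then 1 else 0)"
proof -
  have xd: "weyl_x j \<star> weyl_d i = Poly_Mapping.single (axis j 1, axis i 1) 1"
    unfolding weyl_x_def weyl_d_def weyl_mult_single
    by (subst weyl_monom_mult_trivial)
       (auto simp del: One_nat_def simp: nat_vec_le_0_iff nat_vec_le_axis_iff weyl_scale_1)
  have ne: "(axis l 1 :: nat ^ 'a) \<noteq> 0" for l
    by (simp add: vec_eq_iff axis_def)
  show ?thesis
  proof (cases "i = j")
    case True
    have set: "{k :: nat ^ 'a. k \<le> axis j 1} = {0, axis j 1}"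
      by (auto simp del: One_nat_def simp: nat_vec_le_axis_iff)
    have pr: "(\<Prod>l\<in>UNIV. complex_of_nat (fact (axis j 1 $ l) *
        (axis j 1 $ l choose axis j 1 $ l) * (axis j 1 $ l choose axis j 1 $ l))) = 1"
      by (rule prod.neutral) (simp add: axis_def)
    have "weyl_monom_mult (0, axis j 1) (axis j 1, 0) =
        Poly_Mapping.single (axis j 1, axis j 1) 1 + Poly_Mapping.single (0, 0) 1"
      using ne[of j] pr by (simp add: weyl_monom_mult_def set del: One_nat_def)
    then show ?thesis
      unfolding xd using True by (simp add: weyl_x_def weyl_d_def weyl_const_def weyl_mult_single weyl_scale_1)
  next
    case False
    have "axis i 1 \<noteq> (axis j 1 :: nat ^ 'a)"
      using False by (auto simp: axis_eq_axis)
    then have "weyl_monom_mult (0, axis i 1) (axis j 1, 0) = Poly_Mapping.single (axis j 1, axis i 1) 1"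
      by (subst weyl_monom_mult_trivial) (auto simp del: One_nat_def simp: nat_vec_le_axis_iff ne)
    then show ?thesis
      unfolding xd using False by (simp add: weyl_x_def weyl_d_def weyl_const_def weyl_mult_single weyl_scale_1)
  qed
qed


section \<open>Holomorphic solutions and holonomic rank\<close>

definition holomorphic_several :: "(complex ^ 'n \<Rightarrow> complex) \<Rightarrow> (complex ^ 'n::finite) set \<Rightarrow> bool" where
  "holomorphic_several f U \<longleftrightarrow>
     (\<forall>x\<in>U. \<exists>f'. (f has_derivative f') (at x) \<and> (\<forall>c v. f' (c *s v) = c * f' v))"

definition partial_deriv :: "'n \<Rightarrow> (complex ^ 'n::finite \<Rightarrow> complex) \<Rightarrow> complex ^ 'n \<Rightarrow> complex" where
  "partial_deriv j f x = deriv (\<lambda>t. f (x + t *s axis j 1)) 0"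

text \<open>The order in which the variables are listed is immaterial for holomorphic functions.\<close>
definition multi_deriv :: "nat ^ 'n \<Rightarrow> (complex ^ 'n::finite \<Rightarrow> complex) \<Rightarrow> complex ^ 'n \<Rightarrow> complex" where
  "multi_deriv b f = foldr (\<lambda>j. partial_deriv j ^^ (b $ j)) (SOME js. distinct js \<and> set js = UNIV) f"

definition weyl_action :: "('n::finite) weyl \<Rightarrow> (complex ^ 'n \<Rightarrow> complex) \<Rightarrow> complex ^ 'n \<Rightarrow> complex" where
  "weyl_action P f x =
     (\<Sum>(a, b)\<in>Poly_Mapping.keys P. Poly_Mapping.lookup P (a, b) * monom_eval a x * multi_deriv b f x)"

definition solution_near :: "('n::finite) weyl set \<Rightarrow> complex ^ 'n \<Rightarrow> (complex ^ 'n \<Rightarrow> complex) \<Rightarrow> bool" where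
  "solution_near I p f \<longleftrightarrow>
     (\<exists>U. open U \<and> p \<in> U \<and> holomorphic_several f U \<and> (\<forall>P\<in>I. \<forall>x\<in>U. weyl_action P f x = 0))"

text \<open>Dimension of the space of germs at \<open>p\<close>: functions agreeing near \<open>p\<close> are identified.\<close>
definition solution_dim :: "('n::finite) weyl set \<Rightarrow> complex ^ 'n \<Rightarrow> enat" where
  "solution_dim I p = Sup {enat k | k. \<exists>f :: nat \<Rightarrow> complex ^ 'n \<Rightarrow> complex.
     (\<forall>i<k. solution_near I p (f i)) \<and>
     (\<forall>c. (\<forall>\<^sub>F x in nhds p. (\<Sum>i<k. c i * f i x) = 0) \<longrightarrow> (\<forall>i<k. c i = 0))}"

definition weyl_order :: "('n::finite) weyl \<Rightarrow> nat" where
  "weyl_order P = Max ((\<lambda>(a, b). \<Sum>j\<in>UNIV. b $ j) ` Poly_Mapping.keys P)"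

definition principal_symbol :: "('n::finite) weyl \<Rightarrow> complex ^ 'n \<Rightarrow> complex ^ 'n \<Rightarrow> complex" where
  "principal_symbol P x \<xi> =
     (\<Sum>(a, b) | (a, b) \<in> Poly_Mapping.keys P \<and> (\<Sum>j\<in>UNIV. b $ j) = weyl_order P.
        Poly_Mapping.lookup P (a, b) * monom_eval a x * monom_eval b \<xi>)"

definition characteristic_variety :: "('n::finite) weyl set \<Rightarrow> ((complex ^ 'n) \<times> (complex ^ 'n)) set" where
  "characteristic_variety I = {(x, \<xi>). \<forall>P\<in>I. principal_symbol P x \<xi> = 0}"

text \<open>
  Principal symbols are homogeneous in the cotangent variables, so this projection is already
  Zariski closed.
\<close>
definition singular_locus :: "('n::finite) weyl set \<Rightarrow> (complex ^ 'n) set" where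
  "singular_locus I = {x. \<exists>\<xi>. \<xi> \<noteq> 0 \<and> (x, \<xi>) \<in> characteristic_variety I}"

text \<open>Generic means: off the zero set of some nonzero polynomial.\<close>
definition holonomic_rank :: "('n::finite) weyl set \<Rightarrow> nat" where
  "holonomic_rank I = (THE r. \<exists>q :: 'n cpoly. q \<noteq> 0 \<and>
     (\<forall>p. cpoly_eval q p \<noteq> 0 \<longrightarrow> p \<notin> singular_locus I \<and> solution_dim I p = enat r))"


section \<open>Hypergeometric systems\<close>

definition weyl_of_dpoly :: "('n::finite) cpoly \<Rightarrow> 'n weyl" where
  "weyl_of_dpoly q = (\<Sum>b\<in>Poly_Mapping.keys q. Poly_Mapping.single (0, b) (Poly_Mapping.lookup q b))"

definition homogeneity :: "int ^ 'n ^ 'd \<Rightarrow> complex ^ 'd \<Rightarrow> 'd \<Rightarrow> ('n::finite) weyl" where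
  "homogeneity A \<beta> i =
     (\<Sum>j\<in>UNIV. weyl_const (of_int (A $ i $ j)) \<star> weyl_x j \<star> weyl_d j) - weyl_const (\<beta> $ i)"

definition hypergeometric_ideal :: "int ^ 'n ^ 'd \<Rightarrow> complex ^ 'd \<Rightarrow> ('n::finite) weyl set" where
  "hypergeometric_ideal A \<beta> =
     weyl_left_ideal_gen (weyl_of_dpoly ` toric_ideal A \<union> range (homogeneity A \<beta>))"

text \<open>
  The columns of \<open>A\<close> are assumed to have \<open>i0\<close>-th coordinate 1 and to span the integer lattice, so
  the normalized volume of their convex hull is \<open>(d - 1)!\<close> times its Lebesgue measure in the
  remaining \<open>d - 1\<close> coordinates.
\<close>
definition normalized_volume :: "'d \<Rightarrow> int ^ 'n ^ 'd::finite \<Rightarrow> real" where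
  "normalized_volume i0 A = fact (CARD('d) - 1) *
     measure (\<Pi>\<^sub>M i\<in>-{i0}. lborel)
       ((\<lambda>x. restrict (\<lambda>i. x $ i) (-{i0})) ` (convex hull columns (map_matrix real_of_int A)))"

definition exceptional_set :: "'d \<Rightarrow> int ^ 'n::finite ^ 'd::finite \<Rightarrow> (complex ^ 'd) set" where
  "exceptional_set i0 A =
     {\<beta>. real (holonomic_rank (hypergeometric_ideal A \<beta>)) > normalized_volume i0 A}"

definition gale_diagram :: "int ^ 'n ^ 'd \<Rightarrow> int ^ 2 ^ 'n \<Rightarrow> bool" where
  "gale_diagram A B \<longleftrightarrow> bij_betw (\<lambda>z. B *v z) UNIV {u. A *v u = 0}"

end

theory Submission
  imports Defs "HOL-Complex_Analysis.Conformal_Mappings"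
begin

unbundle no Formal_Power_Series.fps_syntax

text \<open>
  Write \<open>\<gamma>\<close> for points of the semigroup \<open>NA\<close> generated by the columns \<open>a\<^sub>j\<close> of \<open>A\<close>. By the toric equations the
  Taylor coefficients at \<open>p\<close> of a solution are a function \<open>f\<close> on \<open>NA\<close>, and the homogeneities become the
  linear relations \<open>\<Sum>\<^sub>j a\<^sub>i\<^sub>j p\<^sub>j f (\<gamma> + a\<^sub>j) = (\<beta>\<^sub>i - \<gamma>\<^sub>i) f \<gamma>\<close>. At a generic \<open>p\<close> these express \<open>f\<close> through
  its values in low degree, so that every such \<open>f\<close> comes from a convergent series, and the rank is the
  least size of a set \<open>Y \<subseteq> NA\<close> on which \<open>f\<close> is determined.

  Let \<open>E \<gamma>\<close> be the function of \<open>\<alpha> \<in> \<int>\<^sup>d\<close> given by the coefficient of \<open>t\<^sup>\<alpha>\<close> in \<open>t\<^sup>\<gamma> exp (\<Sum>\<^sub>j p\<^sub>j t\<^bsup>a\<^sub>j\<^esup>)\<close>. These functions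
  satisfy the same relations with \<open>\<beta>\<close> replaced by \<open>\<alpha>\<close>, hence by Nakayama's lemma the \<open>E y\<close>,
  \<open>y \<in> Y\<close>, generate the module of all \<open>E \<gamma>\<close> over the polynomials in \<open>\<alpha>\<close> localized at \<open>\<beta>\<close>. Counting dimensions
  in degree at most \<open>k\<close> against lattice points of the cone shows that the generic rank of this module is at
  least the volume. If the rank at \<open>\<beta>\<close> did not exceed the volume, the localized module would therefore be free.

  The Gale diagram yields a hole: a point \<open>\<gamma>\<^sub>0\<close> such that \<open>\<gamma>\<^sub>0 + a\<^sub>j \<in> NA\<close> for \<open>j \<in> {1,2,3,4}\<close>, while all
  translates of \<open>\<gamma>\<^sub>0\<close> by \<open>a\<^sub>5, \<dots>, a\<^sub>n\<close> stay outside \<open>NA\<close>. For \<open>\<beta> \<in> \<gamma>\<^sub>0 + \<Sum>\<^sub>i\<^sub>\<ge>\<^sub>5 \<complex> a\<^sub>i\<close> choose two linear forms vanishing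
  on \<open>a\<^sub>5, \<dots>, a\<^sub>n\<close> and independent on \<open>a\<^sub>3, a\<^sub>4\<close>. Multiplied by either form, shifted to vanish at \<open>\<beta>\<close>, the function
  \<open>E \<gamma>\<^sub>0\<close> falls into the module; in a free module this would put \<open>E \<gamma>\<^sub>0\<close> itself, up to a factor not
  vanishing at \<open>\<beta>\<close>, into the module, which is impossible because \<open>\<gamma>\<^sub>0\<close> is a hole.
\<close>

section \<open>Polynomial functions\<close>

text \<open>Sending \<gamma> to \<open>E p \<gamma>\<close> embeds the semigroup ring, with Euler
  operators twisted by the exponential, into functions on the lattice, where the i-th operator
  becomes multiplication by the coordinate \<alpha>_i. The solutions at \<beta> are thus dual to the
  fibre at \<beta> of a single module over the polynomials in \<alpha>, and the rank jumps where
  this module fails to be free. The lower bound for its generic rank suffices: with at most vol(A)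
  local generators, any relation among them would leave too few after a further localization. A hole
  is detected by depth, which takes two forms: if z1 E and z2 E lie in a free module, the
  coordinates of z1 E are divisible by z1. Hence parameter spaces of codimension 2. The definition
  of the rank presupposes one dimension of solution germs at all generic points; this comes from
  semicontinuity, by minimizing the size of determining sets over p. Genericity of p also needs one
  point to start from: it is p_j = \<epsilon>^(w_j) with a generic weight w and small \<epsilon>,
  which does the work of a Groebner degeneration.\<close>

lemma cpoly_eval_superset:
  assumes "finite S" "Poly_Mapping.keys q \<subseteq> S"
  shows "cpoly_eval q x = (\<Sum>a\<in>S. Poly_Mapping.lookup q a * monom_eval a x)"
  unfolding cpoly_eval_def by (rule sum.mono_neutral_left) (use assms in \<open>auto simp: in_keys_iff\<close>)

lemma cpoly_eval_add: "cpoly_eval (q + r) x = cpoly_eval q x + cpoly_eval r x"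
proof -
  let ?S = "Poly_Mapping.keys q \<union> Poly_Mapping.keys r"
  have "cpoly_eval (q + r) x = (\<Sum>a\<in>?S. Poly_Mapping.lookup (q + r) a * monom_eval a x)"
    by (rule cpoly_eval_superset) (auto dest: subsetD[OF Poly_Mapping.keys_add])
  moreover have "cpoly_eval q x = (\<Sum>a\<in>?S. Poly_Mapping.lookup q a * monom_eval a x)"
    by (rule cpoly_eval_superset) auto
  moreover have "cpoly_eval r x = (\<Sum>a\<in>?S. Poly_Mapping.lookup r a * monom_eval a x)"
    by (rule cpoly_eval_superset) auto
  ultimately show ?thesis by (simp add: lookup_add algebra_simps sum.distrib)
qed

lemma cpoly_eval_0: "cpoly_eval 0 x = 0"
  by (simp add: cpoly_eval_def)

lemma cpoly_eval_sum: "cpoly_eval (sum f S) x = (\<Sum>s\<in>S. cpoly_eval (f s) x)"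
  by (induction S rule: infinite_finite_induct) (auto simp: cpoly_eval_add cpoly_eval_0)

lemma cpoly_eval_single: "cpoly_eval (Poly_Mapping.single a c) x = c * monom_eval a x"
  by (cases "c = 0") (auto simp: cpoly_eval_def)

lemma monom_eval_add: "monom_eval (a + b) x = monom_eval a x * monom_eval b x"
  by (simp add: monom_eval_def power_add prod.distrib)

lemma monom_eval_0: "monom_eval 0 x = 1"
  by (simp add: monom_eval_def)

lemma monom_eval_axis: "monom_eval (axis j 1) x = x $ j"
proof -
  have "monom_eval (axis j 1) x = (\<Prod>i\<in>UNIV. if i = j then x $ i else 1)"
    unfolding monom_eval_def by (rule prod.cong) (auto simp: axis_def)
  then show ?thesis by simp
qed

lemma poly_mapping_eq_sum_single:
  "q = (\<Sum>a\<in>Poly_Mapping.keys q. Poly_Mapping.single a (Poly_Mapping.lookup q a))"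
proof (rule poly_mapping_eqI)
  fix k
  have "Poly_Mapping.lookup (\<Sum>a\<in>Poly_Mapping.keys q. Poly_Mapping.single a (Poly_Mapping.lookup q a)) k
    = (\<Sum>a\<in>Poly_Mapping.keys q. if a = k then Poly_Mapping.lookup q a else 0)"
    by (simp add: lookup_sum lookup_single when_def)
  also have "\<dots> = Poly_Mapping.lookup q k"
    by (simp add: sum.delta in_keys_iff)
  finally show "Poly_Mapping.lookup q k = Poly_Mapping.lookup
      (\<Sum>a\<in>Poly_Mapping.keys q. Poly_Mapping.single a (Poly_Mapping.lookup q a)) k" by simp
qed

lemma cpoly_eval_mult: "cpoly_eval (q * r) x = cpoly_eval q x * cpoly_eval r x"
proof -
  have "q * r = (\<Sum>a\<in>Poly_Mapping.keys q. \<Sum>b\<in>Poly_Mapping.keys r.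
      Poly_Mapping.single (a + b) (Poly_Mapping.lookup q a * Poly_Mapping.lookup r b))"
    by (subst poly_mapping_eq_sum_single[of q], subst poly_mapping_eq_sum_single[of r])
       (simp add: sum_product mult_single)
  then show ?thesis
    by (simp add: cpoly_eval_sum cpoly_eval_single monom_eval_add)
       (simp add: cpoly_eval_def sum_product mult_ac)
qed

text \<open>Total degree is attached to functions, not to polynomials, because coefficients matter
  only through their values. The degree bounds feed the dimension count; \<open>polyfun\<close>
  forgets them.\<close>

definition polydeg :: "nat \<Rightarrow> (complex ^ 'm::finite \<Rightarrow> complex) \<Rightarrow> bool" where
  "polydeg m f \<longleftrightarrow> (\<exists>q. f = cpoly_eval q \<and> (\<forall>b\<in>Poly_Mapping.keys q. (\<Sum>j\<in>UNIV. b $ j) \<le> m))"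

definition polyfun :: "(complex ^ 'm::finite \<Rightarrow> complex) \<Rightarrow> bool" where
  "polyfun f \<longleftrightarrow> (\<exists>m. polydeg m f)"

lemma polydeg_mono: "polydeg m f \<Longrightarrow> m \<le> m' \<Longrightarrow> polydeg m' f"
  unfolding polydeg_def by (blast intro: order_trans)

lemma polydeg_const: "polydeg m (\<lambda>x. c)"
  unfolding polydeg_def
  by (rule exI[of _ "Poly_Mapping.single 0 c"])
     (auto simp: cpoly_eval_single monom_eval_0 fun_eq_iff simp del: Poly_Mapping.keys_single
       dest!: subsetD[OF Poly_Mapping.keys_single[THEN equalityD1]] split: if_splits)

lemma sum_axis: "(\<Sum>j\<in>UNIV. (axis i c :: nat ^ 'n::finite) $ j) = c"
  by (simp add: axis_def)

lemma polydeg_coord: "polydeg (Suc m) (\<lambda>x. x $ i)"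
  unfolding polydeg_def
  by (rule exI[of _ "Poly_Mapping.single (axis i 1) 1"])
     (auto simp: cpoly_eval_single monom_eval_axis fun_eq_iff sum_axis simp del: One_nat_def)

lemma polydeg_add: "polydeg m f \<Longrightarrow> polydeg m g \<Longrightarrow> polydeg m (\<lambda>x. f x + g x)"
proof -
  assume "polydeg m f" "polydeg m g"
  then obtain q r where *: "f = cpoly_eval q" "\<forall>b\<in>Poly_Mapping.keys q. (\<Sum>j\<in>UNIV. b $ j) \<le> m"
    "g = cpoly_eval r" "\<forall>b\<in>Poly_Mapping.keys r. (\<Sum>j\<in>UNIV. b $ j) \<le> m"
    unfolding polydeg_def by blast
  show ?thesis unfolding polydeg_def
    by (rule exI[of _ "q + r"]) (use * in \<open>auto simp: cpoly_eval_add dest!: subsetD[OF Poly_Mapping.keys_add]\<close>)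
qed

lemma polydeg_mult: "polydeg m f \<Longrightarrow> polydeg m' g \<Longrightarrow> polydeg (m + m') (\<lambda>x. f x * g x)"
proof -
  assume "polydeg m f" "polydeg m' g"
  then obtain q r where *: "f = cpoly_eval q" "\<forall>b\<in>Poly_Mapping.keys q. (\<Sum>j\<in>UNIV. b $ j) \<le> m"
    "g = cpoly_eval r" "\<forall>b\<in>Poly_Mapping.keys r. (\<Sum>j\<in>UNIV. b $ j) \<le> m'"
    unfolding polydeg_def by blast
  have "(\<Sum>j\<in>UNIV. b $ j) \<le> m + m'" if b: "b \<in> Poly_Mapping.keys (q * r)" for b
  proof -
    obtain b1 b2 where "b1 \<in> Poly_Mapping.keys q" "b2 \<in> Poly_Mapping.keys r" "b = b1 + b2"
      using subsetD[OF Poly_Mapping.keys_mult b] by blast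
    then show ?thesis using * by (auto simp: sum.distrib intro: add_mono)
  qed
  then show ?thesis unfolding polydeg_def
    by (intro exI[of _ "q * r"]) (use * in \<open>auto simp: cpoly_eval_mult\<close>)
qed

lemma polydeg_sum: "(\<And>s. s \<in> S \<Longrightarrow> polydeg m (f s)) \<Longrightarrow> polydeg m (\<lambda>x. \<Sum>s\<in>S. f s x)"
  by (induction S rule: infinite_finite_induct) (auto intro: polydeg_add polydeg_const)

lemma polyfun_const: "polyfun (\<lambda>x. c)"
  and polyfun_coord: "polyfun (\<lambda>x. x $ i)"
  unfolding polyfun_def using polydeg_const polydeg_coord by blast+

lemma polyfun_mult: "polyfun f \<Longrightarrow> polyfun g \<Longrightarrow> polyfun (\<lambda>x. f x * g x)"
  unfolding polyfun_def using polydeg_mult by blast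

lemma polyfun_add: "polyfun f \<Longrightarrow> polyfun g \<Longrightarrow> polyfun (\<lambda>x. f x + g x)"
  unfolding polyfun_def using polydeg_add polydeg_mono by (metis max.cobounded1 max.cobounded2)

lemma polyfun_uminus: "polyfun f \<Longrightarrow> polyfun (\<lambda>x. - f x)"
  using polyfun_mult[OF polyfun_const[of "-1"]] by simp

lemma polyfun_diff: "polyfun f \<Longrightarrow> polyfun g \<Longrightarrow> polyfun (\<lambda>x. f x - g x)"
  using polyfun_add[OF _ polyfun_uminus] by fastforce

lemma polyfun_sum: "(\<And>s. s \<in> S \<Longrightarrow> polyfun (f s)) \<Longrightarrow> polyfun (\<lambda>x. \<Sum>s\<in>S. f s x)"
  by (induction S rule: infinite_finite_induct) (auto intro: polyfun_add polyfun_const)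

lemma polyfun_prod: "(\<And>s. s \<in> S \<Longrightarrow> polyfun (f s)) \<Longrightarrow> polyfun (\<lambda>x. \<Prod>s\<in>S. f s x)"
  by (induction S rule: infinite_finite_induct) (auto intro: polyfun_mult polyfun_const)

lemmas polyfun_intros = polyfun_const polyfun_coord polyfun_mult polyfun_add polyfun_uminus
  polyfun_diff polyfun_sum polyfun_prod

text \<open>Properties inherited by sums and products, such as divisibility of differences or
  compatibility with an affine substitution, can be checked on constants and coordinates without
  handling monomials.\<close>

lemma polyfun_induct [consumes 1, case_names const coord add mult]:
  assumes "polyfun f"
    and const: "\<And>c. P (\<lambda>x. c)" and coord: "\<And>i. P (\<lambda>x. x $ i)"
    and add: "\<And>f g. polyfun f \<Longrightarrow> polyfun g \<Longrightarrow> P f \<Longrightarrow> P g \<Longrightarrow> P (\<lambda>x. f x + g x)"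
    and mult: "\<And>f g. polyfun f \<Longrightarrow> polyfun g \<Longrightarrow> P f \<Longrightarrow> P g \<Longrightarrow> P (\<lambda>x. f x * g x)"
  shows "P f"
proof -
  obtain q where q: "f = cpoly_eval q" using assms(1) unfolding polyfun_def polydeg_def by blast
  have pw: "polyfun (\<lambda>x. (x $ i) ^ k) \<and> P (\<lambda>x. (x $ i) ^ k)" for i k
    by (induction k) (auto intro: const mult coord polyfun_intros)
  have pr: "polyfun (\<lambda>x. \<Prod>i\<in>S. (x $ i) ^ (b $ i)) \<and> P (\<lambda>x. \<Prod>i\<in>S. (x $ i) ^ (b $ i))" for S and b :: "nat ^ 'a"
    by (induction S rule: infinite_finite_induct) (use pw in \<open>auto intro: const mult polyfun_intros\<close>)
  have mo: "polyfun (\<lambda>x. c * monom_eval b x) \<and> P (\<lambda>x. c * monom_eval b x)" for c and b :: "nat ^ 'a"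
    unfolding monom_eval_def using pr by (auto intro: const mult polyfun_intros)
  have "polyfun (\<lambda>x. \<Sum>b\<in>S. Poly_Mapping.lookup q b * monom_eval b x) \<and>
        P (\<lambda>x. \<Sum>b\<in>S. Poly_Mapping.lookup q b * monom_eval b x)" for S
    by (induction S rule: infinite_finite_induct) (use mo in \<open>auto intro: const add polyfun_intros\<close>)
  then show ?thesis unfolding q cpoly_eval_def[abs_def] by blast
qed

lemma polyfun_imp_cpoly: "polyfun f \<Longrightarrow> \<exists>q. f = cpoly_eval q"
  unfolding polyfun_def polydeg_def by blast

lemma polyfun_cpoly_eval: "polyfun (cpoly_eval q)"
proof -
  have "polydeg (Max ((\<lambda>b. \<Sum>j\<in>UNIV. b $ j) ` Poly_Mapping.keys q)) (cpoly_eval q)"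
    unfolding polydeg_def by (rule exI[of _ q]) auto
  then show ?thesis unfolding polyfun_def by blast
qed

section \<open>Restriction to lines, nonvanishing, and zeros at lattice points\<close>

lemma polydeg_line:
  assumes "polydeg m f"
  shows "\<exists>P. Polynomial.degree P \<le> m \<and> (\<forall>t. f (x + t *s v) = poly P t)"
proof -
  obtain q where q: "f = cpoly_eval q" "\<forall>b\<in>Poly_Mapping.keys q. (\<Sum>j\<in>UNIV. b $ j) \<le> m"
    using assms unfolding polydeg_def by blast
  define P where "P = (\<Sum>b\<in>Poly_Mapping.keys q. Polynomial.smult (Poly_Mapping.lookup q b)
      (\<Prod>j\<in>UNIV. [:x $ j, v $ j:] ^ (b $ j)))"
  have "Polynomial.degree P \<le> m"
    unfolding P_def
  proof (rule degree_sum_le)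
    fix b assume b: "b \<in> Poly_Mapping.keys q"
    have "Polynomial.degree (\<Prod>j\<in>UNIV. [:x $ j, v $ j:] ^ (b $ j)) \<le> (\<Sum>j\<in>UNIV. Polynomial.degree ([:x $ j, v $ j:] ^ (b $ j)))"
      by (rule order_trans[OF degree_prod_sum_le]) (auto simp: o_def)
    also have "\<dots> \<le> (\<Sum>j\<in>UNIV. b $ j)"
      by (rule sum_mono) (use degree_power_le[of "[:x $ _, v $ _:]"] in \<open>auto intro!: order_trans[OF degree_power_le]\<close>)
    also have "\<dots> \<le> m" using q b by blast
    finally show "Polynomial.degree (Polynomial.smult (Poly_Mapping.lookup q b) (\<Prod>j\<in>UNIV. [:x $ j, v $ j:] ^ (b $ j))) \<le> m"
      using degree_smult_le order_trans by blast
  qed auto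
  moreover have "f (x + t *s v) = poly P t" for t
    unfolding q(1) P_def cpoly_eval_def monom_eval_def
    by (simp add: poly_sum poly_prod algebra_simps)
  ultimately show ?thesis by blast
qed

lemma polyfun_line: "polyfun f \<Longrightarrow> \<exists>P. \<forall>t. f (x + t *s v) = poly P t"
  unfolding polyfun_def using polydeg_line by blast

text \<open>On the line joining a nonzero of \<open>f\<close> to a nonzero of \<open>g\<close> both
  factors restrict to nonzero univariate polynomials, and these have no zero divisors. So two
  generic conditions can always be met together.\<close>

lemma polyfun_mult_nonzero:
  assumes "polyfun f" "polyfun g" "f x \<noteq> 0" "g y \<noteq> 0"
  shows "\<exists>z. f z * g z \<noteq> 0"
proof -
  obtain P where P: "\<And>t. f (x + t *s (y - x)) = poly P t" using polyfun_line[OF assms(1)] by blast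
  obtain Q where Q: "\<And>t. g (x + t *s (y - x)) = poly Q t" using polyfun_line[OF assms(2)] by blast
  have "poly P 0 \<noteq> 0" using P[of 0] assms(3) by simp
  moreover have "poly Q 1 \<noteq> 0" using Q[of 1] assms(4) by simp
  ultimately have "P * Q \<noteq> 0" by auto
  then obtain t where "poly (P * Q) t \<noteq> 0"
    using poly_all_0_iff_0 by blast
  then show ?thesis using P Q by (metis mult_eq_0_iff poly_mult)
qed

text \<open>With \<open>w $ j = x ^ e j\<close> for an injective \<open>e\<close>, each z gives a
  nonzero polynomial in x, so all but finitely many natural x work. Such weights separate finitely
  many lattice vectors: exponents of monomials, kernel vectors of \<open>A\<close>, candidates for
  extremal points.\<close>

lemma avoid_hyperplanes:
  fixes Z :: "(int ^ 'n::finite) set"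
  assumes "finite Z" "0 \<notin> Z"
  shows "\<exists>w :: nat ^ 'n. \<forall>z\<in>Z. (\<Sum>j\<in>UNIV. int (w $ j) * z $ j) \<noteq> 0"
proof -
  obtain e :: "'n \<Rightarrow> nat" where e: "inj e"
    using finite_imp_inj_to_nat_seg[of "UNIV :: 'n set"] by auto
  define P where "P z = (\<Sum>j\<in>UNIV. Polynomial.monom (z $ j) (e j))" for z :: "int ^ 'n"
  have nz: "P z \<noteq> 0" if z: "z \<in> Z" for z
  proof -
    obtain j where j: "z $ j \<noteq> 0" using z assms(2) by (metis vec_eq_iff zero_index)
    have "Polynomial.coeff (P z) (e j) = (\<Sum>i\<in>UNIV. if i = j then z $ i else 0)"
      unfolding P_def coeff_sum by (rule sum.cong) (auto simp: inj_eq[OF e])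
    then show ?thesis using j by auto
  qed
  have "finite (\<Union>z\<in>Z. {x. poly (P z) x = 0})"
    using assms(1) nz poly_roots_finite by blast
  then have "finite (nat ` (\<Union>z\<in>Z. {x. poly (P z) x = 0}))" by blast
  then obtain x :: nat where x: "x \<notin> nat ` (\<Union>z\<in>Z. {x. poly (P z) x = 0})"
    using ex_new_if_finite infinite_UNIV_nat by blast
  have "(\<Sum>j\<in>UNIV. int ((\<chi> j. x ^ e j) $ j) * z $ j) \<noteq> 0" if "z \<in> Z" for z
  proof
    assume "(\<Sum>j\<in>UNIV. int ((\<chi> j. x ^ e j) $ j) * z $ j) = 0"
    then have "poly (P z) (int x) = 0"
      unfolding P_def by (simp add: poly_sum poly_monom mult.commute)
    then have "int x \<in> (\<Union>z\<in>Z. {x. poly (P z) x = 0})" using that by blast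
    then have "nat (int x) \<in> nat ` (\<Union>z\<in>Z. {x. poly (P z) x = 0})" by (rule imageI)
    then show False using x by simp
  qed
  then show ?thesis by blast
qed

text \<open>Substituting x_j = t^(w_j), with \<open>w\<close> separating the exponents that occur,
  sends distinct monomials to distinct powers of t, so nothing cancels.\<close>

lemma cpoly_eval_nonzero:
  fixes q :: "('n::finite) cpoly"
  assumes "q \<noteq> 0"
  shows "\<exists>x. cpoly_eval q x \<noteq> 0"
proof -
  let ?K = "Poly_Mapping.keys q"
  define Z where "Z = {int_vec a - int_vec b | a b. a \<in> ?K \<and> b \<in> ?K \<and> a \<noteq> b}"
  have "finite Z"
    unfolding Z_def by (rule finite_subset[of _ "(\<lambda>(a,b). int_vec a - int_vec b) ` (?K \<times> ?K)"]) auto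
  moreover have "0 \<notin> Z" by (auto simp: Z_def int_vec_def vec_eq_iff)
  ultimately obtain w :: "nat ^ 'n" where w: "\<forall>z\<in>Z. (\<Sum>j\<in>UNIV. int (w $ j) * z $ j) \<noteq> 0"
    using avoid_hyperplanes by blast
  define e where "e b = (\<Sum>j\<in>UNIV. w $ j * b $ j)" for b :: "nat ^ 'n"
  have inj: "inj_on e ?K"
  proof (rule inj_onI, rule ccontr)
    fix a b assume ab: "a \<in> ?K" "b \<in> ?K" "e a = e b" "a \<noteq> b"
    then have "int_vec a - int_vec b \<in> Z" by (auto simp: Z_def)
    then have "(\<Sum>j\<in>UNIV. int (w $ j) * (int_vec a - int_vec b) $ j) \<noteq> 0" using w by blast
    moreover have "(\<Sum>j\<in>UNIV. int (w $ j) * (int_vec a - int_vec b) $ j) = int (e a) - int (e b)"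
      by (simp add: e_def int_vec_def right_diff_distrib sum_subtractf)
    ultimately show False using ab by simp
  qed
  define P where "P = (\<Sum>b\<in>?K. Polynomial.monom (Poly_Mapping.lookup q b) (e b))"
  obtain b where b: "b \<in> ?K" using assms by (metis all_not_in_conv keys_eq_empty)
  have "Polynomial.coeff P (e b) = (\<Sum>i\<in>?K. if i = b then Poly_Mapping.lookup q i else 0)"
    unfolding P_def coeff_sum by (rule sum.cong) (use inj b in \<open>auto simp: inj_on_def\<close>)
  then have "P \<noteq> 0" using b by (auto simp: in_keys_iff)
  then obtain t where t: "poly P t \<noteq> 0" using poly_all_0_iff_0 by blast
  have "cpoly_eval q (\<chi> j. t ^ (w $ j)) = poly P t"
    unfolding cpoly_eval_def P_def monom_eval_def e_def
    by (simp add: poly_sum poly_monom power_sum power_mult)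
  then show ?thesis using t by metis
qed

text \<open>A count of Schwartz-Zippel type. It makes the zeros of a localizing denominator, of
  order T^(d - 1), negligible against the T^d lattice points of the cone.\<close>

lemma polydeg_card_zeros:
  fixes f :: "complex ^ 'd::finite \<Rightarrow> complex" and T :: nat
  assumes "polydeg m f" "f x0 \<noteq> 0"
  shows "card {\<alpha> :: int ^ 'd. (\<forall>i. \<bar>\<alpha> $ i\<bar> \<le> int T) \<and> f (\<chi> i. of_int (\<alpha> $ i)) = 0}
    \<le> CARD('d) * m * (2 * T + 1) ^ (CARD('d) - 1)"
proof -
  let ?R = "{- int T..int T}"
  \<comment> \<open>Coordinates in \<open>I\<close> come from the lattice point, the others stay at
    the nonzero \<open>x0\<close>; the induction releases one coordinate at a time.\<close>
  define pt where "pt I \<alpha> = (\<chi> i. if i \<in> I then of_int (\<alpha> i) else x0 $ i)" for I and \<alpha> :: "'d \<Rightarrow> int"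
  have cardR: "card ?R = 2 * T + 1" by simp
  have main: "card {\<alpha> \<in> I \<rightarrow>\<^sub>E ?R. f (pt I \<alpha>) = 0} \<le> card I * m * (2 * T + 1) ^ (card I - 1)" if "finite I" for I :: "'d set"
    using that
  proof (induction I rule: finite_induct)
    case empty
    have "pt {} \<alpha> = x0" for \<alpha> by (simp add: pt_def vec_eq_iff)
    then show ?case using assms(2) by simp
  next
    case (insert i I)
    let ?Z = "{\<alpha> \<in> insert i I \<rightarrow>\<^sub>E ?R. f (pt (insert i I) \<alpha>) = 0}"
    let ?B = "{\<alpha> \<in> I \<rightarrow>\<^sub>E ?R. f (pt I \<alpha>) = 0}"
    let ?G = "{\<alpha> \<in> I \<rightarrow>\<^sub>E ?R. f (pt I \<alpha>) \<noteq> 0}"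
    define Zr where "Zr \<alpha> = {s \<in> ?R. f (pt (insert i I) (\<alpha>(i := s))) = 0}" for \<alpha>
    have finE: "finite (I \<rightarrow>\<^sub>E ?R)" using insert by (intro finite_PiE) auto
    have cardE: "card (I \<rightarrow>\<^sub>E ?R) = (2 * T + 1) ^ card I"
      by (subst card_PiE[OF insert.hyps(1)]) (simp only: cardR prod_constant)
    have sub: "?Z \<subseteq> (\<lambda>(\<alpha>, s). \<alpha>(i := s)) ` ((?B \<times> ?R) \<union> Sigma ?G Zr)"
    proof
      fix \<alpha> assume \<alpha>: "\<alpha> \<in> ?Z"
      define \<alpha>' where "\<alpha>' = \<alpha>(i := undefined)"
      have a1: "\<alpha>' \<in> I \<rightarrow>\<^sub>E ?R" using \<alpha> insert.hyps
        by (auto simp: \<alpha>'_def PiE_def extensional_def Pi_def)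
      have a2: "\<alpha> i \<in> ?R" using \<alpha> by (auto simp: PiE_def Pi_def)
      have a3: "\<alpha> = \<alpha>'(i := \<alpha> i)" by (simp add: \<alpha>'_def)
      have "(\<alpha>', \<alpha> i) \<in> (?B \<times> ?R) \<union> Sigma ?G Zr"
        using a1 a2 a3 \<alpha> by (cases "f (pt I \<alpha>') = 0") (auto simp: Zr_def)
      then show "\<alpha> \<in> (\<lambda>(\<alpha>, s). \<alpha>(i := s)) ` ((?B \<times> ?R) \<union> Sigma ?G Zr)"
        using a3 by (intro image_eqI[of _ _ "(\<alpha>', \<alpha> i)"]) auto
    qed
    have Zr: "card (Zr \<alpha>) \<le> m" if \<alpha>: "\<alpha> \<in> ?G" for \<alpha>
    proof -
      define y where "y = (pt I \<alpha> - (x0 $ i) *s axis i 1)"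
      obtain P where P: "Polynomial.degree P \<le> m" "\<And>t. f (y + t *s axis i 1) = poly P t"
        using polydeg_line[OF assms(1)] by blast
      have "poly P (x0 $ i) \<noteq> 0" using \<alpha> P(2)[of "x0 $ i"] by (simp add: y_def)
      then have P0: "P \<noteq> 0" by auto
      have eq: "pt (insert i I) (\<alpha>(i := s)) = y + of_int s *s axis i 1" for s
        using insert.hyps by (auto simp: pt_def y_def vec_eq_iff axis_def)
      have "of_int ` Zr \<alpha> \<subseteq> {t. poly P t = 0}"
        by (auto simp: Zr_def eq P(2))
      then have "card (of_int ` Zr \<alpha> :: complex set) \<le> card {t. poly P t = 0}"
        by (intro card_mono poly_roots_finite P0)
      also have "\<dots> \<le> Polynomial.degree P" using card_poly_roots_bound P0 by blast
      finally show ?thesis using P(1) by (simp add: card_image inj_on_def)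
    qed
    have finZr: "finite (Zr \<alpha>)" for \<alpha> by (rule finite_subset[of _ ?R]) (auto simp: Zr_def)
    have finB: "finite ?B" and finG: "finite ?G" using finE by auto
    have "card ?Z \<le> card ((?B \<times> ?R) \<union> Sigma ?G Zr)"
      by (rule order_trans[OF card_mono[OF _ sub] card_image_le]) (use finB finG finZr in auto)
    also have "\<dots> \<le> card (?B \<times> ?R) + card (Sigma ?G Zr)" by (rule card_Un_le)
    also have "\<dots> = card ?B * (2 * T + 1) + (\<Sum>\<alpha>\<in>?G. card (Zr \<alpha>))"
      unfolding card_cartesian_product cardR by (subst card_SigmaI[OF finG]) (simp_all add: finZr del: card_atLeastAtMost_int)
    also have "\<dots> \<le> (card I * m * (2 * T + 1) ^ (card I - 1)) * (2 * T + 1) + card ?G * m"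
      by (intro add_mono mult_right_mono insert.IH) (use sum_bounded_above[of ?G "\<lambda>\<alpha>. card (Zr \<alpha>)" m] Zr in auto)
    also have "card ?G * m \<le> (2 * T + 1) ^ card I * m"
      using card_mono[OF finE, of ?G] cardE by (intro mult_right_mono) auto
    also have "(card I * m * (2 * T + 1) ^ (card I - 1)) * (2 * T + 1) = card I * m * (2 * T + 1) ^ card I"
      by (cases "card I") (simp_all only: mult_0 diff_Suc_1 power_Suc mult_ac)
    finally show ?case using insert.hyps by (simp add: algebra_simps)
  qed
  let ?S = "{\<alpha> :: int ^ 'd. (\<forall>i. \<bar>\<alpha> $ i\<bar> \<le> int T) \<and> f (\<chi> i. of_int (\<alpha> $ i)) = 0}"
  have "card ?S = card ((\<lambda>\<alpha> i. \<alpha> $ i) ` ?S)"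
    by (rule card_image[symmetric]) (auto simp: inj_on_def vec_eq_iff fun_eq_iff)
  also have "\<dots> \<le> card {\<alpha> \<in> UNIV \<rightarrow>\<^sub>E ?R. f (pt UNIV \<alpha>) = 0}"
  proof (rule card_mono)
    show "finite {\<alpha> \<in> UNIV \<rightarrow>\<^sub>E ?R. f (pt UNIV \<alpha>) = 0}"
      by (rule finite_subset[of _ "UNIV \<rightarrow>\<^sub>E ?R"]) (auto intro!: finite_PiE)
  qed (auto simp: pt_def abs_le_iff minus_le_iff)
  also have "\<dots> \<le> CARD('d) * m * (2 * T + 1) ^ (CARD('d) - 1)" by (rule main) simp
  finally show ?thesis .
qed

text \<open>\<open>\<pi>\<close> projects onto the hyperplane along the axis \<open>i0\<close>. A
  polynomial minus its pullback under \<open>\<pi>\<close> is divisible by \<open>z\<close>: this is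
  clear for coordinates and passes to sums and products. The pullback of \<open>a\<close> itself
  vanishes.\<close>

lemma polyfun_vanish_on_hyperplane:
  fixes a :: "complex ^ 'd::finite \<Rightarrow> complex"
  assumes a: "polyfun a" and l: "l $ i0 \<noteq> 0"
    and van: "\<And>x. (\<Sum>i\<in>UNIV. l $ i * x $ i) = b \<Longrightarrow> a x = 0"
  shows "\<exists>h. polyfun h \<and> (\<forall>x. a x = ((\<Sum>i\<in>UNIV. l $ i * x $ i) - b) * h x)"
proof -
  define z where "z x = (\<Sum>i\<in>UNIV. l $ i * x $ i) - b" for x :: "complex ^ 'd"
  define \<pi> where "\<pi> x = x - (z x / l $ i0) *s axis i0 1" for x
  have z: "polyfun z" unfolding z_def[abs_def] by (intro polyfun_intros)
  have "polyfun (\<lambda>x. a (\<pi> x)) \<and> (\<exists>h. polyfun h \<and> (\<forall>x. a x - a (\<pi> x) = z x * h x))"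
    using a
  proof (induction rule: polyfun_induct)
    case (const c)
    show ?case by (auto intro!: polyfun_const exI[of _ "\<lambda>x. 0"])
  next
    case (coord i)
    have e: "\<pi> x $ i = x $ i - (if i = i0 then inverse (l $ i0) else 0) * z x" for x
      by (simp add: \<pi>_def axis_def divide_inverse mult.commute)
    have "polyfun (\<lambda>x. \<pi> x $ i)"
      unfolding e by (rule polyfun_diff[OF polyfun_coord polyfun_mult[OF polyfun_const z]])
    moreover have "x $ i - \<pi> x $ i = z x * (if i = i0 then inverse (l $ i0) else 0)" for x
      unfolding e by simp
    ultimately show ?case
      by (intro conjI exI[of _ "\<lambda>x. if i = i0 then inverse (l $ i0) else 0"] polyfun_const) simp_all
  next
    case (add f g)
    then obtain h h' where h: "polyfun h" "polyfun h'" "\<And>x. f x - f (\<pi> x) = z x * h x" "\<And>x. g x - g (\<pi> x) = z x * h' x" by blast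
    have "f x + g x - (f (\<pi> x) + g (\<pi> x)) = z x * (h x + h' x)" for x
      unfolding distrib_left h(3,4)[symmetric] by simp
    moreover have "polyfun (\<lambda>x. h x + h' x)" using h(1,2) by (rule polyfun_add)
    moreover have "polyfun (\<lambda>x. f (\<pi> x) + g (\<pi> x))" using add by (intro polyfun_add) auto
    ultimately show ?case by blast
  next
    case (mult f g)
    then obtain h h' where h: "polyfun h" "polyfun h'" "\<And>x. f x - f (\<pi> x) = z x * h x" "\<And>x. g x - g (\<pi> x) = z x * h' x" by blast
    have "f x * g x - f (\<pi> x) * g (\<pi> x) = z x * (f x * h' x + h x * g (\<pi> x))" for x
    proof -
      have "f x * g x - f (\<pi> x) * g (\<pi> x) = f x * (g x - g (\<pi> x)) + (f x - f (\<pi> x)) * g (\<pi> x)"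
        by (simp only: left_diff_distrib right_diff_distrib) simp
      also have "\<dots> = f x * (z x * h' x) + (z x * h x) * g (\<pi> x)" by (simp only: h)
      also have "\<dots> = z x * (f x * h' x + h x * g (\<pi> x))" by (simp add: distrib_left mult_ac)
      finally show ?thesis .
    qed
    moreover have "polyfun (\<lambda>x. f x * h' x + h x * g (\<pi> x))"
      by (intro polyfun_add polyfun_mult h(1,2) mult.hyps conjunct1[OF mult.IH(2)])
    moreover have "polyfun (\<lambda>x. f (\<pi> x) * g (\<pi> x))"
      by (intro polyfun_mult conjunct1[OF mult.IH(1)] conjunct1[OF mult.IH(2)])
    ultimately show ?case by blast
  qed
  then have "\<exists>h. polyfun h \<and> (\<forall>x. a x - a (\<pi> x) = z x * h x)" by (rule conjunct2)
  then obtain h where "polyfun h \<and> (\<forall>x. a x - a (\<pi> x) = z x * h x)" by (rule exE)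
  then have h: "polyfun h" "\<And>x. a x - a (\<pi> x) = z x * h x" by simp_all
  have "a (\<pi> x) = 0" for x
  proof (rule van)
    have "(\<Sum>i\<in>UNIV. l $ i * \<pi> x $ i) = (\<Sum>i\<in>UNIV. l $ i * x $ i - (if i = i0 then z x else 0))"
      using l by (intro sum.cong) (simp_all add: \<pi>_def axis_def right_diff_distrib)
    also have "\<dots> = b" by (simp add: sum_subtractf z_def)
    finally show "(\<Sum>i\<in>UNIV. l $ i * \<pi> x $ i) = b" .
  qed
  then have "a x = z x * h x" for x using h(2)[of x] by simp
  then show ?thesis using h(1) unfolding z_def by (intro exI[of _ h]) simp
qed

text \<open>A linear system with trivial kernel has a left inverse, so every coordinate functional
  is a combination of the rows. The proof eliminates one column at a time with pivot
  \<open>u i0 x0\<close>. It turns statements of the form "f is determined by these values" into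
  explicit formulas.\<close>

lemma trivial_kernel_imp_delta:
  fixes u :: "'i \<Rightarrow> 'x \<Rightarrow> 'f::field"
  assumes "finite Xs" "finite I"
    and "\<And>lam. (\<forall>i\<in>I. (\<Sum>x\<in>Xs. lam x * u i x) = 0) \<Longrightarrow> \<forall>x\<in>Xs. lam x = 0"
    and "x \<in> Xs"
  shows "\<exists>c. \<forall>y\<in>Xs. (\<Sum>i\<in>I. c i * u i y) = (if y = x then 1 else 0)"
  using assms
proof (induction Xs arbitrary: u x rule: finite_induct)
  case empty
  then show ?case by simp
next
  case (insert x0 Xs)
  have "\<exists>i\<in>I. u i x0 \<noteq> 0"
  proof (rule ccontr)
    assume *: "\<not> (\<exists>i\<in>I. u i x0 \<noteq> 0)"
    have "\<forall>i\<in>I. (\<Sum>x\<in>insert x0 Xs. (if x = x0 then 1 else 0) * u i x) = 0"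
      using * insert.hyps by (simp add: if_distrib[of "\<lambda>c. c * _"] cong: if_cong)
    from insert.prems(2)[OF this] show False by simp
  qed
  then obtain i0 where i0: "i0 \<in> I" "u i0 x0 \<noteq> 0" by blast
  define u' where "u' i y = u i0 x0 * u i y - u i x0 * u i0 y" for i y
  have ker: "\<forall>x\<in>Xs. lam x = 0" if lam: "\<forall>i\<in>I. (\<Sum>x\<in>Xs. lam x * u' i x) = 0" for lam
  proof -
    \<comment> \<open>The pivot row forces the value at \<open>x0\<close>, so a kernel vector of the
      reduced rows extends to one of the full system.\<close>
    define \<mu> where "\<mu> x = (if x = x0 then - (\<Sum>x\<in>Xs. lam x * u i0 x) / u i0 x0 else lam x)" for x
    have s: "(\<Sum>x\<in>Xs. \<mu> x * u i x) = (\<Sum>x\<in>Xs. lam x * u i x)" for i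
      using insert.hyps by (intro sum.cong) (auto simp: \<mu>_def)
    have "(\<Sum>x\<in>insert x0 Xs. \<mu> x * u i x) = 0" if "i \<in> I" for i
    proof -
      have "u i0 x0 * (\<Sum>x\<in>Xs. lam x * u i x) - u i x0 * (\<Sum>x\<in>Xs. lam x * u i0 x) = (\<Sum>x\<in>Xs. lam x * u' i x)"
        by (simp add: u'_def sum_distrib_left sum_subtractf algebra_simps)
      also have "\<dots> = 0" using lam that by blast
      finally have "(\<Sum>x\<in>Xs. lam x * u i x) = u i x0 * (\<Sum>x\<in>Xs. lam x * u i0 x) / u i0 x0"
        using i0 by (simp add: field_simps)
      then show ?thesis using insert.hyps by (simp add: s) (simp add: \<mu>_def)
    qed
    then have "\<forall>x\<in>insert x0 Xs. \<mu> x = 0" using insert.prems(2) by blast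
    then show ?thesis using insert.hyps by (auto simp: \<mu>_def split: if_splits)
  qed
  have delta': "\<exists>c. \<forall>y\<in>insert x0 Xs. (\<Sum>i\<in>I. c i * u i y) = (if y = x then 1 else 0)" if x: "x \<in> Xs" for x
  proof -
    obtain c where c: "\<forall>y\<in>Xs. (\<Sum>i\<in>I. c i * u' i y) = (if y = x then 1 else 0)"
      using insert.IH[OF insert.prems(1) ker x] by blast
    \<comment> \<open>Undoes the elimination: on the original rows these coefficients give what
      \<open>c\<close> gives on the reduced ones.\<close>
    define c' where "c' i = c i * u i0 x0 - (if i = i0 then (\<Sum>k\<in>I. c k * u k x0) else 0)" for i
    have "(\<Sum>i\<in>I. c' i * u i y) = (\<Sum>i\<in>I. c i * u' i y)" for y
    proof -
      have "(\<Sum>i\<in>I. c' i * u i y) = (\<Sum>i\<in>I. c i * u i0 x0 * u i y)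
          - (\<Sum>i\<in>I. if i = i0 then (\<Sum>k\<in>I. c k * u k x0) * u i y else 0)"
        unfolding c'_def left_diff_distrib sum_subtractf
        by (simp add: if_distrib[of "\<lambda>c. c * _"] cong: if_cong)
      also have "\<dots> = (\<Sum>i\<in>I. c i * u i0 x0 * u i y) - (\<Sum>k\<in>I. c k * u k x0 * u i0 y)"
        using i0 insert.prems(1) by (simp add: sum_distrib_right)
      also have "\<dots> = (\<Sum>i\<in>I. c i * u' i y)"
        by (simp add: u'_def right_diff_distrib sum_subtractf mult_ac)
      finally show ?thesis .
    qed
    moreover have "(\<Sum>i\<in>I. c i * u' i x0) = 0" by (simp add: u'_def mult.commute)
    moreover have "x \<noteq> x0" using x insert.hyps by blast
    ultimately show ?thesis using c by (intro exI[of _ c']) auto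
  qed
  show ?case
  proof (cases "x = x0")
    case False
    then show ?thesis using delta'[of x] insert.prems(3) by blast
  next
    case True
    have "\<forall>x\<in>Xs. \<exists>c. \<forall>y\<in>insert x0 Xs. (\<Sum>i\<in>I. c i * u i y) = (if y = x then 1 else 0)"
      using delta' by blast
    then obtain d where d: "\<And>x y. x \<in> Xs \<Longrightarrow> y \<in> insert x0 Xs \<Longrightarrow> (\<Sum>i\<in>I. d x i * u i y) = (if y = x then 1 else 0)"
      by metis
    \<comment> \<open>For the pivot column itself: remove from the pivot row its entries in all
      other columns, then normalize.\<close>
    define c where "c i = ((if i = i0 then 1 else 0) - (\<Sum>x\<in>Xs. u i0 x * d x i)) / u i0 x0" for i
    have "(\<Sum>i\<in>I. c i * u i y) = (if y = x0 then 1 else 0)" if y: "y \<in> insert x0 Xs" for y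
    proof -
      have "(\<Sum>i\<in>I. c i * u i y) = ((\<Sum>i\<in>I. (if i = i0 then 1 else 0) * u i y)
          - (\<Sum>i\<in>I. \<Sum>x\<in>Xs. u i0 x * (d x i * u i y))) / u i0 x0"
        by (simp add: c_def sum_divide_distrib[symmetric] left_diff_distrib sum_subtractf sum_distrib_right mult.assoc)
      also have "(\<Sum>i\<in>I. (if i = i0 then 1 else 0) * u i y) = u i0 y"
        using i0 insert.prems(1) by (simp add: if_distrib[of "\<lambda>c. c * _"] cong: if_cong)
      also have "(\<Sum>i\<in>I. \<Sum>x\<in>Xs. u i0 x * (d x i * u i y)) = (\<Sum>x\<in>Xs. u i0 x * (\<Sum>i\<in>I. d x i * u i y))"
        by (subst sum.swap) (simp add: sum_distrib_left)
      also have "\<dots> = (\<Sum>x\<in>Xs. u i0 x * (if y = x then 1 else 0))"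
        using d y by (intro sum.cong) auto
      also have "\<dots> = (if y \<in> Xs then u i0 y else 0)"
        using insert.hyps by (simp add: if_distrib[of "\<lambda>c. _ * c"] cong: if_cong)
      finally show ?thesis using y insert.hyps i0 by auto
    qed
    then show ?thesis using True by blast
  qed
qed

text \<open>Having a trivial kernel is an open condition on the parameter. The elimination is
  fraction free, so the reduced rows stay polynomial in \<open>p\<close>, and \<open>q\<close> is
  the product of the pivots met at \<open>p1\<close>.\<close>

lemma generic_trivial_kernel:
  fixes u :: "'i \<Rightarrow> complex ^ 'm::finite \<Rightarrow> 'x \<Rightarrow> complex"
  assumes "finite Xs" "\<And>i x. i \<in> I \<Longrightarrow> x \<in> Xs \<Longrightarrow> polyfun (\<lambda>p. u i p x)"
    and "\<And>lam. (\<forall>i\<in>I. (\<Sum>x\<in>Xs. lam x * u i p1 x) = 0) \<Longrightarrow> \<forall>x\<in>Xs. lam x = 0"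
  shows "\<exists>q. polyfun q \<and> q p1 \<noteq> 0 \<and>
    (\<forall>p lam. q p \<noteq> 0 \<longrightarrow> (\<forall>i\<in>I. (\<Sum>x\<in>Xs. lam x * u i p x) = 0) \<longrightarrow> (\<forall>x\<in>Xs. lam x = 0))"
  using assms
proof (induction Xs arbitrary: u rule: finite_induct)
  case empty
  then show ?case by (intro exI[of _ "\<lambda>p. 1"]) (auto intro: polyfun_const)
next
  case (insert x0 Xs)
  have "\<exists>i\<in>I. u i p1 x0 \<noteq> 0"
  proof (rule ccontr)
    assume *: "\<not> (\<exists>i\<in>I. u i p1 x0 \<noteq> 0)"
    have "\<forall>i\<in>I. (\<Sum>x\<in>insert x0 Xs. (if x = x0 then 1 else 0) * u i p1 x) = 0"
      using * insert.hyps by (simp add: if_distrib[of "\<lambda>c. c * _"] cong: if_cong)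
    from insert.prems(2)[OF this] show False by simp
  qed
  then obtain i0 where i0: "i0 \<in> I" "u i0 p1 x0 \<noteq> 0" by blast
  define u' where "u' i p y = u i0 p x0 * u i p y - u i p x0 * u i0 p y" for i p y
  have comb: "u i0 p x0 * (\<Sum>x\<in>Xs. lam x * u i p x) - u i p x0 * (\<Sum>x\<in>Xs. lam x * u i0 p x) = (\<Sum>x\<in>Xs. lam x * u' i p x)" for i p lam
    by (simp add: u'_def sum_distrib_left sum_subtractf algebra_simps)
  have ker: "\<forall>x\<in>Xs. lam x = 0" if lam: "\<forall>i\<in>I. (\<Sum>x\<in>Xs. lam x * u' i p1 x) = 0" for lam
  proof -
    define \<mu> where "\<mu> x = (if x = x0 then - (\<Sum>x\<in>Xs. lam x * u i0 p1 x) / u i0 p1 x0 else lam x)" for x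
    have s: "(\<Sum>x\<in>Xs. \<mu> x * u i p1 x) = (\<Sum>x\<in>Xs. lam x * u i p1 x)" for i
      using insert.hyps by (intro sum.cong) (auto simp: \<mu>_def)
    have "(\<Sum>x\<in>insert x0 Xs. \<mu> x * u i p1 x) = 0" if "i \<in> I" for i
    proof -
      have "(\<Sum>x\<in>Xs. lam x * u i p1 x) = u i p1 x0 * (\<Sum>x\<in>Xs. lam x * u i0 p1 x) / u i0 p1 x0"
        using i0 comb[of p1 lam i] lam that by (simp add: field_simps)
      then show ?thesis using insert.hyps by (simp add: s) (simp add: \<mu>_def)
    qed
    then have "\<forall>x\<in>insert x0 Xs. \<mu> x = 0" using insert.prems(2) by blast
    then show ?thesis using insert.hyps by (auto simp: \<mu>_def split: if_splits)
  qed
  have pu: "polyfun (\<lambda>p. u' i p x)" if "i \<in> I" "x \<in> Xs" for i x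
    unfolding u'_def using insert.prems(1) that i0 by (intro polyfun_diff polyfun_mult) auto
  have "\<exists>q. polyfun q \<and> q p1 \<noteq> 0 \<and>
    (\<forall>p lam. q p \<noteq> 0 \<longrightarrow> (\<forall>i\<in>I. (\<Sum>x\<in>Xs. lam x * u' i p x) = 0) \<longrightarrow> (\<forall>x\<in>Xs. lam x = 0))"
    using pu ker by (rule insert.IH)
  then obtain q where "polyfun q \<and> q p1 \<noteq> 0 \<and>
    (\<forall>p lam. q p \<noteq> 0 \<longrightarrow> (\<forall>i\<in>I. (\<Sum>x\<in>Xs. lam x * u' i p x) = 0) \<longrightarrow> (\<forall>x\<in>Xs. lam x = 0))"
    by (rule exE)
  then have q: "polyfun q" "q p1 \<noteq> 0"
    "\<And>p lam. q p \<noteq> 0 \<Longrightarrow> (\<forall>i\<in>I. (\<Sum>x\<in>Xs. lam x * u' i p x) = 0) \<Longrightarrow> (\<forall>x\<in>Xs. lam x = 0)"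
    by simp_all
  have fin: "\<forall>x\<in>insert x0 Xs. lam x = 0" if p: "u i0 p x0 * q p \<noteq> 0" and lam: "\<forall>i\<in>I. (\<Sum>x\<in>insert x0 Xs. lam x * u i p x) = 0" for p lam
  proof -
    have e: "(\<Sum>x\<in>Xs. lam x * u i p x) = - lam x0 * u i p x0" if "i \<in> I" for i
      using lam that insert.hyps by (simp add: add_eq_0_iff)
    have "\<forall>i\<in>I. (\<Sum>x\<in>Xs. lam x * u' i p x) = 0"
      using i0 e by (simp add: comb[symmetric])
    then have z: "\<forall>x\<in>Xs. lam x = 0" using q(3) p by auto
    then have "lam x0 * u i0 p x0 = 0" using e[OF i0(1)] by simp
    then show ?thesis using z p by auto
  qed
  show ?case
  proof (intro exI[of _ "\<lambda>p. u i0 p x0 * q p"] conjI allI impI)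
    show "polyfun (\<lambda>p. u i0 p x0 * q p)" using insert.prems(1)[OF i0(1)] q(1) by (intro polyfun_mult) auto
    show "u i0 p1 x0 * q p1 \<noteq> 0" using i0 q by simp
  qed (rule fin)
qed

lemma more_unknowns_than_equations:
  fixes M :: "'y \<Rightarrow> 'i \<Rightarrow> 'f::field"
  assumes "finite Y" "finite I" "card Y < card I"
  shows "\<exists>c. (\<exists>i\<in>I. c i \<noteq> 0) \<and> (\<forall>y\<in>Y. (\<Sum>i\<in>I. c i * M y i) = 0)"
  using assms
proof (induction Y arbitrary: I M rule: finite_induct)
  case empty
  then obtain i where "i \<in> I" by fastforce
  then show ?case by (intro exI[of _ "\<lambda>_. 1"]) auto
next
  case (insert y0 Y)
  show ?case
  proof (cases "\<forall>i\<in>I. M y0 i = 0")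
    case True
    have "card Y < card I" using insert by simp
    then obtain c where "\<exists>i\<in>I. c i \<noteq> 0" "\<forall>y\<in>Y. (\<Sum>i\<in>I. c i * M y i) = 0"
      using insert.IH[OF insert.prems(1)] by blast
    then show ?thesis using True by (intro exI[of _ c]) auto
  next
    case False
    then obtain i0 where i0: "i0 \<in> I" "M y0 i0 \<noteq> 0" by blast
    define M' where "M' y i = M y i - M y i0 * M y0 i / M y0 i0" for y i
    have "card Y < card (I - {i0})" using insert.prems insert.hyps i0 by auto
    then obtain c where c: "\<exists>i\<in>I - {i0}. c i \<noteq> 0" "\<forall>y\<in>Y. (\<Sum>i\<in>I - {i0}. c i * M' y i) = 0"
      using insert.IH[of "I - {i0}" M'] insert.prems(1) by blast
    define c' where "c' i = (if i = i0 then - (\<Sum>i\<in>I - {i0}. c i * M y0 i) / M y0 i0 else c i)" for i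
    have s: "(\<Sum>i\<in>I. c' i * M y i) = c' i0 * M y i0 + (\<Sum>i\<in>I - {i0}. c i * M y i)" for y
      by (subst sum.remove[OF insert.prems(1) i0(1)]) (auto simp: c'_def intro!: sum.cong)
    have "(\<Sum>i\<in>I. c' i * M y i) = (\<Sum>i\<in>I - {i0}. c i * M' y i)" for y
      unfolding s by (simp add: M'_def c'_def right_diff_distrib sum_subtractf sum_distrib_right sum_distrib_left sum_divide_distrib mult_ac)
    then have "\<forall>y\<in>Y. (\<Sum>i\<in>I. c' i * M y i) = 0" using c by simp
    moreover have "(\<Sum>i\<in>I. c' i * M y0 i) = 0" unfolding s using i0 by (simp add: c'_def)
    moreover have "\<exists>i\<in>I. c' i \<noteq> 0" using c by (auto simp: c'_def)
    ultimately show ?thesis by blast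
  qed
qed

section \<open>The semigroup of the columns\<close>

lemma rat_common_denominator:
  fixes f :: "'x \<Rightarrow> rat"
  assumes "finite S"
  shows "\<exists>m z. m > (0::int) \<and> (\<forall>x\<in>S. f x * of_int m = of_int (z x))"
  using assms
proof (induction S rule: finite_induct)
  case empty
  then show ?case by (intro exI[of _ 1]) auto
next
  case (insert x S)
  then obtain m z where m: "m > 0" "\<And>x. x \<in> S \<Longrightarrow> f x * of_int m = of_int (z x)" by blast
  obtain a b where "quotient_of (f x) = (a, b)" by (cases "quotient_of (f x)")
  then have ab: "b > 0" "f x = of_int a / of_int b"
    by (rule quotient_of_denom_pos, rule quotient_of_div)
  have "f y * of_int (m * b) = of_int ((if y = x then a * m else z y * b))" if "y \<in> insert x S" for y
  proof (cases "y = x")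
    case True
    then show ?thesis using ab by (simp add: field_simps)
  next
    case False
    then have "f y * of_int m = of_int (z y)" using m that by blast
    then show ?thesis using False by (simp add: mult.assoc[symmetric])
  qed
  moreover have "m * b > 0" using m ab by simp
  ultimately show ?case
    by (intro exI[of _ "m * b"] exI[of _ "\<lambda>y. if y = x then a * m else z y * b"] conjI ballI)
qed

locale toric =
  fixes A :: "int ^ 'n::finite ^ 'd::finite" and i0 :: 'd
  assumes ones: "A $ i0 $ j = 1"
begin

definition col :: "'n \<Rightarrow> int ^ 'd" where "col j = (\<chi> i. A $ i $ j)"

definition wt :: "nat ^ 'n \<Rightarrow> int ^ 'd" where "wt u = A *v int_vec u"

definition NA :: "(int ^ 'd) set" where "NA = range wt"

text \<open>As row \<open>i0\<close> of \<open>A\<close> consists of ones, this coordinate counts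
  the columns in every representation of \<gamma>. The grading has finite pieces and allows elements
  to be split by degree, on which the inductions over the degree rest.\<close>

definition lev :: "nat \<Rightarrow> (int ^ 'd) set" where "lev k = {\<gamma>\<in>NA. \<gamma> $ i0 = int k}"

definition tot :: "nat ^ 'n \<Rightarrow> nat" where "tot u = (\<Sum>j\<in>UNIV. u $ j)"

lemma col_nth: "col j $ i = A $ i $ j" by (simp add: col_def)

lemma wt_nth: "wt u $ i = (\<Sum>j\<in>UNIV. A $ i $ j * int (u $ j))"
  by (simp add: wt_def matrix_vector_mult_def int_vec_def)

lemma wt_add: "wt (u + v) = wt u + wt v"
  by (simp add: vec_eq_iff wt_nth distrib_left sum.distrib)

lemma wt_0: "wt 0 = 0" by (simp add: vec_eq_iff wt_nth)

lemma wt_axis: "wt (axis j 1) = col j"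
proof (subst vec_eq_iff, intro allI)
  fix i
  have "wt (axis j 1) $ i = (\<Sum>k\<in>UNIV. if k = j then A $ i $ k else 0)"
    unfolding wt_nth by (rule sum.cong) (auto simp: axis_def)
  then show "wt (axis j 1) $ i = col j $ i" by (simp add: col_nth)
qed

lemma wt_i0: "wt u $ i0 = int (tot u)"
  by (simp add: wt_nth ones tot_def)

lemma tot_add: "tot (u + v) = tot u + tot v" by (simp add: tot_def sum.distrib)

lemma tot_0: "tot 0 = 0" by (simp add: tot_def)

lemma tot_axis: "tot (axis j 1) = 1" unfolding tot_def by (rule sum_axis)

lemma tot_eq_0_iff: "tot u = 0 \<longleftrightarrow> u = 0"
  by (simp add: tot_def vec_eq_iff)

lemma wt_in_NA: "wt u \<in> NA" by (simp add: NA_def)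

lemma wt_in_lev: "wt u \<in> lev (tot u)" by (simp add: lev_def wt_in_NA wt_i0)

lemma levE:
  assumes "\<gamma> \<in> lev k"
  obtains u where "\<gamma> = wt u" "tot u = k"
  using assms by (auto simp: lev_def NA_def wt_i0)

lemma lev_subset: "lev k \<subseteq> NA" by (auto simp: lev_def)

lemma NA_lev: "\<gamma> \<in> NA \<Longrightarrow> \<gamma> \<in> lev (nat (\<gamma> $ i0))"
  by (auto simp: lev_def NA_def wt_i0)

lemma NA_add: "\<gamma> \<in> NA \<Longrightarrow> \<delta> \<in> NA \<Longrightarrow> \<gamma> + \<delta> \<in> NA"
  unfolding NA_def by (auto simp: wt_add[symmetric])

lemma col_in_NA: "col j \<in> NA" unfolding wt_axis[symmetric] by (rule wt_in_NA)

lemma zero_in_NA: "0 \<in> NA" unfolding wt_0[symmetric] by (rule wt_in_NA)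

lemma lev_add: "\<gamma> \<in> lev k \<Longrightarrow> \<delta> \<in> lev m \<Longrightarrow> \<gamma> + \<delta> \<in> lev (k + m)"
  by (auto simp: lev_def NA_add)

lemma col_in_lev: "col j \<in> lev 1"
  by (simp add: lev_def col_in_NA col_nth ones)

lemma lev_add_col: "\<gamma> \<in> lev k \<Longrightarrow> \<gamma> + col j \<in> lev (Suc k)"
  using lev_add[OF _ col_in_lev] by fastforce

lemma exists_pos_coord: "tot u = Suc k \<Longrightarrow> \<exists>j. u $ j > 0"
proof (rule ccontr)
  assume "tot u = Suc k" "\<nexists>j. u $ j > 0"
  then show False by (simp add: tot_def)
qed

lemma split_axis:
  assumes "(u :: nat ^ 'n) $ j > 0"
  obtains v where "u = v + axis j 1"
proof
  show "u = (\<chi> k. if k = j then u $ k - 1 else u $ k) + axis j 1"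
    using assms by (auto simp: vec_eq_iff axis_def)
qed

lemma tot_split: "tot u = k + m \<Longrightarrow> \<exists>v w. u = v + w \<and> tot v = k \<and> tot w = m"
proof (induction m arbitrary: u)
  case 0
  then show ?case by (intro exI[of _ u] exI[of _ 0]) (auto simp: tot_0)
next
  case (Suc m)
  then obtain j where "u $ j > 0" using exists_pos_coord[of u "k + m"] by auto
  then obtain u' where u': "u = u' + axis j 1" by (rule split_axis)
  then have "tot u' = k + m" using Suc.prems by (simp add: tot_add tot_axis del: One_nat_def)
  then obtain v w where vw: "u' = v + w" "tot v = k" "tot w = m" using Suc.IH by blast
  have "u = v + (w + axis j 1)" using u' vw by (simp only: add.assoc)
  moreover have "tot (w + axis j 1) = Suc m" using vw by (simp add: tot_add tot_axis del: One_nat_def)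
  ultimately show ?case using vw(2) by blast
qed

lemma lev_split:
  assumes "\<gamma> \<in> lev (k + m)"
  obtains \<alpha> \<delta> where "\<alpha> \<in> lev k" "\<delta> \<in> lev m" "\<gamma> = \<alpha> + \<delta>"
proof -
  obtain u where u: "\<gamma> = wt u" "tot u = k + m" using assms by (rule levE)
  obtain v w where vw: "u = v + w" "tot v = k" "tot w = m" using tot_split[OF u(2)] by blast
  show ?thesis by (rule that[of "wt v" "wt w"]) (use u vw wt_in_lev in \<open>auto simp: wt_add\<close>)
qed

lemma lev_0: "lev 0 = {0}"
proof (intro equalityI subsetI)
  fix \<gamma> assume "\<gamma> \<in> lev 0"
  then obtain u where "\<gamma> = wt u" "tot u = 0" by (rule levE)
  then show "\<gamma> \<in> {0}" by (simp add: tot_eq_0_iff wt_0)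
next
  fix \<gamma> :: "int ^ 'd" assume "\<gamma> \<in> {0}"
  then show "\<gamma> \<in> lev 0" by (simp add: lev_def zero_in_NA)
qed

lemma finite_tot: "finite {u. tot u = k}"
proof (rule finite_subset)
  show "{u. tot u = k} \<subseteq> (\<lambda>f. \<chi> j. f j) ` (UNIV \<rightarrow>\<^sub>E {..k})"
  proof
    fix u :: "nat ^ 'n" assume u: "u \<in> {u. tot u = k}"
    then have "u $ j \<le> k" for j unfolding tot_def using member_le_sum[of j UNIV "\<lambda>j. u $ j"] by auto
    then show "u \<in> (\<lambda>f. \<chi> j. f j) ` (UNIV \<rightarrow>\<^sub>E {..k})"
      by (intro image_eqI[of _ _ "\<lambda>j. u $ j"]) auto
  qed
qed (auto intro!: finite_PiE)

lemma finite_lev: "finite (lev k)"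
proof (rule finite_subset)
  show "lev k \<subseteq> wt ` {u. tot u = k}" by (auto elim!: levE)
qed (simp add: finite_tot)

text \<open>The functional \<open>f\<close> evaluated on t^\<gamma> times \<Sum> a_ij p_j t^(a_j),
  the symbol of the i-th homogeneity at \<open>p\<close>. The relation satisfied by solutions adds a
  term of lower degree.\<close>

definition theta :: "complex ^ 'n \<Rightarrow> 'd \<Rightarrow> (int ^ 'd \<Rightarrow> complex) \<Rightarrow> int ^ 'd \<Rightarrow> complex" where
  "theta p i f \<gamma> = (\<Sum>j\<in>UNIV. of_int (A $ i $ j) * p $ j * f (\<gamma> + col j))"

section \<open>Points at which the Euler symbols span a whole degree\<close>

lemma independent_functional:
  assumes indep: "\<And>z :: int ^ 'n. A *v z = 0 \<Longrightarrow> (\<forall>j. j \<notin> \<tau> \<longrightarrow> z $ j = 0) \<Longrightarrow> z = 0"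
    and "j \<in> \<tau>"
  shows "\<exists>l :: 'd \<Rightarrow> rat. \<forall>k\<in>\<tau>. (\<Sum>i\<in>UNIV. l i * of_int (A $ i $ k)) = (if k = j then 1 else 0)"
proof (rule trivial_kernel_imp_delta[OF _ _ _ \<open>j \<in> \<tau>\<close>])
  fix lam :: "'n \<Rightarrow> rat"
  assume lam: "\<forall>i\<in>UNIV. (\<Sum>x\<in>\<tau>. lam x * of_int (A $ i $ x)) = 0"
  obtain m z where mz: "m > (0::int)" "\<And>x. x \<in> \<tau> \<Longrightarrow> lam x * of_int m = of_int (z x)"
    using rat_common_denominator[of \<tau> lam] by auto
  define z' where "z' = (\<chi> x. if x \<in> \<tau> then z x else 0)"
  have "(A *v z') $ i = 0" for i
  proof -
    have "(A *v z') $ i = (\<Sum>x\<in>\<tau>. A $ i $ x * z x)"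
      unfolding matrix_vector_mult_def z'_def
      by (simp add: if_distrib[of "\<lambda>c. _ * c"] sum.If_cases cong: if_cong)
    then have "(of_int ((A *v z') $ i) :: rat) = (\<Sum>x\<in>\<tau>. of_int (A $ i $ x) * (lam x * of_int m))"
      using mz by simp
    also have "\<dots> = of_int m * (\<Sum>x\<in>\<tau>. lam x * of_int (A $ i $ x))"
      by (simp add: sum_distrib_left mult_ac)
    also have "\<dots> = 0" using lam by simp
    finally show ?thesis by simp
  qed
  then have "z' = 0" by (intro indep) (auto simp: vec_eq_iff z'_def)
  then have "z' $ x = 0" for x by simp
  then have "z x = 0" if "x \<in> \<tau>" for x using that by (auto simp: z'_def dest: meta_spec[of _ x])
  then show "\<forall>x\<in>\<tau>. lam x = 0" using mz by fastforce
qed auto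

text \<open>Take p_j = \<epsilon>^(w_j), and for an exponent n let \<open>\<tau>\<close> be the set
  of its large entries. If the columns in \<open>\<tau>\<close> are dependent, a kernel vector
  supported there moves n to another representation of the same lattice point with smaller weight,
  which gains a factor \<epsilon>. If they are independent, a form dual to one of the columns turns
  the vanishing of \<open>theta\<close> into an expression of the value at n through exponents with
  a smaller total deficit, at the price of a bounded factor. The deficit is bounded, so the maximum
  of all values is at most half of itself.\<close>

lemma exists_good_point:
  "\<exists>N p. \<forall>f. (\<forall>i. \<forall>\<gamma>\<in>lev N. theta p i f \<gamma> = 0) \<longrightarrow> (\<forall>\<gamma>\<in>lev (Suc N). f \<gamma> = 0)"
proof -
  define dep where "dep \<tau> \<longleftrightarrow> (\<exists>z :: int ^ 'n. z \<noteq> 0 \<and> A *v z = 0 \<and> (\<forall>j. j \<notin> \<tau> \<longrightarrow> z $ j = 0))" for \<tau>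
  have "\<forall>\<tau>\<in>{\<tau>. dep \<tau>}. \<exists>z :: int ^ 'n. z \<noteq> 0 \<and> A *v z = 0 \<and> (\<forall>j. j \<notin> \<tau> \<longrightarrow> z $ j = 0)"
    by (auto simp: dep_def)
  from bchoice[OF this] obtain zz where "\<forall>\<tau>\<in>{\<tau>. dep \<tau>}. zz \<tau> \<noteq> 0 \<and> A *v zz \<tau> = 0 \<and> (\<forall>j. j \<notin> \<tau> \<longrightarrow> zz \<tau> $ j = 0)"
    by (rule exE)
  then have zz: "\<And>\<tau>. dep \<tau> \<Longrightarrow> zz \<tau> \<noteq> 0" "\<And>\<tau>. dep \<tau> \<Longrightarrow> A *v zz \<tau> = 0"
      "\<And>\<tau> j. dep \<tau> \<Longrightarrow> j \<notin> \<tau> \<Longrightarrow> zz \<tau> $ j = 0"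
    by auto
  \<comment> \<open>The weight is nonzero on each chosen kernel vector; the sign is then fixed so
    that subtracting \<open>z' \<tau>\<close> always lowers the weight.\<close>
  obtain w :: "nat ^ 'n" where w: "\<forall>z\<in>zz ` {\<tau>. dep \<tau>}. (\<Sum>j\<in>UNIV. int (w $ j) * z $ j) \<noteq> 0"
  proof -
    have "0 \<notin> zz ` {\<tau>. dep \<tau>}" using zz(1) by force
    then show ?thesis using avoid_hyperplanes[of "zz ` {\<tau>. dep \<tau>}"] that by auto
  qed
  define wdot where "wdot z = (\<Sum>j\<in>UNIV. int (w $ j) * z $ j)" for z :: "int ^ 'n"
  define z' where "z' \<tau> = (if wdot (zz \<tau>) > 0 then zz \<tau> else - zz \<tau>)" for \<tau>
  have z': "A *v z' \<tau> = 0" "\<And>j. j \<notin> \<tau> \<Longrightarrow> z' \<tau> $ j = 0" "wdot (z' \<tau>) > 0" if "dep \<tau>" for \<tau>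
  proof -
    have "wdot (- z) = - wdot z" for z by (simp add: wdot_def sum_negf)
    moreover have "wdot (zz \<tau>) \<noteq> 0" using w that by (auto simp: wdot_def)
    ultimately show "wdot (z' \<tau>) > 0" by (auto simp: z'_def)
    have "A *v (- zz \<tau>) = - (A *v zz \<tau>)" by (simp add: matrix_vector_mult_def vec_eq_iff sum_negf)
    then show "A *v z' \<tau> = 0" using zz(2)[OF that] by (auto simp: z'_def)
    show "\<And>j. j \<notin> \<tau> \<Longrightarrow> z' \<tau> $ j = 0" using zz(3)[OF that] by (auto simp: z'_def)
  qed
  define K where "K = Max (range (\<lambda>x. nat \<bar>z' (fst x) $ snd x\<bar>))"
  have K: "\<bar>z' \<tau> $ j\<bar> \<le> int K" for \<tau> j
    using Max_ge[OF finite_imageI[OF finite[of UNIV]] rangeI, of "\<lambda>x. nat \<bar>z' (fst x) $ snd x\<bar>" "(\<tau>, j)"] unfolding K_def[symmetric]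
    by simp
  define ll :: "'n set \<Rightarrow> 'n \<Rightarrow> 'd \<Rightarrow> rat" where
    "ll \<tau> j = (SOME l. \<forall>k\<in>\<tau>. (\<Sum>i\<in>UNIV. l i * of_int (A $ i $ k)) = (if k = j then 1 else 0))" for \<tau> j
  have ll: "(\<Sum>i\<in>UNIV. ll \<tau> j i * of_int (A $ i $ k)) = (if k = j then 1 else 0)"
    if "\<not> dep \<tau>" "j \<in> \<tau>" "k \<in> \<tau>" for \<tau> j k
  proof -
    have "\<exists>l :: 'd \<Rightarrow> rat. \<forall>k\<in>\<tau>. (\<Sum>i\<in>UNIV. l i * of_int (A $ i $ k)) = (if k = j then 1 else 0)"
      by (rule independent_functional) (use that in \<open>auto simp: dep_def\<close>)
    from someI_ex[OF this]
    have "\<forall>k\<in>\<tau>. (\<Sum>i\<in>UNIV. ll \<tau> j i * of_int (A $ i $ k)) = (if k = j then 1 else 0)"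
      unfolding ll_def .
    then show ?thesis using that(3) by blast
  qed
  define c where "c \<tau> j k = (\<Sum>i\<in>UNIV. ll \<tau> j i * of_int (A $ i $ k))" for \<tau> j k
  define L where "L = Max (range (\<lambda>x. \<bar>real_of_rat (c (fst x) (fst (snd x)) (snd (snd x)))\<bar>))"
  have L: "\<bar>real_of_rat (c \<tau> j k)\<bar> \<le> L" for \<tau> j k
    using Max_ge[OF finite_imageI[OF finite[of UNIV]] rangeI, of "\<lambda>x. \<bar>real_of_rat (c (fst x) (fst (snd x)) (snd (snd x)))\<bar>" "(\<tau>, j, k)"]
    unfolding L_def[symmetric] by simp
  have L0: "L \<ge> 0" using L[of undefined undefined undefined] by linarith
  define C where "C = 1 + CARD('n) * L"
  have C1: "C \<ge> 1" using L0 by (simp add: C_def)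
  \<comment> \<open>An exponent of total degree N + 1 must have an entry of at least K + 1, and the
    deficit \<open>D\<close> below never exceeds \<open>N\<close>.\<close>
  define N where "N = CARD('n) * K"
  \<comment> \<open>With this choice N losses of a factor \<open>C\<close> against one gain of
    \<open>\<epsilon>\<close> leave the factor 1/2.\<close>
  define \<epsilon> where "\<epsilon> = 1 / (2 * C ^ N)"
  have CN: "1 \<le> C ^ N" using C1 by simp
  have eps: "0 < \<epsilon>" "\<epsilon> \<le> 1" "C ^ N * \<epsilon> < 1"
    using CN by (simp_all add: \<epsilon>_def divide_le_eq)
  define p :: "complex ^ 'n" where "p = (\<chi> j. of_real (\<epsilon> ^ (w $ j)))"
  define wn where "wn n = (\<Sum>j\<in>UNIV. w $ j * n $ j)" for n :: "nat ^ 'n"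
  have mon: "monom_eval n p = of_real (\<epsilon> ^ wn n)" for n
    unfolding monom_eval_def p_def wn_def by (simp add: power_sum power_mult)
  have "f \<gamma> = 0" if f: "\<forall>i. \<forall>\<gamma>\<in>lev N. theta p i f \<gamma> = 0" and "\<gamma> \<in> lev (Suc N)" for f \<gamma>
  proof -
    \<comment> \<open>Two exponents over the same lattice point share the value of \<open>f\<close>,
      so their weighted values differ exactly by a power of \<open>\<epsilon>\<close>.\<close>
    define \<nu> where "\<nu> n = monom_eval n p * f (wt n)" for n
    have nnu: "norm (\<nu> n) = \<epsilon> ^ wn n * norm (f (wt n))" for n
      using eps by (simp add: \<nu>_def mon norm_mult norm_power)
    define V where "V = Max ((\<lambda>n. norm (\<nu> n)) ` {n. tot n = Suc N})"
    have fin: "finite ((\<lambda>n. norm (\<nu> n)) ` {n. tot n = Suc N})" using finite_tot by simp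
    have V: "norm (\<nu> n) \<le> V" if "tot n = Suc N" for n
      unfolding V_def using that fin by (intro Max_ge) auto
    \<comment> \<open>The total amount by which entries fall short of \<open>K\<close>; truncated
      subtraction ignores the large entries.\<close>
    define D where "D n = (\<Sum>j\<in>UNIV. K - n $ j)" for n :: "nat ^ 'n"
    obtain u0 where "tot u0 = Suc N" by (rule levE[OF \<open>\<gamma> \<in> lev (Suc N)\<close>])
    then have V0: "V \<ge> 0" using V[of u0] norm_ge_zero[of "\<nu> u0"] by linarith
    have bound: "norm (\<nu> n) \<le> C ^ D n * (\<epsilon> * V)" if "tot n = Suc N" for n
      using that
    proof (induction "D n" arbitrary: n rule: less_induct)
      case less
      define \<tau> where "\<tau> = {i. K \<le> n $ i}"
      show ?case
      proof (cases "dep \<tau>")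
        case True
        define n' where "n' = (\<chi> j. nat (int (n $ j) - z' \<tau> $ j))"
        have ge: "int (n $ j) - z' \<tau> $ j \<ge> 0" for j
        proof (cases "j \<in> \<tau>")
          case True
          then show ?thesis using K[of \<tau> j] by (auto simp: \<tau>_def abs_le_iff)
        next
          case False
          then show ?thesis using z'(2)[OF True] by auto
        qed
        then have iv: "int_vec n = int_vec n' + z' \<tau>" by (simp add: vec_eq_iff n'_def int_vec_def)
        have wt: "wt n' = wt n"
          unfolding wt_def iv by (simp add: matrix_vector_right_distrib z'(1)[OF True])
        then have "int (tot n') = int (tot n)" using wt_i0[of n'] wt_i0[of n] by simp
        then have sz: "tot n' = Suc N" using less.prems by simp
        have "int (wn n) = int (wn n') + wdot (z' \<tau>)"
        proof -
          have "int (wn n) = (\<Sum>j\<in>UNIV. int (w $ j) * int_vec n $ j)" by (simp add: wn_def int_vec_def)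
          also have "\<dots> = (\<Sum>j\<in>UNIV. int (w $ j) * int_vec n' $ j) + wdot (z' \<tau>)"
            unfolding iv by (simp add: wdot_def distrib_left sum.distrib)
          finally show ?thesis by (simp add: wn_def int_vec_def)
        qed
        then have "wn n \<ge> Suc (wn n')" using z'(3)[OF True] by linarith
        then have "\<epsilon> ^ wn n \<le> \<epsilon> ^ Suc (wn n')" using eps by (intro power_decreasing) auto
        then have "norm (\<nu> n) \<le> \<epsilon> * norm (\<nu> n')"
          unfolding nnu wt using mult_right_mono[OF _ norm_ge_zero[of "f (wt n)"]] by (simp add: mult.assoc[symmetric])
        also have "\<dots> \<le> \<epsilon> * V" using V[OF sz] eps by simp
        also have "\<dots> \<le> C ^ D n * (\<epsilon> * V)"
          using mult_right_mono[of 1 "C ^ D n" "\<epsilon> * V"] C1 V0 eps by simp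
        finally show ?thesis .
      next
        case False
        have "\<exists>j. n $ j \<ge> Suc K"
        proof (rule ccontr)
          assume "\<not> ?thesis"
          then have "n $ j \<le> K" for j by (meson not_less_eq_eq)
          then have "tot n \<le> CARD('n) * K" unfolding tot_def using sum_bounded_above[of UNIV "\<lambda>j. n $ j" K] by simp
          then show False using less.prems by (simp add: N_def)
        qed
        then obtain j where j: "n $ j \<ge> Suc K" by blast
        then have jt: "j \<in> \<tau>" by (auto simp: \<tau>_def)
        obtain m where m: "n = m + axis j 1" using split_axis[of n j] j by auto
        have sm: "tot m = N" using less.prems m by (simp add: tot_add tot_axis del: One_nat_def)
        have nk: "\<nu> (m + axis k 1) = monom_eval m p * (p $ k * f (wt m + col k))" for k
          by (simp add: \<nu>_def monom_eval_add monom_eval_axis wt_add wt_axis del: One_nat_def)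
        have "(\<Sum>k\<in>UNIV. of_rat (c \<tau> j k) * \<nu> (m + axis k 1)) = 0"
        proof -
          have "(\<Sum>k\<in>UNIV. of_rat (c \<tau> j k) * \<nu> (m + axis k 1))
             = (\<Sum>k\<in>UNIV. \<Sum>i\<in>UNIV. monom_eval m p * (of_rat (ll \<tau> j i) * (of_int (A $ i $ k) * p $ k * f (wt m + col k))))"
            unfolding nk c_def by (simp add: of_rat_sum of_rat_mult sum_distrib_right sum_distrib_left mult_ac)
          also have "\<dots> = (\<Sum>i\<in>UNIV. monom_eval m p * (of_rat (ll \<tau> j i) * theta p i f (wt m)))"
            unfolding theta_def by (subst sum.swap) (simp add: sum_distrib_left mult_ac)
          also have "\<dots> = 0" using f wt_in_lev[of m] sm by simp
          finally show ?thesis .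
        qed
        then have "of_rat (c \<tau> j j) * \<nu> n + (\<Sum>k\<in>UNIV - {j}. of_rat (c \<tau> j k) * \<nu> (m + axis k 1)) = 0"
          using m by (subst (asm) sum.remove[of _ j]) auto
        moreover have "c \<tau> j j = 1" using ll[OF False jt jt] by (simp add: c_def)
        ultimately have "\<nu> n = - (\<Sum>k\<in>UNIV - {j}. of_rat (c \<tau> j k) * \<nu> (m + axis k 1))"
          by (simp add: add_eq_0_iff2)
        then have "norm (\<nu> n) \<le> (\<Sum>k\<in>UNIV - {j}. norm (of_rat (c \<tau> j k) * \<nu> (m + axis k 1)))"
          by (simp only: norm_minus_cancel norm_sum)
        also have "\<dots> \<le> (\<Sum>k\<in>UNIV - {j}. L * (C ^ D n / C * (\<epsilon> * V)))"
        proof (rule sum_mono)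
          fix k assume k: "k \<in> UNIV - {j}"
          show "norm (of_rat (c \<tau> j k) * \<nu> (m + axis k 1)) \<le> L * (C ^ D n / C * (\<epsilon> * V))"
          proof (cases "k \<in> \<tau>")
            case True
            then have "c \<tau> j k = 0" using ll[OF False jt] k by (simp add: c_def)
            then show ?thesis using L0 C1 eps V0 by simp
          next
            case F: False
            \<comment> \<open>Entry j is at least K + 1, so lowering it by one leaves its deficit at
              0; entry k is below K, so raising it removes exactly one.\<close>
            have Dlt: "D n = Suc (D (m + axis k 1))"
            proof -
              have "D n = (\<Sum>i\<in>UNIV. (K - (m + axis k 1) $ i) + (if i = k then 1 else 0))"
                unfolding D_def by (rule sum.cong) (use j F k m in \<open>auto simp: \<tau>_def axis_def\<close>)
              then show ?thesis by (simp add: D_def sum.distrib)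
            qed
            have "tot (m + axis k 1) = Suc N" using sm by (simp add: tot_add tot_axis del: One_nat_def)
            then have "norm (\<nu> (m + axis k 1)) \<le> C ^ D n / C * (\<epsilon> * V)"
              using less.hyps[of "m + axis k 1"] Dlt C1 by simp
            moreover have "norm (of_rat (c \<tau> j k) :: complex) \<le> L"
            proof -
              have "(of_rat (c \<tau> j k) :: complex) = of_real (of_rat (c \<tau> j k))"
                by (cases "c \<tau> j k") (simp add: of_rat_rat)
              then show ?thesis using L[of \<tau> j k] by (simp only: norm_of_real)
            qed
            ultimately show ?thesis unfolding norm_mult using L0 by (intro mult_mono) auto
          qed
        qed
        also have "\<dots> = real (CARD('n) - 1) * L * (C ^ D n / C * (\<epsilon> * V))" by simp
        also have "\<dots> \<le> C ^ D n * (\<epsilon> * V)"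
        proof -
          have "real (CARD('n) - 1) * L \<le> real CARD('n) * L" using L0 by (intro mult_right_mono) auto
          also have "\<dots> \<le> C" by (simp add: C_def)
          finally have "real (CARD('n) - 1) * L * (C ^ D n / C * (\<epsilon> * V)) \<le> C * (C ^ D n / C * (\<epsilon> * V))"
            using C1 eps V0 by (intro mult_right_mono) auto
          then show ?thesis using C1 by simp
        qed
        finally show ?thesis .
      qed
    qed
    have DN: "D n \<le> N" for n unfolding D_def N_def using sum_bounded_above[of UNIV "\<lambda>j. K - n $ j" K] by simp
    have all: "norm (\<nu> n) \<le> C ^ N * \<epsilon> * V" if "tot n = Suc N" for n
    proof -
      have "C ^ D n * (\<epsilon> * V) \<le> C ^ N * (\<epsilon> * V)"
        using C1 DN eps V0 by (intro mult_right_mono power_increasing) auto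
      then show ?thesis using bound[OF that] by simp
    qed
    have "V \<le> C ^ N * \<epsilon> * V"
    proof -
      have "V \<in> (\<lambda>n. norm (\<nu> n)) ` {n. tot n = Suc N}"
        unfolding V_def using \<open>tot u0 = Suc N\<close> by (intro Max_in[OF fin]) blast
      then show ?thesis using all by blast
    qed
    then have "V * (1 - C ^ N * \<epsilon>) \<le> 0" by (simp add: algebra_simps)
    then have "V \<le> 0" using eps(3) by (simp add: mult_le_0_iff)
    obtain u where u: "\<gamma> = wt u" "tot u = Suc N" using \<open>\<gamma> \<in> lev (Suc N)\<close> by (rule levE)
    then have "norm (\<nu> u) \<le> 0" using V[OF u(2)] \<open>V \<le> 0\<close> by linarith
    then show ?thesis using zero_less_power[OF eps(1), of "wn u"] u by (auto simp: nnu mult_le_0_iff)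
  qed
  then show ?thesis by (rule_tac exI[of _ N], rule_tac exI[of _ p]) simp
qed

end

section \<open>Iterated partial derivatives\<close>

text \<open>Weaker than \<open>holomorphic_several\<close>, but stable under partial derivatives by
  one-variable arguments. Joint continuity is kept in order to bound the function on compact
  balls.\<close>

definition sepholo :: "(complex ^ 'n::finite) set \<Rightarrow> (complex ^ 'n \<Rightarrow> complex) \<Rightarrow> bool" where
  "sepholo U f \<longleftrightarrow> continuous_on U f \<and>
     (\<forall>x\<in>U. \<forall>j. (\<lambda>t. f (x + t *s axis j 1)) field_differentiable at 0)"

lemma has_derivative_axis_line:
  "((\<lambda>t::complex. x + t *s (axis j 1 :: complex ^ 'n::finite)) has_derivative (\<lambda>t. t *s axis j 1)) (at s)"
proof -
  have "bounded_linear (\<lambda>t::complex. t *s (axis j 1 :: complex ^ 'n))"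
    by (rule linear_conv_bounded_linear[THEN iffD1], rule linearI) (simp_all add: vec_eq_iff distrib_right)
  then show ?thesis by (auto intro!: derivative_eq_intros bounded_linear_imp_has_derivative)
qed

lemma continuous_on_axis_line: "continuous_on S (\<lambda>t::complex. x + t *s (axis j 1 :: complex ^ 'n::finite))"
  by (intro continuous_at_imp_continuous_on ballI has_derivative_continuous[OF has_derivative_axis_line])

lemma holomorphic_several_imp_sepholo:
  assumes "holomorphic_several f U"
  shows "sepholo U f"
  unfolding sepholo_def
proof (intro conjI ballI allI)
  show "continuous_on U f"
  proof (rule continuous_at_imp_continuous_on, rule ballI)
    fix x assume "x \<in> U"
    then obtain f' where "(f has_derivative f') (at x)"
      using assms unfolding holomorphic_several_def by blast
    then show "isCont f x" by (rule has_derivative_continuous)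
  qed
  fix x j assume "x \<in> U"
  then obtain f' where f': "(f has_derivative f') (at x)" "\<And>c v. f' (c *s v) = c * f' v"
    using assms unfolding holomorphic_several_def by blast
  have "((\<lambda>t. f (x + t *s axis j 1)) has_derivative (\<lambda>t. f' (t *s axis j 1))) (at 0)"
    using diff_chain_at[OF has_derivative_axis_line[of x j 0], of f f'] f'(1) by (simp add: o_def)
  then have "((\<lambda>t. f (x + t *s axis j 1)) has_field_derivative f' (axis j 1)) (at 0)"
  proof -
    assume *: "((\<lambda>t. f (x + t *s axis j 1)) has_derivative (\<lambda>t. f' (t *s axis j 1))) (at 0)"
    have "(\<lambda>t. f' (t *s axis j 1)) = (*) (f' (axis j 1))" by (simp add: fun_eq_iff f'(2))
    with * show ?thesis by (simp add: has_field_derivative_def)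
  qed
  then show "(\<lambda>t. f (x + t *s axis j 1)) field_differentiable at 0"
    unfolding field_differentiable_def by blast
qed

section \<open>Coordinate lines and the stability of separate holomorphy under derivatives\<close>

lemma field_differentiable_shift:
  assumes "(\<lambda>t. f (t + s)) field_differentiable at (0::complex)"
  shows "f field_differentiable at s"
  using assms unfolding field_differentiable_def DERIV_shift[symmetric] by (simp only: add_0)

lemma sepholo_line_differentiable:
  assumes "sepholo U f" "x + s *s axis j 1 \<in> U"
  shows "(\<lambda>t. f (x + t *s axis j 1)) field_differentiable at s"
proof (rule field_differentiable_shift)
  have "(\<lambda>t. f ((x + s *s axis j 1) + t *s axis j 1)) field_differentiable at 0"
    using assms unfolding sepholo_def by blast
  moreover have "(x + s *s axis j 1) + t *s axis j 1 = x + (t + s) *s axis j 1" for t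
    by (simp add: vec_eq_iff distrib_right add_ac)
  ultimately show "(\<lambda>t. f (x + (t + s) *s axis j 1)) field_differentiable at 0" by simp
qed

lemma sepholo_line_holomorphic:
  assumes "sepholo U f" "\<And>s. s \<in> S \<Longrightarrow> x + s *s axis j 1 \<in> U"
  shows "(\<lambda>t. f (x + t *s axis j 1)) holomorphic_on S"
  unfolding holomorphic_on_def
  using sepholo_line_differentiable[OF assms(1)] assms(2) field_differentiable_at_within by blast

lemma partial_deriv_line: "partial_deriv j f (x + s *s axis j 1) = deriv (\<lambda>t. f (x + t *s axis j 1)) s"
proof -
  have e: "(x + s *s axis j 1) + t *s axis j 1 = x + (t + s) *s axis j 1" for t
    by (simp add: vec_eq_iff distrib_right add_ac)
  have "((\<lambda>t. f (x + (t + s) *s axis j 1)) has_field_derivative D) (at 0) \<longleftrightarrow>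
      ((\<lambda>t. f (x + t *s axis j 1)) has_field_derivative D) (at s)" for D
    using DERIV_shift[of "\<lambda>t. f (x + t *s axis j 1)" D 0 s] by (simp only: add_0)
  then show ?thesis unfolding partial_deriv_def e deriv_def by simp
qed

lemma partial_deriv_cong_open:
  assumes "open U" "x \<in> U" "\<And>y. y \<in> U \<Longrightarrow> f y = g y"
  shows "partial_deriv j f x = partial_deriv j g x"
  unfolding partial_deriv_def
proof (rule deriv_cong_ev)
  have "open ((\<lambda>t::complex. x + t *s axis j 1) -` U)"
    by (rule open_vimage[OF assms(1) continuous_on_axis_line])
  then have "\<forall>\<^sub>F t in nhds (0::complex). t \<in> (\<lambda>t. x + t *s axis j 1) -` U"
    using assms(2) by (intro eventually_nhds_in_open) auto
  then have "\<forall>\<^sub>F t in nhds (0::complex). x + t *s axis j 1 \<in> U" by simp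
  then show "\<forall>\<^sub>F t in nhds 0. f (x + t *s axis j 1) = g (x + t *s axis j 1)"
    by eventually_elim (rule assms(3))
qed simp

text \<open>Taylor's formula, with the second derivative bounded by Cauchy's inequality on discs of
  radius r/4; this gives the constant 32 = 2! * 4^2. The bound depends on \<open>B\<close> and
  \<open>r\<close> alone, hence is uniform when the function varies with a parameter.\<close>

lemma difference_quotient_bound:
  fixes h :: "complex \<Rightarrow> complex"
  assumes h: "h holomorphic_on ball 0 r" and B: "\<And>z. z \<in> ball 0 r \<Longrightarrow> norm (h z) \<le> B"
    and r: "r > 0" and t: "t \<noteq> 0" "norm t < r / 4"
  shows "norm ((h t - h 0) / t - deriv h 0) \<le> 32 * B / r\<^sup>2 * norm t"
proof -
  let ?S = "ball (0::complex) (r / 4)"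
  have opn: "open (ball (0::complex) r)" by simp
  have d1: "(h has_field_derivative deriv h z) (at z)" if "z \<in> ball 0 r" for z
    using holomorphic_derivI[OF h opn that] .
  have d2: "(deriv h has_field_derivative deriv (deriv h) z) (at z)" if "z \<in> ball 0 r" for z
    using holomorphic_derivI[OF holomorphic_deriv[OF h opn] opn that] .
  have b2: "norm (deriv (deriv h) z) \<le> 32 * B / r\<^sup>2" if z: "z \<in> ?S" for z
  proof -
    have sub: "cball z (r / 4) \<subseteq> ball 0 r"
    proof
      fix y assume "y \<in> cball z (r / 4)"
      then have "norm (y - z) \<le> r / 4" "norm z < r / 4" using z by (auto simp: dist_norm norm_minus_commute)
      then have "norm y < r" using norm_triangle_sub[of y z] r by linarith
      then show "y \<in> ball 0 r" by simp
    qed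
    have "norm ((deriv ^^ 2) h z) \<le> fact 2 * B / (r / 4) ^ 2"
    proof (rule Cauchy_inequality)
      show "h holomorphic_on ball z (r / 4)"
        by (rule holomorphic_on_subset[OF h]) (use sub ball_subset_cball in blast)
      show "continuous_on (cball z (r / 4)) h"
        by (rule holomorphic_on_imp_continuous_on, rule holomorphic_on_subset[OF h sub])
      show "norm (h x) \<le> B" if "norm (z - x) = r / 4" for x
        by (rule B) (use that sub in \<open>auto simp: dist_norm\<close>)
    qed (use r in auto)
    also have "fact 2 * B / (r / 4) ^ 2 = 32 * B / r\<^sup>2" by (simp add: power_divide)
    finally show ?thesis by (simp add: numeral_2_eq_2)
  qed
  define F where "F i = (deriv ^^ i) h" for i
  have tay: "cmod (F 0 t - (\<Sum>i\<le>1. F i 0 * (t - 0) ^ i / fact i)) \<le> 32 * B / r\<^sup>2 * cmod (t - 0) ^ Suc 1 / fact 1"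
  proof (rule complex_Taylor[where S = ?S])
    fix i :: nat and x :: complex assume x: "x \<in> ?S" and i: "i \<le> 1"
    have "x \<in> ball 0 r" using x r by auto
    then have "(F 0 has_field_derivative F (Suc 0) x) (at x within ?S)"
        "(F 1 has_field_derivative F (Suc 1) x) (at x within ?S)"
      using d1 d2 by (simp_all add: F_def has_field_derivative_at_within)
    moreover have "i = 0 \<or> i = 1" using i by auto
    ultimately show "(F i has_field_derivative F (Suc i) x) (at x within ?S)" by blast
  next
    fix x :: complex assume "x \<in> ?S"
    then show "cmod (F (Suc 1) x) \<le> 32 * B / r\<^sup>2" using b2 by (simp add: F_def)
  qed (use t r in auto)
  have "norm (h t - h 0 - deriv h 0 * t) \<le> 32 * B / r\<^sup>2 * norm t ^ 2"
    using tay by (simp add: F_def power2_eq_square diff_diff_eq)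
  moreover have "(h t - h 0) / t - deriv h 0 = (h t - h 0 - deriv h 0 * t) / t"
    using t by (simp add: field_simps)
  ultimately have "norm ((h t - h 0) / t - deriv h 0) \<le> 32 * B / r\<^sup>2 * norm t ^ 2 / norm t"
    using t by (simp only: norm_divide) (intro divide_right_mono, auto)
  then show ?thesis using t by (simp add: power2_eq_square)
qed

lemma norm_axis_scale: "norm (t *s (axis j 1 :: complex ^ 'n::finite)) = norm t"
proof -
  have "norm (t *s (axis j 1 :: complex ^ 'n)) = L2_set (\<lambda>i. if i = j then norm t else 0) UNIV"
    unfolding norm_vec_def by (rule L2_set_cong) (auto simp: axis_def)
  also have "\<dots> = norm t" by (simp add: L2_set_def if_distrib[of "\<lambda>c. c\<^sup>2"] cong: if_cong)
  finally show ?thesis .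
qed

text \<open>On a small ball the derivative is the uniform limit of the quotients \<open>Q m\<close>,
  each of which is continuous and holomorphic along every axis. Both properties survive uniform
  limits.\<close>

lemma sepholo_partial_deriv:
  assumes U: "open U" and f: "sepholo U f"
  shows "sepholo U (partial_deriv j f)"
proof -
  let ?e = "\<lambda>j. axis j 1 :: complex ^ 'a"
  have main: "isCont (partial_deriv j f) x0 \<and> (\<lambda>t. partial_deriv j f (x0 + t *s ?e l)) field_differentiable at 0"
    if x0: "x0 \<in> U" for x0 l
  proof -
    obtain R where R: "R > 0" "cball x0 R \<subseteq> U" using U x0 open_contains_cball by blast
    have "compact (f ` cball x0 R)"
      using f R unfolding sepholo_def by (intro compact_continuous_image) (auto intro: continuous_on_subset)
    then have "bounded (f ` cball x0 R)" by (rule compact_imp_bounded)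
    then obtain B where "\<forall>y\<in>f ` cball x0 R. norm y \<le> B" unfolding bounded_iff by (rule exE)
    then have B: "\<And>x. x \<in> cball x0 R \<Longrightarrow> norm (f x) \<le> B" by blast
    have inU: "x + t *s ?e k \<in> cball x0 R" if "x \<in> ball x0 (R/2)" "norm t < R/2" for x t k
    proof -
      have "dist x0 (x + t *s ?e k) \<le> dist x0 x + norm (t *s ?e k)"
        using norm_triangle_ineq4[of "x0 - x" "t *s ?e k"] by (simp add: dist_norm diff_diff_eq)
      then show ?thesis using that by (simp add: norm_axis_scale)
    qed
    \<comment> \<open>Steps of length at most R/16 stay below r/4 for r = R/2, as the quotient
      estimate requires.\<close>
    define tm :: "nat \<Rightarrow> complex" where "tm m = of_real (R / 16 * inverse (real (Suc m))) " for m
    have tm: "tm m \<noteq> 0" "norm (tm m) = R / 16 * inverse (real (Suc m))" for m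
      using R by (auto simp: tm_def norm_mult norm_inverse norm_divide simp del: of_nat_Suc)
    have tms: "norm (tm m) < R / 2 / 4" for m
    proof -
      have "R / 16 * inverse (real (Suc m)) \<le> R / 16 * 1"
        using R by (intro mult_left_mono) (auto simp: inverse_le_1_iff)
      then show ?thesis using R unfolding tm(2) by linarith
    qed
    have tms2: "norm (tm m) < R / 2" for m using tms[of m] R by linarith
    define Q where "Q m x = (f (x + tm m *s ?e j) - f x) / tm m" for m x
    let ?W = "ball x0 (R/2)"
    have est: "norm (Q m x - partial_deriv j f x) \<le> 32 * B / (R/2)\<^sup>2 * (R / 16 * inverse (real (Suc m)))" if x: "x \<in> ?W" for m x
    proof -
      let ?h = "\<lambda>t. f (x + t *s ?e j)"
      have "norm ((?h (tm m) - ?h 0) / tm m - deriv ?h 0) \<le> 32 * B / (R/2)\<^sup>2 * norm (tm m)"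
      proof (rule difference_quotient_bound)
        show "?h holomorphic_on ball 0 (R/2)"
          by (rule sepholo_line_holomorphic[OF f]) (use inU[OF x] R in auto)
        show "norm (?h z) \<le> B" if "z \<in> ball 0 (R/2)" for z
          using inU[OF x, of z] that by (intro B) simp
      qed (use R tm tms in auto)
      then show ?thesis by (simp add: Q_def partial_deriv_def tm(2))
    qed
    have lim: "filterlim (\<lambda>m. 32 * B / (R/2)\<^sup>2 * (R / 16 * inverse (real (Suc m)))) (nhds 0) sequentially"
      using tendsto_mult[OF tendsto_const tendsto_mult[OF tendsto_const LIMSEQ_inverse_real_of_nat], of "32 * B / (R/2)\<^sup>2" "R / 16"]
      by simp
    have ul: "uniform_limit ?W Q (partial_deriv j f) sequentially"
    proof (rule uniform_limitI)
      fix e :: real assume "e > 0"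
      then have "\<forall>\<^sub>F m in sequentially. 32 * B / (R/2)\<^sup>2 * (R / 16 * inverse (real (Suc m))) < e"
        using order_tendstoD(2)[OF lim] by blast
      then show "\<forall>\<^sub>F m in sequentially. \<forall>x\<in>?W. dist (Q m x) (partial_deriv j f x) < e"
      proof eventually_elim
        case (elim m)
        show ?case
        proof
          fix x assume "x \<in> ?W"
          from est[OF this, of m] elim show "dist (Q m x) (partial_deriv j f x) < e"
            unfolding dist_norm by linarith
        qed
      qed
    qed
    have Wsub: "?W \<subseteq> U" using R by auto
    have contQ: "continuous_on ?W (Q m)" for m
      unfolding Q_def
    proof (intro continuous_intros)
      have fU: "continuous_on U f" using f by (simp add: sepholo_def)
      show "continuous_on ?W f" using fU Wsub by (rule continuous_on_subset)
      show "continuous_on ?W (\<lambda>x. f (x + tm m *s ?e j))"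
      proof (rule continuous_on_compose2[OF fU])
        show "continuous_on ?W (\<lambda>x. x + tm m *s ?e j)" by (intro continuous_intros)
        show "(\<lambda>x. x + tm m *s ?e j) ` ?W \<subseteq> U" using inU[OF _ tms2[of m]] R(2) by blast
      qed
    qed (use tm in auto)
    have "continuous_on ?W (partial_deriv j f)"
      by (rule uniform_limit_theorem[OF _ ul]) (use contQ in auto)
    then have c: "isCont (partial_deriv j f) x0"
      using R by (simp add: continuous_on_eq_continuous_at)
    let ?S = "ball (0::complex) (R/2)"
    have inW: "x0 + s *s ?e l \<in> ?W" if "s \<in> ?S" for s
      using that by (simp add: dist_norm norm_axis_scale)
    have "(\<lambda>s. partial_deriv j f (x0 + s *s ?e l)) holomorphic_on ?S"
    proof (rule holomorphic_uniform_sequence[where f = "\<lambda>m s. Q m (x0 + s *s ?e l)"])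
      fix m
      have 1: "(\<lambda>s. f (x0 + s *s ?e l)) holomorphic_on ?S"
        by (rule sepholo_line_holomorphic[OF f]) (use inW Wsub in blast)
      have 2: "(\<lambda>s. f ((x0 + tm m *s ?e j) + s *s ?e l)) holomorphic_on ?S"
      proof (rule sepholo_line_holomorphic[OF f])
        fix s assume "s \<in> ?S"
        from inU[OF inW[OF this] tms2[of m], of j] R(2)
        have "x0 + s *s ?e l + tm m *s ?e j \<in> U" by blast
        then show "(x0 + tm m *s ?e j) + s *s ?e l \<in> U" by (simp add: add_ac)
      qed
      have e: "(x0 + tm m *s ?e j) + s *s ?e l = x0 + s *s ?e l + tm m *s ?e j" for s by (simp add: add_ac)
      show "(\<lambda>s. Q m (x0 + s *s ?e l)) holomorphic_on ?S"
        unfolding Q_def using 1 2[unfolded e] by (intro holomorphic_intros tm(1))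
    next
      fix s assume "s \<in> ?S"
      then obtain d where d: "d > 0" "cball s d \<subseteq> ?S" using open_contains_cball[of ?S] by blast
      have "uniform_limit (cball s d) (\<lambda>m s. Q m (x0 + s *s ?e l)) (\<lambda>s. partial_deriv j f (x0 + s *s ?e l)) sequentially"
      proof (rule uniform_limitI)
        fix e :: real assume "e > 0"
        from uniform_limitD[OF ul this]
        show "\<forall>\<^sub>F m in sequentially. \<forall>s\<in>cball s d. dist (Q m (x0 + s *s ?e l)) (partial_deriv j f (x0 + s *s ?e l)) < e"
          by eventually_elim (use inW d in blast)
      qed
      then show "\<exists>d>0. cball s d \<subseteq> ?S \<and> uniform_limit (cball s d) (\<lambda>m s. Q m (x0 + s *s ?e l)) (\<lambda>s. partial_deriv j f (x0 + s *s ?e l)) sequentially"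
        using d by blast
    qed simp
    then have "(\<lambda>t. partial_deriv j f (x0 + t *s ?e l)) field_differentiable at 0"
      by (rule holomorphic_on_imp_differentiable_at) (use R in auto)
    then show ?thesis using c by blast
  qed
  show ?thesis
    unfolding sepholo_def
    by (intro conjI ballI allI continuous_at_imp_continuous_on)
       (rule conjunct1[OF main], assumption, rule conjunct2[OF main], assumption)
qed

section \<open>Iterated derivatives as words, and the identity theorem\<close>

definition deriv_word :: "nat ^ 'n::finite \<Rightarrow> 'n list" where
  "deriv_word b = concat (map (\<lambda>j. replicate (b $ j) j) (SOME js. distinct js \<and> set js = UNIV))"

lemma foldr_replicate: "foldr g (replicate k a) = g a ^^ k"
  by (induction k) auto

lemma multi_deriv_word: "multi_deriv b f = foldr partial_deriv (deriv_word b) f"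
proof -
  have "foldr (\<lambda>j. partial_deriv j ^^ (b $ j)) js f = foldr partial_deriv (concat (map (\<lambda>j. replicate (b $ j) j) js)) f" for js
    by (induction js) (auto simp: foldr_replicate)
  then show ?thesis unfolding multi_deriv_def deriv_word_def .
qed

lemma sepholo_foldr: "open U \<Longrightarrow> sepholo U f \<Longrightarrow> sepholo U (foldr partial_deriv js f)"
  by (induction js) (auto intro: sepholo_partial_deriv)

lemma sepholo_foldr_pow:
  "open U \<Longrightarrow> sepholo U f \<Longrightarrow> sepholo U (foldr (\<lambda>j. partial_deriv j ^^ (b $ j)) js f)"
proof (induction js)
  case (Cons j js)
  have "sepholo U ((partial_deriv j ^^ k) g)" if "sepholo U g" for k g
    using that Cons.prems(1) by (induction k) (auto intro: sepholo_partial_deriv)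
  then show ?case using Cons by auto
qed auto

lemma foldr_partial_deriv_cong_open:
  assumes "open U" "\<And>y. y \<in> U \<Longrightarrow> f y = g y" "x \<in> U"
  shows "foldr partial_deriv js f x = foldr partial_deriv js g x"
  using assms(3)
proof (induction js arbitrary: x)
  case Nil
  then show ?case using assms by simp
next
  case (Cons j js)
  then show ?case unfolding foldr.simps o_apply by (intro partial_deriv_cong_open[OF assms(1)])
qed

lemma multi_deriv_cong_open:
  assumes "open U" "\<And>y. y \<in> U \<Longrightarrow> f y = g y" "x \<in> U"
  shows "multi_deriv b f x = multi_deriv b g x"
  unfolding multi_deriv_word by (rule foldr_partial_deriv_cong_open[OF assms])

lemma sepholo_sum:
  assumes "\<And>i. i \<in> I \<Longrightarrow> sepholo U (f i)"
  shows "sepholo U (\<lambda>x. \<Sum>i\<in>I. c i * f i x)"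
  unfolding sepholo_def
proof (intro conjI ballI allI)
  show "continuous_on U (\<lambda>x. \<Sum>i\<in>I. c i * f i x)"
    using assms by (intro continuous_intros) (auto simp: sepholo_def)
  show "(\<lambda>t. \<Sum>i\<in>I. c i * f i (x + t *s axis j 1)) field_differentiable at 0" if "x \<in> U" for x j
    using assms that by (intro field_differentiable_sum field_differentiable_mult) (auto simp: sepholo_def)
qed

lemma partial_deriv_sum:
  assumes "\<And>i. i \<in> I \<Longrightarrow> sepholo U (f i)" "x \<in> U"
  shows "partial_deriv j (\<lambda>x. \<Sum>i\<in>I. c i * f i x) x = (\<Sum>i\<in>I. c i * partial_deriv j (f i) x)"
  unfolding partial_deriv_def
proof (rule DERIV_imp_deriv, rule DERIV_sum)
  fix i assume "i \<in> I"
  then have "(\<lambda>t. f i (x + t *s axis j 1)) field_differentiable at 0"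
    using assms by (auto simp: sepholo_def)
  then show "((\<lambda>t. c i * f i (x + t *s axis j 1)) has_field_derivative c i * deriv (\<lambda>t. f i (x + t *s axis j 1)) 0) (at 0)"
    by (intro DERIV_cmult) (simp add: field_differentiable_derivI)
qed

lemma multi_deriv_sum:
  assumes "open U" "\<And>i. i \<in> I \<Longrightarrow> sepholo U (f i)" "x \<in> U"
  shows "multi_deriv b (\<lambda>x. \<Sum>i\<in>I. c i * f i x) x = (\<Sum>i\<in>I. c i * multi_deriv b (f i) x)"
proof -
  have "foldr partial_deriv js (\<lambda>x. \<Sum>i\<in>I. c i * f i x) x = (\<Sum>i\<in>I. c i * foldr partial_deriv js (f i) x)" if "x \<in> U" for js x
    using that
  proof (induction js arbitrary: x)
    case (Cons j js)
    have "foldr partial_deriv (j # js) (\<lambda>x. \<Sum>i\<in>I. c i * f i x) x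
       = partial_deriv j (\<lambda>x. \<Sum>i\<in>I. c i * foldr partial_deriv js (f i) x) x"
      unfolding foldr.simps o_apply by (rule partial_deriv_cong_open[OF assms(1) Cons.prems Cons.IH])
    also have "\<dots> = (\<Sum>i\<in>I. c i * partial_deriv j (foldr partial_deriv js (f i)) x)"
      by (rule partial_deriv_sum[OF _ Cons.prems]) (intro sepholo_foldr assms)
    finally show ?case by simp
  qed simp
  then show ?thesis unfolding multi_deriv_word using assms(3) .
qed

text \<open>The variables are released in the order in which the derivatives are nested. Along the
  axis of the outermost derivative the inner ones form a holomorphic function of one variable all of
  whose derivatives vanish at \<open>x0 $ j\<close>, hence zero on the disc. Partial derivatives are
  never exchanged.\<close>

lemma iterated_derivs_zero:
  fixes f :: "complex ^ 'n::finite \<Rightarrow> complex"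
  assumes U: "open U" and f: "sepholo U f" and P: "P = {x. \<forall>j. norm (x $ j - p $ j) < r}" "P \<subseteq> U"
    and "distinct js" "x0 \<in> P" "\<And>b. foldr (\<lambda>j. partial_deriv j ^^ (b $ j)) js f x0 = 0"
    and "x \<in> P" "\<And>j. j \<notin> set js \<Longrightarrow> x $ j = x0 $ j"
  shows "f x = 0"
  using assms(5-9)
proof (induction js arbitrary: x0)
  case Nil
  then have "x = x0" by (simp add: vec_eq_iff)
  then show ?case using Nil.prems(3) by simp
next
  case (Cons j js)
  define y where "y = x0 - (x0 $ j) *s axis j 1"
  define g where "g b = foldr (\<lambda>j. partial_deriv j ^^ (b $ j)) js f" for b :: "nat ^ 'n"
  \<comment> \<open>The inner derivatives do not read entry \<open>j\<close> of the multi-index, so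
    this entry can serve as the order of the outermost derivative.\<close>
  have gc: "g (\<chi> i. if i = j then k else b $ i) = g b" for k b
    unfolding g_def using Cons.prems(1) by (intro foldr_cong) auto
  have z: "(partial_deriv j ^^ k) (g b) x0 = 0" for k b
    using Cons.prems(3)[of "\<chi> i. if i = j then k else b $ i"] gc[of k b] by (simp add: g_def)
  have gh: "sepholo U (g b)" for b unfolding g_def by (rule sepholo_foldr_pow[OF U f])
  have inP: "y + t *s axis j 1 \<in> P" if "t \<in> ball (p $ j) r" for t
    using that Cons.prems(2) unfolding P y_def by (auto simp: axis_def dist_norm norm_minus_commute)
  have x0: "x0 = y + (x0 $ j) *s axis j 1" by (simp add: y_def)
  have g0: "g b (y + t *s axis j 1) = 0" if t: "t \<in> ball (p $ j) r" for t b
  proof (rule holomorphic_fun_eq_0_on_connected[where f = "\<lambda>t. g b (y + t *s axis j 1)" and z = "x0 $ j"])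
    show "(\<lambda>t. g b (y + t *s axis j 1)) holomorphic_on ball (p $ j) r"
      by (rule sepholo_line_holomorphic[OF gh]) (use inP P(2) in blast)
    show "(deriv ^^ k) (\<lambda>t. g b (y + t *s axis j 1)) (x0 $ j) = 0" for k
    proof -
      have "(deriv ^^ k) (\<lambda>t. g b (y + t *s axis j 1)) = (\<lambda>t. (partial_deriv j ^^ k) (g b) (y + t *s axis j 1))"
        by (induction k) (simp_all add: partial_deriv_line)
      then show ?thesis using z[of k b] x0 by simp
    qed
    show "x0 $ j \<in> ball (p $ j) r" using Cons.prems(2) unfolding P by (simp add: dist_norm norm_minus_commute)
  qed (use t in auto)
  have xj: "x $ j \<in> ball (p $ j) r" using Cons.prems(4) unfolding P by (simp add: dist_norm norm_minus_commute)
  show ?case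
  proof (rule Cons.IH)
    show "y + (x $ j) *s axis j 1 \<in> P" by (rule inP[OF xj])
    show "foldr (\<lambda>j. partial_deriv j ^^ (b $ j)) js f (y + (x $ j) *s axis j 1) = 0" for b
      using g0[OF xj, of b] by (simp add: g_def)
    show "x $ i = (y + (x $ j) *s axis j 1) $ i" if "i \<notin> set js" for i
      using Cons.prems(5)[of i] that by (auto simp: y_def axis_def)
  qed (use Cons.prems in auto)
qed

text \<open>The identity theorem for germs. Through it a solution germ is determined by its
  functional on the semigroup.\<close>

lemma sepholo_all_derivs_zero:
  fixes f :: "complex ^ 'n::finite \<Rightarrow> complex"
  assumes U: "open U" and f: "sepholo U f" and p: "p \<in> U" and z: "\<And>b. multi_deriv b f p = 0"
  shows "\<forall>\<^sub>F x in nhds p. f x = 0"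
proof -
  obtain R where R: "R > 0" "ball p R \<subseteq> U" using U p open_contains_ball by blast
  \<comment> \<open>The norm is at most the sum of the moduli of the coordinates, so the polydisc of
    this radius lies in the ball of radius \<open>R\<close>.\<close>
  define r where "r = R / CARD('n)"
  define P where "P = {x :: complex ^ 'n. \<forall>j. norm (x $ j - p $ j) < r}"
  have r: "r > 0" using R by (simp add: r_def)
  have "P \<subseteq> U"
  proof
    fix x assume x: "x \<in> P"
    have "norm (x - p) \<le> (\<Sum>j\<in>UNIV. norm ((x - p) $ j))"
      unfolding norm_vec_def by (rule L2_set_le_sum) simp
    also have "\<dots> < (\<Sum>j\<in>(UNIV :: 'n set). r)"
      using x by (intro sum_strict_mono) (auto simp: P_def)
    also have "\<dots> = R" by (simp add: r_def)
    finally show "x \<in> U" using R by (auto simp: dist_norm norm_minus_commute)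
  qed
  define js where "js = (SOME js. distinct js \<and> set js = (UNIV :: 'n set))"
  have js: "distinct js \<and> set js = UNIV"
    unfolding js_def by (rule someI_ex) (use finite_distinct_list[of "UNIV :: 'n set"] in auto)
  have "f x = 0" if "x \<in> P" for x
  proof (rule iterated_derivs_zero[OF U f P_def \<open>P \<subseteq> U\<close>, of js p])
    show "p \<in> P" using r by (simp add: P_def)
    show "foldr (\<lambda>j. partial_deriv j ^^ (b $ j)) js f p = 0" for b
      using z[of b] unfolding multi_deriv_def js_def .
  qed (use js that in auto)
  moreover have "ball p r \<subseteq> P"
  proof
    fix x assume x: "x \<in> ball p r"
    have "norm (x $ j - p $ j) < r" for j
      using Finite_Cartesian_Product.norm_nth_le[of "x - p" j] x by (simp add: dist_norm norm_minus_commute)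
    then show "x \<in> P" by (simp add: P_def)
  qed
  ultimately have "f x = 0" if "x \<in> ball p r" for x using that by blast
  moreover have "\<forall>\<^sub>F x in nhds p. x \<in> ball p r" using r by (intro eventually_nhds_in_open) auto
  ultimately show ?thesis by (rule eventually_mono[rotated])
qed

section \<open>Solutions give functionals on the semigroup\<close>

text \<open>The linear extension of \<open>G\<close> from monomials. The action of operators, their
  symbols and tests on the toric ideal all take this shape, so one set of linearity rules serves
  them.\<close>

definition pmlin :: "('k \<Rightarrow> complex) \<Rightarrow> ('k \<Rightarrow>\<^sub>0 complex) \<Rightarrow> complex" where
  "pmlin G P = (\<Sum>s\<in>Poly_Mapping.keys P. Poly_Mapping.lookup P s * G s)"

lemma pmlin_superset:
  assumes "finite S" "Poly_Mapping.keys P \<subseteq> S"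
  shows "pmlin G P = (\<Sum>s\<in>S. Poly_Mapping.lookup P s * G s)"
  unfolding pmlin_def by (rule sum.mono_neutral_left) (use assms in \<open>auto simp: in_keys_iff\<close>)

lemma pmlin_add: "pmlin G (P + Q) = pmlin G P + pmlin G Q"
proof -
  let ?S = "Poly_Mapping.keys P \<union> Poly_Mapping.keys Q"
  have "pmlin G (P + Q) = (\<Sum>a\<in>?S. Poly_Mapping.lookup (P + Q) a * G a)"
    by (rule pmlin_superset) (auto dest: subsetD[OF Poly_Mapping.keys_add])
  moreover have "pmlin G P = (\<Sum>a\<in>?S. Poly_Mapping.lookup P a * G a)"
    by (rule pmlin_superset) auto
  moreover have "pmlin G Q = (\<Sum>a\<in>?S. Poly_Mapping.lookup Q a * G a)"
    by (rule pmlin_superset) auto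
  ultimately show ?thesis by (simp add: lookup_add distrib_right sum.distrib)
qed

lemma pmlin_0: "pmlin G 0 = 0" by (simp add: pmlin_def)

lemma pmlin_sum: "pmlin G (sum f S) = (\<Sum>s\<in>S. pmlin G (f s))"
  by (induction S rule: infinite_finite_induct) (auto simp: pmlin_add pmlin_0)

lemma pmlin_diff: "pmlin G (P - Q) = pmlin G P - pmlin G Q"
proof -
  have "pmlin G P = pmlin G ((P - Q) + Q)" by simp
  also have "\<dots> = pmlin G (P - Q) + pmlin G Q" by (rule pmlin_add)
  finally show ?thesis by simp
qed

lemma pmlin_single: "pmlin G (Poly_Mapping.single a c) = c * G a"
  by (cases "c = 0") (auto simp: pmlin_def)

lemma pmlin_weyl_scale: "pmlin G (weyl_scale z P) = z * pmlin G P"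
proof -
  have "Poly_Mapping.lookup (weyl_scale z P) k = z * Poly_Mapping.lookup P k" for k
    by (simp add: weyl_scale_def map.rep_eq when_def)
  moreover from this have "Poly_Mapping.keys (weyl_scale z P) \<subseteq> Poly_Mapping.keys P"
    by (auto simp: in_keys_iff)
  ultimately show ?thesis
    using pmlin_superset[of "Poly_Mapping.keys P" "weyl_scale z P" G]
    by (simp add: pmlin_def sum_distrib_left mult.assoc)
qed

lemma weyl_action_pmlin:
  "weyl_action P f x = pmlin (\<lambda>s. monom_eval (fst s) x * multi_deriv (snd s) f x) P"
  unfolding weyl_action_def pmlin_def by (rule sum.cong) (auto simp: case_prod_unfold mult.assoc)

lemma pmlin_weyl_mult:
  "pmlin G (P \<star> Q) = pmlin (\<lambda>s. pmlin (\<lambda>t. pmlin G (weyl_monom_mult s t)) Q) P"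
  unfolding weyl_mult_def pmlin_sum pmlin_weyl_scale
  by (simp add: pmlin_def sum_distrib_left mult.assoc)

lemma pmlin_weyl_of_dpoly: "pmlin G (weyl_of_dpoly q) = pmlin (\<lambda>b. G (0, b)) q"
  unfolding weyl_of_dpoly_def pmlin_sum pmlin_single by (simp add: pmlin_def)

lemma weyl_const_x_d: "weyl_const z \<star> weyl_x j \<star> weyl_d j = Poly_Mapping.single (axis j 1, axis j 1) z"
proof -
  have "weyl_const z \<star> weyl_x j = Poly_Mapping.single (axis j 1, 0) z"
    unfolding weyl_const_def weyl_x_def weyl_mult_single
    by (subst weyl_monom_mult_trivial)
       (auto simp del: One_nat_def simp: nat_vec_le_0_iff nat_vec_le_axis_iff weyl_scale_single)
  then show ?thesis
    unfolding weyl_d_def weyl_mult_single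
    by simp (auto simp del: One_nat_def simp: weyl_mult_single weyl_monom_mult_trivial nat_vec_le_0_iff nat_vec_le_axis_iff weyl_scale_single)
qed

lemma homogeneity_single:
  "homogeneity A \<beta> i = (\<Sum>j\<in>UNIV. Poly_Mapping.single (axis j 1, axis j 1) (of_int (A $ i $ j))) - Poly_Mapping.single (0, 0) (\<beta> $ i)"
  unfolding homogeneity_def weyl_const_x_d by (simp add: weyl_const_def)

section \<open>Leibniz coefficients\<close>

lemma finite_nat_vec_le: "finite {k :: nat ^ 'n::finite. k \<le> c}"
proof (rule finite_subset)
  show "{k. k \<le> c} \<subseteq> (\<lambda>f. \<chi> j. f j) ` (\<Pi>\<^sub>E j\<in>UNIV. {..c $ j})"
  proof
    fix k assume "k \<in> {k. k \<le> c}"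
    then show "k \<in> (\<lambda>f. \<chi> j. f j) ` (\<Pi>\<^sub>E j\<in>UNIV. {..c $ j})"
      by (intro image_eqI[of _ _ "\<lambda>j. k $ j"]) (auto simp: less_eq_vec_def)
  qed
qed (auto intro!: finite_PiE)

text \<open>The coefficient in \<open>weyl_monom_mult\<close>. It vanishes unless k \<le> b, which
  permits summation over all k \<le> c, a range that stays fixed when \<open>b\<close>
  grows.\<close>

definition leib :: "nat ^ 'n::finite \<Rightarrow> nat ^ 'n \<Rightarrow> nat ^ 'n \<Rightarrow> complex" where
  "leib b c k = (\<Prod>j\<in>UNIV. of_nat (fact (k $ j) * (b $ j choose k $ j) * (c $ j choose k $ j)))"

lemma leib_eq_0: "\<not> k \<le> b \<Longrightarrow> leib b c k = 0"
  unfolding leib_def less_eq_vec_def by (rule prod_zero) (auto simp: not_le)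

lemma leib_0: "leib b c 0 = 1" by (simp add: leib_def)

lemma leib_0_left: "leib 0 c k = (if k = 0 then 1 else 0)"
  using leib_eq_0[of k 0 c] leib_0[of 0 c] by (auto simp: nat_vec_le_0_iff)

lemma pmlin_weyl_monom_mult:
  "pmlin G (weyl_monom_mult (a, b) (c, e)) = (\<Sum>k | k \<le> c. leib b c k * G (a + (c - k), (b - k) + e))"
proof -
  have "pmlin G (weyl_monom_mult (a, b) (c, e)) = (\<Sum>k | k \<le> b \<and> k \<le> c. leib b c k * G (a + (c - k), (b - k) + e))"
    unfolding weyl_monom_mult_def by (simp add: pmlin_sum pmlin_single leib_def)
  also have "\<dots> = (\<Sum>k | k \<le> c. leib b c k * G (a + (c - k), (b - k) + e))"
  proof (rule sum.mono_neutral_left)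
    show "\<forall>k\<in>{k. k \<le> c} - {k. k \<le> b \<and> k \<le> c}. leib b c k * G (a + (c - k), b - k + e) = 0"
      using leib_eq_0 by auto
  qed (auto simp: finite_nat_vec_le)
  finally show ?thesis .
qed

text \<open>Pascal's rule in m combined with the absorption identity (c - l) (c choose l) = (l + 1)
  (c choose (l + 1)) for k = l + 1.\<close>

lemma leib_step1: "fact k * (Suc m choose k) * (c choose k) =
    fact k * (m choose k) * (c choose k) +
    (if k = 0 then 0 else (Suc c - k) * (fact (k - 1) * (m choose (k - 1)) * (c choose (k - 1))))"
proof (cases k)
  case (Suc l)
  show ?thesis
  proof (cases "l \<le> c")
    case True
    have "(c - l) * (c choose l) = Suc l * (c choose Suc l)"
      by (simp only: binomial_absorb_comp binomial_absorption)
    then have "(c - l) * (fact l * (m choose l) * (c choose l)) = fact l * (m choose l) * (Suc l * (c choose Suc l))"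
      by (metis mult.assoc mult.left_commute)
    then show ?thesis using Suc by (simp add: algebra_simps)
  next
    case False
    then show ?thesis using Suc by (simp add: binomial_eq_0)
  qed
qed simp

lemma prod_remove_UNIV:
  fixes f :: "'n::finite \<Rightarrow> complex"
  shows "(\<Prod>l\<in>UNIV. f l) = f j * (\<Prod>l\<in>UNIV - {j}. f l)"
  by (rule prod.remove) auto

text \<open>The product rule for one more derivative in direction j: it falls on the derivative
  part, or on the monomial left from index k - e_j, whose j-th exponent is c_j + 1 - k_j.\<close>

lemma leib_step:
  "leib (b + axis j 1) c k = leib b c k +
     (if k $ j = 0 then 0 else of_nat (Suc (c $ j) - k $ j) * leib b c (k - axis j 1))"
proof -
  let ?r = "\<Prod>l\<in>UNIV - {j}. complex_of_nat (fact (k $ l) * (b $ l choose k $ l) * (c $ l choose k $ l))"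
  have 1: "leib (b + axis j 1) c k = of_nat (fact (k $ j) * (Suc (b $ j) choose k $ j) * (c $ j choose k $ j)) * ?r"
    unfolding leib_def prod_remove_UNIV[of _ j] by (intro arg_cong2[of _ _ _ _ "(*)"] prod.cong) (auto simp: axis_def)
  have 2: "leib b c k = of_nat (fact (k $ j) * (b $ j choose k $ j) * (c $ j choose k $ j)) * ?r"
    unfolding leib_def prod_remove_UNIV[of _ j] by simp
  have 3: "leib b c (k - axis j 1) = of_nat (fact (k $ j - 1) * (b $ j choose (k $ j - 1)) * (c $ j choose (k $ j - 1))) * ?r"
    unfolding leib_def prod_remove_UNIV[of _ j] by (intro arg_cong2[of _ _ _ _ "(*)"] prod.cong) (auto simp: axis_def)
  show ?thesis
    unfolding 1 2 3 leib_step1[of "k $ j" "b $ j" "c $ j"] of_nat_add distrib_right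
    by (simp add: mult.assoc del: fact_Suc)
qed

section \<open>Left ideals, the toric ideal and principal symbols\<close>

lemma generators_in_weyl_left_ideal_gen: "S \<subseteq> weyl_left_ideal_gen S"
  by (auto simp: weyl_left_ideal_gen_def)

lemma weyl_left_ideal_gen_mult: "Q \<in> weyl_left_ideal_gen S \<Longrightarrow> P \<star> Q \<in> weyl_left_ideal_gen S"
  by (auto simp: weyl_left_ideal_gen_def weyl_left_ideal_def)

lemma binomial_in_toric_ideal:
  assumes "A *v int_vec u = A *v int_vec u'"
  shows "Poly_Mapping.single u 1 - Poly_Mapping.single u' 1 \<in> toric_ideal A"
  unfolding toric_ideal_def
  by (rule subsetD[OF ring.genideal_self[OF ring_from_type_algebra]])
     (use assms in \<open>auto simp: ring_of_type_algebra_def\<close>)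

text \<open>Minimality of the generated ideal in terms of the ring operations of the type, in a form
  suited to annihilators \<open>J\<close>.\<close>

lemma toric_ideal_subset:
  fixes J :: "('n::finite) cpoly set"
  assumes "0 \<in> J" "\<And>a b. a \<in> J \<Longrightarrow> b \<in> J \<Longrightarrow> a - b \<in> J" "\<And>a b. b \<in> J \<Longrightarrow> a * b \<in> J"
    and "\<And>u u'. A *v int_vec u = A *v int_vec u' \<Longrightarrow> Poly_Mapping.single u 1 - Poly_Mapping.single u' 1 \<in> J"
  shows "toric_ideal A \<subseteq> J"
  unfolding toric_ideal_def
proof (rule ring.genideal_minimal)
  let ?R = "ring_of_type_algebra :: ('n cpoly) ring"
  show R: "ring ?R" by (rule ring_from_type_algebra)
  have neg: "- a \<in> J" if "a \<in> J" for a using assms(2)[OF assms(1) that] by simp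
  have add: "a + b \<in> J" if "a \<in> J" "b \<in> J" for a b using assms(2)[OF that(1) neg[OF that(2)]] by simp
  show "ideal J ?R"
  proof (rule idealI)
    show "ring ?R" by (rule R)
    show "subgroup J (add_monoid ?R)"
    proof (rule group.subgroupI)
      show "group (add_monoid ?R)"
        by (rule abelian_group.a_group[OF ring.is_abelian_group[OF R]])
      show "inv\<^bsub>add_monoid ?R\<^esub> a \<in> J" if "a \<in> J" for a
      proof -
        have "inv\<^bsub>add_monoid ?R\<^esub> a = - a"
          by (rule group.inv_equality[OF abelian_group.a_group[OF ring.is_abelian_group[OF R]]])
             (auto simp: ring_of_type_algebra_def)
        then show ?thesis using neg[OF that] by simp
      qed
    qed (use assms(1) add in \<open>auto simp: ring_of_type_algebra_def\<close>)
  next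
    fix a x assume "a \<in> J" "x \<in> carrier ?R"
    then show "x \<otimes>\<^bsub>?R\<^esub> a \<in> J" "a \<otimes>\<^bsub>?R\<^esub> x \<in> J"
      using assms(3)[of a x] by (auto simp: ring_of_type_algebra_def mult.commute)
  qed
qed (use assms(4) in auto)

lemma principal_symbol_pmlin:
  "principal_symbol P x \<xi> = pmlin (\<lambda>s. if (\<Sum>j\<in>UNIV. snd s $ j) = weyl_order P then monom_eval (fst s) x * monom_eval (snd s) \<xi> else 0) P"
proof -
  have "principal_symbol P x \<xi> = (\<Sum>s\<in>{s \<in> Poly_Mapping.keys P. (\<Sum>j\<in>UNIV. snd s $ j) = weyl_order P}.
      Poly_Mapping.lookup P s * (monom_eval (fst s) x * monom_eval (snd s) \<xi>))"
    unfolding principal_symbol_def by (rule sum.cong) (auto simp: mult.assoc)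
  also have "\<dots> = pmlin (\<lambda>s. if (\<Sum>j\<in>UNIV. snd s $ j) = weyl_order P then monom_eval (fst s) x * monom_eval (snd s) \<xi> else 0) P"
    unfolding pmlin_def by (subst sum.inter_filter) (auto intro!: sum.cong)
  finally show ?thesis .
qed

section \<open>Good points, and functionals obtained from solutions\<close>

context toric
begin

text \<open>The forms \<open>theta p i\<close> in degree \<open>N\<close> generate everything in degree \<open>N + 1\<close>: a nonsingularity condition on \<open>p\<close>.\<close>
definition good :: "nat \<Rightarrow> complex ^ 'n \<Rightarrow> bool" where
  "good N p \<longleftrightarrow> (\<forall>\<gamma>\<in>lev (Suc N). \<exists>s. \<forall>f. f \<gamma> = (\<Sum>i\<in>UNIV. \<Sum>\<gamma>'\<in>lev N. s i \<gamma>' * theta p i f \<gamma>'))"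

text \<open>Here \<open>f (wt u)\<close> plays the role of the value at \<open>p\<close> of the \<open>u\<close>-th derivative of a solution.\<close>
definition inK :: "complex ^ 'd \<Rightarrow> complex ^ 'n \<Rightarrow> (int ^ 'd \<Rightarrow> complex) \<Rightarrow> bool" where
  "inK \<beta> p f \<longleftrightarrow> (\<forall>i. \<forall>\<gamma>\<in>NA. theta p i f \<gamma> + (of_int (\<gamma> $ i) - \<beta> $ i) * f \<gamma> = 0)"

text \<open>Columns may coincide, so an entry of this matrix collects all \<open>j\<close> that lead
  from \<open>\<gamma>'\<close> to \<open>\<gamma>\<close>.\<close>

definition theta_coeff :: "complex ^ 'n \<Rightarrow> 'd \<Rightarrow> int ^ 'd \<Rightarrow> int ^ 'd \<Rightarrow> complex" where
  "theta_coeff p i \<gamma>' \<gamma> = (\<Sum>j\<in>UNIV. if \<gamma>' + col j = \<gamma> then of_int (A $ i $ j) * p $ j else 0)"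

lemma theta_eq_sum:
  assumes "finite S" "\<And>j. \<gamma>' + col j \<in> S"
  shows "theta p i f \<gamma>' = (\<Sum>\<gamma>\<in>S. f \<gamma> * theta_coeff p i \<gamma>' \<gamma>)"
proof -
  have "(\<Sum>\<gamma>\<in>S. f \<gamma> * theta_coeff p i \<gamma>' \<gamma>) = (\<Sum>\<gamma>\<in>S. \<Sum>j\<in>UNIV. if \<gamma>' + col j = \<gamma> then of_int (A $ i $ j) * p $ j * f (\<gamma>' + col j) else 0)"
    unfolding theta_coeff_def sum_distrib_left by (intro sum.cong) auto
  also have "\<dots> = (\<Sum>j\<in>UNIV. \<Sum>\<gamma>\<in>S. if \<gamma>' + col j = \<gamma> then of_int (A $ i $ j) * p $ j * f (\<gamma>' + col j) else 0)"
    by (rule sum.swap)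
  also have "\<dots> = theta p i f \<gamma>'"
    unfolding theta_def using assms by (intro sum.cong) auto
  finally show ?thesis by simp
qed

lemma polyfun_theta_coeff: "polyfun (\<lambda>p. theta_coeff p i \<gamma>' \<gamma>)"
proof -
  have "polyfun (\<lambda>p. if \<gamma>' + col j = \<gamma> then of_int (A $ i $ j) * p $ j else 0)" for j
    by (cases "\<gamma>' + col j = \<gamma>") (simp_all add: polyfun_mult polyfun_const polyfun_coord)
  then show ?thesis unfolding theta_coeff_def by (intro polyfun_sum)
qed

text \<open>At one point the symbols in degree N have no common zero in degree N + 1. This condition
  is open, and elimination turns it into the explicit expressions demanded by
  \<open>good\<close>.\<close>

lemma generic_good:
  obtains N q p1 where "polyfun q" "q p1 \<noteq> 0" "\<And>p. q p \<noteq> 0 \<Longrightarrow> good N p"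
proof -
  obtain N p1 where g: "\<forall>f. (\<forall>i. \<forall>\<gamma>\<in>lev N. theta p1 i f \<gamma> = 0) \<longrightarrow> (\<forall>\<gamma>\<in>lev (Suc N). f \<gamma> = 0)"
    using exists_good_point by (elim exE)
  let ?X = "lev (Suc N)" and ?I = "(UNIV :: 'd set) \<times> lev N"
  have th: "theta p i f \<gamma>' = (\<Sum>\<gamma>\<in>?X. f \<gamma> * theta_coeff p i \<gamma>' \<gamma>)" if "\<gamma>' \<in> lev N" for p i f \<gamma>'
    by (rule theta_eq_sum) (use that finite_lev lev_add_col in auto)
  have "\<exists>q. polyfun q \<and> q p1 \<noteq> 0 \<and>
    (\<forall>p f. q p \<noteq> 0 \<longrightarrow> (\<forall>s\<in>?I. (\<Sum>x\<in>?X. f x * theta_coeff p (fst s) (snd s) x) = 0) \<longrightarrow> (\<forall>x\<in>?X. f x = 0))"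
  proof (rule generic_trivial_kernel)
    fix f assume "\<forall>s\<in>?I. (\<Sum>x\<in>?X. f x * theta_coeff p1 (fst s) (snd s) x) = 0"
    then have "\<forall>i. \<forall>\<gamma>\<in>lev N. theta p1 i f \<gamma> = 0" by (auto simp: th)
    then show "\<forall>x\<in>?X. f x = 0" using g by simp
  qed (auto simp: finite_lev polyfun_theta_coeff)
  then obtain q where "polyfun q \<and> q p1 \<noteq> 0 \<and>
    (\<forall>p f. q p \<noteq> 0 \<longrightarrow> (\<forall>s\<in>?I. (\<Sum>x\<in>?X. f x * theta_coeff p (fst s) (snd s) x) = 0) \<longrightarrow> (\<forall>x\<in>?X. f x = 0))"
    by (rule exE)
  then have q: "polyfun q" "q p1 \<noteq> 0"
    "\<And>p f. q p \<noteq> 0 \<Longrightarrow> (\<forall>s\<in>?I. (\<Sum>x\<in>?X. f x * theta_coeff p (fst s) (snd s) x) = 0) \<Longrightarrow> \<forall>x\<in>?X. f x = 0"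
    by simp_all
  have "good N p" if p: "q p \<noteq> 0" for p
    unfolding good_def
  proof
    fix \<gamma> assume \<gamma>: "\<gamma> \<in> ?X"
    have "\<exists>c. \<forall>y\<in>?X. (\<Sum>s\<in>?I. c s * theta_coeff p (fst s) (snd s) y) = (if y = \<gamma> then 1 else 0)"
      by (rule trivial_kernel_imp_delta[OF _ _ q(3)[OF p] \<gamma>]) (auto simp: finite_lev)
    then obtain c where c: "\<And>y. y \<in> ?X \<Longrightarrow> (\<Sum>s\<in>?I. c s * theta_coeff p (fst s) (snd s) y) = (if y = \<gamma> then 1 else 0)"
      by blast
    have "f \<gamma> = (\<Sum>i\<in>UNIV. \<Sum>\<gamma>'\<in>lev N. c (i, \<gamma>') * theta p i f \<gamma>')" for f
    proof -
      have "(\<Sum>i\<in>UNIV. \<Sum>\<gamma>'\<in>lev N. c (i, \<gamma>') * theta p i f \<gamma>') = (\<Sum>s\<in>?I. c s * (\<Sum>y\<in>?X. f y * theta_coeff p (fst s) (snd s) y))"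
        by (simp add: sum.cartesian_product th case_prod_unfold)
      also have "\<dots> = (\<Sum>y\<in>?X. f y * (\<Sum>s\<in>?I. c s * theta_coeff p (fst s) (snd s) y))"
        unfolding sum_distrib_left by (subst sum.swap) (simp add: mult_ac)
      also have "\<dots> = (\<Sum>y\<in>?X. if y = \<gamma> then f y else 0)"
        using c by (intro sum.cong) auto
      also have "\<dots> = f \<gamma>" using \<gamma> finite_lev by simp
      finally show ?thesis by simp
    qed
    then show "\<exists>s. \<forall>f. f \<gamma> = (\<Sum>i\<in>UNIV. \<Sum>\<gamma>'\<in>lev N. s i \<gamma>' * theta p i f \<gamma>')"
      by (intro exI[of _ "\<lambda>i \<gamma>'. c (i, \<gamma>')"]) simp
  qed
  then show ?thesis using that q(1,2) by blast
qed

lemma binomial_in_hyp: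
  "wt u = wt u' \<Longrightarrow> weyl_of_dpoly (Poly_Mapping.single u 1 - Poly_Mapping.single u' 1) \<in> hypergeometric_ideal A \<beta>"
  unfolding hypergeometric_ideal_def wt_def
  by (rule subsetD[OF generators_in_weyl_left_ideal_gen]) (auto intro: binomial_in_toric_ideal)

lemma homogeneity_in_hyp: "homogeneity A \<beta> i \<in> hypergeometric_ideal A \<beta>"
  unfolding hypergeometric_ideal_def by (rule subsetD[OF generators_in_weyl_left_ideal_gen]) auto

lemma hyp_mult: "Q \<in> hypergeometric_ideal A \<beta> \<Longrightarrow> P \<star> Q \<in> hypergeometric_ideal A \<beta>"
  unfolding hypergeometric_ideal_def by (rule weyl_left_ideal_gen_mult)

lemma sum_le_axis:
  fixes g :: "nat ^ 'n \<Rightarrow> complex"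
  shows "(\<Sum>k | k \<le> axis j 1. g k) = g 0 + g (axis j 1)"
proof -
  have "{k :: nat ^ 'n. k \<le> axis j 1} = {0, axis j 1}"
    by (auto simp del: One_nat_def simp: nat_vec_le_axis_iff)
  moreover have "(axis j 1 :: nat ^ 'n) \<noteq> 0" by (simp add: vec_eq_iff axis_def)
  ultimately show ?thesis by simp
qed

lemma leib_axis: "leib b (axis j 1) (axis j 1) = of_nat (b $ j)"
proof -
  have "leib b (axis j 1) (axis j 1) = (\<Prod>l\<in>UNIV. if l = j then of_nat (b $ j) else 1)"
    unfolding leib_def by (rule prod.cong) (auto simp: axis_def)
  then show ?thesis by simp
qed

text \<open>The relations are the values at \<open>p\<close> of \<partial>^b times a homogeneity,
  applied to the solution: moving \<partial>^b past x_j \<partial>_j adds b_j \<partial>^b, and with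
  the weights a_ij these terms add up to the i-th coordinate of \<open>wt b\<close>.\<close>

lemma solution_functional:
  assumes "solution_near (hypergeometric_ideal A \<beta>) p f"
  shows "\<exists>lam. inK \<beta> p lam \<and> (\<forall>u. lam (wt u) = multi_deriv u f p)"
proof -
  have z: "weyl_action P f p = 0" if "P \<in> hypergeometric_ideal A \<beta>" for P
    using assms that unfolding solution_near_def by blast
  \<comment> \<open>The toric binomials make the derivative independent of the exponent chosen over
    \<open>\<gamma>\<close>.\<close>
  define lam where "lam \<gamma> = multi_deriv (SOME u. wt u = \<gamma>) f p" for \<gamma>
  have eq: "multi_deriv u f p = multi_deriv u' f p" if "wt u = wt u'" for u u'
    using z[OF binomial_in_hyp[OF that]]
    by (simp add: weyl_action_pmlin pmlin_weyl_of_dpoly pmlin_diff pmlin_single monom_eval_0)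
  have lam: "lam (wt u) = multi_deriv u f p" for u
    unfolding lam_def by (rule eq) (rule someI[of _ u], rule refl)
  have "theta p i lam (wt b) + (of_int (wt b $ i) - \<beta> $ i) * lam (wt b) = 0" for i b
  proof -
    let ?G = "\<lambda>s. monom_eval (fst s) p * multi_deriv (snd s) f p"
    have 0: "pmlin ?G (weyl_monom_mult (0, b) (axis j 1, axis j 1)) = p $ j * lam (wt b + col j) + of_nat (b $ j) * lam (wt b)" for j
    proof -
      have "pmlin ?G (weyl_monom_mult (0, b) (axis j 1, axis j 1)) =
          p $ j * multi_deriv (b + axis j 1) f p + of_nat (b $ j) * multi_deriv (b - axis j 1 + axis j 1) f p"
        unfolding pmlin_weyl_monom_mult sum_le_axis leib_0 leib_axis
        by (simp add: monom_eval_axis monom_eval_0 del: One_nat_def)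
      also have "of_nat (b $ j) * multi_deriv (b - axis j 1 + axis j 1) f p = of_nat (b $ j) * multi_deriv b f p"
      proof (cases "b $ j = 0")
        case False
        then have "b - axis j 1 + axis j 1 = b" by (auto simp: vec_eq_iff axis_def)
        then show ?thesis by simp
      qed simp
      also have "multi_deriv (b + axis j 1) f p = lam (wt b + col j)"
        unfolding lam[symmetric] wt_add wt_axis ..
      finally show ?thesis by (simp add: lam)
    qed
    have 1: "pmlin ?G (weyl_monom_mult (0, b) (0, 0)) = lam (wt b)"
    proof -
      have "{k :: nat ^ 'n. k \<le> 0} = {0}" by (auto simp: nat_vec_le_0_iff)
      then show ?thesis unfolding pmlin_weyl_monom_mult by (simp add: leib_0 monom_eval_0 lam)
    qed
    have "0 = weyl_action (Poly_Mapping.single (0, b) 1 \<star> homogeneity A \<beta> i) f p"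
      by (rule z[symmetric], rule hyp_mult, rule homogeneity_in_hyp)
    also have "\<dots> = pmlin (\<lambda>t. pmlin ?G (weyl_monom_mult (0, b) t)) (homogeneity A \<beta> i)"
      by (simp add: weyl_action_pmlin pmlin_weyl_mult pmlin_single)
    also have "\<dots> = (\<Sum>j\<in>UNIV. of_int (A $ i $ j) * (p $ j * lam (wt b + col j) + of_nat (b $ j) * lam (wt b))) - \<beta> $ i * lam (wt b)"
      unfolding homogeneity_single by (simp add: pmlin_diff pmlin_sum pmlin_single 0 1 del: One_nat_def)
    also have "\<dots> = theta p i lam (wt b) + (of_int (wt b $ i) - \<beta> $ i) * lam (wt b)"
      unfolding theta_def wt_nth by (simp add: distrib_left sum.distrib left_diff_distrib sum_distrib_right mult.assoc)
    finally show ?thesis by simp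
  qed
  then have "inK \<beta> p lam" unfolding inK_def NA_def by blast
  then show ?thesis using lam by blast
qed

text \<open>A nonzero covector \<open>\<xi>\<close> of the characteristic variety over
  \<open>p\<close> gives a multiplicative functional wt u \<mapsto> \<xi>^u which every
  \<open>theta p i\<close> kills. Goodness makes it vanish in degree N + 1, in particular at N + 1
  times the j-th column, where its value is the power N + 1 of \<xi>_j.\<close>

lemma good_not_singular:
  assumes g: "good N p"
  shows "p \<notin> singular_locus (hypergeometric_ideal A \<beta>)"
proof
  assume "p \<in> singular_locus (hypergeometric_ideal A \<beta>)"
  then obtain \<xi> where \<xi>: "\<xi> \<noteq> 0" and z: "\<And>P. P \<in> hypergeometric_ideal A \<beta> \<Longrightarrow> principal_symbol P p \<xi> = 0"
    unfolding singular_locus_def characteristic_variety_def by blast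
  have bin: "monom_eval u \<xi> = monom_eval u' \<xi>" if w: "wt u = wt u'" for u u'
  proof (cases "u = u'")
    case False
    define P where "P = weyl_of_dpoly (Poly_Mapping.single u (1::complex) - Poly_Mapping.single u' 1)"
    have tot: "(\<Sum>j\<in>UNIV. u $ j) = tot u" "(\<Sum>j\<in>UNIV. u' $ j) = tot u"
    proof -
      have "int (tot u') = int (tot u)" using wt_i0[of u] wt_i0[of u'] w by simp
      then show "(\<Sum>j\<in>UNIV. u $ j) = tot u" "(\<Sum>j\<in>UNIV. u' $ j) = tot u" by (simp_all add: tot_def[symmetric])
    qed
    have keysq: "Poly_Mapping.keys (Poly_Mapping.single u (1::complex) - Poly_Mapping.single u' 1) = {u, u'}"
      using False by (auto simp: in_keys_iff lookup_minus lookup_single when_def split: if_splits)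
    have Peq: "P = Poly_Mapping.single (0, u) 1 - Poly_Mapping.single (0, u') 1"
      unfolding P_def weyl_of_dpoly_def keysq using False
      by (simp add: lookup_minus lookup_single single_uminus[symmetric])
    have "Poly_Mapping.keys P = {(0, u), (0, u')}"
      unfolding Peq using False by (auto simp: in_keys_iff lookup_minus lookup_single when_def split: if_splits)
    then have "weyl_order P = tot u" unfolding weyl_order_def by (simp add: tot)
    then have "principal_symbol P p \<xi> = monom_eval u \<xi> - monom_eval u' \<xi>"
      unfolding principal_symbol_pmlin by (simp add: Peq pmlin_diff pmlin_single tot monom_eval_0)
    then show ?thesis using z[OF binomial_in_hyp[OF w]] unfolding P_def by simp
  qed simp
  \<comment> \<open>A zero row has to be split off: its homogeneity has no term of order 1, so its
    symbol says nothing about \<open>\<xi>\<close>.\<close>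
  have hom: "(\<Sum>j\<in>UNIV. of_int (A $ i $ j) * (p $ j * \<xi> $ j)) = 0" for i
  proof (cases "\<forall>j. A $ i $ j = 0")
    case False
    then obtain j0 where j0: "A $ i $ j0 \<noteq> 0" by blast
    let ?P = "homogeneity A \<beta> i"
    have look: "Poly_Mapping.lookup ?P (axis j 1, axis j 1) = of_int (A $ i $ j)" for j
    proof -
      have "(axis j 1 :: nat ^ 'n) \<noteq> 0" by (simp add: vec_eq_iff axis_def)
      then show ?thesis
        unfolding homogeneity_single
        by (simp add: lookup_minus lookup_sum lookup_single when_def axis_eq_axis del: One_nat_def)
    qed
    have keys: "Poly_Mapping.keys ?P \<subseteq> insert (0, 0) (range (\<lambda>j. (axis j 1, axis j 1)))"
    proof
      fix s assume s: "s \<in> Poly_Mapping.keys ?P"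
      show "s \<in> insert (0, 0) (range (\<lambda>j. (axis j 1, axis j 1)))"
      proof (rule ccontr)
        assume "s \<notin> insert (0, 0) (range (\<lambda>j. (axis j 1, axis j 1)))"
        then have n: "(0, 0) \<noteq> s" "\<And>j. (axis j 1, axis j 1) \<noteq> s" by auto
        have "Poly_Mapping.lookup ?P s = 0"
          unfolding homogeneity_single lookup_minus lookup_sum lookup_single when_def using n by (simp del: One_nat_def)
        then show False using s by (simp add: in_keys_iff)
      qed
    qed
    have "weyl_order ?P = 1"
      unfolding weyl_order_def
    proof (rule Max_eqI)
      show "y \<le> 1" if "y \<in> (\<lambda>(a, b). \<Sum>j\<in>UNIV. b $ j) ` Poly_Mapping.keys ?P" for y
        using that keys by (auto simp: sum_axis simp del: One_nat_def)
      have "(axis j0 1, axis j0 1) \<in> Poly_Mapping.keys ?P" using look[of j0] j0 by (simp add: in_keys_iff del: One_nat_def)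
      then show "1 \<in> (\<lambda>(a, b). \<Sum>j\<in>UNIV. b $ j) ` Poly_Mapping.keys ?P"
        by (intro image_eqI[of _ _ "(axis j0 1, axis j0 1)"]) (auto simp: sum_axis simp del: One_nat_def)
    qed simp
    then have "principal_symbol ?P p \<xi> = (\<Sum>j\<in>UNIV. of_int (A $ i $ j) * (p $ j * \<xi> $ j))"
      unfolding principal_symbol_pmlin
      by (simp add: homogeneity_single pmlin_diff pmlin_sum pmlin_single sum_axis monom_eval_axis del: One_nat_def)
    then show ?thesis using z[OF homogeneity_in_hyp] by simp
  qed simp
  define lam where "lam \<gamma> = monom_eval (SOME u. wt u = \<gamma>) \<xi>" for \<gamma>
  have lam: "lam (wt u) = monom_eval u \<xi>" for u
    unfolding lam_def by (rule bin) (rule someI[of _ u], rule refl)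
  have th: "theta p i lam \<gamma> = 0" if \<gamma>: "\<gamma> \<in> NA" for i \<gamma>
  proof -
    obtain u where u: "\<gamma> = wt u" using \<gamma> unfolding NA_def by blast
    have "lam (\<gamma> + col j) = monom_eval u \<xi> * \<xi> $ j" for j
      unfolding u wt_axis[symmetric] wt_add[symmetric] lam monom_eval_add monom_eval_axis ..
    then have "theta p i lam \<gamma> = monom_eval u \<xi> * (\<Sum>j\<in>UNIV. of_int (A $ i $ j) * (p $ j * \<xi> $ j))"
      unfolding theta_def by (simp add: sum_distrib_left mult_ac)
    then show ?thesis by (simp add: hom)
  qed
  have zero: "lam \<gamma> = 0" if \<gamma>: "\<gamma> \<in> lev (Suc N)" for \<gamma>
  proof -
    obtain s where s: "\<And>f. f \<gamma> = (\<Sum>i\<in>UNIV. \<Sum>\<gamma>'\<in>lev N. s i \<gamma>' * theta p i f \<gamma>')"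
      using g \<gamma> unfolding good_def by blast
    have "lam \<gamma> = (\<Sum>i\<in>UNIV. \<Sum>\<gamma>'\<in>lev N. s i \<gamma>' * theta p i lam \<gamma>')" by (rule s)
    also have "\<dots> = 0" using th lev_subset by (intro sum.neutral ballI) auto
    finally show ?thesis .
  qed
  have "\<xi> $ j = 0" for j
  proof -
    define u :: "nat ^ 'n" where "u = (\<chi> k. if k = j then Suc N else 0)"
    have "tot u = Suc N" by (simp add: tot_def u_def)
    then have "lam (wt u) = 0" using zero wt_in_lev[of u] by simp
    moreover have "monom_eval u \<xi> = (\<Prod>k\<in>UNIV. if k = j then (\<xi> $ k) ^ Suc N else 1)"
      unfolding monom_eval_def u_def by (rule prod.cong) auto
    ultimately show ?thesis by (auto simp: lam)
  qed
  then show False using \<xi> by (simp add: vec_eq_iff)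
qed

end

section \<open>Functionals give power series solutions\<close>

lemma fact_add_le: "fact (g + k) \<le> (fact g * fact k * 2 ^ (g + k) :: nat)"
proof -
  have "fact (g + k) = fact g * fact k * ((g + k) choose g)"
    using binomial_fact_lemma[of g "g + k"] by simp
  also have "(g + k) choose g \<le> 2 ^ (g + k)" by (rule binomial_le_pow2)
  finally show ?thesis by simp
qed

context toric
begin

text \<open>The sum of y_j times the shift by the j-th column, that is, \<Sum> y_j \<partial>_j
  acting on the derivatives at \<open>p\<close>. Its k-th power over k! gives the part of degree k
  of the Taylor series.\<close>

definition shiftL :: "complex ^ 'n \<Rightarrow> (int ^ 'd \<Rightarrow> complex) \<Rightarrow> int ^ 'd \<Rightarrow> complex" where
  "shiftL y f \<gamma> = (\<Sum>j\<in>UNIV. y $ j * f (\<gamma> + col j))"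

definition pterm :: "(int ^ 'd \<Rightarrow> complex) \<Rightarrow> int ^ 'd \<Rightarrow> nat \<Rightarrow> complex ^ 'n \<Rightarrow> complex" where
  "pterm f \<gamma> k y = (shiftL y ^^ k) f \<gamma> / fact k"

text \<open>The Taylor series at \<open>p\<close> of \<open>\<partial>\<^sup>u \<phi>\<close>, \<open>wt u = \<gamma>\<close>, for a solution \<open>\<phi>\<close> with derivatives \<open>f\<close> at \<open>p\<close>, grouped by total degree.\<close>
definition pser :: "(int ^ 'd \<Rightarrow> complex) \<Rightarrow> int ^ 'd \<Rightarrow> complex ^ 'n \<Rightarrow> complex" where
  "pser f \<gamma> y = suminf (\<lambda>k. pterm f \<gamma> k y)"

text \<open>The growth that Cauchy's estimates give for the derivatives of a holomorphic function;
  here it is the condition for convergence.\<close>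

definition fbound :: "real \<Rightarrow> real \<Rightarrow> (int ^ 'd \<Rightarrow> complex) \<Rightarrow> bool" where
  "fbound C M f \<longleftrightarrow> C \<ge> 0 \<and> M \<ge> 1 \<and> (\<forall>k. \<forall>\<gamma>\<in>lev k. norm (f \<gamma>) \<le> C * fact k * M ^ k)"

lemma shiftL_pow_Suc: "(shiftL y ^^ Suc k) f \<gamma> = (\<Sum>j\<in>UNIV. y $ j * (shiftL y ^^ k) f (\<gamma> + col j))"
  by (simp add: shiftL_def)

lemma norm1_le: "(\<Sum>j\<in>UNIV. norm (y $ j)) \<le> CARD('n) * norm (y :: complex ^ 'n)"
  using sum_bounded_above[of UNIV "\<lambda>j. norm (y $ j)" "norm y"] Finite_Cartesian_Product.norm_nth_le by auto

lemma shiftL_pow_bound: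
  assumes "fbound C M f" "\<gamma> \<in> lev g"
  shows "norm ((shiftL y ^^ k) f \<gamma>) \<le> (\<Sum>j\<in>UNIV. norm (y $ j)) ^ k * (C * fact (g + k) * M ^ (g + k))"
  using assms(2)
proof (induction k arbitrary: \<gamma> g)
  case 0
  then show ?case using assms(1) by (simp add: fbound_def)
next
  case (Suc k)
  have "norm ((shiftL y ^^ Suc k) f \<gamma>) \<le> (\<Sum>j\<in>UNIV. norm (y $ j * (shiftL y ^^ k) f (\<gamma> + col j)))"
    unfolding shiftL_pow_Suc by (rule norm_sum)
  also have "\<dots> \<le> (\<Sum>j\<in>UNIV. norm (y $ j) * ((\<Sum>j\<in>UNIV. norm (y $ j)) ^ k * (C * fact (Suc g + k) * M ^ (Suc g + k))))"
    unfolding norm_mult by (intro sum_mono mult_left_mono Suc.IH lev_add_col Suc.prems) auto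
  also have "\<dots> = (\<Sum>j\<in>UNIV. norm (y $ j)) ^ Suc k * (C * fact (g + Suc k) * M ^ (g + Suc k))"
    unfolding sum_distrib_right[symmetric] by (simp only: power_Suc add_Suc add_Suc_right mult.assoc)
  finally show ?case .
qed

text \<open>The radius is chosen to make the ratio 1/2: replacing (g + k)! by g! k! costs 2^(g + k),
  and the sum of the moduli of the y_j is at most CARD('n) times the norm.\<close>

lemma pterm_bound:
  assumes b: "fbound C M f" and g: "\<gamma> \<in> lev g" and y: "norm y \<le> 1 / (4 * M * CARD('n))"
  shows "norm (pterm f \<gamma> k y) \<le> C * fact g * (2 * M) ^ g * (1 / 2) ^ k"
proof -
  have CM: "C \<ge> 0" "M \<ge> 1" using b by (auto simp: fbound_def)
  define Y where "Y = (\<Sum>j\<in>UNIV. norm (y $ j))"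
  have Y0: "Y \<ge> 0" unfolding Y_def by (intro sum_nonneg) auto
  have "Y \<le> CARD('n) * norm y" unfolding Y_def by (rule norm1_le)
  also have "\<dots> \<le> CARD('n) * (1 / (4 * M * CARD('n)))" using y by (intro mult_left_mono) auto
  also have "\<dots> = 1 / (4 * M)" by simp
  finally have Y: "Y * (2 * M) \<le> 1 / 2" using CM by (simp add: field_simps)
  have f: "real (fact (g + k)) \<le> fact g * fact k * 2 ^ (g + k)"
  proof -
    have "real (fact (g + k)) \<le> real (fact g * fact k * 2 ^ (g + k))" using fact_add_le of_nat_le_iff by blast
    then show ?thesis by simp
  qed
  have "norm (pterm f \<gamma> k y) \<le> Y ^ k * (C * fact (g + k) * M ^ (g + k)) / fact k"
    unfolding pterm_def norm_divide Y_def using shiftL_pow_bound[OF b g]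
    by (simp add: divide_right_mono)
  also have "\<dots> \<le> Y ^ k * (C * (fact g * fact k * 2 ^ (g + k)) * M ^ (g + k)) / fact k"
    using f CM Y0 by (intro divide_right_mono mult_left_mono mult_right_mono) auto
  also have "\<dots> = C * fact g * (2 * M) ^ g * (Y * (2 * M)) ^ k"
    by (simp add: power_add power_mult_distrib)
  also have "\<dots> \<le> C * fact g * (2 * M) ^ g * (1 / 2) ^ k"
    using Y Y0 CM by (intro mult_left_mono power_mono) auto
  finally show ?thesis .
qed

section \<open>Convergence, termwise differentiation and relations for the series\<close>

lemma pterm_sums:
  assumes "fbound C M f" "\<gamma> \<in> lev g" "norm y \<le> 1 / (4 * M * CARD('n))"
  shows "(\<lambda>k. pterm f \<gamma> k y) sums pser f \<gamma> y"
proof -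
  have "summable (\<lambda>k. pterm f \<gamma> k y)"
    by (rule summable_comparison_test'[of "\<lambda>k. C * fact g * (2 * M) ^ g * (1 / 2) ^ k" 0])
       (use pterm_bound[OF assms] in \<open>auto intro: summable_mult summable_geometric\<close>)
  then show ?thesis unfolding pser_def by (rule summable_sums)
qed

lemma pser_tail:
  assumes "fbound C M f" "\<gamma> \<in> lev g" "norm y \<le> 1 / (4 * M * CARD('n))"
  shows "norm ((\<Sum>k<n. pterm f \<gamma> k y) - pser f \<gamma> y) \<le> 2 * (C * fact g * (2 * M) ^ g) * (1 / 2) ^ n"
proof -
  let ?T = "C * fact g * (2 * M) ^ g"
  have s: "summable (\<lambda>k. pterm f \<gamma> k y)" using pterm_sums[OF assms] by (rule sums_summable)
  have g: "(\<lambda>k. ?T * (1 / 2) ^ n * (1 / 2) ^ k) sums (?T * (1 / 2) ^ n * (1 / (1 - 1 / 2)))"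
    by (intro sums_mult geometric_sums) simp
  have "pser f \<gamma> y - (\<Sum>k<n. pterm f \<gamma> k y) = (suminf (\<lambda>k. pterm f \<gamma> (k + n) y))"
    unfolding pser_def by (rule suminf_minus_initial_segment[OF s, symmetric])
  then have "norm ((\<Sum>k<n. pterm f \<gamma> k y) - pser f \<gamma> y) = norm (suminf (\<lambda>k. pterm f \<gamma> (k + n) y))"
    using norm_minus_commute[of "\<Sum>k<n. pterm f \<gamma> k y" "pser f \<gamma> y"] by simp
  also have "\<dots> \<le> suminf (\<lambda>k. ?T * (1 / 2) ^ n * (1 / 2) ^ k)"
  proof (rule norm_suminf_le)
    show "norm (pterm f \<gamma> (k + n) y) \<le> ?T * (1 / 2) ^ n * (1 / 2) ^ k" for k
      using pterm_bound[OF assms, of "k + n"] by (simp add: power_add mult_ac)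
  qed (use g in \<open>rule sums_summable\<close>)
  also have "\<dots> = ?T * (1 / 2) ^ n * 2" using sums_unique[OF g] by simp
  finally show ?thesis by (simp add: mult_ac)
qed

text \<open>The shifts commute, so the usual rule for powers holds: k times the power k - 1 composed
  with the shift along h.\<close>

lemma has_derivative_shiftL_pow:
  "((\<lambda>y. (shiftL y ^^ k) f \<gamma>) has_derivative
     (\<lambda>h. of_nat k * (\<Sum>j\<in>UNIV. h $ j * (shiftL y ^^ (k - 1)) f (\<gamma> + col j)))) (at y within S)"
proof (induction k arbitrary: \<gamma>)
  case 0
  show ?case by simp
next
  case (Suc k)
  have bl: "((\<lambda>y :: complex ^ 'n. y $ j) has_derivative (\<lambda>h. h $ j)) (at y within S)" for j
    by (rule bounded_linear_imp_has_derivative) (rule bounded_linear_vec_nth)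
  have "((\<lambda>y. \<Sum>j\<in>UNIV. y $ j * (shiftL y ^^ k) f (\<gamma> + col j)) has_derivative
     (\<lambda>h. \<Sum>j\<in>UNIV. y $ j * (of_nat k * (\<Sum>l\<in>UNIV. h $ l * (shiftL y ^^ (k - 1)) f (\<gamma> + col j + col l)))
        + h $ j * (shiftL y ^^ k) f (\<gamma> + col j))) (at y within S)"
    by (intro has_derivative_sum has_derivative_mult bl Suc.IH)
  moreover have "(\<Sum>j\<in>UNIV. y $ j * (of_nat k * (\<Sum>l\<in>UNIV. h $ l * (shiftL y ^^ (k - 1)) f (\<gamma> + col j + col l)))
        + h $ j * (shiftL y ^^ k) f (\<gamma> + col j)) = of_nat (Suc k) * (\<Sum>j\<in>UNIV. h $ j * (shiftL y ^^ k) f (\<gamma> + col j))" for h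
  proof (cases k)
    case 0
    then show ?thesis by simp
  next
    case (Suc m)
    have "(\<Sum>j\<in>UNIV. y $ j * (of_nat k * (\<Sum>l\<in>UNIV. h $ l * (shiftL y ^^ (k - 1)) f (\<gamma> + col j + col l))))
        = of_nat k * (\<Sum>j\<in>UNIV. \<Sum>l\<in>UNIV. h $ l * (y $ j * (shiftL y ^^ m) f (\<gamma> + col l + col j)))"
      using Suc by (simp add: sum_distrib_left mult_ac add_ac)
    also have "\<dots> = of_nat k * (\<Sum>l\<in>UNIV. h $ l * (shiftL y ^^ k) f (\<gamma> + col l))"
      unfolding Suc shiftL_pow_Suc sum_distrib_left[symmetric]
      by (subst sum.swap) (simp add: sum_distrib_left)
    finally show ?thesis by (simp add: sum.distrib distrib_right)
  qed
  ultimately show ?case unfolding shiftL_pow_Suc diff_Suc_1 by simp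
qed

lemma has_derivative_pterm:
  "(pterm f \<gamma> k has_derivative
     (\<lambda>h. if k = 0 then 0 else \<Sum>j\<in>UNIV. h $ j * pterm f (\<gamma> + col j) (k - 1) y)) (at y within S)"
proof -
  have "(pterm f \<gamma> k has_derivative (\<lambda>h. (of_nat k * (\<Sum>j\<in>UNIV. h $ j * (shiftL y ^^ (k - 1)) f (\<gamma> + col j))) / fact k)) (at y within S)"
    unfolding pterm_def[abs_def] by (rule bounded_linear.has_derivative[OF bounded_linear_divide has_derivative_shiftL_pow])
  moreover have "(of_nat k * (\<Sum>j\<in>UNIV. h $ j * (shiftL y ^^ (k - 1)) f (\<gamma> + col j))) / fact k
      = (if k = 0 then 0 else \<Sum>j\<in>UNIV. h $ j * pterm f (\<gamma> + col j) (k - 1) y)" for h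
    unfolding pterm_def by (cases k) (simp_all add: sum_divide_distrib fact_Suc del: of_nat_Suc)
  ultimately show ?thesis by simp
qed

text \<open>Termwise differentiation, with tails bounded uniformly on the ball. A derivative in
  direction j replaces \<gamma> by \<gamma> plus the j-th column, so the family of series is closed
  under differentiation.\<close>

lemma has_derivative_pser:
  assumes b: "fbound C M f" and g: "\<gamma> \<in> lev g" and y: "norm y < 1 / (4 * M * CARD('n))"
  shows "(pser f \<gamma> has_derivative (\<lambda>h. \<Sum>j\<in>UNIV. h $ j * pser f (\<gamma> + col j) y)) (at y)"
proof -
  let ?S = "ball (0 :: complex ^ 'n) (1 / (4 * M * CARD('n)))"
  have CM: "C \<ge> 0" "M \<ge> 1" using b by (auto simp: fbound_def)
  define T where "T = 2 * (C * fact (Suc g) * (2 * M) ^ Suc g)"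
  have T0: "T \<ge> 0" using CM by (simp add: T_def)
  have inS: "x \<in> ?S \<Longrightarrow> norm x \<le> 1 / (4 * M * CARD('n))" for x by simp
  have "\<exists>G. \<forall>x\<in>?S. (\<lambda>k. pterm f \<gamma> k x) sums G x \<and>
      (G has_derivative (\<lambda>h. \<Sum>j\<in>UNIV. h $ j * pser f (\<gamma> + col j) x)) (at x within ?S)"
  proof (rule has_derivative_series)
    show "convex ?S" by simp
    show "(pterm f \<gamma> k has_derivative (\<lambda>h. if k = 0 then 0 else \<Sum>j\<in>UNIV. h $ j * pterm f (\<gamma> + col j) (k - 1) x)) (at x within ?S)" for k x
      by (rule has_derivative_pterm)
    show "\<forall>\<^sub>F n in sequentially. \<forall>x\<in>?S. \<forall>h. norm ((\<Sum>k<n. if k = 0 then 0 else \<Sum>j\<in>UNIV. h $ j * pterm f (\<gamma> + col j) (k - 1) x)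
        - (\<Sum>j\<in>UNIV. h $ j * pser f (\<gamma> + col j) x)) \<le> e * norm h" if e: "e > 0" for e
    proof -
      have "filterlim (\<lambda>n. CARD('n) * T * (1 / 2) ^ n) (nhds (CARD('n) * T * 0)) sequentially"
        by (intro tendsto_mult tendsto_const LIMSEQ_power_zero) simp
      then have "\<forall>\<^sub>F n in sequentially. CARD('n) * T * (1 / 2) ^ n < e"
        using e by (intro order_tendstoD(2)) auto
      then have "\<forall>\<^sub>F n in sequentially. CARD('n) * T * (1 / 2) ^ (n - 1) < e"
        by (subst eventually_sequentially_Suc[symmetric]) simp
      moreover have "\<forall>\<^sub>F n in sequentially. n > (0::nat)" by (rule eventually_gt_at_top)
      ultimately show ?thesis
      proof eventually_elim
        case (elim n)
        then obtain m where m: "n = Suc m" using gr0_conv_Suc by blast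
        show ?case
        proof (intro ballI allI)
          fix x h assume x: "x \<in> ?S"
          have "(\<Sum>k<n. if k = 0 then 0 else \<Sum>j\<in>UNIV. h $ j * pterm f (\<gamma> + col j) (k - 1) x)
            = (\<Sum>k<m. \<Sum>j\<in>UNIV. h $ j * pterm f (\<gamma> + col j) k x)"
            unfolding m sum.lessThan_Suc_shift by simp
          also have "\<dots> = (\<Sum>j\<in>UNIV. h $ j * (\<Sum>k<m. pterm f (\<gamma> + col j) k x))"
            by (subst sum.swap) (simp add: sum_distrib_left)
          finally have "norm ((\<Sum>k<n. if k = 0 then 0 else \<Sum>j\<in>UNIV. h $ j * pterm f (\<gamma> + col j) (k - 1) x)
              - (\<Sum>j\<in>UNIV. h $ j * pser f (\<gamma> + col j) x))
            = norm (\<Sum>j\<in>UNIV. h $ j * ((\<Sum>k<m. pterm f (\<gamma> + col j) k x) - pser f (\<gamma> + col j) x))"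
            by (simp add: sum_subtractf right_diff_distrib)
          also have "\<dots> \<le> (\<Sum>j\<in>UNIV. norm (h $ j) * (T * (1 / 2) ^ m))"
            unfolding T_def
            by (rule order_trans[OF norm_sum], unfold norm_mult, intro sum_mono mult_left_mono pser_tail[OF b lev_add_col[OF g] inS[OF x]]) auto
          also have "\<dots> = (\<Sum>j\<in>UNIV. norm (h $ j)) * (T * (1 / 2) ^ m)" by (simp add: sum_distrib_right)
          also have "\<dots> \<le> (CARD('n) * norm h) * (T * (1 / 2) ^ m)"
            using T0 by (intro mult_right_mono norm1_le) auto
          also have "\<dots> = (CARD('n) * T * (1 / 2) ^ m) * norm h" by (simp add: mult_ac)
          also have "\<dots> \<le> e * norm h" using elim m by (intro mult_right_mono) auto
          finally show "norm ((\<Sum>k<n. if k = 0 then 0 else \<Sum>j\<in>UNIV. h $ j * pterm f (\<gamma> + col j) (k - 1) x)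
              - (\<Sum>j\<in>UNIV. h $ j * pser f (\<gamma> + col j) x)) \<le> e * norm h" .
        qed
      qed
    qed
    show "0 \<in> ?S" using CM by simp
    show "(\<lambda>k. pterm f \<gamma> k 0) sums pser f \<gamma> 0" by (rule pterm_sums[OF b g]) (use CM in simp)
  qed
  then obtain G where G: "\<And>x. x \<in> ?S \<Longrightarrow> (\<lambda>k. pterm f \<gamma> k x) sums G x"
    "\<And>x. x \<in> ?S \<Longrightarrow> (G has_derivative (\<lambda>h. \<Sum>j\<in>UNIV. h $ j * pser f (\<gamma> + col j) x)) (at x within ?S)"
    by blast
  have eq: "G x = pser f \<gamma> x" if "x \<in> ?S" for x
    using sums_unique[OF G(1)[OF that]] unfolding pser_def by simp
  have yS: "y \<in> ?S" using y by simp
  have "(G has_derivative (\<lambda>h. \<Sum>j\<in>UNIV. h $ j * pser f (\<gamma> + col j) y)) (at y)"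
    using G(2)[OF yS] at_within_open[OF yS open_ball] by simp
  then show ?thesis
    by (rule has_derivative_transform_within_open[OF _ open_ball yS]) (use eq in simp)
qed

lemma pser_0: "pser f \<gamma> 0 = f \<gamma>"
proof -
  have "(shiftL 0 ^^ Suc k) f \<gamma> = 0" for k \<gamma> unfolding shiftL_pow_Suc by simp
  then have "(\<lambda>k. pterm f \<gamma> k 0) = (\<lambda>k. if k = 0 then f \<gamma> else 0)"
    unfolding pterm_def by (auto simp: fun_eq_iff gr0_conv_Suc simp del: funpow.simps)
  then have "(\<lambda>k. pterm f \<gamma> k 0) sums f \<gamma>" using sums_If_finite_set[of "{0}" "\<lambda>_. f \<gamma>"] by simp
  then show ?thesis unfolding pser_def by (rule sums_unique[symmetric])
qed

text \<open>In degree k > N goodness expresses a value of \<open>f\<close> through values of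
  \<open>theta\<close> in degree k - 1, and the relations replace these by values of
  \<open>f\<close> times a factor of order k. Each degree thus costs at most M * k. The coefficients
  are bounded because \<gamma> = \<alpha> + \<delta> with \<alpha> among the finitely many elements
  of degree N + 1.\<close>

lemma inK_fbound:
  assumes g: "good N p" and f: "inK \<beta> p f"
  shows "\<exists>C M. fbound C M f"
proof -
  have "\<forall>\<alpha>\<in>lev (Suc N). \<exists>s. \<forall>f. f \<alpha> = (\<Sum>i\<in>UNIV. \<Sum>\<gamma>'\<in>lev N. s i \<gamma>' * theta p i f \<gamma>')"
    using g unfolding good_def .
  from bchoice[OF this] obtain s where
    s: "\<forall>\<alpha>\<in>lev (Suc N). \<forall>f. f \<alpha> = (\<Sum>i\<in>UNIV. \<Sum>\<gamma>'\<in>lev N. s \<alpha> i \<gamma>' * theta p i f \<gamma>')"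
    by (rule exE)
  define S where "S = (\<Sum>\<alpha>\<in>lev (Suc N). \<Sum>i\<in>UNIV. \<Sum>\<gamma>'\<in>lev N. norm (s \<alpha> i \<gamma>'))"
  have S: "(\<Sum>i\<in>UNIV. \<Sum>\<gamma>'\<in>lev N. norm (s \<alpha> i \<gamma>')) \<le> S" if "\<alpha> \<in> lev (Suc N)" for \<alpha>
    unfolding S_def by (rule member_le_sum[OF that]) (simp_all add: sum_nonneg finite_lev)
  have S0: "S \<ge> 0" unfolding S_def by (intro sum_nonneg) auto
  define a where "a = (\<Sum>i\<in>UNIV. \<Sum>j\<in>UNIV. real_of_int \<bar>A $ i $ j\<bar>)"
  define b where "b = (\<Sum>i\<in>UNIV. norm (\<beta> $ i))"
  have ab0: "a \<ge> 0" "b \<ge> 0" unfolding a_def b_def by (auto intro!: sum_nonneg)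
  have aA: "real_of_int \<bar>A $ i $ j\<bar> \<le> a" for i j
  proof -
    have "real_of_int \<bar>A $ i $ j\<bar> \<le> (\<Sum>j\<in>UNIV. real_of_int \<bar>A $ i $ j\<bar>)"
      by (rule member_le_sum) auto
    also have "\<dots> \<le> a" unfolding a_def by (rule member_le_sum[of i UNIV "\<lambda>i. \<Sum>j\<in>UNIV. real_of_int \<bar>A $ i $ j\<bar>"]) (auto intro: sum_nonneg)
    finally show ?thesis .
  qed
  have lv: "norm (of_int (\<gamma> $ i) - \<beta> $ i) \<le> (a + b) * real (Suc k)" if \<gamma>: "\<gamma> \<in> lev k" for \<gamma> i k
  proof -
    obtain u where u: "\<gamma> = wt u" "tot u = k" using \<gamma> by (rule levE)
    have "real_of_int \<bar>\<gamma> $ i\<bar> \<le> (\<Sum>j\<in>UNIV. real_of_int \<bar>A $ i $ j * int (u $ j)\<bar>)"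
      unfolding u(1) wt_nth of_int_sum[symmetric] of_int_le_iff by (rule sum_abs)
    also have "\<dots> \<le> (\<Sum>j\<in>UNIV. a * real (u $ j))"
      using aA by (intro sum_mono) (simp add: abs_mult mult_right_mono)
    also have "\<dots> = a * real k" unfolding u(2)[symmetric] tot_def by (simp add: sum_distrib_left)
    finally have 1: "real_of_int \<bar>\<gamma> $ i\<bar> \<le> a * real k" .
    have "norm (of_int (\<gamma> $ i) - \<beta> $ i) \<le> norm (of_int (\<gamma> $ i) :: complex) + norm (\<beta> $ i)"
      by (rule norm_triangle_ineq4)
    also have "\<dots> \<le> a * real k + b"
      using 1 member_le_sum[of i UNIV "\<lambda>i. norm (\<beta> $ i)"] by (auto simp: b_def)
    also have "\<dots> \<le> (a + b) * real (Suc k)" using ab0 by (simp add: algebra_simps)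
    finally show ?thesis .
  qed
  define M where "M = 1 + S * (a + b)"
  define C where "C = (\<Sum>k\<le>N. \<Sum>\<gamma>\<in>lev k. norm (f \<gamma>))"
  have M1: "M \<ge> 1" using S0 ab0 by (simp add: M_def)
  have C0: "C \<ge> 0" unfolding C_def by (intro sum_nonneg) auto
  have "norm (f \<gamma>) \<le> C * fact k * M ^ k" if "\<gamma> \<in> lev k" for k \<gamma>
    using that
  proof (induction k arbitrary: \<gamma> rule: less_induct)
    case (less k)
    show ?case
    proof (cases "k \<le> N")
      case True
      have "norm (f \<gamma>) \<le> (\<Sum>\<gamma>\<in>lev k. norm (f \<gamma>))"
        by (rule member_le_sum[OF less.prems]) (auto simp: finite_lev)
      also have "\<dots> \<le> C"
        unfolding C_def by (rule member_le_sum[of k "{..N}" "\<lambda>k. \<Sum>\<gamma>\<in>lev k. norm (f \<gamma>)"]) (use True in \<open>auto intro: sum_nonneg\<close>)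
      also have "C * 1 * 1 \<le> C * fact k * M ^ k"
        using C0 M1 by (intro mult_mono) auto
      finally show ?thesis by simp
    next
      case False
      then obtain m where m: "k = Suc N + m" using less_iff_Suc_add[of N k] by auto
      obtain \<alpha> \<delta> where ad: "\<alpha> \<in> lev (Suc N)" "\<delta> \<in> lev m" "\<gamma> = \<alpha> + \<delta>"
        using less.prems unfolding m by (rule lev_split)
      let ?B = "(a + b) * real k * (C * fact (N + m) * M ^ (N + m))"
      have t: "norm (theta p i f (\<gamma>' + \<delta>)) \<le> ?B" if \<gamma>': "\<gamma>' \<in> lev N" for i \<gamma>'
      proof -
        have l: "\<gamma>' + \<delta> \<in> lev (N + m)" using \<gamma>' ad(2) by (rule lev_add)
        have "theta p i f (\<gamma>' + \<delta>) = - ((of_int ((\<gamma>' + \<delta>) $ i) - \<beta> $ i) * f (\<gamma>' + \<delta>))"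
        proof -
          have "\<gamma>' + \<delta> \<in> NA" using l lev_subset by blast
          then show ?thesis using f unfolding inK_def by (intro eq_neg_iff_add_eq_0[THEN iffD2]) blast
        qed
        then have "norm (theta p i f (\<gamma>' + \<delta>)) = norm (of_int ((\<gamma>' + \<delta>) $ i) - \<beta> $ i) * norm (f (\<gamma>' + \<delta>))"
          by (simp only: norm_minus_cancel norm_mult)
        also have "\<dots> \<le> ((a + b) * real (Suc (N + m))) * (C * fact (N + m) * M ^ (N + m))"
          using less.IH[OF _ l] m ab0 by (intro mult_mono lv[OF l]) auto
        finally show ?thesis using m by simp
      qed
      have B0: "?B \<ge> 0" using ab0 C0 M1 by simp
      have "f \<gamma> = (\<Sum>i\<in>UNIV. \<Sum>\<gamma>'\<in>lev N. s \<alpha> i \<gamma>' * theta p i (\<lambda>\<gamma>. f (\<gamma> + \<delta>)) \<gamma>')"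
        using s[rule_format, OF ad(1), of "\<lambda>\<gamma>. f (\<gamma> + \<delta>)"] ad(3) by simp
      also have "\<dots> = (\<Sum>i\<in>UNIV. \<Sum>\<gamma>'\<in>lev N. s \<alpha> i \<gamma>' * theta p i f (\<gamma>' + \<delta>))"
        unfolding theta_def by (simp add: add_ac)
      finally have "norm (f \<gamma>) \<le> (\<Sum>i\<in>UNIV. \<Sum>\<gamma>'\<in>lev N. norm (s \<alpha> i \<gamma>') * ?B)"
        by (simp only:) (intro order_trans[OF norm_sum] sum_mono, unfold norm_mult, intro mult_left_mono t norm_ge_zero)
      also have "\<dots> = (\<Sum>i\<in>UNIV. \<Sum>\<gamma>'\<in>lev N. norm (s \<alpha> i \<gamma>')) * ?B"
        by (simp add: sum_distrib_right)
      also have "\<dots> \<le> S * ?B" using S[OF ad(1)] B0 by (rule mult_right_mono)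
      also have "\<dots> = (S * (a + b)) * (C * (real k * fact (N + m)) * M ^ (N + m))" by (simp only: mult_ac)
      also have "\<dots> \<le> M * (C * (real k * fact (N + m)) * M ^ (N + m))"
        using C0 M1 by (intro mult_right_mono) (auto simp: M_def)
      also have "\<dots> = C * fact k * M ^ k" using m by (simp add: fact_Suc)
      finally show ?thesis .
    qed
  qed
  then show ?thesis using C0 M1 unfolding fbound_def by blast
qed

text \<open>The relations are transported from \<open>p\<close> to p + y. Passing \<gamma>_i through
  a shift by the l-th column produces a_il, so k shifts produce k copies of \<open>T\<close>; after
  division by k! these cancel the terms with coefficient y_j, which stand one degree lower.\<close>

lemma pser_inK:
  assumes f: "inK \<beta> p f" and b: "fbound C M f" and y: "norm y \<le> 1 / (4 * M * CARD('n))" and \<gamma>: "\<gamma> \<in> NA"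
  shows "(\<Sum>j\<in>UNIV. of_int (A $ i $ j) * (p + y) $ j * pser f (\<gamma> + col j) y) + (of_int (\<gamma> $ i) - \<beta> $ i) * pser f \<gamma> y = 0"
proof -
  define T where "T k \<gamma> = (\<Sum>l\<in>UNIV. of_int (A $ i $ l) * y $ l * (shiftL y ^^ k) f (\<gamma> + col l))" for k \<gamma>
  have TS: "(\<Sum>l\<in>UNIV. y $ l * T k (\<gamma> + col l)) = T (Suc k) \<gamma>" for k \<gamma>
  proof -
    have "(\<Sum>l\<in>UNIV. y $ l * T k (\<gamma> + col l)) = (\<Sum>l\<in>UNIV. \<Sum>j\<in>UNIV. of_int (A $ i $ j) * y $ j * (y $ l * (shiftL y ^^ k) f (\<gamma> + col j + col l)))"
      unfolding T_def by (simp add: sum_distrib_left mult_ac add_ac)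
    also have "\<dots> = T (Suc k) \<gamma>"
      unfolding T_def shiftL_pow_Suc by (subst sum.swap) (simp add: sum_distrib_left)
    finally show ?thesis .
  qed
  have rec: "theta p i ((shiftL y ^^ k) f) \<gamma> + (of_int (\<gamma> $ i) - \<beta> $ i) * (shiftL y ^^ k) f \<gamma> = - of_nat k * T (k - 1) \<gamma>"
    if "\<gamma> \<in> NA" for k \<gamma>
    using that
  proof (induction k arbitrary: \<gamma>)
    case 0
    then show ?case using f by (simp add: inK_def)
  next
    case (Suc k)
    let ?L = "(shiftL y ^^ k) f"
    have IH: "theta p i ?L (\<gamma> + col l) + (of_int ((\<gamma> + col l) $ i) - \<beta> $ i) * ?L (\<gamma> + col l) = - of_nat k * T (k - 1) (\<gamma> + col l)" for l
      by (rule Suc.IH[OF NA_add[OF Suc.prems col_in_NA]])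
    have "theta p i ((shiftL y ^^ Suc k) f) \<gamma> = (\<Sum>j\<in>UNIV. \<Sum>l\<in>UNIV. y $ l * (of_int (A $ i $ j) * p $ j * ?L (\<gamma> + col l + col j)))"
      unfolding theta_def shiftL_pow_Suc by (simp add: sum_distrib_left mult_ac add_ac)
    also have "\<dots> = (\<Sum>l\<in>UNIV. y $ l * theta p i ?L (\<gamma> + col l))"
      unfolding theta_def by (subst sum.swap) (simp add: sum_distrib_left)
    finally have "theta p i ((shiftL y ^^ Suc k) f) \<gamma> + (of_int (\<gamma> $ i) - \<beta> $ i) * (shiftL y ^^ Suc k) f \<gamma>
       = (\<Sum>l\<in>UNIV. y $ l * (theta p i ?L (\<gamma> + col l) + (of_int (\<gamma> $ i) - \<beta> $ i) * ?L (\<gamma> + col l)))"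
      unfolding shiftL_pow_Suc by (simp add: sum_distrib_left sum.distrib distrib_left mult_ac)
    also have "\<dots> = (\<Sum>l\<in>UNIV. y $ l * (- of_nat k * T (k - 1) (\<gamma> + col l) - of_int (A $ i $ l) * ?L (\<gamma> + col l)))"
      unfolding IH[symmetric] by (simp add: col_nth algebra_simps)
    also have "\<dots> = - of_nat k * (\<Sum>l\<in>UNIV. y $ l * T (k - 1) (\<gamma> + col l)) - T k \<gamma>"
      unfolding T_def[of k] by (simp add: right_diff_distrib sum_subtractf sum_distrib_left sum_negf mult_ac)
    also have "\<dots> = - (of_nat k * T k \<gamma>) - T k \<gamma>"
      using TS[of "k - 1" \<gamma>] by (cases k) (simp_all del: of_nat_Suc)
    finally show ?case by (simp add: algebra_simps)
  qed
  have NAs: "\<exists>g. \<gamma> \<in> lev g" if "\<gamma> \<in> NA" for \<gamma> using NA_lev[OF that] by blast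
  have sm: "(\<lambda>k. pterm f \<gamma> k y) sums pser f \<gamma> y" if \<gamma>: "\<gamma> \<in> NA" for \<gamma>
    using NAs[OF \<gamma>] pterm_sums[OF b _ y] by blast
  have sm2: "(\<lambda>k. if k = 0 then 0 else pterm f \<gamma> (k - 1) y) sums pser f \<gamma> y" if "\<gamma> \<in> NA" for \<gamma>
    using sm[OF that] by (subst sums_Suc_iff[symmetric, where f = "\<lambda>k. if k = 0 then 0 else pterm f \<gamma> (k - 1) y", simplified])
  have cn: "\<gamma> + col j \<in> NA" for j by (rule NA_add[OF \<gamma> col_in_NA])
  have total: "(\<lambda>k. (\<Sum>j\<in>UNIV. of_int (A $ i $ j) * p $ j * pterm f (\<gamma> + col j) k y)
      + (\<Sum>j\<in>UNIV. of_int (A $ i $ j) * y $ j * (if k = 0 then 0 else pterm f (\<gamma> + col j) (k - 1) y))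
      + (of_int (\<gamma> $ i) - \<beta> $ i) * pterm f \<gamma> k y) sums
     ((\<Sum>j\<in>UNIV. of_int (A $ i $ j) * p $ j * pser f (\<gamma> + col j) y)
      + (\<Sum>j\<in>UNIV. of_int (A $ i $ j) * y $ j * pser f (\<gamma> + col j) y)
      + (of_int (\<gamma> $ i) - \<beta> $ i) * pser f \<gamma> y)"
    by (intro sums_add sums_sum sums_mult sm sm2 cn \<gamma>)
  have termz: "(\<Sum>j\<in>UNIV. of_int (A $ i $ j) * p $ j * pterm f (\<gamma> + col j) k y)
      + (\<Sum>j\<in>UNIV. of_int (A $ i $ j) * y $ j * (if k = 0 then 0 else pterm f (\<gamma> + col j) (k - 1) y))
      + (of_int (\<gamma> $ i) - \<beta> $ i) * pterm f \<gamma> k y = 0" for k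
  proof (cases k)
    case 0
    then show ?thesis using rec[OF \<gamma>, of 0] unfolding theta_def pterm_def by simp
  next
    case (Suc m)
    have "(\<Sum>j\<in>UNIV. of_int (A $ i $ j) * p $ j * pterm f (\<gamma> + col j) k y)
      + (of_int (\<gamma> $ i) - \<beta> $ i) * pterm f \<gamma> k y = (theta p i ((shiftL y ^^ k) f) \<gamma> + (of_int (\<gamma> $ i) - \<beta> $ i) * (shiftL y ^^ k) f \<gamma>) / fact k"
      unfolding theta_def pterm_def by (simp add: sum_divide_distrib add_divide_distrib)
    also have "\<dots> = - (T m \<gamma> / fact m)"
      unfolding rec[OF \<gamma>] Suc by (simp add: fact_Suc del: of_nat_Suc)
    also have "T m \<gamma> / fact m = (\<Sum>j\<in>UNIV. of_int (A $ i $ j) * y $ j * (if k = 0 then 0 else pterm f (\<gamma> + col j) (k - 1) y))"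
      unfolding T_def pterm_def Suc by (simp add: sum_divide_distrib)
    finally show ?thesis by (simp add: algebra_simps)
  qed
  from sums_unique2[OF total[unfolded termz] sums_zero]
  show ?thesis by (simp add: distrib_left distrib_right sum.distrib)
qed

text \<open>The value at x of x^a \<partial>^b on the candidate solution, written without
  derivatives. Its companion \<open>lterm\<close> is the Leibniz expansion of a further \<partial>^b
  applied to such a term.\<close>

definition mterm :: "(int ^ 'd \<Rightarrow> complex) \<Rightarrow> complex ^ 'n \<Rightarrow> complex ^ 'n \<Rightarrow> (nat ^ 'n) \<times> (nat ^ 'n) \<Rightarrow> complex" where
  "mterm f p x s = monom_eval (fst s) x * pser f (wt (snd s)) (x - p)"

definition lterm :: "(int ^ 'd \<Rightarrow> complex) \<Rightarrow> complex ^ 'n \<Rightarrow> nat ^ 'n \<Rightarrow> complex ^ 'n \<Rightarrow> (nat ^ 'n) \<times> (nat ^ 'n) \<Rightarrow> complex" where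
  "lterm f p b x s = (\<Sum>k | k \<le> fst s. leib b (fst s) k * mterm f p x (fst s - k, (b - k) + snd s))"

section \<open>The Leibniz rule for the candidate solution\<close>

lemma DERIV_monom_eval:
  "((\<lambda>t. monom_eval c (x + t *s axis j 1)) has_field_derivative of_nat (c $ j) * monom_eval (c - axis j 1) x) (at 0)"
proof -
  have e: "monom_eval c (x + t *s axis j 1) = (x $ j + t) ^ (c $ j) * (\<Prod>l\<in>UNIV - {j}. x $ l ^ (c $ l))" for t
    unfolding monom_eval_def prod_remove_UNIV[of _ j] by (intro arg_cong2[of _ _ _ _ "(*)"] prod.cong) (auto simp: axis_def)
  have e2: "monom_eval (c - axis j 1) x = (x $ j) ^ (c $ j - 1) * (\<Prod>l\<in>UNIV - {j}. x $ l ^ (c $ l))"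
    unfolding monom_eval_def prod_remove_UNIV[of _ j] by (intro arg_cong2[of _ _ _ _ "(*)"] prod.cong) (auto simp: axis_def)
  show ?thesis unfolding e e2
    by (auto intro!: derivative_eq_intros simp: mult.assoc)
qed

lemma DERIV_pser:
  assumes b: "fbound C M f" and x: "x \<in> ball p (1 / (4 * M * CARD('n)))"
  shows "((\<lambda>t. pser f (wt e) (x + t *s axis j 1 - p)) has_field_derivative pser f (wt (e + axis j 1)) (x - p)) (at 0)"
proof -
  have y: "norm (x - p) < 1 / (4 * M * CARD('n))" using x by (simp add: dist_norm norm_minus_commute)
  let ?D = "\<lambda>h. \<Sum>l\<in>UNIV. h $ l * pser f (wt e + col l) (x - p)"
  have d: "(pser f (wt e) has_derivative ?D) (at ((x - p) + 0 *s axis j 1))"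
    using has_derivative_pser[OF b wt_in_lev y, of e] by simp
  have "((\<lambda>t. pser f (wt e) ((x - p) + t *s axis j 1)) has_derivative (\<lambda>t. ?D (t *s axis j 1))) (at 0)"
    using diff_chain_at[OF has_derivative_axis_line[of "x - p" j 0] d] by (simp add: o_def)
  moreover have "(\<lambda>t. ?D (t *s axis j 1)) = (*) (pser f (wt (e + axis j 1)) (x - p))"
  proof
    fix t :: complex
    have "?D (t *s axis j 1) = (\<Sum>l\<in>UNIV. if l = j then t * pser f (wt e + col l) (x - p) else 0)"
      by (rule sum.cong) (auto simp: axis_def)
    then show "?D (t *s axis j 1) = pser f (wt (e + axis j 1)) (x - p) * t"
      by (simp add: wt_add wt_axis del: One_nat_def)
  qed
  moreover have "(x - p) + t *s axis j 1 = x + t *s axis j 1 - p" for t by simp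
  ultimately show ?thesis by (simp add: has_field_derivative_def)
qed

lemma DERIV_mterm:
  assumes "fbound C M f" "x \<in> ball p (1 / (4 * M * CARD('n)))"
  shows "((\<lambda>t. mterm f p (x + t *s axis j 1) (c, e)) has_field_derivative
     of_nat (c $ j) * mterm f p x (c - axis j 1, e) + mterm f p x (c, e + axis j 1)) (at 0)"
proof -
  have "((\<lambda>t. monom_eval c (x + t *s axis j 1) * pser f (wt e) (x + t *s axis j 1 - p)) has_field_derivative
      (of_nat (c $ j) * monom_eval (c - axis j 1) x) * pser f (wt e) (x + 0 *s axis j 1 - p)
      + pser f (wt (e + axis j 1)) (x - p) * monom_eval c (x + 0 *s axis j 1)) (at 0)"
    by (rule DERIV_mult[OF DERIV_monom_eval DERIV_pser[OF assms]])
  then show ?thesis unfolding mterm_def by (simp add: mult_ac)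
qed

text \<open>The product rule inside the Leibniz sum. In the half where x^(c - k) is differentiated
  the index is shifted from k to k + e_j; then both halves combine by
  \<open>leib_step\<close>.\<close>

lemma DERIV_lterm:
  assumes "fbound C M f" "x \<in> ball p (1 / (4 * M * CARD('n)))"
  shows "((\<lambda>t. lterm f p b (x + t *s axis j 1) s) has_field_derivative lterm f p (b + axis j 1) x s) (at 0)"
proof -
  obtain c e where s: "s = (c, e)" by (cases s)
  let ?T = "mterm f p x" and ?a = "axis j 1 :: nat ^ 'n"
  have "((\<lambda>t. lterm f p b (x + t *s axis j 1) s) has_field_derivative
     (\<Sum>k | k \<le> c. leib b c k * (of_nat ((c - k) $ j) * ?T (c - k - ?a, (b - k) + e) + ?T (c - k, (b - k) + e + ?a)))) (at 0)"
    unfolding lterm_def s fst_conv snd_conv by (intro DERIV_sum DERIV_cmult DERIV_mterm[OF assms])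
  moreover have "(\<Sum>k | k \<le> c. leib b c k * (of_nat ((c - k) $ j) * ?T (c - k - ?a, (b - k) + e) + ?T (c - k, (b - k) + e + ?a)))
      = lterm f p (b + ?a) x s"
  proof -
    let ?H = "\<lambda>k. ?T (c - k, ((b + ?a) - k) + e)"
    have 1: "leib b c k * ?T (c - k, (b - k) + e + ?a) = leib b c k * ?H k" for k
    proof (cases "k \<le> b")
      case True
      then have le: "k $ i \<le> b $ i" for i by (simp add: less_eq_vec_def)
      have "(b - k) + e + ?a = ((b + ?a) - k) + e"
      proof (subst vec_eq_iff, intro allI)
        fix i
        show "((b - k) + e + ?a) $ i = (((b + ?a) - k) + e) $ i" using le[of i] by simp
      qed
      then show ?thesis by simp
    qed (simp add: leib_eq_0)
    have 2: "(\<Sum>k | k \<le> c. leib b c k * (of_nat ((c - k) $ j) * ?T (c - k - ?a, (b - k) + e)))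
       = (\<Sum>k | k \<le> c. (if k $ j = 0 then 0 else of_nat (Suc (c $ j) - k $ j) * leib b c (k - ?a)) * ?H k)"
    proof -
      have "(\<Sum>k | k \<le> c. leib b c k * (of_nat ((c - k) $ j) * ?T (c - k - ?a, (b - k) + e)))
          = (\<Sum>k | k \<le> c \<and> k $ j < c $ j. leib b c k * (of_nat ((c - k) $ j) * ?T (c - k - ?a, (b - k) + e)))"
        by (rule sum.mono_neutral_right) (auto simp: finite_nat_vec_le)
      also have "\<dots> = (\<Sum>k | k \<le> c \<and> k $ j \<noteq> 0. of_nat (Suc (c $ j) - k $ j) * leib b c (k - ?a) * ?H k)"
      proof (rule sum.reindex_bij_witness[where i = "\<lambda>k. k - ?a" and j = "\<lambda>k. k + ?a"])
        fix k assume k: "k \<in> {k. k \<le> c \<and> k $ j < c $ j}"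
        show "k + ?a - ?a = k" by simp
        show "k + ?a \<in> {k. k \<le> c \<and> k $ j \<noteq> 0}" using k by (auto simp: less_eq_vec_def axis_def)
        have "c - (k + ?a) = c - k - ?a" by (simp add: vec_eq_iff)
        moreover have "(b + ?a) - (k + ?a) = b - k" by (simp add: vec_eq_iff)
        moreover have "Suc (c $ j) - (k + ?a) $ j = (c - k) $ j" by (simp add: axis_def)
        ultimately show "of_nat (Suc (c $ j) - (k + ?a) $ j) * leib b c (k + ?a - ?a) * ?H (k + ?a) =
            leib b c k * (of_nat ((c - k) $ j) * ?T (c - k - ?a, (b - k) + e))"
          by (simp add: mult_ac)
      next
        fix k assume k: "k \<in> {k. k \<le> c \<and> k $ j \<noteq> 0}"
        show "k - ?a + ?a = k" using k by (auto simp: vec_eq_iff axis_def)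
        show "k - ?a \<in> {k. k \<le> c \<and> k $ j < c $ j}"
        proof -
          have le: "k $ i \<le> c $ i" for i using k by (simp add: less_eq_vec_def)
          have "(k - ?a) $ i \<le> c $ i" for i using le[of i] by (simp add: le_diff_conv trans_le_add1)
          moreover have "(k - ?a) $ j < c $ j" using le[of j] k by (auto simp: axis_def)
          ultimately show ?thesis by (simp add: less_eq_vec_def)
        qed
      qed
      also have "\<dots> = (\<Sum>k | k \<le> c. (if k $ j = 0 then 0 else of_nat (Suc (c $ j) - k $ j) * leib b c (k - ?a)) * ?H k)"
        by (rule sum.mono_neutral_cong_left) (auto simp: finite_nat_vec_le)
      finally show ?thesis .
    qed
    have "(\<Sum>k | k \<le> c. leib b c k * (of_nat ((c - k) $ j) * ?T (c - k - ?a, (b - k) + e) + ?T (c - k, (b - k) + e + ?a)))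
        = (\<Sum>k | k \<le> c. leib b c k * ?H k) + (\<Sum>k | k \<le> c. (if k $ j = 0 then 0 else of_nat (Suc (c $ j) - k $ j) * leib b c (k - ?a)) * ?H k)"
      unfolding distrib_left sum.distrib 1 2 by (rule add.commute)
    also have "\<dots> = lterm f p (b + ?a) x s"
      unfolding lterm_def s fst_conv snd_conv leib_step distrib_right sum.distrib ..
    finally show ?thesis .
  qed
  ultimately show ?thesis by simp
qed

lemma lterm_0: "lterm f p 0 x s = mterm f p x s"
proof -
  have "lterm f p 0 x s = (\<Sum>k | k \<le> fst s. if k = 0 then mterm f p x s else 0)"
    unfolding lterm_def by (rule sum.cong) (auto simp: leib_0_left)
  also have "\<dots> = mterm f p x s"
    using finite_nat_vec_le[of "fst s"] by (simp add: less_eq_vec_def)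
  finally show ?thesis .
qed

lemma sum_list_deriv_word: "sum_list (map (\<lambda>j. axis j 1) (deriv_word b)) = (b :: nat ^ 'n)"
proof -
  define js where "js = (SOME js. distinct js \<and> set js = (UNIV :: 'n set))"
  have js: "distinct js \<and> set js = UNIV"
    unfolding js_def by (rule someI_ex) (use finite_distinct_list[of "UNIV :: 'n set"] in auto)
  have r: "sum_list (map (\<lambda>j. axis j 1) (replicate k j)) = (axis j k :: nat ^ 'n)" for k j
    by (induction k) (auto simp: vec_eq_iff axis_def)
  have "sum_list (map (\<lambda>j. axis j 1) (deriv_word b)) = (\<Sum>j\<leftarrow>js. axis j (b $ j))"
    unfolding deriv_word_def js_def[symmetric] by (induction js) (auto simp: r simp del: map_replicate One_nat_def)
  also have "\<dots> = (\<Sum>j\<in>UNIV. axis j (b $ j))" using js by (simp add: sum_list_distinct_conv_sum_set)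
  also have "\<dots> = b"
    by (subst vec_eq_iff) (simp add: axis_def)
  finally show ?thesis .
qed

text \<open>Ties the product \<open>\<star>\<close> to differentiation:
  \<open>pmlin (lterm f p b x) Q\<close> is also the value of \<partial>^b times Q on the candidate,
  so operators that annihilate it remain so after multiplication from the left.\<close>

lemma multi_deriv_mterm:
  assumes b: "fbound C M f" and x: "x \<in> ball p (1 / (4 * M * CARD('n)))"
  shows "multi_deriv b (\<lambda>x. pmlin (mterm f p x) Q) x = pmlin (lterm f p b x) Q"
proof -
  let ?U = "ball p (1 / (4 * M * CARD('n)))"
  have pd: "partial_deriv j (\<lambda>x. pmlin (lterm f p b x) Q) x = pmlin (lterm f p (b + axis j 1) x) Q" if "x \<in> ?U" for j b x
    unfolding partial_deriv_def pmlin_def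
    by (rule DERIV_imp_deriv, intro DERIV_sum DERIV_cmult DERIV_lterm[OF assms(1) that])
  have "foldr partial_deriv js (\<lambda>x. pmlin (mterm f p x) Q) x = pmlin (lterm f p (sum_list (map (\<lambda>j. axis j 1) js)) x) Q" if "x \<in> ?U" for js x
    using that
  proof (induction js arbitrary: x)
    case Nil
    then show ?case by (simp add: lterm_0[abs_def] pmlin_def)
  next
    case (Cons j js)
    have "foldr partial_deriv (j # js) (\<lambda>x. pmlin (mterm f p x) Q) x
        = partial_deriv j (\<lambda>x. pmlin (lterm f p (sum_list (map (\<lambda>j. axis j 1) js)) x) Q) x"
      unfolding foldr.simps o_apply by (rule partial_deriv_cong_open[OF open_ball Cons.prems Cons.IH])
    also have "\<dots> = pmlin (lterm f p (sum_list (map (\<lambda>j. axis j 1) js) + axis j 1) x) Q"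
      by (rule pd[OF Cons.prems])
    finally show ?case by (simp add: add.commute)
  qed
  from this[OF x, of "deriv_word b"] show ?thesis unfolding multi_deriv_word sum_list_deriv_word .
qed

lemma multi_deriv_pser:
  assumes b: "fbound C M f" and x: "x \<in> ball p (1 / (4 * M * CARD('n)))"
  shows "multi_deriv b (\<lambda>x. pser f 0 (x - p)) x = pser f (wt b) (x - p)"
proof -
  have "{k :: nat ^ 'n. k \<le> 0} = {0}" by (auto simp: nat_vec_le_0_iff)
  then have "pmlin (lterm f p b x) (Poly_Mapping.single (0, 0) 1) = pser f (wt b) (x - p)"
    by (simp add: pmlin_single lterm_def leib_0 mterm_def monom_eval_0)
  moreover have "(\<lambda>x. pmlin (mterm f p x) (Poly_Mapping.single (0, 0) 1)) = (\<lambda>x. pser f 0 (x - p))"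
    by (simp add: pmlin_single mterm_def monom_eval_0 wt_0)
  ultimately show ?thesis using multi_deriv_mterm[OF assms, of b "Poly_Mapping.single (0, 0) 1"] by simp
qed

text \<open>The operators annihilating the series on a ball form a left ideal by the Leibniz
  expansion. They contain the toric ideal because the derivatives depend on u through
  \<open>wt u\<close> alone, and the homogeneities by \<open>pser_inK\<close>.\<close>

lemma functional_solution:
  assumes g: "good N p" and f: "inK \<beta> p f"
  shows "\<exists>F. solution_near (hypergeometric_ideal A \<beta>) p F \<and> (\<forall>u. multi_deriv u F p = f (wt u))"
proof -
  obtain C M where b: "fbound C M f" using inK_fbound[OF g f] by blast
  have M1: "M \<ge> 1" using b by (simp add: fbound_def)
  let ?U = "ball p (1 / (4 * M * CARD('n)))"
  have pU: "p \<in> ?U" using M1 by simp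
  define F where "F x = pser f 0 (x - p)" for x
  have Fe: "F = (\<lambda>x. pser f 0 (x - p))" by (simp add: F_def fun_eq_iff)
  have act: "weyl_action Q F x = pmlin (mterm f p x) Q" if x: "x \<in> ?U" for Q x
    unfolding weyl_action_pmlin Fe multi_deriv_pser[OF b x] by (simp add: mterm_def[abs_def])
  define J where "J = {Q. \<forall>x\<in>?U. pmlin (mterm f p x) Q = 0}"
  have md0: "multi_deriv b (\<lambda>x. 0) = (\<lambda>x. 0)" for b :: "nat ^ 'n"
  proof -
    have "foldr partial_deriv js (\<lambda>x. 0) = (\<lambda>x. 0)" for js :: "'n list"
      by (induction js) (auto simp: partial_deriv_def)
    then show ?thesis unfolding multi_deriv_word .
  qed
  have "weyl_left_ideal J"
    unfolding weyl_left_ideal_def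
  proof (intro conjI ballI allI)
    show "0 \<in> J" by (simp add: J_def pmlin_0)
    show "P + Q \<in> J" if "P \<in> J" "Q \<in> J" for P Q using that by (simp add: J_def pmlin_add)
    show "P \<star> Q \<in> J" if Q: "Q \<in> J" for P Q
      unfolding J_def
    proof (intro CollectI ballI)
      fix x assume x: "x \<in> ?U"
      have "pmlin (\<lambda>t. pmlin (mterm f p x) (weyl_monom_mult s t)) Q = 0" for s
      proof -
        obtain a b' where s: "s = (a, b')" by (cases s)
        have "pmlin (mterm f p x) (weyl_monom_mult s t) = monom_eval a x * lterm f p b' x t" for t
        proof -
          obtain c e where t: "t = (c, e)" by (cases t)
          show ?thesis
            unfolding s t pmlin_weyl_monom_mult lterm_def fst_conv snd_conv sum_distrib_left
            by (rule sum.cong) (simp_all add: mterm_def monom_eval_add mult_ac)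
        qed
        then have "pmlin (\<lambda>t. pmlin (mterm f p x) (weyl_monom_mult s t)) Q = monom_eval a x * pmlin (lterm f p b' x) Q"
          by (simp add: pmlin_def sum_distrib_left mult_ac)
        also have "pmlin (lterm f p b' x) Q = multi_deriv b' (\<lambda>x. pmlin (mterm f p x) Q) x"
          by (rule multi_deriv_mterm[OF b x, symmetric])
        also have "\<dots> = multi_deriv b' (\<lambda>x. 0) x"
          by (rule multi_deriv_cong_open[OF open_ball _ x]) (use Q in \<open>simp add: J_def\<close>)
        finally show ?thesis by (simp add: md0)
      qed
      then show "pmlin (mterm f p x) (P \<star> Q) = 0"
        unfolding pmlin_weyl_mult by (simp add: pmlin_def)
    qed
  qed
  moreover have "weyl_of_dpoly ` toric_ideal A \<union> range (homogeneity A \<beta>) \<subseteq> J"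
  proof (intro Un_least image_subsetI)
    \<comment> \<open>All translates by \<open>\<gamma>\<close> are included to make the condition
      stable under multiplication by monomials.\<close>
    have tor: "toric_ideal A \<subseteq> {q. \<forall>x\<in>?U. \<forall>\<gamma>. pmlin (\<lambda>b. pser f (\<gamma> + wt b) (x - p)) q = 0}" (is "_ \<subseteq> ?J")
    proof (rule toric_ideal_subset)
      fix q r :: "'n cpoly" assume r: "r \<in> ?J"
      have "pmlin G (q * r) = pmlin (\<lambda>s. pmlin (\<lambda>t. G (s + t)) r) q" for G
        by (subst poly_mapping_eq_sum_single[of q], subst poly_mapping_eq_sum_single[of r])
           (simp add: sum_product mult_single pmlin_sum pmlin_single, simp add: pmlin_def sum_distrib_left mult_ac)
      moreover have "pmlin (\<lambda>t. pser f (\<gamma> + wt (s + t)) (x - p)) r = 0" if "x \<in> ?U" for \<gamma> s x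
        using r that by (simp add: wt_add add.assoc[symmetric])
      ultimately show "q * r \<in> ?J" by (simp add: pmlin_def[of _ q])
    next
      fix u u' :: "nat ^ 'n" assume "A *v int_vec u = A *v int_vec u'"
      then show "Poly_Mapping.single u 1 - Poly_Mapping.single u' 1 \<in> ?J"
        by (simp add: pmlin_diff pmlin_single wt_def)
    qed (auto simp: pmlin_0 pmlin_diff)
    fix q assume "q \<in> toric_ideal A"
    then have "pmlin (\<lambda>b. pser f (0 + wt b) (x - p)) q = 0" if "x \<in> ?U" for x using tor that by blast
    then show "weyl_of_dpoly q \<in> J"
      by (simp add: J_def pmlin_weyl_of_dpoly mterm_def monom_eval_0)
  next
    fix i
    have "pmlin (mterm f p x) (homogeneity A \<beta> i) = 0" if x: "x \<in> ?U" for x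
    proof -
      have "norm (x - p) \<le> 1 / (4 * M * CARD('n))" using x by (simp add: dist_norm norm_minus_commute)
      from pser_inK[OF f b this zero_in_NA, of i]
      show ?thesis
        unfolding homogeneity_single
        by (simp add: pmlin_diff pmlin_sum pmlin_single mterm_def monom_eval_axis monom_eval_0 wt_axis wt_0 mult.assoc del: One_nat_def)
    qed
    then show "homogeneity A \<beta> i \<in> J" by (simp add: J_def)
  qed
  ultimately have "hypergeometric_ideal A \<beta> \<subseteq> J"
    unfolding hypergeometric_ideal_def weyl_left_ideal_gen_def by blast
  then have z: "\<forall>P\<in>hypergeometric_ideal A \<beta>. \<forall>x\<in>?U. weyl_action P F x = 0"
    using act by (auto simp: J_def)
  have hol: "holomorphic_several F ?U"
    unfolding holomorphic_several_def
  proof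
    fix x assume x: "x \<in> ?U"
    have y: "norm (x - p) < 1 / (4 * M * CARD('n))" using x by (simp add: dist_norm norm_minus_commute)
    have d: "(pser f 0 has_derivative (\<lambda>h. \<Sum>j\<in>UNIV. h $ j * pser f (0 + col j) (x - p))) (at (x - p))"
      by (rule has_derivative_pser[OF b _ y, of 0 0]) (simp add: lev_0)
    have "((\<lambda>x. x - p) has_derivative (\<lambda>h. h)) (at x)" by (auto intro!: derivative_eq_intros)
    from diff_chain_at[OF this d]
    have "(F has_derivative (\<lambda>h. \<Sum>j\<in>UNIV. h $ j * pser f (0 + col j) (x - p))) (at x)"
      by (simp add: o_def Fe)
    moreover have "(\<Sum>j\<in>UNIV. (c *s v) $ j * pser f (0 + col j) (x - p)) = c * (\<Sum>j\<in>UNIV. v $ j * pser f (0 + col j) (x - p))" for c v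
      by (simp add: sum_distrib_left mult.assoc)
    ultimately show "\<exists>f'. (F has_derivative f') (at x) \<and> (\<forall>c v. f' (c *s v) = c * f' v)" by blast
  qed
  have "solution_near (hypergeometric_ideal A \<beta>) p F"
    unfolding solution_near_def using z hol pU by (intro exI[of _ ?U]) simp
  moreover have "multi_deriv u F p = f (wt u)" for u
    unfolding Fe multi_deriv_pser[OF b pU] by (simp add: pser_0)
  ultimately show ?thesis by blast
qed

section \<open>The dimension of the space of solution germs\<close>

lemma inK_sum:
  assumes "\<And>i. i \<in> I \<Longrightarrow> inK \<beta> p (f i)"
  shows "inK \<beta> p (\<lambda>\<gamma>. \<Sum>i\<in>I. c i * f i \<gamma>)"
  unfolding inK_def
proof (intro allI ballI)
  fix k \<gamma> assume \<gamma>: "\<gamma> \<in> NA"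
  have "theta p k (\<lambda>\<gamma>. \<Sum>i\<in>I. c i * f i \<gamma>) \<gamma> = (\<Sum>i\<in>I. c i * theta p k (f i) \<gamma>)"
    unfolding theta_def sum_distrib_left by (subst sum.swap) (simp add: mult_ac)
  then have "theta p k (\<lambda>\<gamma>. \<Sum>i\<in>I. c i * f i \<gamma>) \<gamma> + (of_int (\<gamma> $ k) - \<beta> $ k) * (\<Sum>i\<in>I. c i * f i \<gamma>)
     = (\<Sum>i\<in>I. c i * (theta p k (f i) \<gamma> + (of_int (\<gamma> $ k) - \<beta> $ k) * f i \<gamma>))"
    by (simp add: sum_distrib_left distrib_left sum.distrib mult_ac)
  also have "\<dots> = 0" using assms \<gamma> unfolding inK_def by (intro sum.neutral) auto
  finally show "theta p k (\<lambda>\<gamma>. \<Sum>i\<in>I. c i * f i \<gamma>) \<gamma> + (of_int (\<gamma> $ k) - \<beta> $ k) * (\<Sum>i\<in>I. c i * f i \<gamma>) = 0" .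
qed

lemma solutions_common_nbhd:
  fixes k :: nat
  assumes "\<And>i. i < k \<Longrightarrow> solution_near I p (f i)"
  shows "\<exists>U. open U \<and> p \<in> U \<and> (\<forall>i<k. sepholo U (f i))"
  using assms
proof (induction k)
  case 0
  show ?case by (intro exI[of _ UNIV]) auto
next
  case (Suc k)
  have "\<exists>U. open U \<and> p \<in> U \<and> (\<forall>i<k. sepholo U (f i))" by (rule Suc.IH) (use Suc.prems in simp)
  then obtain U where U: "open U" "p \<in> U" "\<forall>i<k. sepholo U (f i)" by blast
  have "solution_near I p (f k)" using Suc.prems by simp
  then obtain V where V: "open V" "p \<in> V" "sepholo V (f k)"
    unfolding solution_near_def using holomorphic_several_imp_sepholo by blast
  have sub: "sepholo (U \<inter> V) g" if "sepholo U g \<or> sepholo V g" for g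
    using that unfolding sepholo_def by (auto intro: continuous_on_subset)
  show ?case
    by (rule exI[of _ "U \<inter> V"]) (use U V sub in \<open>auto simp: less_Suc_eq\<close>)
qed

text \<open>Germs are compared with their functionals. Among more than |Y| germs some combination
  has a functional vanishing on \<open>Y\<close>, hence everywhere, and is the zero germ. Conversely
  the functionals dual to \<open>Y\<close> lift to independent germs.\<close>

lemma solution_dim_eq:
  assumes g: "good N p" and Y: "finite Y" "Y \<subseteq> NA"
    and det: "\<And>f. inK \<beta> p f \<Longrightarrow> (\<forall>y\<in>Y. f y = 0) \<Longrightarrow> \<forall>\<gamma>\<in>NA. f \<gamma> = 0"
    and dual: "\<And>y. y \<in> Y \<Longrightarrow> \<exists>f. inK \<beta> p f \<and> (\<forall>y'\<in>Y. f y' = (if y' = y then 1 else 0))"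
  shows "solution_dim (hypergeometric_ideal A \<beta>) p = enat (card Y)"
proof (rule antisym)
  let ?I = "hypergeometric_ideal A \<beta>"
  have lin: "multi_deriv u (\<lambda>x. \<Sum>i<k. c i * F i x) p = (\<Sum>i<k. c i * multi_deriv u (F i) p)
      \<and> ((\<forall>b. multi_deriv b (\<lambda>x. \<Sum>i<k. c i * F i x) p = 0) \<longrightarrow> (\<forall>\<^sub>F x in nhds p. (\<Sum>i<k. c i * F i x) = 0))"
    if F: "\<And>i. i < k \<Longrightarrow> solution_near ?I p (F i)" for F c u and k :: nat
  proof -
    have "\<exists>U. open U \<and> p \<in> U \<and> (\<forall>i<k. sepholo U (F i))" by (rule solutions_common_nbhd[OF F])
    then obtain U where U: "open U" "p \<in> U" "\<And>i. i < k \<Longrightarrow> sepholo U (F i)" by blast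
    have s: "sepholo U (\<lambda>x. \<Sum>i<k. c i * F i x)" by (rule sepholo_sum) (use U in auto)
    show ?thesis
    proof (intro conjI impI)
      show "multi_deriv u (\<lambda>x. \<Sum>i<k. c i * F i x) p = (\<Sum>i<k. c i * multi_deriv u (F i) p)"
        by (rule multi_deriv_sum[OF U(1) _ U(2)]) (use U(3) in simp)
      show "\<forall>\<^sub>F x in nhds p. (\<Sum>i<k. c i * F i x) = 0" if "\<forall>b. multi_deriv b (\<lambda>x. \<Sum>i<k. c i * F i x) p = 0"
        by (rule sepholo_all_derivs_zero[OF U(1) s U(2)]) (use that in simp)
    qed
  qed
  show "solution_dim ?I p \<le> enat (card Y)"
    unfolding solution_dim_def
  proof (rule Sup_least, elim CollectE exE conjE)
    fix e k F assume e: "e = enat k" and F: "\<forall>i<k. solution_near ?I p (F i)"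
      and ind: "\<forall>c. (\<forall>\<^sub>F x in nhds p. (\<Sum>i<k. c i * F i x) = 0) \<longrightarrow> (\<forall>i<k. c i = 0)"
    show "e \<le> enat (card Y)"
    proof (rule ccontr)
      assume "\<not> e \<le> enat (card Y)"
      then have less: "card Y < card {..<k}" using e by simp
      have "\<forall>i\<in>{..<k}. \<exists>lam. inK \<beta> p lam \<and> (\<forall>u. lam (wt u) = multi_deriv u (F i) p)"
        using F solution_functional by blast
      from bchoice[OF this] obtain lam where lam: "\<And>i. i < k \<Longrightarrow> inK \<beta> p (lam i)" "\<And>i u. i < k \<Longrightarrow> lam i (wt u) = multi_deriv u (F i) p"
        by auto
      obtain c where c: "\<exists>i\<in>{..<k}. c i \<noteq> 0" "\<forall>y\<in>Y. (\<Sum>i\<in>{..<k}. c i * lam i y) = 0"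
        using more_unknowns_than_equations[OF Y(1) _ less, of "\<lambda>y i. lam i y"] by auto
      have "inK \<beta> p (\<lambda>\<gamma>. \<Sum>i<k. c i * lam i \<gamma>)" by (rule inK_sum) (use lam in auto)
      from det[OF this] c(2) have z: "\<forall>\<gamma>\<in>NA. (\<Sum>i<k. c i * lam i \<gamma>) = 0" by simp
      have "multi_deriv u (\<lambda>x. \<Sum>i<k. c i * F i x) p = 0" for u
        using lin[of k F u c] F z[rule_format, OF wt_in_NA[of u]] lam(2) by simp
      then have "\<forall>\<^sub>F x in nhds p. (\<Sum>i<k. c i * F i x) = 0" using lin[of k F 0 c] F by simp
      then show False using ind c(1) by blast
    qed
  qed
  show "enat (card Y) \<le> solution_dim ?I p"
    unfolding solution_dim_def
  proof (rule Sup_upper, intro CollectI exI[of _ "card Y"] conjI refl)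
    obtain y where y: "bij_betw y {..<card Y} Y"
      using ex_bij_betw_nat_finite[OF Y(1)] by (auto simp: atLeast0LessThan)
    have yY: "y i \<in> Y" if "i < card Y" for i using y that by (auto simp: bij_betw_def)
    have "\<forall>i\<in>{..<card Y}. \<exists>f. inK \<beta> p f \<and> (\<forall>y'\<in>Y. f y' = (if y' = y i then 1 else 0))"
      using dual yY by blast
    from bchoice[OF this] obtain f where f: "\<And>i. i < card Y \<Longrightarrow> inK \<beta> p (f i)"
      "\<And>i y'. i < card Y \<Longrightarrow> y' \<in> Y \<Longrightarrow> f i y' = (if y' = y i then 1 else 0)" by auto
    have "\<forall>i\<in>{..<card Y}. \<exists>F. solution_near ?I p F \<and> (\<forall>u. multi_deriv u F p = f i (wt u))"
      using functional_solution[OF g f(1)] by blast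
    from bchoice[OF this] obtain F where F: "\<And>i. i < card Y \<Longrightarrow> solution_near ?I p (F i)"
      "\<And>i u. i < card Y \<Longrightarrow> multi_deriv u (F i) p = f i (wt u)" by auto
    have "c i = 0" if ev: "\<forall>\<^sub>F x in nhds p. (\<Sum>i<card Y. c i * F i x) = 0" and i: "i < card Y" for c i
    proof -
      obtain u where u: "y i = wt u" using yY[OF i] Y(2) unfolding NA_def by blast
      obtain V where V: "open V" "p \<in> V" "\<And>x. x \<in> V \<Longrightarrow> (\<Sum>i<card Y. c i * F i x) = 0"
        using ev unfolding eventually_nhds by blast
      \<comment> \<open>The sum on the right is empty: it stands for the zero function.\<close>
      have "multi_deriv u (\<lambda>x. \<Sum>i<card Y. c i * F i x) p = multi_deriv u (\<lambda>x. \<Sum>i<(0::nat). (0::complex) * x $ undefined) p"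
        by (rule multi_deriv_cong_open[OF V(1) _ V(2)]) (use V(3) in simp)
      also have "\<dots> = 0"
      proof -
        have "foldr partial_deriv js (\<lambda>x. 0) = (\<lambda>x. 0)" for js :: "'n list"
          by (induction js) (auto simp: partial_deriv_def)
        then show ?thesis unfolding multi_deriv_word by simp
      qed
      finally have "(\<Sum>l<card Y. c l * f l (y i)) = 0"
        using lin[of "card Y" F u c] F u by simp
      also have "(\<Sum>l<card Y. c l * f l (y i)) = (\<Sum>l<card Y. if l = i then c l else 0)"
      proof (rule sum.cong[OF refl])
        fix l assume l: "l \<in> {..<card Y}"
        have "y i = y l \<longleftrightarrow> l = i" using y l i unfolding bij_betw_def inj_on_def by auto
        then show "c l * f l (y i) = (if l = i then c l else 0)" using f(2)[of l "y i"] l yY[OF i] by auto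
      qed
      finally show ?thesis using i by simp
    qed
    then show "\<exists>f. (\<forall>i<card Y. solution_near ?I p (f i)) \<and> (\<forall>c. (\<forall>\<^sub>F x in nhds p. (\<Sum>i<card Y. c i * f i x) = 0) \<longrightarrow> (\<forall>i<card Y. c i = 0))"
      using F(1) by (intro exI[of _ F]) blast
  qed
qed

end

section \<open>The rank as the size of a determining set\<close>

text \<open>The module generated by the \<open>E y\<close> over the polynomial functions.
  Localization at \<beta> is expressed by admitting a multiplier that is nonzero at \<beta>.\<close>

definition polyspan :: "('a \<Rightarrow> complex ^ 'm::finite) \<Rightarrow> ('g \<Rightarrow> 'a \<Rightarrow> complex) \<Rightarrow> 'g set \<Rightarrow> ('a \<Rightarrow> complex) \<Rightarrow> bool" where
  "polyspan v E Y u \<longleftrightarrow> (\<exists>a. (\<forall>y\<in>Y. polyfun (a y)) \<and> (\<forall>\<alpha>. u \<alpha> = (\<Sum>y\<in>Y. a y (v \<alpha>) * E y \<alpha>)))"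

lemma polyspan_mult: "polyspan v E Y u \<Longrightarrow> polyfun c \<Longrightarrow> polyspan v E Y (\<lambda>\<alpha>. c (v \<alpha>) * u \<alpha>)"
proof -
  assume "polyspan v E Y u" and c: "polyfun c"
  then obtain a where a: "\<forall>y\<in>Y. polyfun (a y)" "\<And>\<alpha>. u \<alpha> = (\<Sum>y\<in>Y. a y (v \<alpha>) * E y \<alpha>)"
    unfolding polyspan_def by blast
  show ?thesis unfolding polyspan_def
    by (rule exI[of _ "\<lambda>y x. c x * a y x"]) (use a c in \<open>simp add: polyfun_mult sum_distrib_left mult.assoc\<close>)
qed

lemma polyspan_add: "polyspan v E Y u \<Longrightarrow> polyspan v E Y w \<Longrightarrow> polyspan v E Y (\<lambda>\<alpha>. u \<alpha> + w \<alpha>)"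
proof -
  assume "polyspan v E Y u" "polyspan v E Y w"
  then obtain a b where a: "\<forall>y\<in>Y. polyfun (a y)" "\<And>\<alpha>. u \<alpha> = (\<Sum>y\<in>Y. a y (v \<alpha>) * E y \<alpha>)"
     and b: "\<forall>y\<in>Y. polyfun (b y)" "\<And>\<alpha>. w \<alpha> = (\<Sum>y\<in>Y. b y (v \<alpha>) * E y \<alpha>)"
    unfolding polyspan_def by blast
  show ?thesis unfolding polyspan_def
    by (rule exI[of _ "\<lambda>y x. a y x + b y x"]) (use a b in \<open>simp add: polyfun_add sum.distrib distrib_right\<close>)
qed

lemma polyspan_0: "polyspan v E Y (\<lambda>\<alpha>. 0)"
  unfolding polyspan_def by (rule exI[of _ "\<lambda>y x. 0"]) (simp add: polyfun_const)

lemma polyspan_sum: "(\<And>s. s \<in> S \<Longrightarrow> polyspan v E Y (u s)) \<Longrightarrow> polyspan v E Y (\<lambda>\<alpha>. \<Sum>s\<in>S. u s \<alpha>)"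
  by (induction S rule: infinite_finite_induct) (auto intro: polyspan_add polyspan_0)

text \<open>Proved by eliminating the generators one at a time.\<close>
lemma nakayama:
  fixes E :: "'g \<Rightarrow> 'a \<Rightarrow> complex" and v :: "'a \<Rightarrow> complex ^ 'm::finite"
  assumes "finite M"
    and "\<And>\<gamma>. \<gamma> \<in> M \<Longrightarrow> \<exists>c r. polyfun c \<and> c \<beta> \<noteq> 0 \<and> (\<forall>\<gamma>'\<in>M. polyfun (r \<gamma>') \<and> r \<gamma>' \<beta> = 0) \<and>
       polyspan v E Y (\<lambda>\<alpha>. c (v \<alpha>) * E \<gamma> \<alpha> - (\<Sum>\<gamma>'\<in>M. r \<gamma>' (v \<alpha>) * E \<gamma>' \<alpha>))"
  shows "\<exists>c. polyfun c \<and> c \<beta> \<noteq> 0 \<and> (\<forall>\<gamma>\<in>M. polyspan v E Y (\<lambda>\<alpha>. c (v \<alpha>) * E \<gamma> \<alpha>))"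
  using assms
proof (induction M rule: finite_induct)
  case empty
  show ?case by (intro exI[of _ "\<lambda>x. 1"]) (simp add: polyfun_const)
next
  case (insert \<gamma>0 M)
  from insert.prems[OF insertI1] obtain c0 r0 where
    c0: "polyfun c0" "c0 \<beta> \<noteq> 0" "\<And>\<gamma>'. \<gamma>' \<in> insert \<gamma>0 M \<Longrightarrow> polyfun (r0 \<gamma>')" "\<And>\<gamma>'. \<gamma>' \<in> insert \<gamma>0 M \<Longrightarrow> r0 \<gamma>' \<beta> = 0"
      "polyspan v E Y (\<lambda>\<alpha>. c0 (v \<alpha>) * E \<gamma>0 \<alpha> - (\<Sum>\<gamma>'\<in>insert \<gamma>0 M. r0 \<gamma>' (v \<alpha>) * E \<gamma>' \<alpha>))"
    by auto
  \<comment> \<open>To solve for \<open>E \<gamma>0\<close> its own term is brought to the left; as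
    \<open>r0 \<gamma>0\<close> vanishes at \<open>\<beta>\<close>, the new coefficient is still a
    local unit.\<close>
  define d where "d x = c0 x - r0 \<gamma>0 x" for x
  have d: "polyfun d" "d \<beta> \<noteq> 0" unfolding d_def[abs_def] using c0 by (auto intro!: polyfun_diff)
  have s0: "polyspan v E Y (\<lambda>\<alpha>. d (v \<alpha>) * E \<gamma>0 \<alpha> - (\<Sum>\<gamma>'\<in>M. r0 \<gamma>' (v \<alpha>) * E \<gamma>' \<alpha>))"
    using c0(5) insert.hyps by (simp add: d_def left_diff_distrib diff_diff_eq)
  have "\<exists>c r. polyfun c \<and> c \<beta> \<noteq> 0 \<and> (\<forall>\<gamma>'\<in>M. polyfun (r \<gamma>') \<and> r \<gamma>' \<beta> = 0) \<and>
       polyspan v E Y (\<lambda>\<alpha>. c (v \<alpha>) * E \<gamma> \<alpha> - (\<Sum>\<gamma>'\<in>M. r \<gamma>' (v \<alpha>) * E \<gamma>' \<alpha>))" if \<gamma>: "\<gamma> \<in> M" for \<gamma>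
  proof -
    from insert.prems[OF insertI2[OF \<gamma>]] obtain c r where
      c: "polyfun c" "c \<beta> \<noteq> 0" "\<And>\<gamma>'. \<gamma>' \<in> insert \<gamma>0 M \<Longrightarrow> polyfun (r \<gamma>')" "\<And>\<gamma>'. \<gamma>' \<in> insert \<gamma>0 M \<Longrightarrow> r \<gamma>' \<beta> = 0"
        "polyspan v E Y (\<lambda>\<alpha>. c (v \<alpha>) * E \<gamma> \<alpha> - (\<Sum>\<gamma>'\<in>insert \<gamma>0 M. r \<gamma>' (v \<alpha>) * E \<gamma>' \<alpha>))"
      by auto
    define c' where "c' x = d x * c x" for x
    define r' where "r' \<gamma>' x = d x * r \<gamma>' x + r \<gamma>0 x * r0 \<gamma>' x" for \<gamma>' x
    have "polyspan v E Y (\<lambda>\<alpha>. d (v \<alpha>) * (c (v \<alpha>) * E \<gamma> \<alpha> - (\<Sum>\<gamma>'\<in>insert \<gamma>0 M. r \<gamma>' (v \<alpha>) * E \<gamma>' \<alpha>))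
        + r \<gamma>0 (v \<alpha>) * (d (v \<alpha>) * E \<gamma>0 \<alpha> - (\<Sum>\<gamma>'\<in>M. r0 \<gamma>' (v \<alpha>) * E \<gamma>' \<alpha>)))"
      by (intro polyspan_add polyspan_mult c(5) s0 d(1) c(3) insertI1)
    moreover have "d (v \<alpha>) * (c (v \<alpha>) * E \<gamma> \<alpha> - (\<Sum>\<gamma>'\<in>insert \<gamma>0 M. r \<gamma>' (v \<alpha>) * E \<gamma>' \<alpha>))
        + r \<gamma>0 (v \<alpha>) * (d (v \<alpha>) * E \<gamma>0 \<alpha> - (\<Sum>\<gamma>'\<in>M. r0 \<gamma>' (v \<alpha>) * E \<gamma>' \<alpha>))
        = c' (v \<alpha>) * E \<gamma> \<alpha> - (\<Sum>\<gamma>'\<in>M. r' \<gamma>' (v \<alpha>) * E \<gamma>' \<alpha>)" for \<alpha>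
      using insert.hyps by (simp add: c'_def r'_def algebra_simps sum_distrib_left sum.distrib)
    ultimately have "polyspan v E Y (\<lambda>\<alpha>. c' (v \<alpha>) * E \<gamma> \<alpha> - (\<Sum>\<gamma>'\<in>M. r' \<gamma>' (v \<alpha>) * E \<gamma>' \<alpha>))" by simp
    moreover have "polyfun c'" unfolding c'_def[abs_def] by (rule polyfun_mult[OF d(1) c(1)])
    moreover have "polyfun (r' \<gamma>')" if "\<gamma>' \<in> M" for \<gamma>'
      unfolding r'_def[abs_def] by (intro polyfun_add polyfun_mult d c(3) c0(3) insertI1 insertI2 that)
    moreover have "r' \<gamma>' \<beta> = 0" if "\<gamma>' \<in> M" for \<gamma>' using c(4) c0(4) that by (simp add: r'_def)
    moreover have "c' \<beta> \<noteq> 0" using d c by (simp add: c'_def)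
    ultimately show ?thesis by (intro exI[of _ c'] exI[of _ r']) simp
  qed
  from insert.IH[OF this] obtain c where c: "polyfun c" "c \<beta> \<noteq> 0" "\<And>\<gamma>. \<gamma> \<in> M \<Longrightarrow> polyspan v E Y (\<lambda>\<alpha>. c (v \<alpha>) * E \<gamma> \<alpha>)"
    by auto
  have fin: "polyspan v E Y (\<lambda>\<alpha>. (d (v \<alpha>) * c (v \<alpha>)) * E \<gamma> \<alpha>)" if g: "\<gamma> \<in> insert \<gamma>0 M" for \<gamma>
  proof (cases "\<gamma> = \<gamma>0")
    case True
    have "polyspan v E Y (\<lambda>\<alpha>. c (v \<alpha>) * (d (v \<alpha>) * E \<gamma>0 \<alpha> - (\<Sum>\<gamma>'\<in>M. r0 \<gamma>' (v \<alpha>) * E \<gamma>' \<alpha>))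
        + (\<Sum>\<gamma>'\<in>M. r0 \<gamma>' (v \<alpha>) * (c (v \<alpha>) * E \<gamma>' \<alpha>)))"
      by (intro polyspan_add polyspan_mult polyspan_sum s0 c(1,3) c0(3) insertI2)
    then show ?thesis using True by (simp add: algebra_simps sum_distrib_left)
  next
    case False
    then have "\<gamma> \<in> M" using g by simp
    from polyspan_mult[OF c(3)[OF this] d(1)] show ?thesis by (simp add: mult.assoc)
  qed
  show ?case
    by (rule exI[of _ "\<lambda>x. d x * c x"]) (use fin c d in \<open>simp add: polyfun_mult\<close>)
qed

section \<open>Truncated systems and determining sets\<close>

context toric
begin

definition relp :: "complex ^ 'd \<Rightarrow> complex ^ 'n \<Rightarrow> 'd \<Rightarrow> (int ^ 'd \<Rightarrow> complex) \<Rightarrow> int ^ 'd \<Rightarrow> complex" where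
  "relp \<beta> p i f \<gamma> = theta p i f \<gamma> + (of_int (\<gamma> $ i) - \<beta> $ i) * f \<gamma>"

text \<open>A relation in degree m involves values up to degree m + 1. So relations are imposed in
  degrees below k (\<open>strictlev\<close>) on values in degrees up to k (\<open>lowlev\<close>),
  which is a finite linear system.\<close>

definition lowlev :: "nat \<Rightarrow> (int ^ 'd) set" where "lowlev k = (\<Union>m\<le>k. lev m)"

definition strictlev :: "nat \<Rightarrow> (int ^ 'd) set" where "strictlev k = (\<Union>m<k. lev m)"

definition detk :: "complex ^ 'd \<Rightarrow> nat \<Rightarrow> (int ^ 'd) set \<Rightarrow> complex ^ 'n \<Rightarrow> bool" where
  "detk \<beta> k Y p \<longleftrightarrow> (\<forall>f. (\<forall>i. \<forall>\<gamma>\<in>strictlev k. relp \<beta> p i f \<gamma> = 0) \<longrightarrow> (\<forall>y\<in>Y. f y = 0) \<longrightarrow> (\<forall>\<gamma>\<in>lowlev k. f \<gamma> = 0))"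

lemma finite_lowlev: "finite (lowlev k)" and finite_strictlev: "finite (strictlev k)"
  by (auto simp: lowlev_def strictlev_def finite_lev)

lemma strictlev_lowlev: "strictlev k \<subseteq> lowlev k" by (force simp: lowlev_def strictlev_def)

lemma lowlev_mono: "k \<le> m \<Longrightarrow> lowlev k \<subseteq> lowlev m" by (force simp: lowlev_def)

lemma strictlev_mono: "k \<le> m \<Longrightarrow> strictlev k \<subseteq> strictlev m" by (force simp: strictlev_def)

lemma lowlev_Suc: "lowlev (Suc k) = lowlev k \<union> lev (Suc k)"
  by (auto simp: lowlev_def le_Suc_eq)

lemma lowlev_NA: "lowlev k \<subseteq> NA" using lev_subset by (auto simp: lowlev_def)

lemma strictlev_add_col: "\<gamma> \<in> strictlev k \<Longrightarrow> \<gamma> + col j \<in> lowlev k"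
  unfolding strictlev_def lowlev_def using lev_add_col by (blast intro: Suc_leI)

lemma relp_sub: "relp \<beta> p i (\<lambda>\<gamma>. f \<gamma> - g \<gamma>) \<gamma> = relp \<beta> p i f \<gamma> - relp \<beta> p i g \<gamma>"
  unfolding relp_def theta_def by (simp add: right_diff_distrib sum_subtractf)

lemma relp_mult: "relp \<beta> p i (\<lambda>\<gamma>. c * f \<gamma>) \<gamma> = c * relp \<beta> p i f \<gamma>"
  unfolding relp_def theta_def by (simp add: distrib_left sum_distrib_left mult_ac)

lemma relp_cong:
  assumes "f \<gamma> = g \<gamma>" "\<And>j. f (\<gamma> + col j) = g (\<gamma> + col j)"
  shows "relp \<beta> p i f \<gamma> = relp \<beta> p i g \<gamma>"
  unfolding relp_def theta_def by (simp add: assms)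

text \<open>From degree N on, goodness expresses values of degree k + 1 through \<open>theta\<close>
  in degree k, and there the relations reduce \<open>theta\<close> to values already known to
  vanish.\<close>

lemma detk_Suc:
  assumes g: "good N p" and N: "N \<le> k" and d: "detk \<beta> k Y p"
  shows "detk \<beta> (Suc k) Y p"
  unfolding detk_def
proof (intro allI impI ballI)
  fix f \<gamma>
  assume f: "\<forall>i. \<forall>\<gamma>\<in>strictlev (Suc k). relp \<beta> p i f \<gamma> = 0" and y: "\<forall>y\<in>Y. f y = 0" and \<gamma>: "\<gamma> \<in> lowlev (Suc k)"
  have "\<forall>i. \<forall>\<gamma>\<in>strictlev k. relp \<beta> p i f \<gamma> = 0" using f strictlev_mono[of k "Suc k"] by auto
  then have low: "\<forall>\<gamma>\<in>lowlev k. f \<gamma> = 0" using d y unfolding detk_def by blast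
  show "f \<gamma> = 0"
  proof (cases "\<gamma> \<in> lowlev k")
    case False
    then have "\<gamma> \<in> lev (Suc N + (k - N))" using \<gamma> N by (simp add: lowlev_Suc)
    then obtain \<alpha> \<delta> where ad: "\<alpha> \<in> lev (Suc N)" "\<delta> \<in> lev (k - N)" "\<gamma> = \<alpha> + \<delta>" by (rule lev_split)
    obtain s where s: "\<And>f. f \<alpha> = (\<Sum>i\<in>UNIV. \<Sum>\<gamma>'\<in>lev N. s i \<gamma>' * theta p i f \<gamma>')"
      using g ad(1) unfolding good_def by blast
    have "f \<gamma> = (\<Sum>i\<in>UNIV. \<Sum>\<gamma>'\<in>lev N. s i \<gamma>' * theta p i (\<lambda>\<gamma>. f (\<gamma> + \<delta>)) \<gamma>')"
      using s[of "\<lambda>\<gamma>. f (\<gamma> + \<delta>)"] ad(3) by simp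
    also have "\<dots> = 0"
    proof (intro sum.neutral ballI)
      fix i \<gamma>' assume "\<gamma>' \<in> lev N"
      then have "\<gamma>' + \<delta> \<in> lev k" using lev_add[OF _ ad(2)] N by fastforce
      then have "relp \<beta> p i f (\<gamma>' + \<delta>) = 0" "f (\<gamma>' + \<delta>) = 0"
        using f low by (auto simp: strictlev_def lowlev_def)
      then have "theta p i f (\<gamma>' + \<delta>) = 0" by (simp add: relp_def)
      moreover have "theta p i (\<lambda>\<gamma>. f (\<gamma> + \<delta>)) \<gamma>' = theta p i f (\<gamma>' + \<delta>)"
        unfolding theta_def by (simp add: add_ac)
      ultimately show "s i \<gamma>' * theta p i (\<lambda>\<gamma>. f (\<gamma> + \<delta>)) \<gamma>' = 0" by simp
    qed
    finally show ?thesis .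
  qed (use low in blast)
qed

lemma detk_mono:
  assumes "good N p" "N \<le> k" "detk \<beta> k Y p" "k \<le> m"
  shows "detk \<beta> m Y p"
  using assms(4)
proof (induction m rule: dec_induct)
  case (step m)
  then show ?case using detk_Suc[OF assms(1) _ step.IH] assms(2) by simp
qed (rule assms(3))

text \<open>One truncation at some k \<ge> N is enough, since determination then passes to all
  higher degrees.\<close>

definition detset :: "complex ^ 'd \<Rightarrow> nat \<Rightarrow> complex ^ 'n \<Rightarrow> (int ^ 'd) set \<Rightarrow> bool" where
  "detset \<beta> N p Y \<longleftrightarrow> finite Y \<and> Y \<subseteq> NA \<and> (\<exists>k\<ge>N. Y \<subseteq> lowlev k \<and> detk \<beta> k Y p)"

definition hrank :: "complex ^ 'd \<Rightarrow> nat \<Rightarrow> complex ^ 'n \<Rightarrow> nat" where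
  "hrank \<beta> N p = (LEAST r. \<exists>Y. detset \<beta> N p Y \<and> card Y = r)"

lemma hrank_attained: "\<exists>Y. detset \<beta> N p Y \<and> card Y = hrank \<beta> N p"
  unfolding hrank_def
proof (rule LeastI_ex)
  have "detset \<beta> N p (lowlev N)"
    unfolding detset_def detk_def using finite_lowlev lowlev_NA by blast
  then show "\<exists>r Y. detset \<beta> N p Y \<and> card Y = r" by blast
qed

lemma hrank_le: "detset \<beta> N p Y \<Longrightarrow> hrank \<beta> N p \<le> card Y"
  unfolding hrank_def by (rule Least_le) blast

lemma solution_dim_hrank:
  assumes g: "good N p"
  shows "solution_dim (hypergeometric_ideal A \<beta>) p = enat (hrank \<beta> N p)"
proof -
  obtain Y where Y: "detset \<beta> N p Y" "card Y = hrank \<beta> N p" using hrank_attained by blast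
  then obtain k0 where k0: "finite Y" "Y \<subseteq> NA" "k0 \<ge> N" "Y \<subseteq> lowlev k0" "detk \<beta> k0 Y p"
    unfolding detset_def by blast
  have dm: "detk \<beta> m Y p" if "m \<ge> k0" for m by (rule detk_mono[OF g k0(3,5) that])
  have "solution_dim (hypergeometric_ideal A \<beta>) p = enat (card Y)"
  proof (rule solution_dim_eq[OF g k0(1,2)])
    fix f assume f: "inK \<beta> p f" and y: "\<forall>y\<in>Y. f y = 0"
    have r: "relp \<beta> p i f \<gamma> = 0" if "\<gamma> \<in> NA" for i \<gamma> using f that unfolding inK_def relp_def by blast
    show "\<forall>\<gamma>\<in>NA. f \<gamma> = 0"
    proof
      fix \<gamma> assume \<gamma>: "\<gamma> \<in> NA"
      define m where "m = max k0 (nat (\<gamma> $ i0))"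
      have "\<gamma> \<in> lowlev m" using NA_lev[OF \<gamma>] by (auto simp: lowlev_def m_def)
      moreover have "detk \<beta> m Y p" by (rule dm) (simp add: m_def)
      ultimately show "f \<gamma> = 0"
        unfolding detk_def using y r strictlev_lowlev lowlev_NA by blast
    qed
  next
    fix y assume y: "y \<in> Y"
    have nd: "\<not> detk \<beta> m (Y - {y}) p" if "m \<ge> k0" for m
    proof
      assume "detk \<beta> m (Y - {y}) p"
      then have "detset \<beta> N p (Y - {y})"
        unfolding detset_def using k0 that lowlev_mono[OF that] by (intro conjI exI[of _ m]) auto
      then have "card Y \<le> card (Y - {y})" using hrank_le Y(2) by metis
      then show False using y k0(1) by (metis card_Diff1_less not_le)
    qed
    have "\<exists>f. (\<forall>i. \<forall>\<gamma>\<in>strictlev m. relp \<beta> p i f \<gamma> = 0) \<and> (\<forall>y'\<in>Y. f y' = (if y' = y then 1 else 0))" if m: "m \<ge> k0" for m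
    proof -
      obtain f where f: "\<forall>i. \<forall>\<gamma>\<in>strictlev m. relp \<beta> p i f \<gamma> = 0" "\<forall>y\<in>Y - {y}. f y = 0" "\<not> (\<forall>\<gamma>\<in>lowlev m. f \<gamma> = 0)"
        using nd[OF m] unfolding detk_def by blast
      have fy: "f y \<noteq> 0"
      proof
        assume "f y = 0"
        then have "\<forall>y\<in>Y. f y = 0" using f(2) by blast
        then show False using dm[OF m] f(1,3) unfolding detk_def by blast
      qed
      show ?thesis
        by (rule exI[of _ "\<lambda>\<gamma>. inverse (f y) * f \<gamma>"]) (use f fy in \<open>auto simp: relp_mult\<close>)
    qed
    then have "\<forall>m\<in>{k0..}. \<exists>f. (\<forall>i. \<forall>\<gamma>\<in>strictlev m. relp \<beta> p i f \<gamma> = 0) \<and> (\<forall>y'\<in>Y. f y' = (if y' = y then 1 else 0))"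
      by simp
    from bchoice[OF this] obtain F where "\<forall>m\<in>{k0..}. (\<forall>i. \<forall>\<gamma>\<in>strictlev m. relp \<beta> p i (F m) \<gamma> = 0) \<and> (\<forall>y'\<in>Y. F m y' = (if y' = y then 1 else 0))"
      by (rule exE)
    then have F: "\<And>m i \<gamma>. m \<ge> k0 \<Longrightarrow> \<gamma> \<in> strictlev m \<Longrightarrow> relp \<beta> p i (F m) \<gamma> = 0"
      "\<And>m y'. m \<ge> k0 \<Longrightarrow> y' \<in> Y \<Longrightarrow> F m y' = (if y' = y then 1 else 0)"
      by auto
    have comp: "F m \<gamma> = F m' \<gamma>" if m: "m \<ge> k0" "m' \<ge> m" and \<gamma>: "\<gamma> \<in> lowlev m" for m m' \<gamma>
    proof -
      let ?g = "\<lambda>\<gamma>. F m \<gamma> - F m' \<gamma>"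
      have "\<forall>i. \<forall>\<gamma>\<in>strictlev m. relp \<beta> p i ?g \<gamma> = 0"
        unfolding relp_sub using F(1) m strictlev_mono[OF m(2)] by auto
      moreover have "\<forall>y\<in>Y. ?g y = 0" using F(2) m by auto
      ultimately have "?g \<gamma> = 0" using dm[OF m(1)] \<gamma> unfolding detk_def by blast
      then show ?thesis by simp
    qed
    define f where "f \<gamma> = F (max k0 (nat (\<gamma> $ i0))) \<gamma>" for \<gamma>
    have ff: "f \<gamma> = F m \<gamma>" if m: "m \<ge> k0" and \<gamma>: "\<gamma> \<in> lowlev m" for m \<gamma>
    proof -
      have "\<gamma> $ i0 \<le> int m" using \<gamma> by (auto simp: lowlev_def lev_def)
      then have "max k0 (nat (\<gamma> $ i0)) \<le> m" using m by simp
      moreover have "\<gamma> \<in> lowlev (max k0 (nat (\<gamma> $ i0)))"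
      proof -
        have "\<gamma> \<in> NA" using \<gamma> lowlev_NA by blast
        then have "\<gamma> \<in> lev (nat (\<gamma> $ i0))" by (rule NA_lev)
        then show ?thesis unfolding lowlev_def by (intro UN_I[of "nat (\<gamma> $ i0)"]) auto
      qed
      ultimately show ?thesis unfolding f_def by (intro comp) auto
    qed
    have "inK \<beta> p f"
      unfolding inK_def
    proof (intro allI ballI)
      fix i \<gamma> assume \<gamma>: "\<gamma> \<in> NA"
      define m where "m = max k0 (Suc (nat (\<gamma> $ i0)))"
      have sl: "\<gamma> \<in> strictlev m" using NA_lev[OF \<gamma>] by (auto simp: strictlev_def m_def)
      have "relp \<beta> p i f \<gamma> = relp \<beta> p i (F m) \<gamma>"
        by (rule relp_cong; rule ff) (use sl strictlev_lowlev strictlev_add_col in \<open>auto simp: m_def\<close>)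
      also have "\<dots> = 0" by (rule F(1)) (use sl in \<open>auto simp: m_def\<close>)
      finally show "theta p i f \<gamma> + (of_int (\<gamma> $ i) - \<beta> $ i) * f \<gamma> = 0" by (simp add: relp_def)
    qed
    moreover have "\<forall>y'\<in>Y. f y' = (if y' = y then 1 else 0)"
      using ff[of k0] F(2)[of k0] k0(4) by auto
    ultimately show "\<exists>f. inK \<beta> p f \<and> (\<forall>y'\<in>Y. f y' = (if y' = y then 1 else 0))" by blast
  qed
  then show ?thesis using Y(2) by simp
qed

text \<open>The rows of the truncated system: \<open>Inl y\<close> reads off a value,
  \<open>Inr (i, \<gamma>)\<close> is the relation with index i at \<gamma>.\<close>

definition detu :: "complex ^ 'd \<Rightarrow> complex ^ 'n \<Rightarrow> (int ^ 'd) + ('d \<times> (int ^ 'd)) \<Rightarrow> int ^ 'd \<Rightarrow> complex" where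
  "detu \<beta> p s x = (case s of Inl y \<Rightarrow> (if x = y then 1 else 0)
     | Inr (i, \<gamma>) \<Rightarrow> theta_coeff p i \<gamma> x + (if x = \<gamma> then of_int (\<gamma> $ i) - \<beta> $ i else 0))"

lemma sum_detu:
  shows "y \<in> lowlev k \<Longrightarrow> (\<Sum>x\<in>lowlev k. f x * detu \<beta> p (Inl y) x) = f y"
    and "\<gamma> \<in> strictlev k \<Longrightarrow> (\<Sum>x\<in>lowlev k. f x * detu \<beta> p (Inr (i, \<gamma>)) x) = relp \<beta> p i f \<gamma>"
proof -
  show "(\<Sum>x\<in>lowlev k. f x * detu \<beta> p (Inl y) x) = f y" if "y \<in> lowlev k"
    using that finite_lowlev by (simp add: detu_def if_distrib[of "\<lambda>c. _ * c"] cong: if_cong)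
  assume \<gamma>: "\<gamma> \<in> strictlev k"
  have "theta p i f \<gamma> = (\<Sum>x\<in>lowlev k. f x * theta_coeff p i \<gamma> x)"
    by (rule theta_eq_sum[OF finite_lowlev]) (rule strictlev_add_col[OF \<gamma>])
  moreover have "(\<Sum>x\<in>lowlev k. f x * (if x = \<gamma> then of_int (\<gamma> $ i) - \<beta> $ i else 0)) = f \<gamma> * (of_int (\<gamma> $ i) - \<beta> $ i)"
    using \<gamma> strictlev_lowlev finite_lowlev by (auto simp: if_distrib[of "\<lambda>c. _ * c"] cong: if_cong)
  ultimately show "(\<Sum>x\<in>lowlev k. f x * detu \<beta> p (Inr (i, \<gamma>)) x) = relp \<beta> p i f \<gamma>"
    by (simp add: detu_def relp_def distrib_left sum.distrib)
qed

lemma detk_detu: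
  assumes "Y \<subseteq> lowlev k"
  shows "detk \<beta> k Y p \<longleftrightarrow> (\<forall>f. (\<forall>s\<in>Inl ` Y \<union> Inr ` (UNIV \<times> strictlev k). (\<Sum>x\<in>lowlev k. f x * detu \<beta> p s x) = 0) \<longrightarrow> (\<forall>x\<in>lowlev k. f x = 0))"
proof -
  have "(\<forall>s\<in>Inl ` Y \<union> Inr ` (UNIV \<times> strictlev k). (\<Sum>x\<in>lowlev k. f x * detu \<beta> p s x) = 0) \<longleftrightarrow>
      (\<forall>i. \<forall>\<gamma>\<in>strictlev k. relp \<beta> p i f \<gamma> = 0) \<and> (\<forall>y\<in>Y. f y = 0)" for f
  proof -
    have "(\<Sum>x\<in>lowlev k. f x * detu \<beta> p (Inl y) x) = f y" if "y \<in> Y" for y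
      using assms that by (intro sum_detu) auto
    then show ?thesis by (auto simp: ball_Un sum_detu)
  qed
  then show ?thesis unfolding detk_def by blast
qed

text \<open>The rows depend polynomially on \<open>p\<close>, so a determining set at one point
  remains one on a Zariski open set. This is the semicontinuity of the rank in
  \<open>p\<close>.\<close>

lemma detk_generic:
  assumes Y: "Y \<subseteq> lowlev k" and d: "detk \<beta> k Y p0"
  shows "\<exists>q. polyfun q \<and> q p0 \<noteq> 0 \<and> (\<forall>p. q p \<noteq> 0 \<longrightarrow> detk \<beta> k Y p)"
proof -
  have pu: "polyfun (\<lambda>p. detu \<beta> p s x)" for s x
    unfolding detu_def by (cases s) (auto split: prod.splits intro!: polyfun_add polyfun_theta_coeff polyfun_const)
  have "\<exists>q. polyfun q \<and> q p0 \<noteq> 0 \<and>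
    (\<forall>p f. q p \<noteq> 0 \<longrightarrow> (\<forall>s\<in>Inl ` Y \<union> Inr ` (UNIV \<times> strictlev k). (\<Sum>x\<in>lowlev k. f x * detu \<beta> p s x) = 0) \<longrightarrow> (\<forall>x\<in>lowlev k. f x = 0))"
    by (rule generic_trivial_kernel[OF finite_lowlev pu]) (use d detk_detu[OF Y] in simp)
  then show ?thesis unfolding detk_detu[OF Y] by (elim exE conjE) (rule exI, intro conjI, assumption+, simp)
qed

end

section \<open>Coefficients of twisted exponentials\<close>

definition cv :: "int ^ 'd::finite \<Rightarrow> complex ^ 'd" where "cv \<alpha> = (\<chi> i. of_int (\<alpha> $ i))"

lemma cv_nth: "cv \<alpha> $ i = of_int (\<alpha> $ i)" by (simp add: cv_def)

text \<open>Bilinear, without conjugation, hence polynomial in \<open>x\<close>.\<close>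

definition dotc :: "complex ^ 'd::finite \<Rightarrow> complex ^ 'd \<Rightarrow> complex" where
  "dotc l x = (\<Sum>i\<in>UNIV. l $ i * x $ i)"

lemma dotc_add: "dotc l (x + y) = dotc l x + dotc l y"
  by (simp add: dotc_def distrib_left sum.distrib)

lemma dotc_scale: "dotc l (t *s x) = t * dotc l x"
  by (simp add: dotc_def sum_distrib_left mult_ac)

lemma dotc_0: "dotc l 0 = 0" by (simp add: dotc_def)

lemma dotc_sum: "dotc l (\<Sum>s\<in>S. f s) = (\<Sum>s\<in>S. dotc l (f s))"
  by (induction S rule: infinite_finite_induct) (auto simp: dotc_add dotc_0)

lemma polyfun_dotc: "polyfun (dotc l)"
  unfolding dotc_def[abs_def] by (intro polyfun_sum polyfun_mult polyfun_const polyfun_coord)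

text \<open>A generic weight attains its maximum on \<open>G\<close> and on \<open>Xs\<close> at one
  point each, and the sum of the two maximizers has no other representation. This is the usual
  reason why Laurent polynomials have no zero divisors.\<close>

lemma unique_sum:
  fixes G Xs :: "(int ^ 'd::finite) set"
  assumes "finite G" "G \<noteq> {}" "finite Xs" "Xs \<noteq> {}"
  shows "\<exists>\<gamma>\<in>G. \<exists>x\<in>Xs. \<forall>\<gamma>'\<in>G. \<forall>x'\<in>Xs. \<gamma>' + x' = \<gamma> + x \<longrightarrow> \<gamma>' = \<gamma> \<and> x' = x"
proof -
  define Z where "Z = {a - b | a b. a \<in> G \<union> Xs \<and> b \<in> G \<union> Xs \<and> a \<noteq> b}"
  have "finite Z"
    unfolding Z_def by (rule finite_subset[of _ "(\<lambda>(a, b). a - b) ` ((G \<union> Xs) \<times> (G \<union> Xs))"]) (use assms in auto)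
  moreover have "0 \<notin> Z" by (auto simp: Z_def)
  ultimately obtain w :: "nat ^ 'd" where w: "\<forall>z\<in>Z. (\<Sum>j\<in>UNIV. int (w $ j) * z $ j) \<noteq> 0"
    using avoid_hyperplanes by blast
  define \<omega> where "\<omega> z = (\<Sum>j\<in>UNIV. int (w $ j) * z $ j)" for z :: "int ^ 'd"
  have add: "\<omega> (a + b) = \<omega> a + \<omega> b" for a b by (simp add: \<omega>_def distrib_left sum.distrib)
  have inj: "a = b" if "a \<in> G \<union> Xs" "b \<in> G \<union> Xs" "\<omega> a = \<omega> b" for a b
  proof (rule ccontr)
    assume "a \<noteq> b"
    then have "a - b \<in> Z" using that by (auto simp: Z_def)
    then have "\<omega> (a - b) \<noteq> 0" using w unfolding \<omega>_def by blast
    moreover have "\<omega> (a - b) = \<omega> a - \<omega> b" by (simp add: \<omega>_def right_diff_distrib sum_subtractf)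
    ultimately show False using that by simp
  qed
  have "\<exists>\<gamma>\<in>S. \<forall>\<gamma>'\<in>S. \<omega> \<gamma>' \<le> \<omega> \<gamma>" if S: "finite S" "S \<noteq> {}" for S
  proof -
    have "Max (\<omega> ` S) \<in> \<omega> ` S" using S by (intro Max_in) auto
    then obtain \<gamma> where "\<gamma> \<in> S" "\<omega> \<gamma> = Max (\<omega> ` S)" by auto
    then show ?thesis using S Max_ge[of "\<omega> ` S"] by (intro bexI[of _ \<gamma>]) auto
  qed
  then obtain \<gamma> x where gx: "\<gamma> \<in> G" "\<And>\<gamma>'. \<gamma>' \<in> G \<Longrightarrow> \<omega> \<gamma>' \<le> \<omega> \<gamma>" "x \<in> Xs" "\<And>x'. x' \<in> Xs \<Longrightarrow> \<omega> x' \<le> \<omega> x"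
    using assms by metis
  have "\<gamma>' = \<gamma> \<and> x' = x" if h: "\<gamma>' \<in> G" "x' \<in> Xs" "\<gamma>' + x' = \<gamma> + x" for \<gamma>' x'
  proof -
    have "\<omega> \<gamma>' + \<omega> x' = \<omega> \<gamma> + \<omega> x" using h(3) add by metis
    then have "\<omega> \<gamma>' = \<omega> \<gamma>" using gx(2)[OF h(1)] gx(4)[OF h(2)] by linarith
    then have "\<gamma>' = \<gamma>" using inj h gx by blast
    then show ?thesis using h(3) by simp
  qed
  then show ?thesis using gx by blast
qed

section \<open>Density of the natural points, and the recurrence for the functions
  \<open>E\<close>\<close>

lemma poly_vanish_nat:
  fixes P :: "complex poly"
  assumes "\<And>n::nat. poly P (of_nat n) = 0"
  shows "P = 0"
proof (rule ccontr)
  assume "P \<noteq> 0"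
  then have "finite {x. poly P x = 0}" by (rule poly_roots_finite)
  moreover have "range (of_nat :: nat \<Rightarrow> complex) \<subseteq> {x. poly P x = 0}" using assms by auto
  ultimately have "finite (range (of_nat :: nat \<Rightarrow> complex))" by (rule finite_subset[rotated])
  then show False by (simp add: finite_image_iff inj_of_nat)
qed

text \<open>The coordinates are freed one by one; a univariate polynomial vanishing at all natural
  numbers is zero.\<close>

lemma polyfun_vanish_nat:
  fixes f :: "complex ^ 'm::finite \<Rightarrow> complex"
  assumes f: "polyfun f" and z: "\<And>x :: nat ^ 'm. f (\<chi> j. of_nat (x $ j)) = 0"
  shows "f x = 0"
proof -
  have "f x = 0" if "finite I" "\<And>j. j \<notin> I \<Longrightarrow> x $ j \<in> range of_nat" for I x
    using that
  proof (induction I arbitrary: x rule: finite_induct)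
    case empty
    then have "\<forall>j. \<exists>n. x $ j = of_nat n" by blast
    then obtain n where "\<And>j. x $ j = of_nat (n j)" by metis
    then have "x = (\<chi> j. of_nat ((\<chi> j. n j) $ j))" by (simp add: vec_eq_iff)
    then show ?case using z[of "\<chi> j. n j"] by metis
  next
    case (insert i I)
    define y where "y = x - (x $ i) *s axis i 1"
    obtain P where P: "\<And>t. f (y + t *s axis i 1) = poly P t" using polyfun_line[OF f] by blast
    have "poly P (of_nat n) = 0" for n
      unfolding P[symmetric] by (rule insert.IH) (use insert.prems in \<open>auto simp: y_def axis_def\<close>)
    then have "P = 0" by (rule poly_vanish_nat)
    then show ?case using P[of "x $ i"] by (simp add: y_def)
  qed
  from this[of UNIV] show ?thesis by simp
qed

context toric
begin

definition mfac :: "complex ^ 'n \<Rightarrow> nat ^ 'n \<Rightarrow> complex" where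
  "mfac p n = monom_eval n p / (\<Prod>j\<in>UNIV. fact (n $ j))"

text \<open>The coefficient of \<open>t\<^sup>\<alpha>\<close> in \<open>exp (\<Sum>\<^sub>j p\<^sub>j t\<^bsup>a\<^sub>j\<^esup>)\<close>.\<close>
definition E0 :: "complex ^ 'n \<Rightarrow> int ^ 'd \<Rightarrow> complex" where
  "E0 p \<alpha> = (\<Sum>n | wt n = \<alpha>. mfac p n)"

definition E :: "complex ^ 'n \<Rightarrow> int ^ 'd \<Rightarrow> int ^ 'd \<Rightarrow> complex" where
  "E p \<gamma> \<alpha> = E0 p (\<alpha> - \<gamma>)"

lemma finite_fiber: "finite {n. wt n = \<alpha>}"
  by (rule finite_subset[OF _ finite_tot[of "nat (\<alpha> $ i0)"]]) (auto simp: wt_i0)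

lemma E0_notin: "\<alpha> \<notin> NA \<Longrightarrow> E0 p \<alpha> = 0"
  unfolding E0_def NA_def by (rule sum.neutral) auto

lemma E0_0: "E0 p 0 = 1"
proof -
  have "{n. wt n = 0} = {0}"
  proof (intro equalityI subsetI)
    fix n assume "n \<in> {n. wt n = 0}"
    then have "int (tot n) = 0" using wt_i0[of n] by simp
    then show "n \<in> {0}" by (simp add: tot_eq_0_iff)
  qed (simp add: wt_0)
  then show ?thesis by (simp add: E0_def mfac_def monom_eval_0)
qed

lemma mfac_add_axis: "of_nat (Suc (n $ j)) * mfac p (n + axis j 1) = p $ j * mfac p n"
proof -
  have "(\<Prod>l\<in>UNIV. fact ((n + axis j 1) $ l) :: complex) = of_nat (Suc (n $ j)) * (\<Prod>l\<in>UNIV. fact (n $ l))"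
  proof -
    have "(\<Prod>l\<in>UNIV. fact ((n + axis j 1) $ l) :: complex) = fact (Suc (n $ j)) * (\<Prod>l\<in>UNIV - {j}. fact (n $ l))"
      unfolding prod_remove_UNIV[of _ j] by (intro arg_cong2[of _ _ _ _ "(*)"] prod.cong) (auto simp: axis_def)
    also have "\<dots> = of_nat (Suc (n $ j)) * (\<Prod>l\<in>UNIV. fact (n $ l))"
      unfolding prod_remove_UNIV[of "\<lambda>l. fact (n $ l)" j] by (simp add: fact_Suc del: of_nat_Suc)
    finally show ?thesis .
  qed
  then show ?thesis
    unfolding mfac_def monom_eval_add monom_eval_axis by (simp del: of_nat_Suc One_nat_def)
qed

text \<open>The logarithmic derivative of exp(\<Sum> p_j t^(a_j)) with respect to t_i, compared
  coefficientwise: n_j times the term of n equals p_j times the term of n - e_j.\<close>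

lemma E0_rec: "of_int (\<alpha> $ i) * E0 p \<alpha> = (\<Sum>j\<in>UNIV. of_int (A $ i $ j) * p $ j * E0 p (\<alpha> - col j))"
proof -
  have sh: "(\<Sum>n | wt n = \<alpha>. of_nat (n $ j) * mfac p n) = p $ j * E0 p (\<alpha> - col j)" for j
  proof -
    have "(\<Sum>n | wt n = \<alpha>. of_nat (n $ j) * mfac p n) = (\<Sum>n | wt n = \<alpha> \<and> n $ j \<noteq> 0. of_nat (n $ j) * mfac p n)"
      by (rule sum.mono_neutral_right) (auto simp: finite_fiber)
    also have "\<dots> = (\<Sum>n | wt n = \<alpha> - col j. p $ j * mfac p n)"
    proof (rule sum.reindex_bij_witness[where i = "\<lambda>n. n + axis j 1" and j = "\<lambda>n. n - axis j 1"])
      fix n assume n: "n \<in> {n. wt n = \<alpha> \<and> n $ j \<noteq> 0}"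
      have e: "n - axis j 1 + axis j 1 = n" using n by (auto simp: vec_eq_iff axis_def)
      then show "n - axis j 1 + axis j 1 = n" .
      have "wt (n - axis j 1) + col j = \<alpha>" unfolding wt_axis[symmetric] wt_add[symmetric] e using n by simp
      then show "n - axis j 1 \<in> {n. wt n = \<alpha> - col j}" by (simp add: eq_diff_eq)
      have "Suc ((n - axis j 1) $ j) = n $ j" using n by (simp add: axis_def)
      then show "p $ j * mfac p (n - axis j 1) = of_nat (n $ j) * mfac p n"
        using mfac_add_axis[of "n - axis j 1" j p] unfolding e by (simp del: of_nat_Suc)
    next
      fix n assume n: "n \<in> {n. wt n = \<alpha> - col j}"
      show "n + axis j 1 - axis j 1 = n" by simp
      have "wt (n + axis j 1) = \<alpha>" using n by (simp add: wt_add wt_axis del: One_nat_def)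
      moreover have "(n + axis j 1) $ j \<noteq> 0" by (simp add: axis_def)
      ultimately show "n + axis j 1 \<in> {n. wt n = \<alpha> \<and> n $ j \<noteq> 0}" by simp
    qed
    finally show ?thesis by (simp add: E0_def sum_distrib_left)
  qed
  have "of_int (\<alpha> $ i) * E0 p \<alpha> = (\<Sum>n | wt n = \<alpha>. (\<Sum>j\<in>UNIV. of_int (A $ i $ j) * of_nat (n $ j)) * mfac p n)"
    unfolding E0_def sum_distrib_left by (rule sum.cong) (auto simp: wt_nth)
  also have "\<dots> = (\<Sum>j\<in>UNIV. of_int (A $ i $ j) * (\<Sum>n | wt n = \<alpha>. of_nat (n $ j) * mfac p n))"
    unfolding sum_distrib_right sum_distrib_left by (subst sum.swap) (simp add: mult.assoc)
  finally show ?thesis by (simp add: sh mult.assoc)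
qed

lemma E_rec: "theta p i (\<lambda>\<gamma>. E p \<gamma> \<alpha>) \<gamma> = (of_int (\<alpha> $ i) - of_int (\<gamma> $ i)) * E p \<gamma> \<alpha>"
  using E0_rec[of "\<alpha> - \<gamma>" i p] unfolding theta_def E_def by (simp add: diff_diff_eq)

lemma relp_E: "relp \<beta> p i (\<lambda>\<gamma>. E p \<gamma> \<alpha>) \<gamma> = (cv \<alpha> $ i - \<beta> $ i) * E p \<gamma> \<alpha>"
  unfolding relp_def E_rec cv_nth by (simp add: algebra_simps)

text \<open>For a form vanishing on some of the columns these drop out of the sum, so the product is
  a combination of \<open>E p \<gamma>\<close> and translates by the remaining columns. This is how
  a hole is filled.\<close>

lemma E_rec_dotc:
  "dotc l (cv \<alpha>) * E p \<gamma> \<alpha> = dotc l (cv \<gamma>) * E p \<gamma> \<alpha> + (\<Sum>j\<in>UNIV. dotc l (cv (col j)) * p $ j * E p (\<gamma> + col j) \<alpha>)"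
proof -
  have "(\<Sum>j\<in>UNIV. dotc l (cv (col j)) * p $ j * E p (\<gamma> + col j) \<alpha>) = (\<Sum>i\<in>UNIV. l $ i * theta p i (\<lambda>\<gamma>. E p \<gamma> \<alpha>) \<gamma>)"
    unfolding dotc_def theta_def sum_distrib_left sum_distrib_right
    by (subst sum.swap) (simp add: cv_nth col_nth mult.assoc)
  also have "\<dots> = (\<Sum>i\<in>UNIV. l $ i * cv \<alpha> $ i * E p \<gamma> \<alpha>) - (\<Sum>i\<in>UNIV. l $ i * cv \<gamma> $ i * E p \<gamma> \<alpha>)"
    unfolding E_rec cv_nth by (simp add: left_diff_distrib right_diff_distrib sum_subtractf mult.assoc)
  also have "\<dots> = dotc l (cv \<alpha>) * E p \<gamma> \<alpha> - dotc l (cv \<gamma>) * E p \<gamma> \<alpha>"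
    by (simp add: dotc_def sum_distrib_right)
  finally show ?thesis by simp
qed

lemma E_diag: "E p \<gamma> \<gamma> = 1" by (simp add: E_def E0_0)

text \<open>Together with \<open>E_diag\<close> this makes the functions unitriangular with respect
  to the degree.\<close>

lemma E_low: "\<alpha> $ i0 \<le> \<gamma> $ i0 \<Longrightarrow> \<alpha> \<noteq> \<gamma> \<Longrightarrow> E p \<gamma> \<alpha> = 0"
proof -
  assume le: "\<alpha> $ i0 \<le> \<gamma> $ i0" and ne: "\<alpha> \<noteq> \<gamma>"
  have "\<alpha> - \<gamma> \<notin> NA"
  proof
    assume "\<alpha> - \<gamma> \<in> NA"
    then have "\<alpha> - \<gamma> \<in> lev (nat ((\<alpha> - \<gamma>) $ i0))" by (rule NA_lev)
    moreover have "nat ((\<alpha> - \<gamma>) $ i0) = 0" using le by simp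
    ultimately show False using ne lev_0 by simp
  qed
  then show ?thesis unfolding E_def by (rule E0_notin)
qed

text \<open>Evaluation at an element of least degree in the support leaves a single term. Only the
  values of \<open>h\<close> on \<open>H\<close> enter, so \<open>h\<close> is allowed to vanish
  elsewhere.\<close>

lemma E_independent_on:
  assumes fin: "finite H" and z: "\<And>\<alpha>. \<alpha> \<in> H \<Longrightarrow> h \<alpha> * (\<Sum>\<epsilon>\<in>H. g \<epsilon> * E p \<epsilon> \<alpha>) = 0" and h: "\<And>\<alpha>. \<alpha> \<in> H \<Longrightarrow> h \<alpha> \<noteq> (0::complex)"
  shows "\<forall>\<epsilon>\<in>H. g \<epsilon> = 0"
proof (rule ccontr)
  assume "\<not> ?thesis"
  then have ne: "{\<epsilon>\<in>H. g \<epsilon> \<noteq> 0} \<noteq> {}" by blast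
  let ?S = "{\<epsilon>\<in>H. g \<epsilon> \<noteq> 0}"
  have "Min ((\<lambda>\<epsilon>. \<epsilon> $ i0) ` ?S) \<in> (\<lambda>\<epsilon>. \<epsilon> $ i0) ` ?S" using ne fin by (intro Min_in) auto
  then obtain \<alpha> where \<alpha>: "\<alpha> \<in> ?S" "\<alpha> $ i0 = Min ((\<lambda>\<epsilon>. \<epsilon> $ i0) ` ?S)" by auto
  have min: "\<alpha> $ i0 \<le> \<epsilon> $ i0" if "\<epsilon> \<in> ?S" for \<epsilon> unfolding \<alpha>(2) using fin that by (intro Min_le) auto
  have "(\<Sum>\<epsilon>\<in>H. g \<epsilon> * E p \<epsilon> \<alpha>) = (\<Sum>\<epsilon>\<in>H. if \<epsilon> = \<alpha> then g \<epsilon> else 0)"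
  proof (rule sum.cong[OF refl])
    fix \<epsilon> assume "\<epsilon> \<in> H"
    then show "g \<epsilon> * E p \<epsilon> \<alpha> = (if \<epsilon> = \<alpha> then g \<epsilon> else 0)"
      using E_low[of \<alpha> \<epsilon> p] min[of \<epsilon>] by (cases "g \<epsilon> = 0") (auto simp: E_diag)
  qed
  also have "\<dots> = g \<alpha>" using fin \<alpha>(1) by simp
  finally show False using z[of \<alpha>] h[of \<alpha>] \<alpha>(1) by simp
qed

lemma E_independent:
  assumes "finite H" "\<And>\<alpha>. (\<Sum>\<epsilon>\<in>H. g \<epsilon> * E p \<epsilon> \<alpha>) = 0"
  shows "\<forall>\<epsilon>\<in>H. g \<epsilon> = 0"
  by (rule E_independent_on[OF assms(1), of "\<lambda>_. 1" g p]) (simp_all add: assms(2))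

end

section \<open>Generation over the polynomial functions and the dimension count\<close>

lemma polydeg_diff_const: "polydeg (Suc m) (\<lambda>x. x $ i - c)"
  using polydeg_add[OF polydeg_coord[of m i] polydeg_const[of "Suc m" "- c"]] by simp

lemma polyfun_common_degree:
  assumes "finite S" "\<And>s. s \<in> S \<Longrightarrow> polyfun (f s)"
  shows "\<exists>K. \<forall>s\<in>S. polydeg K (f s)"
  using assms
proof (induction S rule: finite_induct)
  case (insert s S)
  then obtain K where K: "\<forall>s\<in>S. polydeg K (f s)" by auto
  obtain K' where "polydeg K' (f s)" using insert.prems[of s] unfolding polyfun_def by auto
  then have "polydeg (max K K') (f t)" if "t \<in> insert s S" for t
    using K that by (auto intro: polydeg_mono)
  then show ?case by blast
qed simp

context toric
begin

text \<open>The dual form of \<open>detk\<close>, valid for every \<open>f\<close> and not just for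
  those satisfying the relations. It is meant for \<open>E\<close>, on which the i-th relation has
  the value (\<alpha>_i - \<beta>_i) E and hence vanishes modulo the maximal ideal at
  \<beta>.\<close>

lemma detk_expansion:
  assumes Y: "Y \<subseteq> lowlev k" and d: "detk \<beta> k Y p" and \<gamma>: "\<gamma> \<in> lowlev k"
  shows "\<exists>c r. \<forall>f. f \<gamma> = (\<Sum>y\<in>Y. c y * f y) + (\<Sum>s\<in>UNIV \<times> strictlev k. r s * relp \<beta> p (fst s) f (snd s))"
proof -
  have fY: "finite Y" using Y finite_lowlev finite_subset by blast
  let ?I = "Inl ` Y \<union> Inr ` ((UNIV :: 'd set) \<times> strictlev k)"
  have fI: "finite ?I"
    by (intro finite_UnI finite_imageI finite_cartesian_product fY finite_strictlev finite)
  have "\<exists>c. \<forall>x\<in>lowlev k. (\<Sum>s\<in>?I. c s * detu \<beta> p s x) = (if x = \<gamma> then 1 else 0)"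
    by (rule trivial_kernel_imp_delta[OF finite_lowlev fI _ \<gamma>]) (use d[unfolded detk_detu[OF Y]] in simp)
  then obtain c where c: "\<And>x. x \<in> lowlev k \<Longrightarrow> (\<Sum>s\<in>?I. c s * detu \<beta> p s x) = (if x = \<gamma> then 1 else 0)" by blast
  have "f \<gamma> = (\<Sum>y\<in>Y. c (Inl y) * f y) + (\<Sum>s\<in>UNIV \<times> strictlev k. c (Inr s) * relp \<beta> p (fst s) f (snd s))" for f
  proof -
    have "f \<gamma> = (\<Sum>x\<in>lowlev k. f x * (if x = \<gamma> then 1 else 0))"
      using \<gamma> finite_lowlev by (simp add: if_distrib[of "\<lambda>c. _ * c"] cong: if_cong)
    also have "\<dots> = (\<Sum>x\<in>lowlev k. f x * (\<Sum>s\<in>?I. c s * detu \<beta> p s x))"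
      using c by (intro sum.cong) auto
    also have "\<dots> = (\<Sum>s\<in>?I. c s * (\<Sum>x\<in>lowlev k. f x * detu \<beta> p s x))"
      unfolding sum_distrib_left by (subst sum.swap) (simp add: mult_ac)
    also have "\<dots> = (\<Sum>s\<in>Inl ` Y. c s * (\<Sum>x\<in>lowlev k. f x * detu \<beta> p s x)) + (\<Sum>s\<in>Inr ` (UNIV \<times> strictlev k). c s * (\<Sum>x\<in>lowlev k. f x * detu \<beta> p s x))"
      by (rule sum.union_disjoint) (use fY finite_strictlev in auto)
    also have "(\<Sum>s\<in>Inl ` Y. c s * (\<Sum>x\<in>lowlev k. f x * detu \<beta> p s x)) = (\<Sum>y\<in>Y. c (Inl y) * f y)"
      by (subst sum.reindex) (use Y in \<open>auto simp: sum_detu subset_iff intro!: sum.cong\<close>)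
    also have "(\<Sum>s\<in>Inr ` (UNIV \<times> strictlev k). c s * (\<Sum>x\<in>lowlev k. f x * detu \<beta> p s x)) = (\<Sum>s\<in>UNIV \<times> strictlev k. c (Inr s) * relp \<beta> p (fst s) f (snd s))"
      by (subst sum.reindex) (auto simp: sum_detu intro!: sum.cong)
    finally show ?thesis .
  qed
  then show ?thesis by (intro exI[of _ "\<lambda>y. c (Inl y)"] exI[of _ "\<lambda>s. c (Inr s)"]) simp
qed

text \<open>Goodness expresses \<open>E p \<gamma>\<close> through \<open>theta\<close> one degree
  lower, where \<open>theta\<close> acts as multiplication by a linear polynomial in \<alpha>. Each
  descent in degree costs one polynomial degree, whence the bound \<open>m\<close>.\<close>

lemma E_generated:
  assumes g: "good N p" and "\<gamma> \<in> lev m"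
  shows "\<exists>a. (\<forall>\<gamma>'\<in>lowlev N. polydeg m (a \<gamma>')) \<and> (\<forall>\<alpha>. E p \<gamma> \<alpha> = (\<Sum>\<gamma>'\<in>lowlev N. a \<gamma>' (cv \<alpha>) * E p \<gamma>' \<alpha>))"
  using assms(2)
proof (induction m arbitrary: \<gamma> rule: less_induct)
  case (less m)
  show ?case
  proof (cases "m \<le> N")
    case True
    then have "\<gamma> \<in> lowlev N" using less.prems by (auto simp: lowlev_def)
    then show ?thesis using finite_lowlev
      by (intro exI[of _ "\<lambda>\<gamma>' x. if \<gamma>' = \<gamma> then 1 else 0"])
         (auto intro: polydeg_const simp: if_distrib[of "\<lambda>c. c * _"] cong: if_cong)
  next
    case False
    then obtain l where m: "m = Suc N + l" using less_iff_Suc_add[of N m] by auto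
    obtain \<alpha>0 \<delta> where ad: "\<alpha>0 \<in> lev (Suc N)" "\<delta> \<in> lev l" "\<gamma> = \<alpha>0 + \<delta>"
      using less.prems unfolding m by (rule lev_split)
    obtain s where s: "\<And>f. f \<alpha>0 = (\<Sum>i\<in>UNIV. \<Sum>\<gamma>'\<in>lev N. s i \<gamma>' * theta p i f \<gamma>')"
      using g ad(1) unfolding good_def by blast
    have "\<forall>\<gamma>'\<in>lev N. \<exists>a. (\<forall>\<epsilon>\<in>lowlev N. polydeg (N + l) (a \<epsilon>)) \<and> (\<forall>\<alpha>. E p (\<gamma>' + \<delta>) \<alpha> = (\<Sum>\<epsilon>\<in>lowlev N. a \<epsilon> (cv \<alpha>) * E p \<epsilon> \<alpha>))"
      using less.IH[of "N + l"] lev_add[OF _ ad(2)] m by simp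
    from bchoice[OF this] obtain a where
      "\<forall>\<gamma>'\<in>lev N. (\<forall>\<epsilon>\<in>lowlev N. polydeg (N + l) (a \<gamma>' \<epsilon>)) \<and> (\<forall>\<alpha>. E p (\<gamma>' + \<delta>) \<alpha> = (\<Sum>\<epsilon>\<in>lowlev N. a \<gamma>' \<epsilon> (cv \<alpha>) * E p \<epsilon> \<alpha>))"
      by (rule exE)
    then have a: "\<And>\<gamma>' \<epsilon>. \<gamma>' \<in> lev N \<Longrightarrow> \<epsilon> \<in> lowlev N \<Longrightarrow> polydeg (N + l) (a \<gamma>' \<epsilon>)"
      "\<And>\<gamma>' \<alpha>. \<gamma>' \<in> lev N \<Longrightarrow> E p (\<gamma>' + \<delta>) \<alpha> = (\<Sum>\<epsilon>\<in>lowlev N. a \<gamma>' \<epsilon> (cv \<alpha>) * E p \<epsilon> \<alpha>)" by auto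
    define b where "b \<epsilon> x = (\<Sum>i\<in>UNIV. \<Sum>\<gamma>'\<in>lev N. s i \<gamma>' * ((x $ i - of_int ((\<gamma>' + \<delta>) $ i)) * a \<gamma>' \<epsilon> x))" for \<epsilon> x
    have "polydeg m (b \<epsilon>)" if \<epsilon>: "\<epsilon> \<in> lowlev N" for \<epsilon>
      unfolding b_def[abs_def]
    proof (intro polydeg_sum)
      fix i \<gamma>' assume "\<gamma>' \<in> lev N"
      from polydeg_mult[OF polydeg_const[of 0 "s i \<gamma>'"] polydeg_mult[OF polydeg_diff_const[of 0 i "of_int ((\<gamma>' + \<delta>) $ i)"] a(1)[OF this \<epsilon>]]]
      show "polydeg m (\<lambda>x. s i \<gamma>' * ((x $ i - of_int ((\<gamma>' + \<delta>) $ i)) * a \<gamma>' \<epsilon> x))" by (simp add: m)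
    qed
    moreover have "E p \<gamma> \<alpha> = (\<Sum>\<epsilon>\<in>lowlev N. b \<epsilon> (cv \<alpha>) * E p \<epsilon> \<alpha>)" for \<alpha>
    proof -
      have "E p \<gamma> \<alpha> = (\<Sum>i\<in>UNIV. \<Sum>\<gamma>'\<in>lev N. s i \<gamma>' * theta p i (\<lambda>\<gamma>. E p (\<gamma> + \<delta>) \<alpha>) \<gamma>')"
        using s[of "\<lambda>\<gamma>. E p (\<gamma> + \<delta>) \<alpha>"] ad(3) by simp
      also have "\<dots> = (\<Sum>i\<in>UNIV. \<Sum>\<gamma>'\<in>lev N. s i \<gamma>' * ((cv \<alpha> $ i - of_int ((\<gamma>' + \<delta>) $ i)) * E p (\<gamma>' + \<delta>) \<alpha>))"
      proof -
        have "theta p i (\<lambda>\<gamma>. E p (\<gamma> + \<delta>) \<alpha>) \<gamma>' = theta p i (\<lambda>\<gamma>. E p \<gamma> \<alpha>) (\<gamma>' + \<delta>)" for i \<gamma>'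
          unfolding theta_def by (simp add: add_ac)
        then show ?thesis unfolding E_rec cv_nth by simp
      qed
      also have "\<dots> = (\<Sum>i\<in>UNIV. \<Sum>\<gamma>'\<in>lev N. \<Sum>\<epsilon>\<in>lowlev N. s i \<gamma>' * ((cv \<alpha> $ i - of_int ((\<gamma>' + \<delta>) $ i)) * a \<gamma>' \<epsilon> (cv \<alpha>)) * E p \<epsilon> \<alpha>)"
        by (intro sum.cong refl) (simp only: a(2) sum_distrib_left mult.assoc)
      also have "\<dots> = (\<Sum>\<epsilon>\<in>lowlev N. b \<epsilon> (cv \<alpha>) * E p \<epsilon> \<alpha>)"
        unfolding b_def sum_distrib_right
        by (rule trans[OF sum.cong[OF refl sum.swap] sum.swap])
      finally show ?thesis .
    qed
    ultimately show ?thesis by blast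
  qed
qed

text \<open>By the expansion \<open>Y\<close> generates the fibre at \<beta>, and
  \<open>nakayama\<close> extends this to a neighbourhood. The excess \<open>K\<close> is
  independent of \<gamma> because only the finitely many generators of degree at most
  \<open>N\<close> have to be localized.\<close>

lemma E_localized:
  assumes g: "good N p" and Y: "detset \<beta> N p Y"
  shows "\<exists>c K. polyfun c \<and> c \<beta> \<noteq> 0 \<and> (\<forall>m. \<forall>\<gamma>\<in>lev m. \<exists>a. (\<forall>y\<in>Y. polydeg (m + K) (a y)) \<and>
     (\<forall>\<alpha>. c (cv \<alpha>) * E p \<gamma> \<alpha> = (\<Sum>y\<in>Y. a y (cv \<alpha>) * E p y \<alpha>)))"
proof -
  obtain k where k: "finite Y" "k \<ge> N" "Y \<subseteq> lowlev k" "detk \<beta> k Y p" using Y unfolding detset_def by blast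
  let ?M = "lowlev N"
  have gen: "\<exists>a. (\<forall>\<gamma>'\<in>?M. polyfun (a \<gamma>')) \<and> (\<forall>\<alpha>. E p \<gamma> \<alpha> = (\<Sum>\<gamma>'\<in>?M. a \<gamma>' (cv \<alpha>) * E p \<gamma>' \<alpha>))" if \<gamma>: "\<gamma> \<in> NA" for \<gamma>
    using E_generated[OF g NA_lev[OF \<gamma>]] unfolding polyfun_def by blast
  have "\<exists>c. polyfun c \<and> c \<beta> \<noteq> 0 \<and> (\<forall>\<gamma>\<in>?M. polyspan cv (E p) Y (\<lambda>\<alpha>. c (cv \<alpha>) * E p \<gamma> \<alpha>))"
  proof (rule nakayama[OF finite_lowlev])
    fix \<gamma> assume "\<gamma> \<in> ?M"
    then have \<gamma>: "\<gamma> \<in> lowlev k" using lowlev_mono[OF k(2)] by blast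
    obtain c r where cr: "\<And>f. f \<gamma> = (\<Sum>y\<in>Y. c y * f y) + (\<Sum>s\<in>UNIV \<times> strictlev k. r s * relp \<beta> p (fst s) f (snd s))"
      using detk_expansion[OF k(3,4) \<gamma>] by blast
    have "\<forall>\<gamma>\<in>strictlev k. \<exists>a. (\<forall>\<gamma>'\<in>?M. polyfun (a \<gamma>')) \<and> (\<forall>\<alpha>. E p \<gamma> \<alpha> = (\<Sum>\<gamma>'\<in>?M. a \<gamma>' (cv \<alpha>) * E p \<gamma>' \<alpha>))"
      using gen strictlev_lowlev lowlev_NA by blast
    from bchoice[OF this] obtain a where
      "\<forall>\<gamma>\<in>strictlev k. (\<forall>\<gamma>'\<in>?M. polyfun (a \<gamma> \<gamma>')) \<and> (\<forall>\<alpha>. E p \<gamma> \<alpha> = (\<Sum>\<gamma>'\<in>?M. a \<gamma> \<gamma>' (cv \<alpha>) * E p \<gamma>' \<alpha>))" by (rule exE)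
    then have a: "\<And>\<gamma> \<gamma>'. \<gamma> \<in> strictlev k \<Longrightarrow> \<gamma>' \<in> ?M \<Longrightarrow> polyfun (a \<gamma> \<gamma>')"
      "\<And>\<gamma> \<alpha>. \<gamma> \<in> strictlev k \<Longrightarrow> E p \<gamma> \<alpha> = (\<Sum>\<gamma>'\<in>?M. a \<gamma> \<gamma>' (cv \<alpha>) * E p \<gamma>' \<alpha>)" by auto
    define R where "R \<gamma>' x = (\<Sum>s\<in>UNIV \<times> strictlev k. r s * ((x $ fst s - \<beta> $ fst s) * a (snd s) \<gamma>' x))" for \<gamma>' x
    have pR: "polyfun (R \<gamma>')" if "\<gamma>' \<in> ?M" for \<gamma>'
      unfolding R_def[abs_def]
      by (intro polyfun_sum polyfun_mult polyfun_const polyfun_diff polyfun_coord a(1) that) auto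
    have "E p \<gamma> \<alpha> - (\<Sum>\<gamma>'\<in>?M. R \<gamma>' (cv \<alpha>) * E p \<gamma>' \<alpha>) = (\<Sum>y\<in>Y. c y * E p y \<alpha>)" for \<alpha>
    proof -
      have "(\<Sum>s\<in>UNIV \<times> strictlev k. r s * relp \<beta> p (fst s) (\<lambda>\<gamma>. E p \<gamma> \<alpha>) (snd s))
         = (\<Sum>s\<in>UNIV \<times> strictlev k. \<Sum>\<gamma>'\<in>?M. r s * ((cv \<alpha> $ fst s - \<beta> $ fst s) * a (snd s) \<gamma>' (cv \<alpha>)) * E p \<gamma>' \<alpha>)"
        unfolding relp_E
      proof (rule sum.cong[OF refl])
        fix s assume "s \<in> (UNIV :: 'd set) \<times> strictlev k"
        then have "snd s \<in> strictlev k" by auto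
        from a(2)[OF this, of \<alpha>]
        show "r s * ((cv \<alpha> $ fst s - \<beta> $ fst s) * E p (snd s) \<alpha>) = (\<Sum>\<gamma>'\<in>?M. r s * ((cv \<alpha> $ fst s - \<beta> $ fst s) * a (snd s) \<gamma>' (cv \<alpha>)) * E p \<gamma>' \<alpha>)"
          by (simp only: sum_distrib_left mult.assoc)
      qed
      also have "\<dots> = (\<Sum>\<gamma>'\<in>?M. R \<gamma>' (cv \<alpha>) * E p \<gamma>' \<alpha>)"
        unfolding R_def sum_distrib_right by (rule sum.swap)
      finally show ?thesis using cr[of "\<lambda>\<gamma>. E p \<gamma> \<alpha>"] by simp
    qed
    then have "polyspan cv (E p) Y (\<lambda>\<alpha>. 1 * E p \<gamma> \<alpha> - (\<Sum>\<gamma>'\<in>?M. R \<gamma>' (cv \<alpha>) * E p \<gamma>' \<alpha>))"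
      unfolding polyspan_def by (intro exI[of _ "\<lambda>y x. c y"]) (simp add: polyfun_const)
    moreover have "R \<gamma>' \<beta> = 0" for \<gamma>' by (simp add: R_def)
    ultimately show "\<exists>c r. polyfun c \<and> c \<beta> \<noteq> 0 \<and> (\<forall>\<gamma>'\<in>?M. polyfun (r \<gamma>') \<and> r \<gamma>' \<beta> = 0) \<and>
       polyspan cv (E p) Y (\<lambda>\<alpha>. c (cv \<alpha>) * E p \<gamma> \<alpha> - (\<Sum>\<gamma>'\<in>?M. r \<gamma>' (cv \<alpha>) * E p \<gamma>' \<alpha>))"
      using pR by (intro exI[of _ "\<lambda>x. 1"] exI[of _ R]) (simp add: polyfun_const)
  qed
  then obtain c where c: "polyfun c" "c \<beta> \<noteq> 0" "\<And>\<gamma>. \<gamma> \<in> ?M \<Longrightarrow> polyspan cv (E p) Y (\<lambda>\<alpha>. c (cv \<alpha>) * E p \<gamma> \<alpha>)" by auto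
  have "\<forall>\<gamma>\<in>?M. \<exists>a. (\<forall>y\<in>Y. polyfun (a y)) \<and> (\<forall>\<alpha>. c (cv \<alpha>) * E p \<gamma> \<alpha> = (\<Sum>y\<in>Y. a y (cv \<alpha>) * E p y \<alpha>))"
    using c(3) unfolding polyspan_def by blast
  from bchoice[OF this] obtain a where
    "\<forall>\<gamma>\<in>?M. (\<forall>y\<in>Y. polyfun (a \<gamma> y)) \<and> (\<forall>\<alpha>. c (cv \<alpha>) * E p \<gamma> \<alpha> = (\<Sum>y\<in>Y. a \<gamma> y (cv \<alpha>) * E p y \<alpha>))" by (rule exE)
  then have a: "\<And>\<gamma> y. \<gamma> \<in> ?M \<Longrightarrow> y \<in> Y \<Longrightarrow> polyfun (a \<gamma> y)"
     "\<And>\<gamma> \<alpha>. \<gamma> \<in> ?M \<Longrightarrow> c (cv \<alpha>) * E p \<gamma> \<alpha> = (\<Sum>y\<in>Y. a \<gamma> y (cv \<alpha>) * E p y \<alpha>)" by auto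
  have "\<exists>K. \<forall>s\<in>?M \<times> Y. polydeg K (a (fst s) (snd s))"
    by (rule polyfun_common_degree) (use a finite_lowlev k(1) in auto)
  then obtain K where K: "\<And>\<gamma> y. \<gamma> \<in> ?M \<Longrightarrow> y \<in> Y \<Longrightarrow> polydeg K (a \<gamma> y)" by auto
  have "\<exists>b. (\<forall>y\<in>Y. polydeg (m + K) (b y)) \<and> (\<forall>\<alpha>. c (cv \<alpha>) * E p \<gamma> \<alpha> = (\<Sum>y\<in>Y. b y (cv \<alpha>) * E p y \<alpha>))" if \<gamma>: "\<gamma> \<in> lev m" for m \<gamma>
  proof -
    obtain e where e: "\<And>\<gamma>'. \<gamma>' \<in> ?M \<Longrightarrow> polydeg m (e \<gamma>')" "\<And>\<alpha>. E p \<gamma> \<alpha> = (\<Sum>\<gamma>'\<in>?M. e \<gamma>' (cv \<alpha>) * E p \<gamma>' \<alpha>)"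
      using E_generated[OF g \<gamma>] by blast
    have "c (cv \<alpha>) * E p \<gamma> \<alpha> = (\<Sum>y\<in>Y. (\<Sum>\<gamma>'\<in>?M. e \<gamma>' (cv \<alpha>) * a \<gamma>' y (cv \<alpha>)) * E p y \<alpha>)" for \<alpha>
    proof -
      have "c (cv \<alpha>) * E p \<gamma> \<alpha> = (\<Sum>\<gamma>'\<in>?M. e \<gamma>' (cv \<alpha>) * (c (cv \<alpha>) * E p \<gamma>' \<alpha>))"
        unfolding e(2) sum_distrib_left by (intro sum.cong refl) (simp add: mult_ac)
      also have "\<dots> = (\<Sum>\<gamma>'\<in>?M. \<Sum>y\<in>Y. e \<gamma>' (cv \<alpha>) * a \<gamma>' y (cv \<alpha>) * E p y \<alpha>)"
        by (intro sum.cong refl) (simp only: a(2) sum_distrib_left mult.assoc)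
      also have "\<dots> = (\<Sum>y\<in>Y. (\<Sum>\<gamma>'\<in>?M. e \<gamma>' (cv \<alpha>) * a \<gamma>' y (cv \<alpha>)) * E p y \<alpha>)"
        unfolding sum_distrib_right by (rule sum.swap)
      finally show ?thesis .
    qed
    moreover have "polydeg (m + K) (\<lambda>x. \<Sum>\<gamma>'\<in>?M. e \<gamma>' x * a \<gamma>' y x)" if "y \<in> Y" for y
      by (intro polydeg_sum polydeg_mult e(1) K that)
    ultimately show ?thesis by (intro exI[of _ "\<lambda>y x. \<Sum>\<gamma>'\<in>?M. e \<gamma>' x * a \<gamma>' y x"]) simp
  qed
  then show ?thesis using c(1,2) by blast
qed

text \<open>The products of \<open>h\<close> with the \<open>E \<gamma>\<close> counted on the left
  are linearly independent, since \<open>h\<close> is nonzero at these \<gamma>. They lie in the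
  span of the products of some \<open>E y\<close> with a monomial of degree at most k + K.\<close>

lemma count_bound:
  assumes Y: "finite Y" and h: "\<And>m \<gamma>. \<gamma> \<in> lev m \<Longrightarrow> \<exists>a. (\<forall>y\<in>Y. polydeg (m + K) (a y)) \<and>
     (\<forall>\<alpha>. h (cv \<alpha>) * E p \<gamma> \<alpha> = (\<Sum>y\<in>Y. a y (cv \<alpha>) * E p y \<alpha>))"
  shows "card {\<gamma>\<in>lowlev k. h (cv \<gamma>) \<noteq> 0} \<le> card Y * card {b :: nat ^ 'd. (\<Sum>i\<in>UNIV. b $ i) \<le> k + K}"
proof (rule ccontr)
  let ?Z = "{\<gamma>\<in>lowlev k. h (cv \<gamma>) \<noteq> 0}" and ?B = "{b :: nat ^ 'd. (\<Sum>i\<in>UNIV. b $ i) \<le> k + K}"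
  have fZ: "finite ?Z" using finite_lowlev by simp
  have fB: "finite ?B"
  proof (rule finite_subset[OF _ finite_nat_vec_le])
    show "?B \<subseteq> {b. b \<le> (\<chi> i. k + K)}"
    proof
      fix b :: "nat ^ 'd" assume "b \<in> ?B"
      then have "b $ i \<le> k + K" for i using member_le_sum[of i UNIV "\<lambda>i. b $ i"] by auto
      then show "b \<in> {b. b \<le> (\<chi> i. k + K)}" by (simp add: less_eq_vec_def)
    qed
  qed
  assume "\<not> ?thesis"
  then have less: "card (Y \<times> ?B) < card ?Z" by (simp add: card_cartesian_product)
  have "\<forall>\<gamma>\<in>?Z. \<exists>q. (\<forall>y\<in>Y. \<forall>b\<in>Poly_Mapping.keys (q y). (\<Sum>i\<in>UNIV. b $ i) \<le> k + K) \<and>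
     (\<forall>\<alpha>. h (cv \<alpha>) * E p \<gamma> \<alpha> = (\<Sum>y\<in>Y. cpoly_eval (q y) (cv \<alpha>) * E p y \<alpha>))"
  proof
    fix \<gamma> assume "\<gamma> \<in> ?Z"
    then obtain m where m: "m \<le> k" "\<gamma> \<in> lev m" by (auto simp: lowlev_def)
    obtain a where a: "\<forall>y\<in>Y. polydeg (m + K) (a y)" "\<forall>\<alpha>. h (cv \<alpha>) * E p \<gamma> \<alpha> = (\<Sum>y\<in>Y. a y (cv \<alpha>) * E p y \<alpha>)"
      using h[OF m(2)] by blast
    have "\<forall>y\<in>Y. \<exists>q. a y = cpoly_eval q \<and> (\<forall>b\<in>Poly_Mapping.keys q. (\<Sum>j\<in>UNIV. b $ j) \<le> m + K)"
      using a(1) unfolding polydeg_def .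
    from bchoice[OF this] obtain q where q: "\<forall>y\<in>Y. a y = cpoly_eval (q y) \<and> (\<forall>b\<in>Poly_Mapping.keys (q y). (\<Sum>j\<in>UNIV. b $ j) \<le> m + K)" by (rule exE)
    show "\<exists>q. (\<forall>y\<in>Y. \<forall>b\<in>Poly_Mapping.keys (q y). (\<Sum>i\<in>UNIV. b $ i) \<le> k + K) \<and>
     (\<forall>\<alpha>. h (cv \<alpha>) * E p \<gamma> \<alpha> = (\<Sum>y\<in>Y. cpoly_eval (q y) (cv \<alpha>) * E p y \<alpha>))"
      using q a(2) m(1) by (intro exI[of _ q]) (fastforce intro: order_trans)
  qed
  from bchoice[OF this] obtain q where
    "\<forall>\<gamma>\<in>?Z. (\<forall>y\<in>Y. \<forall>b\<in>Poly_Mapping.keys (q \<gamma> y). (\<Sum>i\<in>UNIV. b $ i) \<le> k + K) \<and>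
     (\<forall>\<alpha>. h (cv \<alpha>) * E p \<gamma> \<alpha> = (\<Sum>y\<in>Y. cpoly_eval (q \<gamma> y) (cv \<alpha>) * E p y \<alpha>))" by (rule exE)
  then have q: "\<And>\<gamma> y. \<gamma> \<in> ?Z \<Longrightarrow> y \<in> Y \<Longrightarrow> Poly_Mapping.keys (q \<gamma> y) \<subseteq> ?B"
     "\<And>\<gamma> \<alpha>. \<gamma> \<in> ?Z \<Longrightarrow> h (cv \<alpha>) * E p \<gamma> \<alpha> = (\<Sum>y\<in>Y. cpoly_eval (q \<gamma> y) (cv \<alpha>) * E p y \<alpha>)"
    by blast+
  obtain g where g: "\<exists>\<gamma>\<in>?Z. g \<gamma> \<noteq> 0" "\<forall>s\<in>Y \<times> ?B. (\<Sum>\<gamma>\<in>?Z. g \<gamma> * Poly_Mapping.lookup (q \<gamma> (fst s)) (snd s)) = 0"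
    using more_unknowns_than_equations[OF _ fZ less, of "\<lambda>s \<gamma>. Poly_Mapping.lookup (q \<gamma> (fst s)) (snd s)"] Y fB by auto
  have "h (cv \<alpha>) * (\<Sum>\<gamma>\<in>?Z. g \<gamma> * E p \<gamma> \<alpha>) = 0" for \<alpha>
  proof -
    have "h (cv \<alpha>) * (\<Sum>\<gamma>\<in>?Z. g \<gamma> * E p \<gamma> \<alpha>) = (\<Sum>\<gamma>\<in>?Z. g \<gamma> * (h (cv \<alpha>) * E p \<gamma> \<alpha>))"
      by (simp add: sum_distrib_left mult_ac)
    also have "\<dots> = (\<Sum>\<gamma>\<in>?Z. g \<gamma> * (\<Sum>y\<in>Y. (\<Sum>b\<in>?B. Poly_Mapping.lookup (q \<gamma> y) b * monom_eval b (cv \<alpha>)) * E p y \<alpha>))"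
    proof (rule sum.cong[OF refl])
      fix \<gamma> assume \<gamma>: "\<gamma> \<in> ?Z"
      have "cpoly_eval (q \<gamma> y) (cv \<alpha>) = (\<Sum>b\<in>?B. Poly_Mapping.lookup (q \<gamma> y) b * monom_eval b (cv \<alpha>))" if "y \<in> Y" for y
        by (rule cpoly_eval_superset[OF fB q(1)[OF \<gamma> that]])
      then show "g \<gamma> * (h (cv \<alpha>) * E p \<gamma> \<alpha>) = g \<gamma> * (\<Sum>y\<in>Y. (\<Sum>b\<in>?B. Poly_Mapping.lookup (q \<gamma> y) b * monom_eval b (cv \<alpha>)) * E p y \<alpha>)"
        using q(2)[OF \<gamma>] by simp
    qed
    also have "\<dots> = (\<Sum>\<gamma>\<in>?Z. \<Sum>s\<in>Y \<times> ?B. g \<gamma> * Poly_Mapping.lookup (q \<gamma> (fst s)) (snd s) * (monom_eval (snd s) (cv \<alpha>) * E p (fst s) \<alpha>))"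
      by (intro sum.cong refl) (simp add: sum.cartesian_product' sum_distrib_left sum_distrib_right mult_ac)
    also have "\<dots> = (\<Sum>s\<in>Y \<times> ?B. (\<Sum>\<gamma>\<in>?Z. g \<gamma> * Poly_Mapping.lookup (q \<gamma> (fst s)) (snd s)) * (monom_eval (snd s) (cv \<alpha>) * E p (fst s) \<alpha>))"
      unfolding sum_distrib_right by (rule sum.swap)
    also have "\<dots> = 0" using g(2) by (intro sum.neutral) auto
    finally show ?thesis .
  qed
  from E_independent_on[OF fZ this] g(1) show False by blast
qed

end

section \<open>Holes of the semigroup\<close>

context toric
begin

text \<open>By the recurrence, multiplication by a coordinate of \<alpha> again gives a constant
  combination of the \<open>E\<close>, so polynomial coefficients can be absorbed.\<close>

lemma polyfun_mult_E:
  assumes "polyfun f"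
  shows "\<exists>G g. finite G \<and> (\<forall>\<alpha>. f (cv \<alpha>) * E p \<gamma> \<alpha> = (\<Sum>\<delta>\<in>G. g \<delta> * E p \<delta> \<alpha>))"
proof -
  define comb where "comb u \<longleftrightarrow> (\<exists>G g. finite G \<and> (\<forall>\<alpha>. u \<alpha> = (\<Sum>\<delta>\<in>G. g \<delta> * E p \<delta> \<alpha>)))" for u
  have comb_E: "comb (E p \<gamma>)" for \<gamma>
    unfolding comb_def by (rule exI[of _ "{\<gamma>}"], rule exI[of _ "\<lambda>_. 1"]) simp
  have comb_scale: "comb (\<lambda>\<alpha>. c * u \<alpha>)" if cu: "comb u" for c u
  proof -
    obtain G g where "finite G" "\<And>\<alpha>. u \<alpha> = (\<Sum>\<delta>\<in>G. g \<delta> * E p \<delta> \<alpha>)" using cu unfolding comb_def by auto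
    then show ?thesis unfolding comb_def
      by (intro exI[of _ G] exI[of _ "\<lambda>\<delta>. c * g \<delta>"]) (simp add: sum_distrib_left mult.assoc)
  qed
  have comb_add: "comb (\<lambda>\<alpha>. u \<alpha> + w \<alpha>)" if cu: "comb u" and cw: "comb w" for u w
  proof -
    obtain G g where g: "finite G" "\<And>\<alpha>. u \<alpha> = (\<Sum>\<delta>\<in>G. g \<delta> * E p \<delta> \<alpha>)" using cu unfolding comb_def by auto
    obtain H h where h: "finite H" "\<And>\<alpha>. w \<alpha> = (\<Sum>\<delta>\<in>H. h \<delta> * E p \<delta> \<alpha>)" using cw unfolding comb_def by auto
    have "u \<alpha> + w \<alpha> = (\<Sum>\<delta>\<in>G \<union> H. ((if \<delta> \<in> G then g \<delta> else 0) + (if \<delta> \<in> H then h \<delta> else 0)) * E p \<delta> \<alpha>)" for \<alpha>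
    proof -
      have "u \<alpha> = (\<Sum>\<delta>\<in>G \<union> H. (if \<delta> \<in> G then g \<delta> else 0) * E p \<delta> \<alpha>)"
        unfolding g(2) by (rule sum.mono_neutral_cong_left) (use g h in auto)
      moreover have "w \<alpha> = (\<Sum>\<delta>\<in>G \<union> H. (if \<delta> \<in> H then h \<delta> else 0) * E p \<delta> \<alpha>)"
        unfolding h(2) by (rule sum.mono_neutral_cong_left) (use g h in auto)
      ultimately show ?thesis by (simp add: distrib_right sum.distrib)
    qed
    then show ?thesis unfolding comb_def using g(1) h(1)
      by (intro exI[of _ "G \<union> H"] exI[of _ "\<lambda>\<delta>. (if \<delta> \<in> G then g \<delta> else 0) + (if \<delta> \<in> H then h \<delta> else 0)"]) simp
  qed
  have comb_0: "comb (\<lambda>\<alpha>. 0)" using comb_scale[OF comb_E, of 0] by simp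
  have comb_sum: "comb (\<lambda>\<alpha>. \<Sum>s\<in>S. u s \<alpha>)" if "\<And>s. s \<in> S \<Longrightarrow> comb (u s)" for S :: "'x set" and u
    using that by (induction S rule: infinite_finite_induct) (auto intro: comb_add comb_0)
  have "\<forall>\<gamma>. comb (\<lambda>\<alpha>. f (cv \<alpha>) * E p \<gamma> \<alpha>)"
    using assms
  proof (induction rule: polyfun_induct)
    case (const c)
    show ?case using comb_scale[OF comb_E] by blast
  next
    case (coord i)
    have "cv \<alpha> $ i * E p \<gamma> \<alpha> = (\<Sum>j\<in>UNIV. (of_int (A $ i $ j) * p $ j) * E p (\<gamma> + col j) \<alpha>) + of_int (\<gamma> $ i) * E p \<gamma> \<alpha>" for \<alpha> \<gamma>
      using E_rec[of p i \<alpha> \<gamma>] unfolding theta_def cv_nth by (simp add: left_diff_distrib mult.assoc)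
    then show ?case by (simp add: comb_add comb_sum comb_scale comb_E)
  next
    case (add f g)
    then show ?case by (simp add: distrib_right comb_add)
  next
    case (mult f g)
    show ?case
    proof
      fix \<gamma>
      obtain G h where h: "\<And>\<alpha>. g (cv \<alpha>) * E p \<gamma> \<alpha> = (\<Sum>\<delta>\<in>G. h \<delta> * E p \<delta> \<alpha>)"
        using mult.IH(2) unfolding comb_def by blast
      have "f (cv \<alpha>) * g (cv \<alpha>) * E p \<gamma> \<alpha> = (\<Sum>\<delta>\<in>G. h \<delta> * (f (cv \<alpha>) * E p \<delta> \<alpha>))" for \<alpha>
        unfolding mult.assoc h by (simp add: sum_distrib_left mult_ac)
      moreover have "comb (\<lambda>\<alpha>. \<Sum>\<delta>\<in>G. h \<delta> * (f (cv \<alpha>) * E p \<delta> \<alpha>))"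
        by (induction G rule: infinite_finite_induct) (use mult.IH(1) comb_scale comb_0 comb_add in auto)
      ultimately show "comb (\<lambda>\<alpha>. f (cv \<alpha>) * g (cv \<alpha>) * E p \<gamma> \<alpha>)" by simp
    qed
  qed
  then show ?thesis unfolding comb_def by blast
qed

text \<open>In top degree the form acts as multiplication by the Laurent polynomial \<Sum> l(a_j)
  p_j t^(a_j). A uniquely represented term of the product cannot cancel; its coefficient contains
  the sum of the p_j over all columns equal to x, which explains the condition on partial
  sums.\<close>

lemma linear_form_injective:
  assumes p: "\<And>J. J \<noteq> {} \<Longrightarrow> (\<Sum>j\<in>J. p $ j) \<noteq> 0" and l: "dotc l (cv (col j3)) \<noteq> 0"
    and G: "finite G" and z: "\<And>\<alpha>. (dotc l (cv \<alpha>) - b) * (\<Sum>\<delta>\<in>G. g \<delta> * E p \<delta> \<alpha>) = 0"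
  shows "\<forall>\<delta>\<in>G. g \<delta> = 0"
proof (rule ccontr)
  assume nz: "\<not> ?thesis"
  define G' where "G' = {\<delta>\<in>G. g \<delta> \<noteq> 0}"
  have G': "finite G'" "G' \<noteq> {}" using G nz by (auto simp: G'_def)
  define D where "D = Max ((\<lambda>\<delta>. \<delta> $ i0) ` G')"
  define Gt where "Gt = {\<delta>\<in>G'. \<delta> $ i0 = D}"
  have Dle: "\<delta> $ i0 \<le> D" if "\<delta> \<in> G'" for \<delta> unfolding D_def using G' that by (intro Max_ge) auto
  have "D \<in> (\<lambda>\<delta>. \<delta> $ i0) ` G'" unfolding D_def using G' by (intro Max_in) auto
  then have Gt: "finite Gt" "Gt \<noteq> {}" using G' by (auto simp: Gt_def)
  define Xs where "Xs = {col j | j. dotc l (cv (col j)) \<noteq> 0}"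
  have Xs: "finite Xs" "Xs \<noteq> {}" using l by (auto simp: Xs_def)
  obtain \<gamma> x where gx: "\<gamma> \<in> Gt" "x \<in> Xs" "\<And>\<gamma>' x'. \<gamma>' \<in> Gt \<Longrightarrow> x' \<in> Xs \<Longrightarrow> \<gamma>' + x' = \<gamma> + x \<Longrightarrow> \<gamma>' = \<gamma> \<and> x' = x"
    using unique_sum[OF Gt Xs] by blast
  obtain j0 where j0: "x = col j0" "dotc l (cv x) \<noteq> 0" using gx(2) by (auto simp: Xs_def)
  define H where "H = G' \<union> (\<lambda>(\<delta>, j). \<delta> + col j) ` (G' \<times> UNIV)"
  have H: "finite H" using G' by (auto simp: H_def)
  \<comment> \<open>The coefficients of the product, re-expanded in the
    \<open>E p \<epsilon>\<close>: one part in unchanged degree, one part raised by a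
    column.\<close>
  define \<kappa> where "\<kappa> \<epsilon> = (if \<epsilon> \<in> G' then g \<epsilon> * (dotc l (cv \<epsilon>) - b) else 0)
     + (\<Sum>\<delta>\<in>G'. \<Sum>j\<in>UNIV. if \<delta> + col j = \<epsilon> then g \<delta> * (dotc l (cv (col j)) * p $ j) else 0)" for \<epsilon>
  have "(\<Sum>\<epsilon>\<in>H. \<kappa> \<epsilon> * E p \<epsilon> \<alpha>) = 0" for \<alpha>
  proof -
    have s: "(\<Sum>\<delta>\<in>G. g \<delta> * E p \<delta> \<alpha>) = (\<Sum>\<delta>\<in>G'. g \<delta> * E p \<delta> \<alpha>)"
      unfolding G'_def using G by (intro sum.mono_neutral_right) auto
    have "0 = (\<Sum>\<delta>\<in>G'. g \<delta> * (dotc l (cv \<alpha>) * E p \<delta> \<alpha> - b * E p \<delta> \<alpha>))"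
      using z[of \<alpha>] unfolding s by (simp add: sum_distrib_left algebra_simps)
    also have "\<dots> = (\<Sum>\<delta>\<in>G'. g \<delta> * (dotc l (cv \<delta>) - b) * E p \<delta> \<alpha>)
        + (\<Sum>\<delta>\<in>G'. \<Sum>j\<in>UNIV. g \<delta> * (dotc l (cv (col j)) * p $ j) * E p (\<delta> + col j) \<alpha>)"
      unfolding E_rec_dotc by (simp add: sum.distrib[symmetric] algebra_simps sum_distrib_left)
    also have "(\<Sum>\<delta>\<in>G'. g \<delta> * (dotc l (cv \<delta>) - b) * E p \<delta> \<alpha>) = (\<Sum>\<epsilon>\<in>H. (if \<epsilon> \<in> G' then g \<epsilon> * (dotc l (cv \<epsilon>) - b) else 0) * E p \<epsilon> \<alpha>)"
      by (rule sum.mono_neutral_cong_left) (use H in \<open>auto simp: H_def\<close>)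
    also have "(\<Sum>\<delta>\<in>G'. \<Sum>j\<in>UNIV. g \<delta> * (dotc l (cv (col j)) * p $ j) * E p (\<delta> + col j) \<alpha>)
        = (\<Sum>\<delta>\<in>G'. \<Sum>j\<in>UNIV. \<Sum>\<epsilon>\<in>H. (if \<delta> + col j = \<epsilon> then g \<delta> * (dotc l (cv (col j)) * p $ j) else 0) * E p \<epsilon> \<alpha>)"
    proof (intro sum.cong refl)
      fix \<delta> j assume "\<delta> \<in> G'"
      then have "\<delta> + col j \<in> H" by (auto simp: H_def)
      then show "g \<delta> * (dotc l (cv (col j)) * p $ j) * E p (\<delta> + col j) \<alpha> = (\<Sum>\<epsilon>\<in>H. (if \<delta> + col j = \<epsilon> then g \<delta> * (dotc l (cv (col j)) * p $ j) else 0) * E p \<epsilon> \<alpha>)"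
        using H by (simp add: if_distrib[of "\<lambda>c. c * _"] cong: if_cong)
    qed
    also have "\<dots> = (\<Sum>\<epsilon>\<in>H. (\<Sum>\<delta>\<in>G'. \<Sum>j\<in>UNIV. if \<delta> + col j = \<epsilon> then g \<delta> * (dotc l (cv (col j)) * p $ j) else 0) * E p \<epsilon> \<alpha>)"
      unfolding sum_distrib_right by (rule trans[OF sum.cong[OF refl sum.swap] sum.swap])
    finally show ?thesis unfolding \<kappa>_def distrib_right sum.distrib by simp
  qed
  moreover have "\<gamma> + x \<in> H"
    unfolding H_def using gx(1) j0(1) by (intro UnI2 image_eqI[of _ _ "(\<gamma>, j0)"]) (auto simp: Gt_def)
  ultimately have "\<kappa> (\<gamma> + x) = 0" using E_independent[OF H] by blast
  moreover have "\<gamma> + x \<notin> G'"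
  proof
    assume "\<gamma> + x \<in> G'"
    from Dle[OF this] show False using gx(1) by (simp add: Gt_def j0(1) col_nth ones)
  qed
  moreover have "(\<Sum>\<delta>\<in>G'. \<Sum>j\<in>UNIV. if \<delta> + col j = \<gamma> + x then g \<delta> * (dotc l (cv (col j)) * p $ j) else 0)
      = (\<Sum>\<delta>\<in>G'. \<Sum>j\<in>UNIV. if \<delta> = \<gamma> \<and> col j = x then g \<gamma> * (dotc l (cv x) * p $ j) else 0)"
  proof (intro sum.cong refl)
    fix \<delta> j assume \<delta>: "\<delta> \<in> G'"
    show "(if \<delta> + col j = \<gamma> + x then g \<delta> * (dotc l (cv (col j)) * p $ j) else 0) = (if \<delta> = \<gamma> \<and> col j = x then g \<gamma> * (dotc l (cv x) * p $ j) else 0)"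
    proof (cases "\<delta> + col j = \<gamma> + x \<and> dotc l (cv (col j)) \<noteq> 0")
      case True
      then have "(\<delta> + col j) $ i0 = (\<gamma> + x) $ i0" by simp
      then have "\<delta> $ i0 = D" using gx(1) by (simp add: col_nth ones j0(1) Gt_def)
      then have "\<delta> \<in> Gt" "col j \<in> Xs" using \<delta> True by (auto simp: Gt_def Xs_def)
      then have "\<delta> = \<gamma> \<and> col j = x" using gx(3) True by blast
      then show ?thesis by simp
    next
      case False
      then show ?thesis using j0(2) by auto
    qed
  qed
  moreover have "\<dots> = (\<Sum>\<delta>\<in>G'. if \<delta> = \<gamma> then (\<Sum>j | col j = x. g \<gamma> * (dotc l (cv x) * p $ j)) else 0)"
    by (intro sum.cong refl) (simp add: sum.If_cases Collect_conj_eq)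
  moreover have "\<dots> = g \<gamma> * dotc l (cv x) * (\<Sum>j | col j = x. p $ j)"
    using gx(1) G' by (simp add: Gt_def sum_distrib_left mult.assoc)
  ultimately have "g \<gamma> * dotc l (cv x) * (\<Sum>j | col j = x. p $ j) = 0" unfolding \<kappa>_def by simp
  moreover have "(\<Sum>j | col j = x. p $ j) \<noteq> 0" by (rule p) (use j0 in auto)
  ultimately show False using gx(1) j0(2) by (auto simp: Gt_def G'_def)
qed

text \<open>Freeness enters as \<open>indep\<close>: comparing the coordinates a of z1 E and b of z2
  E it yields z2 a = z1 b. What remains is division by z1, and evaluation at the translates of
  \<open>\<gamma>0\<close> by sums of columns in \<open>F\<close>, where every \<open>E p y\<close>
  vanishes but \<open>E p \<gamma>0\<close> does not.\<close>

lemma hole_contradiction: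
  assumes p: "\<And>J. J \<noteq> {} \<Longrightarrow> (\<Sum>j\<in>J. p $ j) \<noteq> 0"
    and Y: "finite Y" "Y \<subseteq> NA" and c: "polyfun c" "c \<beta> \<noteq> 0"
    and span: "\<And>\<gamma>. \<gamma> \<in> NA \<Longrightarrow> polyspan cv (E p) Y (\<lambda>\<alpha>. c (cv \<alpha>) * E p \<gamma> \<alpha>)"
    and indep: "\<And>f. (\<And>y. y \<in> Y \<Longrightarrow> polyfun (f y)) \<Longrightarrow> (\<And>\<alpha>. (\<Sum>y\<in>Y. f y (cv \<alpha>) * E p y \<alpha>) = 0) \<Longrightarrow> \<forall>y\<in>Y. \<forall>x. f y x = 0"
    and F: "\<And>j. j \<in> F \<Longrightarrow> dotc l1 (cv (col j)) = 0" "\<And>j. j \<in> F \<Longrightarrow> dotc l2 (cv (col j)) = 0"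
    and l1: "dotc l1 (cv (col j3)) = 1" "dotc l1 (cv (col j4)) = 0" and l2: "dotc l2 (cv (col j4)) = 1"
    and near: "\<And>j. j \<notin> F \<Longrightarrow> \<gamma>0 + col j \<in> NA"
    and hole: "\<And>m. (\<And>j. j \<notin> F \<Longrightarrow> m $ j = 0) \<Longrightarrow> \<gamma>0 + wt m \<notin> NA"
    and uniq: "\<And>m n. (\<And>j. j \<notin> F \<Longrightarrow> m $ j = 0) \<Longrightarrow> wt n = wt m \<Longrightarrow> n = m"
    and \<beta>: "\<beta> = cv \<gamma>0 + (\<Sum>j\<in>F. s j *s cv (col j))"
  shows False
proof -
  define z1 where "z1 x = dotc l1 x - dotc l1 \<beta>" for x
  define z2 where "z2 x = dotc l2 x - dotc l2 \<beta>" for x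
  have pz: "polyfun z1" "polyfun z2"
    unfolding z1_def[abs_def] z2_def[abs_def] by (intro polyfun_diff polyfun_dotc polyfun_const)+
  have lb: "dotc l \<beta> = dotc l (cv \<gamma>0)" if "\<And>j. j \<in> F \<Longrightarrow> dotc l (cv (col j)) = 0" for l
    unfolding \<beta> dotc_add dotc_sum dotc_scale using that by simp
  have sp: "polyspan cv (E p) Y (\<lambda>\<alpha>. c (cv \<alpha>) * ((dotc l (cv \<alpha>) - dotc l \<beta>) * E p \<gamma>0 \<alpha>))"
    if l: "\<And>j. j \<in> F \<Longrightarrow> dotc l (cv (col j)) = 0" for l
  proof -
    have "(dotc l (cv \<alpha>) - dotc l \<beta>) * E p \<gamma>0 \<alpha> = (\<Sum>j\<in>-F. dotc l (cv (col j)) * p $ j * E p (\<gamma>0 + col j) \<alpha>)" for \<alpha>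
    proof -
      have "(dotc l (cv \<alpha>) - dotc l \<beta>) * E p \<gamma>0 \<alpha> = (\<Sum>j\<in>UNIV. dotc l (cv (col j)) * p $ j * E p (\<gamma>0 + col j) \<alpha>)"
        using E_rec_dotc[of l \<alpha> p \<gamma>0] lb[OF l] by (simp add: left_diff_distrib)
      also have "\<dots> = (\<Sum>j\<in>-F. dotc l (cv (col j)) * p $ j * E p (\<gamma>0 + col j) \<alpha>)"
        by (rule sum.mono_neutral_right) (auto simp: l)
      finally show ?thesis .
    qed
    then have "(\<lambda>\<alpha>. c (cv \<alpha>) * ((dotc l (cv \<alpha>) - dotc l \<beta>) * E p \<gamma>0 \<alpha>))
       = (\<lambda>\<alpha>. \<Sum>j\<in>-F. (\<lambda>x. dotc l (cv (col j)) * p $ j) (cv \<alpha>) * (c (cv \<alpha>) * E p (\<gamma>0 + col j) \<alpha>))"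
      by (simp add: fun_eq_iff sum_distrib_left mult_ac)
    moreover have "polyspan cv (E p) Y (\<lambda>\<alpha>. \<Sum>j\<in>-F. (\<lambda>x. dotc l (cv (col j)) * p $ j) (cv \<alpha>) * (c (cv \<alpha>) * E p (\<gamma>0 + col j) \<alpha>))"
      by (rule polyspan_sum, rule polyspan_mult[OF span polyfun_const], rule near) simp
    ultimately show ?thesis by simp
  qed
  obtain a where a: "\<forall>y\<in>Y. polyfun (a y)" "\<And>\<alpha>. c (cv \<alpha>) * (z1 (cv \<alpha>) * E p \<gamma>0 \<alpha>) = (\<Sum>y\<in>Y. a y (cv \<alpha>) * E p y \<alpha>)"
    using sp[OF F(1)] unfolding polyspan_def z1_def by auto
  obtain b where b: "\<forall>y\<in>Y. polyfun (b y)" "\<And>\<alpha>. c (cv \<alpha>) * (z2 (cv \<alpha>) * E p \<gamma>0 \<alpha>) = (\<Sum>y\<in>Y. b y (cv \<alpha>) * E p y \<alpha>)"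
    using sp[OF F(2)] unfolding polyspan_def z2_def by auto
  have "\<forall>y\<in>Y. \<forall>x. z2 x * a y x - z1 x * b y x = 0"
  proof (rule indep[of "\<lambda>y x. z2 x * a y x - z1 x * b y x"])
    show "polyfun (\<lambda>x. z2 x * a y x - z1 x * b y x)" if "y \<in> Y" for y
      using a b pz that by (intro polyfun_diff polyfun_mult) auto
    show "(\<Sum>y\<in>Y. (z2 (cv \<alpha>) * a y (cv \<alpha>) - z1 (cv \<alpha>) * b y (cv \<alpha>)) * E p y \<alpha>) = 0" for \<alpha>
    proof -
      have "(\<Sum>y\<in>Y. (z2 (cv \<alpha>) * a y (cv \<alpha>) - z1 (cv \<alpha>) * b y (cv \<alpha>)) * E p y \<alpha>)
         = z2 (cv \<alpha>) * (\<Sum>y\<in>Y. a y (cv \<alpha>) * E p y \<alpha>) - z1 (cv \<alpha>) * (\<Sum>y\<in>Y. b y (cv \<alpha>) * E p y \<alpha>)"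
        by (simp add: sum_distrib_left left_diff_distrib sum_subtractf mult.assoc)
      then show ?thesis unfolding a(2)[symmetric] b(2)[symmetric] by simp
    qed
  qed
  then have zab: "z2 x * a y x = z1 x * b y x" if "y \<in> Y" for y x using that by auto
  \<comment> \<open>On the hyperplane z1 = 0 the equation reads z2 a = 0. Moving along column
    \<open>j4\<close> keeps z1 at 0 and changes z2, so a vanishes on the whole line.\<close>
  have van: "a y x = 0" if y: "y \<in> Y" and x: "dotc l1 x = dotc l1 \<beta>" for y x
  proof -
    let ?v = "cv (col j4)"
    obtain P where P: "\<And>t. a y (x + t *s ?v) = poly P t" using polyfun_line[of "a y" x ?v] a(1) y by blast
    have "(t + z2 x) * poly P t = 0" for t
    proof -
      have "z2 (x + t *s ?v) = t + z2 x" by (simp add: z2_def dotc_add dotc_scale l2)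
      moreover have "z1 (x + t *s ?v) = 0" by (simp add: z1_def dotc_add dotc_scale l1 x)
      ultimately show ?thesis using zab[OF y, of "x + t *s ?v"] by (simp add: P)
    qed
    moreover have "poly ([:z2 x, 1:] * P) t = (t + z2 x) * poly P t" for t
      unfolding poly_mult by (simp add: add.commute)
    ultimately have "poly ([:z2 x, 1:] * P) t = 0" for t by simp
    then have "[:z2 x, 1:] * P = 0" using poly_all_0_iff_0 by blast
    moreover have "[:z2 x, 1:] \<noteq> 0" by simp
    ultimately have "P = 0" using mult_eq_0_iff by blast
    then show ?thesis using P[of 0] by simp
  qed
  have "\<exists>i. l1 $ i \<noteq> 0"
  proof (rule ccontr)
    assume "\<nexists>i. l1 $ i \<noteq> 0"
    then have "dotc l1 (cv (col j3)) = 0" by (simp add: dotc_def)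
    then show False using l1(1) by simp
  qed
  then obtain i where i: "l1 $ i \<noteq> 0" by blast
  have "\<forall>y\<in>Y. \<exists>h. polyfun h \<and> (\<forall>x. a y x = z1 x * h x)"
  proof
    fix y assume y: "y \<in> Y"
    have "\<exists>h. polyfun h \<and> (\<forall>x. a y x = ((\<Sum>i\<in>UNIV. l1 $ i * x $ i) - dotc l1 \<beta>) * h x)"
      by (rule polyfun_vanish_on_hyperplane[OF _ i]) (use a(1) y van[OF y] in \<open>auto simp: dotc_def\<close>)
    then show "\<exists>h. polyfun h \<and> (\<forall>x. a y x = z1 x * h x)" unfolding z1_def dotc_def .
  qed
  from bchoice[OF this] obtain h where "\<forall>y\<in>Y. polyfun (h y) \<and> (\<forall>x. a y x = z1 x * h y x)" by (rule exE)
  then have h: "\<And>y. y \<in> Y \<Longrightarrow> polyfun (h y)" "\<And>y x. y \<in> Y \<Longrightarrow> a y x = z1 x * h y x" by auto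
  \<comment> \<open>The relation that would put \<open>c\<close> times \<open>E p \<gamma>0\<close>
    into the module. It is annihilated by z1, and multiplication by z1 is injective on such
    combinations.\<close>
  define u where "u \<alpha> = c (cv \<alpha>) * E p \<gamma>0 \<alpha> - (\<Sum>y\<in>Y. h y (cv \<alpha>) * E p y \<alpha>)" for \<alpha>
  have zu: "z1 (cv \<alpha>) * u \<alpha> = 0" for \<alpha>
  proof -
    have "(\<Sum>y\<in>Y. a y (cv \<alpha>) * E p y \<alpha>) = z1 (cv \<alpha>) * (\<Sum>y\<in>Y. h y (cv \<alpha>) * E p y \<alpha>)"
      unfolding sum_distrib_left by (rule sum.cong) (simp_all add: h(2) mult.assoc)
    then show ?thesis using a(2)[of \<alpha>] unfolding u_def by (simp add: right_diff_distrib mult_ac)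
  qed
  define f where "f y = (if y = \<gamma>0 then c else (\<lambda>x. 0))" for y :: "int ^ 'd"
  define f' where "f' y x = f y x - (if y \<in> Y then h y x else 0)" for y x
  have ff: "polyfun (f' y)" if "y \<in> insert \<gamma>0 Y" for y
    using that h(1)[of y] c(1) unfolding f'_def[abs_def] f_def by (cases "y \<in> Y") (auto intro!: polyfun_diff polyfun_uminus polyfun_const)
  have ue: "u \<alpha> = (\<Sum>y\<in>insert \<gamma>0 Y. f' y (cv \<alpha>) * E p y \<alpha>)" for \<alpha>
  proof -
    have "(\<Sum>y\<in>insert \<gamma>0 Y. f y (cv \<alpha>) * E p y \<alpha>) = c (cv \<alpha>) * E p \<gamma>0 \<alpha>"
      using Y(1) by (subst sum.remove[of _ \<gamma>0]) (auto simp: f_def intro!: sum.neutral)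
    moreover have "(\<Sum>y\<in>insert \<gamma>0 Y. (if y \<in> Y then h y (cv \<alpha>) else 0) * E p y \<alpha>) = (\<Sum>y\<in>Y. h y (cv \<alpha>) * E p y \<alpha>)"
      using Y(1) by (intro sum.mono_neutral_cong_right) auto
    ultimately show ?thesis unfolding u_def f'_def by (simp only: left_diff_distrib sum_subtractf)
  qed
  have comb: "\<exists>G g. finite G \<and> (\<forall>\<alpha>. (\<Sum>y\<in>S. f' y (cv \<alpha>) * E p y \<alpha>) = (\<Sum>\<delta>\<in>G. g \<delta> * E p \<delta> \<alpha>))" if "finite S" "S \<subseteq> insert \<gamma>0 Y" for S
    using that
  proof (induction S rule: finite_induct)
    case empty
    show ?case by (intro exI[of _ "{}"]) simp
  next
    case (insert y S)
    then obtain G g where g: "finite G" "\<And>\<alpha>. (\<Sum>y\<in>S. f' y (cv \<alpha>) * E p y \<alpha>) = (\<Sum>\<delta>\<in>G. g \<delta> * E p \<delta> \<alpha>)" by auto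
    obtain H k where k: "finite H" "\<And>\<alpha>. f' y (cv \<alpha>) * E p y \<alpha> = (\<Sum>\<delta>\<in>H. k \<delta> * E p \<delta> \<alpha>)"
      using polyfun_mult_E[OF ff[of y], of p y] insert.prems by blast
    have "(\<Sum>y\<in>insert y S. f' y (cv \<alpha>) * E p y \<alpha>) = (\<Sum>\<delta>\<in>G \<union> H. ((if \<delta> \<in> G then g \<delta> else 0) + (if \<delta> \<in> H then k \<delta> else 0)) * E p \<delta> \<alpha>)" for \<alpha>
    proof -
      have 1: "(\<Sum>\<delta>\<in>G. g \<delta> * E p \<delta> \<alpha>) = (\<Sum>\<delta>\<in>G \<union> H. (if \<delta> \<in> G then g \<delta> else 0) * E p \<delta> \<alpha>)"
        by (rule sum.mono_neutral_cong_left) (use g k in auto)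
      have 2: "(\<Sum>\<delta>\<in>H. k \<delta> * E p \<delta> \<alpha>) = (\<Sum>\<delta>\<in>G \<union> H. (if \<delta> \<in> H then k \<delta> else 0) * E p \<delta> \<alpha>)"
        by (rule sum.mono_neutral_cong_left) (use g k in auto)
      show ?thesis using insert.hyps by (simp add: g(2) k(2) 1 2 distrib_right sum.distrib)
    qed
    then show ?case using g(1) k(1)
      by (intro exI[of _ "G \<union> H"] exI[of _ "\<lambda>\<delta>. (if \<delta> \<in> G then g \<delta> else 0) + (if \<delta> \<in> H then k \<delta> else 0)"]) simp
  qed
  have "\<exists>G g. finite G \<and> (\<forall>\<alpha>. u \<alpha> = (\<Sum>\<delta>\<in>G. g \<delta> * E p \<delta> \<alpha>))"
    unfolding ue by (rule comb) (use Y(1) in auto)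
  then obtain G g where g: "finite G" "\<And>\<alpha>. u \<alpha> = (\<Sum>\<delta>\<in>G. g \<delta> * E p \<delta> \<alpha>)"
    by (elim exE conjE) simp
  have "\<forall>\<delta>\<in>G. g \<delta> = 0"
  proof (rule linear_form_injective[OF p _ g(1), of l1 j3 "dotc l1 \<beta>"])
    show "dotc l1 (cv (col j3)) \<noteq> 0" using l1(1) by simp
    show "(dotc l1 (cv \<alpha>) - dotc l1 \<beta>) * (\<Sum>\<delta>\<in>G. g \<delta> * E p \<delta> \<alpha>) = 0" for \<alpha>
      using zu[of \<alpha>] unfolding g(2) z1_def .
  qed
  then have u0: "u \<alpha> = 0" for \<alpha> unfolding g(2) by simp
  \<comment> \<open>A nonzero \<open>E p y\<close> at this point would place the point in y + NA,
    against the hole; and by \<open>uniq\<close> the exponent \<open>m\<close> alone contributes to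
    \<open>E p \<gamma>0\<close> there.\<close>
  have cz: "c (cv (\<gamma>0 + wt m)) = 0" if m: "\<And>j. j \<notin> F \<Longrightarrow> m $ j = 0" for m
  proof -
    let ?\<alpha> = "\<gamma>0 + wt m"
    have "E p y ?\<alpha> = 0" if "y \<in> Y" for y
      unfolding E_def
    proof (rule E0_notin, rule notI)
      assume "?\<alpha> - y \<in> NA"
      then have "?\<alpha> - y + y \<in> NA" using that Y(2) by (intro NA_add) auto
      then show False using hole[OF m] by simp
    qed
    then have "c (cv ?\<alpha>) * E p \<gamma>0 ?\<alpha> = 0" using u0[of ?\<alpha>] unfolding u_def by simp
    moreover have "E p \<gamma>0 ?\<alpha> = mfac p m"
    proof -
      have "{n. wt n = wt m} = {m}" using uniq[OF m] by auto
      then show ?thesis by (simp add: E_def E0_def)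
    qed
    moreover have "p $ j \<noteq> 0" for j using p[of "{j}"] by simp
    then have "mfac p m \<noteq> 0" by (simp add: mfac_def monom_eval_def)
    ultimately show ?thesis by simp
  qed
  \<comment> \<open>Natural coefficients are Zariski dense, so \<open>c\<close> vanishes on all of
    \<open>\<gamma>0\<close> plus the complex span of the columns in \<open>F\<close>, which
    contains \<open>\<beta>\<close>.\<close>
  define C where "C x = c (cv \<gamma>0 + (\<Sum>j\<in>F. x $ j *s cv (col j)))" for x :: "complex ^ 'n"
  have "polyfun C"
    unfolding C_def[abs_def] using c(1)
  proof (induction rule: polyfun_induct)
    case (coord i)
    have "(cv \<gamma>0 + (\<Sum>j\<in>F. x $ j *s cv (col j))) $ i = cv \<gamma>0 $ i + (\<Sum>j\<in>F. x $ j * cv (col j) $ i)" for x :: "complex ^ 'n"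
      by simp
    then show ?case by (simp only:) (intro polyfun_add polyfun_sum polyfun_mult polyfun_const polyfun_coord)
  qed (auto intro: polyfun_const polyfun_add polyfun_mult)
  moreover have "C (\<chi> j. of_nat (n $ j)) = 0" for n :: "nat ^ 'n"
  proof -
    define m where "m = (\<chi> j. if j \<in> F then n $ j else 0)"
    have "cv (\<gamma>0 + wt m) = cv \<gamma>0 + (\<Sum>j\<in>F. of_nat (n $ j) *s cv (col j))"
    proof (subst vec_eq_iff, intro allI)
      fix i
      have "(\<Sum>j\<in>UNIV. A $ i $ j * int (m $ j)) = (\<Sum>j\<in>F. A $ i $ j * int (n $ j))"
        by (rule sum.mono_neutral_cong_right) (auto simp: m_def)
      then show "cv (\<gamma>0 + wt m) $ i = (cv \<gamma>0 + (\<Sum>j\<in>F. of_nat (n $ j) *s cv (col j))) $ i"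
        by (simp add: cv_nth wt_nth col_nth mult.commute)
    qed
    moreover have "c (cv (\<gamma>0 + wt m)) = 0" by (rule cz) (simp add: m_def)
    ultimately show ?thesis by (simp add: C_def)
  qed
  ultimately have "C (\<chi> j. s j) = 0" by (rule polyfun_vanish_nat)
  then show False using c(2) unfolding \<beta> C_def by simp
qed

end

section \<open>Volume and lattice points\<close>

lemma card_bounded_exponents: "card {b :: nat ^ 'd::finite. (\<Sum>i\<in>UNIV. b $ i) \<le> m} \<le> (m + CARD('d)) choose CARD('d)"
proof -
  have "finite {b :: nat ^ 'd. (\<forall>i. i \<notin> I \<longrightarrow> b $ i = 0) \<and> (\<Sum>i\<in>I. b $ i) \<le> m} \<and>
     card {b :: nat ^ 'd. (\<forall>i. i \<notin> I \<longrightarrow> b $ i = 0) \<and> (\<Sum>i\<in>I. b $ i) \<le> m} \<le> (m + card I) choose card I" if "finite I" for I m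
    using that
  proof (induction I arbitrary: m rule: finite_induct)
    case empty
    have "{b :: nat ^ 'd. (\<forall>i. i \<notin> {} \<longrightarrow> b $ i = 0) \<and> (\<Sum>i\<in>{}. b $ i) \<le> m} = {0}" by (auto simp: vec_eq_iff)
    then show ?case by simp
  next
    case (insert i I)
    define T where "T I m = {b :: nat ^ 'd. (\<forall>i. i \<notin> I \<longrightarrow> b $ i = 0) \<and> (\<Sum>i\<in>I. b $ i) \<le> m}" for I m
    have sub: "T (insert i I) m \<subseteq> (\<Union>t\<le>m. (\<lambda>b. b + axis i t) ` T I (m - t))"
    proof
      fix b assume b: "b \<in> T (insert i I) m"
      define b' where "b' = (\<chi> k. if k = i then 0 else b $ k)"
      have "(\<Sum>k\<in>I. b' $ k) = (\<Sum>k\<in>I. b $ k)" using insert.hyps by (intro sum.cong) (auto simp: b'_def)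
      then have "b' \<in> T I (m - b $ i)" "b $ i \<le> m" using b insert.hyps by (auto simp: T_def b'_def)
      moreover have "b = b' + axis i (b $ i)" by (simp add: vec_eq_iff b'_def axis_def)
      ultimately show "b \<in> (\<Union>t\<le>m. (\<lambda>b. b + axis i t) ` T I (m - t))" by auto
    qed
    have IH: "finite (T I k)" "card (T I k) \<le> (k + card I) choose card I" for k
      using insert.IH[of k] unfolding T_def by auto
    have fin: "finite (\<Union>t\<le>m. (\<lambda>b. b + axis i t) ` T I (m - t))" using IH by auto
    have "card (T (insert i I) m) \<le> card (\<Union>t\<le>m. (\<lambda>b. b + axis i t) ` T I (m - t))"
      by (rule card_mono[OF fin sub])
    also have "\<dots> \<le> (\<Sum>t\<le>m. card ((\<lambda>b. b + axis i t) ` T I (m - t)))" by (rule card_UN_le) simp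
    also have "\<dots> \<le> (\<Sum>t\<le>m. (m - t + card I) choose card I)"
      by (intro sum_mono order_trans[OF card_image_le] IH)
    also have "\<dots> = (\<Sum>t\<le>m. (t + card I) choose card I)"
      by (rule sum.reindex_bij_witness[of _ "\<lambda>t. m - t" "\<lambda>t. m - t"]) auto
    also have "\<dots> = (m + card (insert i I)) choose card (insert i I)"
      using choose_rising_sum(1)[of "card I" m] insert.hyps by (simp add: add.commute)
    finally show ?case using finite_subset[OF sub fin] unfolding T_def by blast
  qed
  from this[of UNIV m] show ?thesis by simp
qed

text \<open>Telescoping of (T + 1)^d - T^d \<le> d (T + 1)^(d - 1).\<close>

lemma sum_powers_ge: "d > 0 \<Longrightarrow> real T ^ d / d \<le> (\<Sum>M=1..T. real M ^ (d - 1))"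
proof (induction T)
  case (Suc T)
  let ?x = "real T"
  have d: "real d > 0" using Suc.prems by simp
  obtain e where e: "d = Suc e" using Suc.prems by (cases d) auto
  have "(?x + 1) ^ d - ?x ^ d = ((?x + 1) - ?x) * (\<Sum>p<d. (?x + 1) ^ p * ?x ^ (e - p))"
    unfolding e by (rule diff_power_eq_sum)
  also have "\<dots> = (\<Sum>p<d. (?x + 1) ^ p * ?x ^ (e - p))" by simp
  also have "\<dots> \<le> (\<Sum>p<d. (?x + 1) ^ e)"
  proof (rule sum_mono)
    fix p assume "p \<in> {..<d}"
    then have "e = p + (e - p)" using e by auto
    then have eq: "(?x + 1) ^ e = (?x + 1) ^ p * (?x + 1) ^ (e - p)" by (metis power_add)
    show "(?x + 1) ^ p * ?x ^ (e - p) \<le> (?x + 1) ^ e"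
      unfolding eq by (intro mult_left_mono power_mono) auto
  qed
  also have "\<dots> = real d * (?x + 1) ^ e" by simp
  finally have "(?x + 1) ^ d \<le> real d * (?x + 1) ^ e + ?x ^ d" by linarith
  then have "(?x + 1) ^ d / d \<le> (real d * (?x + 1) ^ e + ?x ^ d) / d" by (rule divide_right_mono) simp
  also have "\<dots> = (?x + 1) ^ e + ?x ^ d / d" unfolding add_divide_distrib using d by simp
  also have "\<dots> \<le> (?x + 1) ^ e + (\<Sum>M=1..T. real M ^ (d - 1))" using Suc.IH Suc.prems by linarith
  also have "\<dots> = (\<Sum>M=1..Suc T. real M ^ (d - 1))" by (simp add: e add.commute)
  finally show ?case by (simp only: of_nat_Suc add.commute)
qed (simp add: zero_power)

text \<open>Divide by T^d and let T tend to infinity; the variable in \<open>?g\<close> is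
  1/T.\<close>

lemma leading_coeff_le:
  fixes v r :: real
  assumes d: "d > 0" and h: "\<And>T::nat. T \<ge> 1 \<Longrightarrow> v * real T ^ d \<le> r * (real T + c) ^ d + e * (a * real T + b) ^ (d - 1)"
  shows "v \<le> r"
proof -
  let ?g = "\<lambda>t. r * (1 + c * t) ^ d + e * (a + b * t) ^ (d - 1) * t"
  have lim: "filterlim (\<lambda>T. ?g (inverse (real T))) (nhds (?g 0)) sequentially"
    by (intro tendsto_add tendsto_mult tendsto_power tendsto_const lim_inverse_n)
  have "\<forall>\<^sub>F T in sequentially. v \<le> ?g (inverse (real T))"
  proof (rule eventually_sequentiallyI[of 1])
    fix T :: nat assume T: "T \<ge> 1"
    have T0: "real T > 0" using T by simp
    define t where "t = inverse (real T)"
    have tT: "t * real T = 1" using T0 by (simp add: t_def)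
    have 1: "real T + c = (1 + c * t) * real T" using tT by (simp add: distrib_right)
    have 2: "a * real T + b = (a + b * t) * real T" using tT by (simp add: distrib_right)
    have 3: "real T ^ (d - 1) = t * real T ^ d" using tT d by (cases d) (simp_all add: mult.assoc[symmetric])
    have "v * real T ^ d \<le> r * ((1 + c * t) ^ d * real T ^ d) + e * ((a + b * t) ^ (d - 1) * (t * real T ^ d))"
      using h[OF T] unfolding 1 2 power_mult_distrib 3 .
    also have "\<dots> = ?g t * real T ^ d" unfolding distrib_right mult.assoc ..
    finally show "v \<le> ?g (inverse (real T))"
      unfolding t_def[symmetric] by (rule mult_right_le_imp_le) (use T0 in simp)
  qed
  then have "v \<le> ?g 0" by (rule tendsto_lowerbound[OF lim]) simp
  then show ?thesis by simp
qed

section \<open>Lattice points in the cone over the convex hull\<close>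

context toric
begin

definition hull_volume :: real where
  "hull_volume = measure (\<Pi>\<^sub>M i\<in>-{i0}. lborel)
       ((\<lambda>x. restrict (\<lambda>i. x $ i) (-{i0})) ` (convex hull columns (map_matrix real_of_int A)))"

lemma hull_point:
  assumes "x \<in> convex hull columns (map_matrix real_of_int A)"
  shows "\<exists>r. (\<forall>j. r j \<ge> 0) \<and> (\<Sum>j\<in>UNIV. r j) = 1 \<and> (\<forall>i. x $ i = (\<Sum>j\<in>UNIV. real_of_int (A $ i $ j) * r j))"
proof -
  let ?C = "{x :: real ^ 'd. \<exists>r. (\<forall>j. r j \<ge> 0) \<and> (\<Sum>j\<in>UNIV. r j) = 1 \<and> (\<forall>i. x $ i = (\<Sum>j\<in>UNIV. real_of_int (A $ i $ j) * r j))}"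
  have "convex hull columns (map_matrix real_of_int A) \<subseteq> ?C"
  proof (rule hull_minimal)
    show "columns (map_matrix real_of_int A) \<subseteq> ?C"
    proof
      fix x assume "x \<in> columns (map_matrix real_of_int A)"
      then obtain j where "x = column j (map_matrix real_of_int A)" by (auto simp: columns_def)
      then show "x \<in> ?C"
        by (intro CollectI exI[of _ "\<lambda>k. if k = j then 1 else 0"])
           (simp add: column_def map_matrix_def mult_delta_right)
    qed
    show "convex ?C"
    proof (rule convexI)
      fix x y :: "real ^ 'd" and u v :: real
      assume "x \<in> ?C" "y \<in> ?C" and uv: "0 \<le> u" "0 \<le> v" "u + v = 1"
      then obtain r s where r: "\<forall>j. r j \<ge> 0" "(\<Sum>j\<in>UNIV. r j) = 1" "\<forall>i. x $ i = (\<Sum>j\<in>UNIV. real_of_int (A $ i $ j) * r j)"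
        and s: "\<forall>j. s j \<ge> 0" "(\<Sum>j\<in>UNIV. s j) = 1" "\<forall>i. y $ i = (\<Sum>j\<in>UNIV. real_of_int (A $ i $ j) * s j)" by auto
      show "u *\<^sub>R x + v *\<^sub>R y \<in> ?C"
      proof (intro CollectI exI[of _ "\<lambda>j. u * r j + v * s j"] conjI allI)
        show "0 \<le> u * r j + v * s j" for j using r(1) s(1) uv by simp
        show "(\<Sum>j\<in>UNIV. u * r j + v * s j) = 1"
          by (simp add: sum.distrib sum_distrib_left[symmetric] r(2) s(2) uv(3))
        fix i
        have "(\<Sum>j\<in>UNIV. real_of_int (A $ i $ j) * (u * r j + v * s j)) =
            (\<Sum>j\<in>UNIV. u * (real_of_int (A $ i $ j) * r j) + v * (real_of_int (A $ i $ j) * s j))"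
          by (intro sum.cong refl) (simp add: distrib_left)
        also have "\<dots> = (u *\<^sub>R x + v *\<^sub>R y) $ i"
          by (simp add: sum.distrib sum_distrib_left[symmetric] r(3)[rule_format] s(3)[rule_format])
        finally show "(u *\<^sub>R x + v *\<^sub>R y) $ i = (\<Sum>j\<in>UNIV. real_of_int (A $ i $ j) * (u * r j + v * s j))" by simp
      qed
    qed
  qed
  from subsetD[OF this assms] show ?thesis by (rule CollectD)
qed

text \<open>Rounding down leaves the cone only by a bounded amount; the shift \<open>U\<close> compensates for it.\<close>
lemma lattice_points:
  assumes surj: "surj (\<lambda>u :: int ^ 'n. A *v u)"
  shows "\<exists>U :: nat. \<forall>M :: nat. \<forall>r. (\<forall>j. r j \<ge> 0) \<and> (\<Sum>j\<in>UNIV. r j) = 1 \<longrightarrow>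
     (\<chi> i. \<lfloor>M * (\<Sum>j\<in>UNIV. real_of_int (A $ i $ j) * r j)\<rfloor>) + wt (\<chi> j. U) \<in> lev (M + CARD('n) * U)"
proof -
  \<comment> \<open>A section of the surjection onto the lattice. It is applied only to unit vectors
    and to finitely many error vectors, hence with bounded values.\<close>
  define up :: "int ^ 'd \<Rightarrow> int ^ 'n" where "up \<phi> = (SOME u. A *v u = \<phi>)" for \<phi>
  have up: "A *v up \<phi> = \<phi>" for \<phi>
    unfolding up_def by (rule someI_ex) (use surjD[OF surj, of \<phi>] in auto)
  have upn: "(\<Sum>j\<in>UNIV. A $ i $ j * up \<phi> $ j) = \<phi> $ i" for i \<phi>
  proof -
    have "(A *v up \<phi>) $ i = \<phi> $ i" by (simp only: up)
    then show ?thesis by (simp add: matrix_vector_mult_def)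
  qed
  define w where "w i = up (axis i 1)" for i
  define a where "a = (\<Sum>i\<in>UNIV. \<Sum>j\<in>UNIV. \<bar>A $ i $ j\<bar>)"
  define \<tau> where "\<tau> = (\<Sum>i\<in>UNIV. \<Sum>j\<in>UNIV. \<bar>w i $ j\<bar>)"
  define \<Phi> where "\<Phi> = {\<phi> :: int ^ 'd. \<forall>i. \<bar>\<phi> $ i\<bar> \<le> a}"
  have "\<Phi> \<subseteq> (\<lambda>f. \<chi> i. f i) ` (UNIV \<rightarrow>\<^sub>E {-a..a})"
  proof
    fix \<phi> assume "\<phi> \<in> \<Phi>"
    then show "\<phi> \<in> (\<lambda>f. \<chi> i. f i) ` (UNIV \<rightarrow>\<^sub>E {-a..a})"
      by (intro image_eqI[of _ _ "\<lambda>i. \<phi> $ i"]) (auto simp: \<Phi>_def abs_le_iff minus_le_iff)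
  qed
  then have fin: "finite \<Phi>" by (rule finite_subset) (auto intro!: finite_PiE)
  define U1 where "U1 = (\<Sum>\<phi>\<in>\<Phi>. \<Sum>j\<in>UNIV. \<bar>up \<phi> $ j\<bar>)"
  have U1: "\<bar>up \<phi> $ j\<bar> \<le> U1" if "\<phi> \<in> \<Phi>" for \<phi> j
  proof -
    have "\<bar>up \<phi> $ j\<bar> \<le> (\<Sum>j\<in>UNIV. \<bar>up \<phi> $ j\<bar>)" by (rule member_le_sum) auto
    also have "\<dots> \<le> U1" unfolding U1_def by (rule member_le_sum[OF that]) (auto intro: sum_nonneg fin)
    finally show ?thesis .
  qed
  have tau0: "\<tau> \<ge> 0" "U1 \<ge> 0" unfolding \<tau>_def U1_def by (auto intro!: sum_nonneg)
  define U where "U = nat (\<tau> + 1 + U1)"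
  have "(\<chi> i. \<lfloor>M * (\<Sum>j\<in>UNIV. real_of_int (A $ i $ j) * r j)\<rfloor>) + wt (\<chi> j. U) \<in> lev (M + CARD('n) * U)"
    if r: "\<And>j. r j \<ge> 0" "(\<Sum>j\<in>UNIV. r j) = 1" for M :: nat and r
  proof -
    define x where "x i = M * (\<Sum>j\<in>UNIV. real_of_int (A $ i $ j) * r j)" for i
    define fl where "fl = (\<chi> i. \<lfloor>x i\<rfloor>)"
    define fr where "fr i = x i - of_int \<lfloor>x i\<rfloor>" for i
    have fr: "0 \<le> fr i" "fr i < 1" for i unfolding fr_def by linarith+
    \<comment> \<open>A real lift of the fractional parts, bounded above by \<open>\<tau>\<close>;
      thus y = M r - g lies over the rounded point.\<close>
    define g where "g j = (\<Sum>i\<in>UNIV. fr i * of_int (w i $ j))" for j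
    define y where "y j = M * r j - g j" for j
    have Ag: "(\<Sum>j\<in>UNIV. of_int (A $ i $ j) * g j) = fr i" for i
    proof -
      have "(\<Sum>j\<in>UNIV. of_int (A $ i $ j) * g j) = (\<Sum>k\<in>UNIV. fr k * of_int (\<Sum>j\<in>UNIV. A $ i $ j * w k $ j))"
        unfolding g_def sum_distrib_left of_int_sum of_int_mult by (subst sum.swap) (simp add: mult_ac)
      also have "\<dots> = (\<Sum>k\<in>UNIV. if k = i then fr k else 0)"
        unfolding w_def upn by (intro sum.cong) (auto simp: axis_def)
      finally show ?thesis by simp
    qed
    have Ay: "(\<Sum>j\<in>UNIV. of_int (A $ i $ j) * y j) = of_int (fl $ i)" for i
    proof -
      have "(\<Sum>j\<in>UNIV. of_int (A $ i $ j) * y j) = x i - (\<Sum>j\<in>UNIV. of_int (A $ i $ j) * g j)"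
        unfolding y_def x_def by (simp add: right_diff_distrib sum_subtractf sum_distrib_left mult_ac)
      then show ?thesis unfolding Ag by (simp add: fr_def fl_def)
    qed
    have gb: "g j \<le> of_int \<tau>" for j
    proof -
      have "g j \<le> (\<Sum>i\<in>UNIV. of_int \<bar>w i $ j\<bar>)"
        unfolding g_def
      proof (rule sum_mono)
        fix i
        have "fr i * of_int (w i $ j) \<le> fr i * of_int \<bar>w i $ j\<bar>" using fr[of i] by (intro mult_left_mono) auto
        also have "\<dots> \<le> 1 * of_int \<bar>w i $ j\<bar>" using fr[of i] by (intro mult_right_mono) auto
        finally show "fr i * of_int (w i $ j) \<le> of_int \<bar>w i $ j\<bar>" by simp
      qed
      also have "\<dots> \<le> (\<Sum>i\<in>UNIV. of_int (\<Sum>j\<in>UNIV. \<bar>w i $ j\<bar>))"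
        unfolding of_int_le_iff by (intro sum_mono, unfold of_int_le_iff, rule member_le_sum) auto
      also have "\<dots> = of_int \<tau>" by (simp add: \<tau>_def)
      finally show ?thesis .
    qed
    define k where "k = (\<chi> j. \<lfloor>y j\<rfloor>)"
    have kb: "k $ j \<ge> - \<tau> - 1" for j
    proof -
      have "M * r j \<ge> 0" using r(1)[of j] by simp
      then have "y j \<ge> - of_int \<tau>" using gb[of j] by (simp add: y_def)
      then show ?thesis unfolding k_def by (simp, linarith)
    qed
    \<comment> \<open>The error of rounding y down. Its entries are bounded by \<open>a\<close>, so
      it is one of finitely many vectors and its integral lift is bounded by
      \<open>U1\<close>.\<close>
    define \<phi> where "\<phi> = fl - A *v k"
    have phn: "of_int (\<phi> $ i) = (\<Sum>j\<in>UNIV. real_of_int (A $ i $ j) * (y j - of_int (k $ j)))" for i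
      unfolding \<phi>_def using Ay[of i] by (simp add: matrix_vector_mult_def right_diff_distrib sum_subtractf)
    have "\<phi> \<in> \<Phi>"
      unfolding \<Phi>_def
    proof (intro CollectI allI)
      fix i
      have "real_of_int \<bar>\<phi> $ i\<bar> = \<bar>\<Sum>j\<in>UNIV. real_of_int (A $ i $ j) * (y j - of_int (k $ j))\<bar>"
        unfolding phn[symmetric] by simp
      also have "\<dots> \<le> (\<Sum>j\<in>UNIV. \<bar>real_of_int (A $ i $ j) * (y j - of_int (k $ j))\<bar>)" by (rule sum_abs)
      also have "\<dots> \<le> (\<Sum>j\<in>UNIV. of_int \<bar>A $ i $ j\<bar>)"
      proof (rule sum_mono)
        fix j
        have "\<bar>y j - of_int (k $ j)\<bar> \<le> 1" unfolding k_def by (simp, linarith)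
        then have "\<bar>real_of_int (A $ i $ j)\<bar> * \<bar>y j - of_int (k $ j)\<bar> \<le> \<bar>real_of_int (A $ i $ j)\<bar> * 1"
          by (intro mult_left_mono) auto
        then show "\<bar>real_of_int (A $ i $ j) * (y j - of_int (k $ j))\<bar> \<le> of_int \<bar>A $ i $ j\<bar>" by (simp add: abs_mult)
      qed
      also have "\<dots> = of_int (\<Sum>j\<in>UNIV. \<bar>A $ i $ j\<bar>)" by simp
      also have "\<dots> \<le> of_int a"
        unfolding a_def of_int_le_iff by (rule member_le_sum[of i UNIV "\<lambda>i. \<Sum>j\<in>UNIV. \<bar>A $ i $ j\<bar>"]) (auto intro: sum_nonneg)
      finally show "\<bar>\<phi> $ i\<bar> \<le> a" by simp
    qed
    define n where "n = (\<chi> j. nat (int U + k $ j + up \<phi> $ j))"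
    have nn: "int (n $ j) = int U + k $ j + up \<phi> $ j" for j
      using kb[of j] U1[OF \<open>\<phi> \<in> \<Phi>\<close>, of j] tau0 unfolding n_def U_def by simp
    have "fl + wt (\<chi> j. U) = wt n"
    proof (subst vec_eq_iff, intro allI)
      fix i
      have "wt n $ i = wt (\<chi> j. U) $ i + (A *v k) $ i + (\<Sum>j\<in>UNIV. A $ i $ j * up \<phi> $ j)"
        unfolding wt_nth nn matrix_vector_mult_def by (simp add: distrib_left sum.distrib)
      then show "(fl + wt (\<chi> j. U)) $ i = wt n $ i" unfolding upn \<phi>_def by simp
    qed
    moreover have "(fl + wt (\<chi> j. U)) $ i0 = int (M + CARD('n) * U)"
    proof -
      have "x i0 = of_nat M" unfolding x_def by (simp add: ones r(2))
      then have "fl $ i0 = int M" by (simp add: fl_def)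
      then show ?thesis by (simp add: wt_i0 tot_def)
    qed
    ultimately show ?thesis unfolding lev_def fl_def x_def[symmetric] by (simp add: wt_in_NA)
  qed
  then show ?thesis by (intro exI[of _ U] allI impI) simp
qed

text \<open>Half-open cells of side 1/M cover the projected hull: x lies in the cell of the rounding
  of M x, whose translate by \<open>wt (\<chi> j. U)\<close> belongs to the level. Comparing volumes
  gives the bound.\<close>

lemma card_lev_ge:
  assumes surj: "surj (\<lambda>u :: int ^ 'n. A *v u)"
  shows "\<exists>m1. \<forall>M\<ge>1. hull_volume * real M ^ (CARD('d) - 1) \<le> real (card (lev (M + m1)))"
proof -
  obtain U :: nat where U0: "\<forall>M :: nat. \<forall>r. (\<forall>j. r j \<ge> 0) \<and> (\<Sum>j\<in>UNIV. r j) = 1 \<longrightarrow>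
     (\<chi> i. \<lfloor>M * (\<Sum>j\<in>UNIV. real_of_int (A $ i $ j) * r j)\<rfloor>) + wt (\<chi> j. U) \<in> lev (M + CARD('n) * U)"
    using lattice_points[OF surj] by (rule exE)
  have U: "\<And>M r. (\<And>j. r j \<ge> 0) \<Longrightarrow> (\<Sum>j\<in>UNIV. r j) = 1 \<Longrightarrow>
     (\<chi> i. \<lfloor>real M * (\<Sum>j\<in>UNIV. real_of_int (A $ i $ j) * r j)\<rfloor>) + wt (\<chi> j. U) \<in> lev (M + CARD('n) * U)"
    using U0 by simp
  let ?I = "-{i0} :: 'd set"
  let ?P = "(\<lambda>x. restrict (\<lambda>i. x $ i) ?I) ` (convex hull columns (map_matrix real_of_int A))"
  let ?\<mu> = "\<Pi>\<^sub>M i\<in>?I. (lborel :: real measure)"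
  interpret product_sigma_finite "\<lambda>_ :: 'd. lborel :: real measure" by standard
  have "hull_volume * real M ^ (CARD('d) - 1) \<le> real (card (lev (M + CARD('n) * U)))" if M: "M \<ge> 1" for M
  proof -
    let ?L = "lev (M + CARD('n) * U)"
    define q where "q \<alpha> i = real_of_int (\<alpha> $ i - wt (\<chi> j. U) $ i)" for \<alpha> i
    define cell where "cell \<alpha> = (\<Pi>\<^sub>E i\<in>?I. {q \<alpha> i / M ..< (q \<alpha> i + 1) / M})" for \<alpha>
    have sets: "cell \<alpha> \<in> sets ?\<mu>" for \<alpha> unfolding cell_def by (intro sets_PiM_I_finite) auto
    have em: "emeasure ?\<mu> (cell \<alpha>) = ennreal ((1 / M) ^ (CARD('d) - 1))" for \<alpha>
    proof -
      have "emeasure ?\<mu> (cell \<alpha>) = (\<Prod>i\<in>?I. emeasure lborel {q \<alpha> i / M ..< (q \<alpha> i + 1) / M})"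
        unfolding cell_def by (rule emeasure_PiM) auto
      also have "\<dots> = (\<Prod>i\<in>?I. ennreal (1 / M))"
        using M by (intro prod.cong refl) (simp add: divide_right_mono diff_divide_distrib[symmetric])
      also have "\<dots> = ennreal ((1 / M) ^ card ?I)" by (simp add: ennreal_power)
      finally show ?thesis by (simp add: card_Diff_singleton Compl_eq_Diff_UNIV)
    qed
    have cover: "?P \<subseteq> (\<Union>\<alpha>\<in>?L. cell \<alpha>)"
    proof
      fix f assume "f \<in> ?P"
      then obtain x where x: "x \<in> convex hull columns (map_matrix real_of_int A)" "f = restrict (\<lambda>i. x $ i) ?I" by blast
      obtain r where r: "\<forall>j. r j \<ge> 0" "(\<Sum>j\<in>UNIV. r j) = 1" "\<forall>i. x $ i = (\<Sum>j\<in>UNIV. real_of_int (A $ i $ j) * r j)"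
        using hull_point[OF x(1)] by (elim exE conjE)
      define \<alpha> where "\<alpha> = (\<chi> i. \<lfloor>real M * (\<Sum>j\<in>UNIV. real_of_int (A $ i $ j) * r j)\<rfloor>) + wt (\<chi> j. U)"
      have "\<alpha> \<in> ?L" unfolding \<alpha>_def by (rule U) (use r in auto)
      moreover have "f \<in> cell \<alpha>"
        unfolding cell_def x(2)
      proof (rule restrict_PiE_iff[THEN iffD2], intro ballI)
        fix i assume "i \<in> ?I"
        have qi: "q \<alpha> i = of_int \<lfloor>real M * x $ i\<rfloor>" unfolding q_def \<alpha>_def using r(3) by simp
        have "of_int \<lfloor>real M * x $ i\<rfloor> \<le> real M * x $ i" "real M * x $ i < of_int \<lfloor>real M * x $ i\<rfloor> + 1" by linarith+
        then show "x $ i \<in> {q \<alpha> i / M ..< (q \<alpha> i + 1) / M}"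
          unfolding qi using M by (simp add: divide_le_eq less_divide_eq mult.commute)
      qed
      ultimately show "f \<in> (\<Union>\<alpha>\<in>?L. cell \<alpha>)" by blast
    qed
    have "emeasure ?\<mu> ?P \<le> emeasure ?\<mu> (\<Union>\<alpha>\<in>?L. cell \<alpha>)"
      by (rule emeasure_mono[OF cover]) (use sets finite_lev in auto)
    also have "\<dots> \<le> (\<Sum>\<alpha>\<in>?L. emeasure ?\<mu> (cell \<alpha>))"
      by (rule emeasure_subadditive_finite) (use sets finite_lev in auto)
    also have "\<dots> = ennreal (real (card ?L) * (1 / M) ^ (CARD('d) - 1))"
      by (simp add: em ennreal_mult' ennreal_of_nat_eq_real_of_nat)
    finally have "measure ?\<mu> ?P \<le> real (card ?L) * (1 / M) ^ (CARD('d) - 1)"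
      unfolding measure_def by (rule enn2real_leI[rotated]) simp
    then show ?thesis using M unfolding hull_volume_def by (simp add: power_divide pos_le_divide_eq)
  qed
  then show ?thesis by (intro exI[of _ "CARD('n) * U"]) simp
qed

text \<open>Summing over the degrees up to T gives at least hull_volume * T^d / d elements, against
  about r * T^d / d! on the side of the generators. The zeros of \<open>h\<close> and the constant
  shifts change lower order terms only.\<close>

lemma volume_le_rank:
  assumes surj: "surj (\<lambda>u :: int ^ 'n. A *v u)" and h: "polyfun h" "h x0 \<noteq> 0"
    and cnt: "\<And>k. card {\<gamma>\<in>lowlev k. h (cv \<gamma>) \<noteq> 0} \<le> r * card {b :: nat ^ 'd. (\<Sum>i\<in>UNIV. b $ i) \<le> k + K}"
  shows "fact (CARD('d) - 1) * hull_volume \<le> real r"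
proof -
  define d where "d = CARD('d)"
  have d0: "d > 0" by (simp add: d_def)
  obtain m1 where m1: "\<And>M. M \<ge> 1 \<Longrightarrow> hull_volume * real M ^ (d - 1) \<le> real (card (lev (M + m1)))"
    using card_lev_ge[OF surj] unfolding d_def by auto
  obtain D where D: "polydeg D h" using h(1) unfolding polyfun_def by blast
  define a where "a = nat (\<Sum>i\<in>UNIV. \<Sum>j\<in>UNIV. \<bar>A $ i $ j\<bar>)"
  have box: "\<bar>\<gamma> $ i\<bar> \<le> int (a * k)" if \<gamma>: "\<gamma> \<in> lowlev k" for \<gamma> i k
  proof -
    obtain m where m: "m \<le> k" "\<gamma> \<in> lev m" using \<gamma> by (auto simp: lowlev_def)
    obtain u where u: "\<gamma> = wt u" "tot u = m" using m(2) by (rule levE)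
    have A: "\<bar>A $ i $ j\<bar> \<le> int a" for j
    proof -
      have "\<bar>A $ i $ j\<bar> \<le> (\<Sum>j\<in>UNIV. \<bar>A $ i $ j\<bar>)" by (rule member_le_sum) auto
      also have "\<dots> \<le> (\<Sum>i\<in>UNIV. \<Sum>j\<in>UNIV. \<bar>A $ i $ j\<bar>)"
        by (rule member_le_sum[of i UNIV "\<lambda>i. \<Sum>j\<in>UNIV. \<bar>A $ i $ j\<bar>"]) (auto intro: sum_nonneg)
      also have "\<dots> \<le> int a" unfolding a_def by (simp add: sum_nonneg)
      finally show ?thesis .
    qed
    have "\<bar>\<gamma> $ i\<bar> \<le> (\<Sum>j\<in>UNIV. \<bar>A $ i $ j * int (u $ j)\<bar>)" unfolding u(1) wt_nth by (rule sum_abs)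
    also have "\<dots> \<le> (\<Sum>j\<in>UNIV. int a * int (u $ j))" using A by (intro sum_mono) (simp add: abs_mult mult_right_mono)
    also have "\<dots> = int (a * m)" unfolding u(2)[symmetric] tot_def by (simp add: sum_distrib_left)
    also have "\<dots> \<le> int (a * k)" using m(1) by (simp add: mult_left_mono)
    finally show ?thesis .
  qed
  have key: "(fact d * (hull_volume / d)) * real T ^ d \<le> real r * (real T + real (m1 + K + d)) ^ d
      + (fact d * real (d * D)) * (real (2 * a) * real T + real (2 * a * m1 + 1)) ^ (d - 1)" for T :: nat
  proof -
    define k where "k = T + m1"
    have "hull_volume * (real T ^ d / d) \<le> hull_volume * (\<Sum>M=1..T. real M ^ (d - 1))"
      using sum_powers_ge[OF d0] by (intro mult_left_mono) (simp_all add: hull_volume_def)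
    also have "\<dots> \<le> (\<Sum>M=1..T. real (card (lev (M + m1))))"
      unfolding sum_distrib_left using m1 by (intro sum_mono) auto
    also have "\<dots> = real (card (\<Union>M\<in>{1..T}. lev (M + m1)))"
    proof -
      have "card (\<Union>M\<in>{1..T}. lev (M + m1)) = (\<Sum>M=1..T. card (lev (M + m1)))"
        by (rule card_UN_disjoint) (auto simp: finite_lev, auto simp: lev_def)
      then show ?thesis by simp
    qed
    also have "\<dots> \<le> real (card (lowlev k))"
    proof (intro of_nat_mono card_mono finite_lowlev UN_least)
      fix M assume "M \<in> {1..T}"
      then show "lev (M + m1) \<subseteq> lowlev k" unfolding lowlev_def k_def by (intro UN_upper) auto
    qed
    also have "card (lowlev k) = card {\<gamma>\<in>lowlev k. h (cv \<gamma>) \<noteq> 0} + card {\<gamma>\<in>lowlev k. h (cv \<gamma>) = 0}"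
      by (subst card_Un_disjoint[symmetric]) (auto simp: finite_lowlev intro!: arg_cong[of _ _ card])
    also have "real \<dots> \<le> real (r * ((k + K + d) choose d)) + real (d * D * (2 * (a * k) + 1) ^ (d - 1))"
    proof -
      have "card {\<gamma>\<in>lowlev k. h (cv \<gamma>) \<noteq> 0} \<le> r * ((k + K + d) choose d)"
        using order_trans[OF cnt[of k] mult_le_mono2[OF card_bounded_exponents]] unfolding d_def .
      moreover have "card {\<gamma>\<in>lowlev k. h (cv \<gamma>) = 0} \<le> d * D * (2 * (a * k) + 1) ^ (d - 1)"
      proof -
        let ?S = "{\<alpha> :: int ^ 'd. (\<forall>i. \<bar>\<alpha> $ i\<bar> \<le> int (a * k)) \<and> h (\<chi> i. of_int (\<alpha> $ i)) = 0}"
        have "?S \<subseteq> (\<lambda>f. \<chi> i. f i) ` (UNIV \<rightarrow>\<^sub>E {- int (a * k)..int (a * k)})"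
        proof
          fix \<alpha> assume "\<alpha> \<in> ?S"
          then show "\<alpha> \<in> (\<lambda>f. \<chi> i. f i) ` (UNIV \<rightarrow>\<^sub>E {- int (a * k)..int (a * k)})"
            by (intro image_eqI[of _ _ "\<lambda>i. \<alpha> $ i"]) (auto simp: abs_le_iff minus_le_iff)
        qed
        then have "finite ?S" by (rule finite_subset) (auto intro!: finite_PiE)
        then have "card {\<gamma>\<in>lowlev k. h (cv \<gamma>) = 0} \<le> card ?S"
          by (rule card_mono) (use box in \<open>auto simp: cv_def\<close>)
        then show ?thesis using polydeg_card_zeros[OF D h(2), of "a * k"] unfolding d_def by linarith
      qed
      ultimately show ?thesis unfolding of_nat_add[symmetric] of_nat_le_iff by (rule add_mono)
    qed
    finally have 0: "hull_volume * (real T ^ d / d) \<le> real (r * ((k + K + d) choose d)) + real (d * D * (2 * (a * k) + 1) ^ (d - 1))" .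
    have eq: "real (2 * (a * k) + 1) = real (2 * a) * real T + real (2 * a * m1 + 1)" by (simp add: k_def distrib_left)
    have 1: "hull_volume * (real T ^ d / d) \<le> real r * real ((k + K + d) choose d) + real (d * D) * (real (2 * a) * real T + real (2 * a * m1 + 1)) ^ (d - 1)"
      using 0 unfolding of_nat_mult[of r] of_nat_mult[of "d * D"] of_nat_power eq .
    have 2: "fact d * real ((k + K + d) choose d) \<le> (real T + real (m1 + K + d)) ^ d"
    proof -
      have "((k + K + d) choose d) * fact d \<le> (k + K + d) ^ d" by (rule binomial_fact_pow)
      then have "real (((k + K + d) choose d) * fact d) \<le> real ((k + K + d) ^ d)" by (rule of_nat_mono)
      then show ?thesis by (simp add: k_def mult.commute add_ac)
    qed
    have "(fact d * (hull_volume / d)) * real T ^ d = fact d * (hull_volume * (real T ^ d / d))" by simp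
    also have "\<dots> \<le> fact d * (real r * real ((k + K + d) choose d) + real (d * D) * (real (2 * a) * real T + real (2 * a * m1 + 1)) ^ (d - 1))"
      using 1 by (intro mult_left_mono) auto
    also have "\<dots> = real r * (fact d * real ((k + K + d) choose d)) + (fact d * real (d * D)) * (real (2 * a) * real T + real (2 * a * m1 + 1)) ^ (d - 1)"
      by (simp only: distrib_left mult_ac)
    also have "\<dots> \<le> real r * (real T + real (m1 + K + d)) ^ d + (fact d * real (d * D)) * (real (2 * a) * real T + real (2 * a * m1 + 1)) ^ (d - 1)"
      using 2 by (intro add_right_mono mult_left_mono) auto
    finally show ?thesis .
  qed
  have "fact d * (hull_volume / d) \<le> real r" by (rule leading_coeff_le[OF d0 key])
  moreover have "fact d = real d * fact (d - 1)" using d0 by (simp add: fact_reduce)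
  ultimately show ?thesis using d0 unfolding d_def[symmetric] by simp
qed

end

section \<open>Rank jumps\<close>

context toric
begin

text \<open>A nontrivial relation allows y0 to be eliminated after multiplication by its
  coefficient. Then |Y| - 1 functions would generate over a further localization, and |Y| - 1 would
  already bound the volume.\<close>

lemma E_relation_trivial:
  assumes surj: "surj (\<lambda>u :: int ^ 'n. A *v u)" and g: "good N p" and Y: "detset \<beta> N p Y"
    and small: "real (card Y) \<le> fact (CARD('d) - 1) * hull_volume"
    and f: "\<And>y. y \<in> Y \<Longrightarrow> polyfun (f y)" and rel: "\<And>\<alpha>. (\<Sum>y\<in>Y. f y (cv \<alpha>) * E p y \<alpha>) = 0"
  shows "\<forall>y\<in>Y. \<forall>x. f y x = 0"
proof (intro ballI allI, rule ccontr)
  fix y0 x0 assume y0: "y0 \<in> Y" and x0: "f y0 x0 \<noteq> 0"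
  have finY: "finite Y" using Y unfolding detset_def by blast
  obtain c K where c: "polyfun c" "c \<beta> \<noteq> 0" and
    cK: "\<forall>m. \<forall>\<gamma>\<in>lev m. \<exists>a. (\<forall>y\<in>Y. polydeg (m + K) (a y)) \<and>
     (\<forall>\<alpha>. c (cv \<alpha>) * E p \<gamma> \<alpha> = (\<Sum>y\<in>Y. a y (cv \<alpha>) * E p y \<alpha>))"
    using E_localized[OF g Y] by (elim exE conjE)
  obtain K' where K': "\<forall>y\<in>Y. polydeg K' (f y)"
    using polyfun_common_degree[of Y f] finY f by auto
  define h where "h x = f y0 x * c x" for x
  have h: "polyfun h" unfolding h_def[abs_def] by (intro polyfun_mult f y0 c)
  obtain z where z: "h z \<noteq> 0" using polyfun_mult_nonzero[OF f[OF y0] c(1) x0 c(2)] unfolding h_def by (elim exE)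
  have ex: "\<exists>b. (\<forall>y\<in>Y - {y0}. polydeg (m + (K + K')) (b y)) \<and>
     (\<forall>\<alpha>. h (cv \<alpha>) * E p \<gamma> \<alpha> = (\<Sum>y\<in>Y - {y0}. b y (cv \<alpha>) * E p y \<alpha>))" if \<gamma>: "\<gamma> \<in> lev m" for m \<gamma>
  proof -
    obtain a where a: "\<forall>y\<in>Y. polydeg (m + K) (a y)"
      "\<forall>\<alpha>. c (cv \<alpha>) * E p \<gamma> \<alpha> = (\<Sum>y\<in>Y. a y (cv \<alpha>) * E p y \<alpha>)"
      using cK[rule_format, OF \<gamma>] by (elim exE conjE)
    \<comment> \<open>The expansion times \<open>f y0\<close> minus the relation times
      \<open>a y0\<close>; the coefficient at y0 cancels.\<close>
    define b where "b y x = f y0 x * a y x + (- 1) * (a y0 x * f y x)" for y x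
    have "polydeg (m + (K + K')) (b y)" if y: "y \<in> Y - {y0}" for y
    proof -
      have y': "y \<in> Y" using y by simp
      have 1: "polydeg (K' + (m + K)) (\<lambda>x. f y0 x * a y x)"
        by (rule polydeg_mult[OF K'[rule_format, OF y0] a(1)[rule_format, OF y']])
      have "polydeg (0 + (m + K + K')) (\<lambda>x. (- 1) * (a y0 x * f y x))"
        by (rule polydeg_mult[OF polydeg_const polydeg_mult[OF a(1)[rule_format, OF y0] K'[rule_format, OF y']]])
      then have 2: "polydeg (m + (K + K')) (\<lambda>x. (- 1) * (a y0 x * f y x))" by (rule polydeg_mono) simp
      have "polydeg (m + (K + K')) (\<lambda>x. f y0 x * a y x)" using 1 by (rule polydeg_mono) simp
      from polydeg_add[OF this 2] show ?thesis unfolding b_def[abs_def] .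
    qed
    moreover have "h (cv \<alpha>) * E p \<gamma> \<alpha> = (\<Sum>y\<in>Y - {y0}. b y (cv \<alpha>) * E p y \<alpha>)" for \<alpha>
    proof -
      have "h (cv \<alpha>) * E p \<gamma> \<alpha> = f y0 (cv \<alpha>) * (\<Sum>y\<in>Y. a y (cv \<alpha>) * E p y \<alpha>) - a y0 (cv \<alpha>) * (\<Sum>y\<in>Y. f y (cv \<alpha>) * E p y \<alpha>)"
        using a(2) by (simp add: h_def rel mult.assoc)
      also have "\<dots> = (\<Sum>y\<in>Y. b y (cv \<alpha>) * E p y \<alpha>)"
        unfolding sum_distrib_left sum_subtractf[symmetric] by (intro sum.cong refl) (simp add: b_def algebra_simps)
      also have "\<dots> = (\<Sum>y\<in>Y - {y0}. b y (cv \<alpha>) * E p y \<alpha>)"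
        using sum.remove[OF finY y0, of "\<lambda>y. b y (cv \<alpha>) * E p y \<alpha>"] by (simp add: b_def)
      finally show ?thesis .
    qed
    ultimately show ?thesis by (intro exI[of _ b]) simp
  qed
  have fin': "finite (Y - {y0})" using finY by simp
  have "fact (CARD('d) - 1) * hull_volume \<le> real (card (Y - {y0}))"
    by (rule volume_le_rank[OF surj h z]) (rule count_bound[OF fin' ex])
  moreover have "card (Y - {y0}) < card Y" using finY y0 by (rule card_Diff1_less)
  ultimately show False using small by linarith
qed

lemma hrank_gt_volume:
  assumes surj: "surj (\<lambda>u :: int ^ 'n. A *v u)" and g: "good N p"
    and p: "\<And>J. J \<noteq> {} \<Longrightarrow> (\<Sum>j\<in>J. p $ j) \<noteq> 0"
    and F: "\<And>j. j \<in> F \<Longrightarrow> dotc l1 (cv (col j)) = 0" "\<And>j. j \<in> F \<Longrightarrow> dotc l2 (cv (col j)) = 0"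
    and l1: "dotc l1 (cv (col j3)) = 1" "dotc l1 (cv (col j4)) = 0" and l2: "dotc l2 (cv (col j4)) = 1"
    and near: "\<And>j. j \<notin> F \<Longrightarrow> \<gamma>0 + col j \<in> NA"
    and hole: "\<And>m. (\<And>j. j \<notin> F \<Longrightarrow> m $ j = 0) \<Longrightarrow> \<gamma>0 + wt m \<notin> NA"
    and uniq: "\<And>m n. (\<And>j. j \<notin> F \<Longrightarrow> m $ j = 0) \<Longrightarrow> wt n = wt m \<Longrightarrow> n = m"
    and \<beta>: "\<beta> = cv \<gamma>0 + (\<Sum>j\<in>F. s j *s cv (col j))"
  shows "normalized_volume i0 A < real (hrank \<beta> N p)"
proof (rule ccontr)
  assume nlt: "\<not> normalized_volume i0 A < real (hrank \<beta> N p)"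
  obtain Y where Y: "detset \<beta> N p Y" "card Y = hrank \<beta> N p" using hrank_attained[of \<beta> N p] by (elim exE conjE)
  have small: "real (card Y) \<le> fact (CARD('d) - 1) * hull_volume"
    using nlt unfolding Y(2) normalized_volume_def hull_volume_def by simp
  have Y': "finite Y" "Y \<subseteq> NA" using Y(1) unfolding detset_def by auto
  obtain c K where c: "polyfun c" "c \<beta> \<noteq> 0" and
    cK: "\<forall>m. \<forall>\<gamma>\<in>lev m. \<exists>a. (\<forall>y\<in>Y. polydeg (m + K) (a y)) \<and>
     (\<forall>\<alpha>. c (cv \<alpha>) * E p \<gamma> \<alpha> = (\<Sum>y\<in>Y. a y (cv \<alpha>) * E p y \<alpha>))"
    using E_localized[OF g Y(1)] by (elim exE conjE)
  show False
  proof (rule hole_contradiction[where c = c and ?\<beta> = \<beta> and Y = Y and p = p and F = F and ?l1.0 = l1 and ?l2.0 = l2 and ?j3.0 = j3 and ?j4.0 = j4 and ?\<gamma>0.0 = \<gamma>0 and s = s])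
    fix \<gamma> assume "\<gamma> \<in> NA"
    then have "\<gamma> \<in> lev (nat (\<gamma> $ i0))" by (rule NA_lev)
    from cK[rule_format, OF this]
    obtain a where a: "\<forall>y\<in>Y. polydeg (nat (\<gamma> $ i0) + K) (a y)"
      "\<forall>\<alpha>. c (cv \<alpha>) * E p \<gamma> \<alpha> = (\<Sum>y\<in>Y. a y (cv \<alpha>) * E p y \<alpha>)" by (elim exE conjE)
    show "polyspan cv (E p) Y (\<lambda>\<alpha>. c (cv \<alpha>) * E p \<gamma> \<alpha>)"
      unfolding polyspan_def polyfun_def by (rule exI[of _ a]) (use a in auto)
  next
    fix f assume "\<And>y. y \<in> Y \<Longrightarrow> polyfun (f y)" "\<And>\<alpha>. (\<Sum>y\<in>Y. f y (cv \<alpha>) * E p y \<alpha>) = 0"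
    then show "\<forall>y\<in>Y. \<forall>x. f y x = 0" by (rule E_relation_trivial[OF surj g Y(1) small])
  qed (fact p Y' c F l1 l2 near hole uniq \<beta>)+
qed

text \<open>Choose p0 of least \<open>hrank\<close> among the points with \<open>Q\<close> nonzero.
  A determining set at p0 works on a Zariski open set, so \<open>hrank\<close> is at most the
  minimum there, hence constant.\<close>

lemma hrank_generic:
  assumes "polyfun Q" "Q x \<noteq> 0" "\<And>p. Q p \<noteq> 0 \<Longrightarrow> good N p"
  shows "\<exists>p0 q. Q p0 \<noteq> 0 \<and> polyfun q \<and> q p0 \<noteq> 0 \<and>
    (\<forall>p. q p \<noteq> 0 \<longrightarrow> p \<notin> singular_locus (hypergeometric_ideal A \<beta>) \<and>
       solution_dim (hypergeometric_ideal A \<beta>) p = enat (hrank \<beta> N p0))"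
proof -
  define r where "r = (LEAST r. \<exists>p. Q p \<noteq> 0 \<and> hrank \<beta> N p = r)"
  have "\<exists>p. Q p \<noteq> 0 \<and> hrank \<beta> N p = r" unfolding r_def
    by (rule LeastI_ex) (use assms(2) in auto)
  then obtain p0 where p0: "Q p0 \<noteq> 0" "hrank \<beta> N p0 = r" by (elim exE conjE)
  have min: "hrank \<beta> N p0 \<le> hrank \<beta> N p" if "Q p \<noteq> 0" for p
    unfolding p0(2) unfolding r_def by (rule Least_le) (use that in auto)
  obtain Y where Y: "detset \<beta> N p0 Y" "card Y = hrank \<beta> N p0" using hrank_attained[of \<beta> N p0] by (elim exE conjE)
  then obtain k where k: "finite Y" "Y \<subseteq> NA" "k \<ge> N" "Y \<subseteq> lowlev k" "detk \<beta> k Y p0"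
    unfolding detset_def by (elim exE conjE)
  obtain q where q: "polyfun q" "q p0 \<noteq> 0" "\<forall>p. q p \<noteq> 0 \<longrightarrow> detk \<beta> k Y p"
    using detk_generic[OF k(4,5)] by (elim exE conjE)
  have eq: "hrank \<beta> N p = hrank \<beta> N p0" if "Q p \<noteq> 0" "q p \<noteq> 0" for p
  proof (rule antisym)
    have "detset \<beta> N p Y" unfolding detset_def using k q(3) that(2) by auto
    from hrank_le[OF this] show "hrank \<beta> N p \<le> hrank \<beta> N p0" unfolding Y(2) .
  qed (rule min[OF that(1)])
  show ?thesis
  proof (intro exI[of _ p0] exI[of _ "\<lambda>p. Q p * q p"] conjI allI impI)
    show "polyfun (\<lambda>p. Q p * q p)" by (rule polyfun_mult[OF assms(1) q(1)])
    show "Q p0 * q p0 \<noteq> 0" using p0(1) q(2) by simp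
    fix p assume "Q p * q p \<noteq> 0"
    then have Q: "Q p \<noteq> 0" and q: "q p \<noteq> 0" by auto
    show "p \<notin> singular_locus (hypergeometric_ideal A \<beta>)" by (rule good_not_singular[OF assms(3)[OF Q]])
    show "solution_dim (hypergeometric_ideal A \<beta>) p = enat (hrank \<beta> N p0)"
      unfolding solution_dim_hrank[OF assms(3)[OF Q]] eq[OF Q q] ..
  qed (rule p0(1))
qed

text \<open>Uniqueness in the definite description: two nonempty Zariski open sets meet.\<close>

lemma holonomic_rank_eq:
  assumes q: "polyfun q" "q x \<noteq> 0"
    and r: "\<And>p. q p \<noteq> 0 \<Longrightarrow> p \<notin> singular_locus I \<and> solution_dim I p = enat r"
  shows "holonomic_rank I = r"
  unfolding holonomic_rank_def
proof (rule the_equality)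
  obtain c where c: "q = cpoly_eval c" using polyfun_imp_cpoly[OF q(1)] by (elim exE)
  have "c \<noteq> 0" using q(2) by (auto simp: c cpoly_eval_0)
  then show "\<exists>c. c \<noteq> 0 \<and> (\<forall>p. cpoly_eval c p \<noteq> 0 \<longrightarrow> p \<notin> singular_locus I \<and> solution_dim I p = enat r)"
    using r unfolding c by (intro exI[of _ c]) simp
next
  fix r' assume "\<exists>c. c \<noteq> 0 \<and> (\<forall>p. cpoly_eval c p \<noteq> 0 \<longrightarrow> p \<notin> singular_locus I \<and> solution_dim I p = enat r')"
  then obtain c where c: "c \<noteq> 0" "\<forall>p. cpoly_eval c p \<noteq> 0 \<longrightarrow> p \<notin> singular_locus I \<and> solution_dim I p = enat r'"
    by (elim exE conjE)
  obtain y where y: "cpoly_eval c y \<noteq> 0" using cpoly_eval_nonzero[OF c(1)] by (elim exE)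
  obtain z where "q z * cpoly_eval c z \<noteq> 0"
    using polyfun_mult_nonzero[OF q(1) polyfun_cpoly_eval q(2) y] by (elim exE)
  then have "q z \<noteq> 0" "cpoly_eval c z \<noteq> 0" by auto
  then show "r' = r" using r[of z] c(2) by auto
qed

lemma exceptionalI:
  assumes surj: "surj (\<lambda>u :: int ^ 'n. A *v u)"
    and F: "\<And>j. j \<in> F \<Longrightarrow> dotc l1 (cv (col j)) = 0" "\<And>j. j \<in> F \<Longrightarrow> dotc l2 (cv (col j)) = 0"
    and l1: "dotc l1 (cv (col j3)) = 1" "dotc l1 (cv (col j4)) = 0" and l2: "dotc l2 (cv (col j4)) = 1"
    and near: "\<And>j. j \<notin> F \<Longrightarrow> \<gamma>0 + col j \<in> NA"
    and hole: "\<And>m. (\<And>j. j \<notin> F \<Longrightarrow> m $ j = 0) \<Longrightarrow> \<gamma>0 + wt m \<notin> NA"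
    and uniq: "\<And>m n. (\<And>j. j \<notin> F \<Longrightarrow> m $ j = 0) \<Longrightarrow> wt n = wt m \<Longrightarrow> n = m"
    and \<beta>: "\<beta> = cv \<gamma>0 + (\<Sum>j\<in>F. s j *s cv (col j))"
  shows "\<beta> \<in> exceptional_set i0 A"
proof -
  obtain N q p1 where q: "polyfun q" "q p1 \<noteq> 0" "\<And>p. q p \<noteq> 0 \<Longrightarrow> good N p" by (rule generic_good) blast
  \<comment> \<open>Nonzero exactly when all nonempty partial sums of the coordinates are nonzero,
    for instance at the point with all coordinates 1.\<close>
  define t :: "complex ^ 'n \<Rightarrow> complex" where "t p = (\<Prod>J\<in>Pow UNIV - {{}}. \<Sum>j\<in>J. p $ j)" for p
  have t: "polyfun t" unfolding t_def[abs_def] by (intro polyfun_prod polyfun_sum polyfun_coord)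
  have t1: "t (\<chi> j. 1) \<noteq> 0" unfolding t_def by (auto simp: prod_zero_iff)
  obtain z where z: "q z * t z \<noteq> 0" using polyfun_mult_nonzero[OF q(1) t q(2) t1] by (elim exE)
  have good: "good N p" if "q p * t p \<noteq> 0" for p using that q(3) by simp
  have "\<exists>p0 q2. q p0 * t p0 \<noteq> 0 \<and> polyfun q2 \<and> q2 p0 \<noteq> 0 \<and>
    (\<forall>p. q2 p \<noteq> 0 \<longrightarrow> p \<notin> singular_locus (hypergeometric_ideal A \<beta>) \<and>
       solution_dim (hypergeometric_ideal A \<beta>) p = enat (hrank \<beta> N p0))"
    by (rule hrank_generic[OF polyfun_mult[OF q(1) t]], rule z, rule good)
  then obtain p0 q2 where p0: "q p0 * t p0 \<noteq> 0" and q2: "polyfun q2" "q2 p0 \<noteq> 0"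
    "\<forall>p. q2 p \<noteq> 0 \<longrightarrow> p \<notin> singular_locus (hypergeometric_ideal A \<beta>) \<and>
       solution_dim (hypergeometric_ideal A \<beta>) p = enat (hrank \<beta> N p0)"
    by (elim exE conjE)
  have "holonomic_rank (hypergeometric_ideal A \<beta>) = hrank \<beta> N p0"
    by (rule holonomic_rank_eq[OF q2(1,2)]) (use q2(3) in simp)
  moreover have "(\<Sum>j\<in>J. p0 $ j) \<noteq> 0" if "J \<noteq> {}" for J
  proof
    assume "(\<Sum>j\<in>J. p0 $ j) = 0"
    then have "t p0 = 0" unfolding t_def by (intro prod_zero) (use that in auto)
    then show False using p0 by simp
  qed
  then have "normalized_volume i0 A < real (hrank \<beta> N p0)"
    by (rule hrank_gt_volume[where F = F and ?l1.0 = l1 and ?l2.0 = l2 and ?j3.0 = j3 and ?j4.0 = j4 and ?\<gamma>0.0 = \<gamma>0 and s = s, OF surj good[OF p0]])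
       (assumption | fact F l1 l2 near hole uniq \<beta>)+
  ultimately show ?thesis unfolding exceptional_set_def by simp
qed

end

section \<open>Gale diagrams\<close>

lemma int_both_zero:
  fixes a b x y :: int
  assumes "a * x \<le> 0" "b * y \<le> 0" "a \<noteq> 0" "b \<noteq> 0" "a * x + b * y \<ge> 0"
  shows "x = 0 \<and> y = 0"
proof -
  have "a * x = 0" "b * y = 0" using assms by linarith+
  then show ?thesis using assms by simp
qed

lemma matrix_vector_mult_2: "((B :: int ^ 2 ^ 'n) *v z) $ j = B $ j $ 1 * z $ 1 + B $ j $ 2 * z $ 2"
  by (simp add: matrix_vector_mult_def sum_2)

text \<open>Dual forms show that the vectors are distinct and that none lies in the span of the
  others.\<close>

lemma dim_span_dual:
  fixes C :: "'n \<Rightarrow> complex ^ 'd::finite"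
  assumes F: "finite F" and dual: "\<And>j k. j \<in> F \<Longrightarrow> k \<in> F \<Longrightarrow> dotc (l j) (C k) = (if k = j then 1 else 0)"
  shows "vec.dim {\<Sum>j\<in>F. s j *s C j | s. True} = card F"
proof -
  have inj: "inj_on C F"
  proof (rule inj_onI)
    fix j k assume jk: "j \<in> F" "k \<in> F" "C j = C k"
    have "dotc (l j) (C j) = dotc (l j) (C k)" by (simp only: jk(3))
    then show "j = k" using dual[OF jk(1,1)] dual[OF jk(1,2)] by (simp split: if_splits)
  qed
  have "vec.independent (C ` F)"
    unfolding vec.dependent_def
  proof (rule notI, elim bexE)
    fix a assume "a \<in> C ` F" and sp: "a \<in> vec.span (C ` F - {a})"
    then obtain j where j: "j \<in> F" "a = C j" by auto
    have "vec.subspace {x. dotc (l j) x = 0}"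
      unfolding vec.subspace_def by (simp add: dotc_add dotc_scale dotc_0)
    moreover have "C ` F - {a} \<subseteq> {x. dotc (l j) x = 0}"
    proof
      fix x assume "x \<in> C ` F - {a}"
      then obtain k where "k \<in> F" "x = C k" "k \<noteq> j" using j(2) by blast
      then show "x \<in> {x. dotc (l j) x = 0}" using dual[OF j(1), of k] by simp
    qed
    ultimately have "vec.span (C ` F - {a}) \<subseteq> {x. dotc (l j) x = 0}" using vec.span_minimal by blast
    then have "dotc (l j) a = 0" using sp by blast
    then show False using dual[OF j(1,1)] j(2) by simp
  qed
  then have "vec.dim (vec.span (C ` F)) = card (C ` F)" by (rule vec.dim_span_eq_card_independent)
  moreover have "vec.span (C ` F) = {\<Sum>j\<in>F. s j *s C j | s. True}"
  proof -
    have 1: "(\<Sum>v\<in>C ` F. u v *s v) = (\<Sum>j\<in>F. u (C j) *s C j)" for u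
      by (subst sum.reindex[OF inj]) (simp only: o_def)
    have 2: "(\<Sum>j\<in>F. s j *s C j) = (\<Sum>j\<in>F. s (the_inv_into F C (C j)) *s C j)" for s
      by (rule sum.cong) (simp_all add: the_inv_into_f_f[OF inj])
    show ?thesis
      unfolding vec.span_finite[OF finite_imageI[OF F]] 1
    proof (intro equalityI subsetI)
      fix x assume "x \<in> {\<Sum>j\<in>F. s j *s C j | s. True}"
      then obtain s where "x = (\<Sum>j\<in>F. s j *s C j)" by auto
      then show "x \<in> range (\<lambda>u. \<Sum>j\<in>F. u (C j) *s C j)"
        using 2[of s] by (intro image_eqI[of _ _ "\<lambda>y. s (the_inv_into F C y)"]) simp_all
    qed auto
  qed
  ultimately show ?thesis by (simp only: card_image[OF inj])
qed

lemma infinite_line: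
  assumes "finite F" "f \<in> F" "\<And>k. k \<in> F \<Longrightarrow> dotc l (C k) = (if k = f then 1 else 0)"
  shows "infinite {b + (\<Sum>j\<in>F. s j *s C j) | s. True}"
proof
  assume fin: "finite {b + (\<Sum>j\<in>F. s j *s C j) | s. True}"
  have "dotc l (b + (\<Sum>j\<in>F. s j *s C j)) = dotc l b + s f" for s
  proof -
    have "(\<Sum>j\<in>F. dotc l (s j *s C j)) = (\<Sum>j\<in>F. if j = f then s j else 0)"
      by (rule sum.cong) (auto simp: dotc_scale assms(3))
    then show ?thesis using assms(1,2) by (simp add: dotc_add dotc_sum)
  qed
  note eq = this
  have "UNIV \<subseteq> (\<lambda>x. dotc l x - dotc l b) ` {b + (\<Sum>j\<in>F. s j *s C j) | s. True}"
  proof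
    fix t :: complex
    show "t \<in> (\<lambda>x. dotc l x - dotc l b) ` {b + (\<Sum>j\<in>F. s j *s C j) | s. True}"
    proof (rule image_eqI)
      show "t = dotc l (b + (\<Sum>j\<in>F. t *s C j)) - dotc l b" unfolding eq by simp
      show "b + (\<Sum>j\<in>F. t *s C j) \<in> {b + (\<Sum>j\<in>F. s j *s C j) | s. True}"
        by (intro CollectI exI[of _ "\<lambda>_. t"] conjI refl TrueI)
    qed
  qed
  from finite_subset[OF this finite_imageI[OF fin]] show False by (simp add: infinite_UNIV_char_0)
qed

section \<open>Independent columns and holes read off the Gale diagram\<close>

context toric
begin

lemma matrix_axis: "A *v axis j 1 = col j"
  by (simp add: vec_eq_iff matrix_vector_mult_def col_nth axis_def mult_delta_right)

lemma matrix_nonneg_in_NA: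
  assumes "\<And>k. u $ k \<ge> 0"
  shows "A *v u \<in> NA"
proof -
  have "u = int_vec (\<chi> k. nat (u $ k))" using assms by (simp add: vec_eq_iff int_vec_def)
  then have "A *v u = wt (\<chi> k. nat (u $ k))" by (simp add: wt_def)
  then show ?thesis by (simp add: wt_in_NA)
qed

lemma cv_matrix: "cv (A *v u) = (\<Sum>j\<in>UNIV. of_int (u $ j) *s cv (col j))"
  by (simp add: vec_eq_iff cv_nth matrix_vector_mult_def col_nth mult.commute)

lemma gale_kernel: "gale_diagram A B \<Longrightarrow> A *v u = 0 \<Longrightarrow> \<exists>z. u = B *v z"
  and gale_image: "gale_diagram A B \<Longrightarrow> A *v (B *v z) = 0"
proof -
  assume "gale_diagram A B"
  then have eq: "range (\<lambda>z. B *v z) = {u. A *v u = 0}" unfolding gale_diagram_def bij_betw_def by (rule conjunct2)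
  have "B *v z \<in> range (\<lambda>z. B *v z)" by (rule rangeI)
  then show "A *v (B *v z) = 0" unfolding eq by (rule CollectD)
  assume "A *v u = 0"
  then have "u \<in> range (\<lambda>z. B *v z)" unfolding eq by (rule CollectI)
  then show "\<exists>z. u = B *v z" by (simp only: image_iff UNIV_I simp_thms bex_UNIV)
qed

text \<open>A kernel vector vanishing in rows \<open>j1\<close> and \<open>j2\<close> is B y with y
  killed by an invertible 2 x 2 block, hence zero. So the other columns of \<open>A\<close> are
  independent and possess dual forms, first over the rationals.\<close>

lemma gale_functional:
  assumes gale: "gale_diagram A B" and det: "B $ j1 $ 1 * B $ j2 $ 2 - B $ j1 $ 2 * B $ j2 $ 1 \<noteq> 0"
    and j: "j \<notin> {j1, j2}"
  shows "\<exists>l. \<forall>k. k \<notin> {j1, j2} \<longrightarrow> dotc l (cv (col k)) = (if k = j then 1 else 0)"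
proof -
  have "\<exists>l :: 'd \<Rightarrow> rat. \<forall>k\<in>-{j1, j2}. (\<Sum>i\<in>UNIV. l i * of_int (A $ i $ k)) = (if k = j then 1 else 0)"
  proof (rule independent_functional)
    fix z :: "int ^ 'n" assume z: "A *v z = 0" "\<forall>j. j \<notin> - {j1, j2} \<longrightarrow> z $ j = 0"
    obtain y where y: "z = B *v y" using gale_kernel[OF gale z(1)] by (elim exE)
    have 1: "B $ j1 $ 1 * y $ 1 + B $ j1 $ 2 * y $ 2 = 0" and 2: "B $ j2 $ 1 * y $ 1 + B $ j2 $ 2 * y $ 2 = 0"
      using z(2) by (auto simp: y matrix_vector_mult_2)
    have "(B $ j1 $ 1 * B $ j2 $ 2 - B $ j1 $ 2 * B $ j2 $ 1) * y $ 1 =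
        B $ j2 $ 2 * (B $ j1 $ 1 * y $ 1 + B $ j1 $ 2 * y $ 2) - B $ j1 $ 2 * (B $ j2 $ 1 * y $ 1 + B $ j2 $ 2 * y $ 2)"
      "(B $ j1 $ 1 * B $ j2 $ 2 - B $ j1 $ 2 * B $ j2 $ 1) * y $ 2 =
        B $ j1 $ 1 * (B $ j2 $ 1 * y $ 1 + B $ j2 $ 2 * y $ 2) - B $ j2 $ 1 * (B $ j1 $ 1 * y $ 1 + B $ j1 $ 2 * y $ 2)"
      by (simp_all add: left_diff_distrib right_diff_distrib distrib_left mult_ac)
    then have "(B $ j1 $ 1 * B $ j2 $ 2 - B $ j1 $ 2 * B $ j2 $ 1) * y $ 1 = 0"
      "(B $ j1 $ 1 * B $ j2 $ 2 - B $ j1 $ 2 * B $ j2 $ 1) * y $ 2 = 0" unfolding 1 2 by simp_all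
    then have "y $ 1 = 0" "y $ 2 = 0" using det by auto
    then show "z = 0" by (simp add: y vec_eq_iff matrix_vector_mult_2)
  qed (use j in simp)
  then obtain l :: "'d \<Rightarrow> rat" where l: "\<forall>k\<in>-{j1, j2}. (\<Sum>i\<in>UNIV. l i * of_int (A $ i $ k)) = (if k = j then 1 else 0)"
    by (rule exE)
  have "dotc (\<chi> i. of_rat (l i)) (cv (col k)) = (if k = j then 1 else 0)" if "k \<notin> {j1, j2}" for k
  proof -
    have "dotc (\<chi> i. of_rat (l i)) (cv (col k)) = of_rat (\<Sum>i\<in>UNIV. l i * of_int (A $ i $ k))"
      by (simp add: dotc_def cv_nth col_nth of_rat_sum of_rat_mult)
    then show ?thesis using l that by simp
  qed
  then show ?thesis by (intro exI[of _ "\<chi> i. of_rat (l i)"]) simp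
qed

text \<open>The entries of \<open>v\<close> are tuned to the quadrants: for every integral z one of
  the four rows of v + B z is negative, so the point is a hole in every direction of the remaining
  columns. Adding one of the four columns suffices to make one of v, v - B_1, v - B_2, v - B_1 - B_2
  nonnegative in these rows.\<close>

lemma gale_exceptional:
  assumes surj: "surj (\<lambda>u :: int ^ 'n. A *v u)" and gale: "gale_diagram A B"
    and dist: "distinct [j1, j2, j3, j4]"
    and q1: "B $ j1 $ 1 > 0" "B $ j1 $ 2 > 0" and q2: "B $ j2 $ 1 < 0" "B $ j2 $ 2 > 0"
    and q3: "B $ j3 $ 1 < 0" "B $ j3 $ 2 < 0" and q4: "B $ j4 $ 1 > 0" "B $ j4 $ 2 < 0"
    and v: "v $ j1 = B $ j1 $ 1 + B $ j1 $ 2 - 1" "v $ j2 = B $ j2 $ 2 - 1" "v $ j3 = - 1" "v $ j4 = B $ j4 $ 1 - 1"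
  shows "cv (A *v v) + (\<Sum>j\<in>-{j1, j2, j3, j4}. s j *s cv (col j)) \<in> exceptional_set i0 A"
proof -
  define F where "F = - {j1, j2, j3, j4}"
  have kF: "k = j1 \<or> k = j2 \<or> k = j3 \<or> k = j4 \<or> k \<in> F" for k by (auto simp: F_def)
  have nF: "j1 \<notin> F" "j2 \<notin> F" "j3 \<notin> F" "j4 \<notin> F" by (auto simp: F_def)
  have "B $ j1 $ 1 * B $ j2 $ 2 > 0" "B $ j1 $ 2 * B $ j2 $ 1 < 0"
    using q1 q2 by (simp_all add: mult_pos_neg)
  then have det: "B $ j1 $ 1 * B $ j2 $ 2 - B $ j1 $ 2 * B $ j2 $ 1 \<noteq> 0" by linarith
  obtain l1 where l1: "\<forall>k. k \<notin> {j1, j2} \<longrightarrow> dotc l1 (cv (col k)) = (if k = j3 then 1 else 0)"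
    by (rule exE[OF gale_functional[OF gale det, of j3]]) (use dist in auto)
  obtain l2 where l2: "\<forall>k. k \<notin> {j1, j2} \<longrightarrow> dotc l2 (cv (col k)) = (if k = j4 then 1 else 0)"
    by (rule exE[OF gale_functional[OF gale det, of j4]]) (use dist in auto)
  \<comment> \<open>Large enough that rows in \<open>F\<close> never obstruct any of the four
    translates. The shift runs along columns in \<open>F\<close> and is compensated by the
    parameters s.\<close>
  define M where "M = \<bar>\<Sum>k\<in>UNIV. \<bar>v $ k\<bar>\<bar> + (\<Sum>k\<in>UNIV. \<bar>B $ k $ 1\<bar> + \<bar>B $ k $ 2\<bar>)"
  have M: "M + v $ k \<ge> \<bar>B $ k $ 1\<bar> + \<bar>B $ k $ 2\<bar>" for k
  proof -
    have "\<bar>v $ k\<bar> \<le> (\<Sum>k\<in>UNIV. \<bar>v $ k\<bar>)" by (rule member_le_sum) auto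
    moreover have "\<bar>B $ k $ 1\<bar> + \<bar>B $ k $ 2\<bar> \<le> (\<Sum>k\<in>UNIV. \<bar>B $ k $ 1\<bar> + \<bar>B $ k $ 2\<bar>)"
      by (rule member_le_sum[of k UNIV "\<lambda>k. \<bar>B $ k $ 1\<bar> + \<bar>B $ k $ 2\<bar>"]) auto
    ultimately show ?thesis unfolding M_def by linarith
  qed
  define v0 where "v0 = (\<chi> k. if k \<in> F then M + v $ k else v $ k)"
  have v0: "v0 $ j1 = B $ j1 $ 1 + B $ j1 $ 2 - 1" "v0 $ j2 = B $ j2 $ 2 - 1" "v0 $ j3 = - 1" "v0 $ j4 = B $ j4 $ 1 - 1"
    using v nF by (simp_all add: v0_def)
  have v0F: "v0 $ k \<ge> 0 \<and> v0 $ k \<ge> B $ k $ 1 \<and> v0 $ k \<ge> B $ k $ 2 \<and> v0 $ k \<ge> B $ k $ 1 + B $ k $ 2" if "k \<in> F" for k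
  proof -
    have "v0 $ k \<ge> \<bar>B $ k $ 1\<bar> + \<bar>B $ k $ 2\<bar>" using M[of k] that by (simp add: v0_def)
    then show ?thesis by linarith
  qed
  have AB: "A *v (B *v z) = 0" for z by (rule gale_image[OF gale])
  have nearI: "A *v v0 + col j \<in> NA"
    if "\<And>k. v0 $ k + (if k = j then 1 else 0) + (B $ k $ 1 * z1 + B $ k $ 2 * z2) \<ge> 0" for j z1 z2
  proof -
    define z :: "int ^ 2" where "z = (\<chi> i. if i = 1 then z1 else z2)"
    have "A *v (v0 + axis j 1 + B *v z) \<in> NA"
      by (rule matrix_nonneg_in_NA) (use that in \<open>simp add: matrix_vector_mult_2 z_def axis_def\<close>)
    then show ?thesis by (simp add: matrix_vector_right_distrib AB matrix_axis)
  qed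
  show ?thesis
    unfolding F_def[symmetric]
  proof (rule exceptionalI[OF surj, where F = F and ?l1.0 = l1 and ?l2.0 = l2 and ?j3.0 = j3 and ?j4.0 = j4 and ?\<gamma>0.0 = "A *v v0" and s = "\<lambda>j. s j - of_int M"])
    show "dotc l1 (cv (col j)) = 0" "dotc l2 (cv (col j)) = 0" if "j \<in> F" for j
      using that l1 l2 by (auto simp: F_def)
    show "dotc l1 (cv (col j3)) = 1" "dotc l1 (cv (col j4)) = 0" "dotc l2 (cv (col j4)) = 1"
      using l1 l2 dist by auto
  next
    fix j assume "j \<notin> F"
    then consider "j = j1" | "j = j2" | "j = j3" | "j = j4" by (auto simp: F_def)
    \<comment> \<open>Witnesses z: (-1, -1) for \<open>j1\<close>, (0, -1) for \<open>j2\<close>,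
      (0, 0) for \<open>j3\<close>, (-1, 0) for \<open>j4\<close>. The row of the added column
      becomes exactly 0.\<close>
    then show "A *v v0 + col j \<in> NA"
    proof cases
      case 1
      show ?thesis
        apply (rule nearI[of j "-1" "-1"])
        subgoal for k using kF[of k] v0 v0F[of k] q1 q2 q3 q4 dist nF 1 by (elim disjE) auto
        done
    next
      case 2
      show ?thesis
        apply (rule nearI[of j 0 "-1"])
        subgoal for k using kF[of k] v0 v0F[of k] q1 q2 q3 q4 dist nF 2 by (elim disjE) auto
        done
    next
      case 3
      show ?thesis
        apply (rule nearI[of j 0 0])
        subgoal for k using kF[of k] v0 v0F[of k] q1 q2 q3 q4 dist nF 3 by (elim disjE) auto
        done
    next
      case 4
      show ?thesis
        apply (rule nearI[of j "-1" 0])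
        subgoal for k using kF[of k] v0 v0F[of k] q1 q2 q3 q4 dist nF 4 by (elim disjE) auto
        done
    qed
  next
    fix m :: "nat ^ 'n" assume m: "\<And>j. j \<notin> F \<Longrightarrow> m $ j = 0"
    show "A *v v0 + wt m \<notin> NA"
    proof
      assume "A *v v0 + wt m \<in> NA"
      then obtain n where "wt n = A *v v0 + wt m" by (auto simp: NA_def)
      then have "A *v (int_vec n - (v0 + int_vec m)) = 0"
        by (simp add: wt_def matrix_vector_right_distrib matrix_vector_mult_diff_distrib)
      from gale_kernel[OF gale this] obtain z where z: "int_vec n - (v0 + int_vec m) = B *v z" by (elim exE)
      have row: "v0 $ k + (B $ k $ 1 * z $ 1 + B $ k $ 2 * z $ 2) \<ge> 0" if "k \<notin> F" for k
      proof -
        have "(int_vec n - (v0 + int_vec m)) $ k = (B *v z) $ k" by (simp only: z)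
        then have "int (n $ k) = v0 $ k + (B $ k $ 1 * z $ 1 + B $ k $ 2 * z $ 2)"
          using m[OF that] by (simp add: int_vec_def matrix_vector_mult_2)
        then show ?thesis by linarith
      qed
      \<comment> \<open>By integrality the four shifted quadrants cover all z; in each of them the
        row lying in the opposite quadrant has value at most -1.\<close>
      consider "z $ 1 \<ge> 0" "z $ 2 \<ge> 0" | "z $ 1 \<ge> 0" "z $ 2 + 1 \<le> 0" | "z $ 1 + 1 \<le> 0" "z $ 2 \<ge> 0" | "z $ 1 + 1 \<le> 0" "z $ 2 + 1 \<le> 0"
        by linarith
      then show False
      proof cases
        case 1
        then have "B $ j3 $ 1 * z $ 1 \<le> 0" "B $ j3 $ 2 * z $ 2 \<le> 0" using q3 by (auto intro: mult_nonpos_nonneg)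
        then show False using row[OF nF(3)] v0 by linarith
      next
        case 2
        then have "B $ j2 $ 1 * z $ 1 \<le> 0" "B $ j2 $ 2 * (z $ 2 + 1) \<le> 0" using q2 by (auto intro: mult_nonpos_nonneg mult_nonneg_nonpos)
        then show False using row[OF nF(2)] v0 unfolding distrib_left by linarith
      next
        case 3
        then have "B $ j4 $ 1 * (z $ 1 + 1) \<le> 0" "B $ j4 $ 2 * z $ 2 \<le> 0" using q4 by (auto intro: mult_nonpos_nonneg mult_nonneg_nonpos)
        then show False using row[OF nF(4)] v0 unfolding distrib_left by linarith
      next
        case 4
        then have "B $ j1 $ 1 * (z $ 1 + 1) \<le> 0" "B $ j1 $ 2 * (z $ 2 + 1) \<le> 0" using q1 by (auto intro: mult_nonneg_nonpos)
        then show False using row[OF nF(1)] v0 unfolding distrib_left by linarith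
      qed
    qed
  next
    fix m n :: "nat ^ 'n" assume m: "\<And>j. j \<notin> F \<Longrightarrow> m $ j = 0" and w: "wt n = wt m"
    from w have "A *v (int_vec n - int_vec m) = 0"
      by (simp add: wt_def matrix_vector_mult_diff_distrib)
    from gale_kernel[OF gale this] obtain z where z: "int_vec n - int_vec m = B *v z" by (elim exE)
    have row: "B $ k $ 1 * z $ 1 + B $ k $ 2 * z $ 2 \<ge> 0" if "k \<notin> F" for k
    proof -
      have "(int_vec n - int_vec m) $ k = (B *v z) $ k" by (simp only: z)
      then show ?thesis using m[OF that] by (simp add: int_vec_def matrix_vector_mult_2)
    qed
    \<comment> \<open>Here the closed quadrants suffice: a nonzero z would make the row in the
      opposite quadrant strictly negative.\<close>
    consider "z $ 1 \<ge> 0" "z $ 2 \<ge> 0" | "z $ 1 \<ge> 0" "z $ 2 \<le> 0" | "z $ 1 \<le> 0" "z $ 2 \<ge> 0" | "z $ 1 \<le> 0" "z $ 2 \<le> 0"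
      by linarith
    then have "z $ 1 = 0 \<and> z $ 2 = 0"
    proof cases
      case 1 then show ?thesis using q3 by (intro int_both_zero[OF _ _ _ _ row[OF nF(3)]]) (auto intro: mult_nonpos_nonneg)
    next
      case 2 then show ?thesis using q2 by (intro int_both_zero[OF _ _ _ _ row[OF nF(2)]]) (auto intro: mult_nonpos_nonneg mult_nonneg_nonpos)
    next
      case 3 then show ?thesis using q4 by (intro int_both_zero[OF _ _ _ _ row[OF nF(4)]]) (auto intro: mult_nonpos_nonneg mult_nonneg_nonpos)
    next
      case 4 then show ?thesis using q1 by (intro int_both_zero[OF _ _ _ _ row[OF nF(1)]]) (auto intro: mult_nonneg_nonpos)
    qed
    then have "B *v z = 0" by (simp add: vec_eq_iff matrix_vector_mult_2)
    then show "n = m" using z by (simp add: vec_eq_iff int_vec_def)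
  next
    have "cv (A *v v0) = (\<Sum>j\<in>UNIV. of_int (v $ j) *s cv (col j) + (if j \<in> F then of_int M *s cv (col j) else 0))"
      unfolding cv_matrix by (intro sum.cong refl) (simp add: v0_def vector_sadd_rdistrib add.commute)
    also have "\<dots> = cv (A *v v) + (\<Sum>j\<in>F. of_int M *s cv (col j))"
      unfolding cv_matrix sum.distrib by (simp add: sum.inter_filter[symmetric])
    finally have "cv (A *v v0) + (\<Sum>j\<in>F. (s j - of_int M) *s cv (col j)) =
      cv (A *v v) + ((\<Sum>j\<in>F. of_int M *s cv (col j)) + (\<Sum>j\<in>F. (s j - of_int M) *s cv (col j)))" by (simp add: add.assoc)
    also have "\<dots> = cv (A *v v) + (\<Sum>j\<in>F. s j *s cv (col j))"
      unfolding sum.distrib[symmetric] vector_sadd_rdistrib[symmetric] by simp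
    finally show "cv (A *v v) + (\<Sum>j\<in>F. s j *s cv (col j)) = cv (A *v v0) + (\<Sum>j\<in>F. (s j - of_int M) *s cv (col j))" by simp
  qed
qed

lemma complex_matrix_vector: "map_matrix of_int A *v x = (\<Sum>j\<in>UNIV. x $ j *s cv (col j))"
  by (simp add: vec_eq_iff matrix_vector_mult_def map_matrix_def cv_nth col_nth mult.commute)

end

theorem theorem4p9:
  fixes A :: "int ^ 'n::finite ^ 'd::finite"
    and B :: "int ^ 2 ^ 'n"
    and i0 :: 'd
    and j1 j2 j3 j4 :: 'n
    and L :: "(complex ^ 'd) set"
  assumes "rank (map_matrix real_of_int A) = CARD('d)"
    and "CARD('n) = CARD('d) + 2"
    and "\<And>j. A $ i0 $ j = 1"
    and "surj (\<lambda>u :: int ^ 'n. A *v u)"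
    and "\<not> cohen_macaulay_ideal (toric_ideal A)"
    and "gale_diagram A B"
    and "distinct [j1, j2, j3, j4]"
    and "B $ j1 $ 1 > 0" "B $ j1 $ 2 > 0"
    and "B $ j2 $ 1 < 0" "B $ j2 $ 2 > 0"
    and "B $ j3 $ 1 < 0" "B $ j3 $ 2 < 0"
    and "B $ j4 $ 1 > 0" "B $ j4 $ 2 < 0"
    and "independent {row j2 (map_matrix real_of_int B), row j4 (map_matrix real_of_int B)} \<Longrightarrow>
           {z :: real ^ 2. (map_matrix real_of_int B *v z) $ j2 \<ge> 0 \<and>
                           (map_matrix real_of_int B *v z) $ j4 \<ge> 0}
             \<subseteq> {z. z $ 1 \<ge> 0 \<and> z $ 2 \<ge> 0}"
    and "CARD('n) > 4"
    and "L = {map_matrix of_int A *v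
      (of_int (B $ j1 $ 1 + B $ j1 $ 2 - 1) *s axis j1 1
       + of_int (B $ j2 $ 2 - 1) *s axis j2 1
       - axis j3 1
       + of_int (B $ j4 $ 1 - 1) *s axis j4 1
       + (\<Sum>i\<in>-{j1, j2, j3, j4}. s i *s axis i 1)) | s :: 'n \<Rightarrow> complex. True}"
  shows "vec.dim {x - y | x y. x \<in> L \<and> y \<in> L} = CARD('n) - 4
    \<and> L \<subseteq> exceptional_set i0 A
    \<and> infinite (exceptional_set i0 A)"
proof -
  interpret toric A i0 by unfold_locales (rule assms(3))
  define F where "F = - {j1, j2, j3, j4}"
  have nF: "j1 \<notin> F" "j2 \<notin> F" "j3 \<notin> F" "j4 \<notin> F" by (auto simp: F_def)
  have card: "card F = CARD('n) - 4"
    using assms(7) by (simp add: F_def Compl_eq_Diff_UNIV card_Diff_subset)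
  define v where "v = (\<chi> j. if j = j1 then B $ j1 $ 1 + B $ j1 $ 2 - 1 else if j = j2 then B $ j2 $ 2 - 1
    else if j = j3 then - 1 else if j = j4 then B $ j4 $ 1 - 1 else 0)"
  have v: "v $ j1 = B $ j1 $ 1 + B $ j1 $ 2 - 1" "v $ j2 = B $ j2 $ 2 - 1" "v $ j3 = - 1" "v $ j4 = B $ j4 $ 1 - 1"
    using assms(7) by (auto simp: v_def)
  define b where "b = cv (A *v v)"
  have L: "L = {b + (\<Sum>j\<in>F. s j *s cv (col j)) | s. True}"
  proof -
    have "map_matrix of_int A *v
      (of_int (B $ j1 $ 1 + B $ j1 $ 2 - 1) *s axis j1 1 + of_int (B $ j2 $ 2 - 1) *s axis j2 1
       - axis j3 1 + of_int (B $ j4 $ 1 - 1) *s axis j4 1 + (\<Sum>i\<in>-{j1, j2, j3, j4}. s i *s axis i 1))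
      = b + (\<Sum>j\<in>F. s j *s cv (col j))" for s :: "'n \<Rightarrow> complex"
    proof -
      let ?w = "of_int (B $ j1 $ 1 + B $ j1 $ 2 - 1) *s axis j1 1 + of_int (B $ j2 $ 2 - 1) *s axis j2 1
       - axis j3 1 + of_int (B $ j4 $ 1 - 1) *s axis j4 1 + (\<Sum>i\<in>F. s i *s axis i 1) :: complex ^ 'n"
      have sF: "(\<Sum>i\<in>F. s i *s axis i 1) $ j = (if j \<in> F then s j else 0)" for j
      proof -
        have "(\<Sum>i\<in>F. s i *s axis i 1) $ j = (\<Sum>i\<in>F. if i = j then s i else 0)"
          unfolding sum_component by (rule sum.cong) (auto simp: axis_def)
        then show ?thesis by simp
      qed
      have w: "?w $ j = of_int (v $ j) + (if j \<in> F then s j else 0)" for j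
        using assms(7) nF unfolding vector_add_component vector_minus_component sF
        by (auto simp: v_def axis_def)
      have "map_matrix of_int A *v ?w = (\<Sum>j\<in>UNIV. of_int (v $ j) *s cv (col j) + (if j \<in> F then s j *s cv (col j) else 0))"
        unfolding complex_matrix_vector w by (intro sum.cong refl) (simp add: vector_sadd_rdistrib)
      then show ?thesis unfolding F_def[symmetric] b_def cv_matrix sum.distrib by (simp add: sum.inter_filter[symmetric])
    qed
    then show ?thesis unfolding assms(18) by simp
  qed
  have "B $ j1 $ 1 * B $ j2 $ 2 > 0" "B $ j1 $ 2 * B $ j2 $ 1 < 0"
    using assms(8-11) by (simp_all add: mult_pos_neg)
  then have det: "B $ j1 $ 1 * B $ j2 $ 2 - B $ j1 $ 2 * B $ j2 $ 1 \<noteq> 0" by linarith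
  \<comment> \<open>Forms dual to the columns in \<open>F\<close> give both the dimension of
    \<open>L\<close> and its infinitude.\<close>
  have "\<forall>j\<in>F. \<exists>l. \<forall>k. k \<notin> {j1, j2} \<longrightarrow> dotc l (cv (col k)) = (if k = j then 1 else 0)"
    by (intro ballI gale_functional[OF assms(6) det]) (auto simp: F_def)
  from bchoice[OF this] obtain l where
    "\<forall>j\<in>F. \<forall>k. k \<notin> {j1, j2} \<longrightarrow> dotc (l j) (cv (col k)) = (if k = j then 1 else 0)" by (rule exE)
  then have l: "dotc (l j) (cv (col k)) = (if k = j then 1 else 0)" if "j \<in> F" "k \<in> F" for j k
    using that by (simp add: F_def)
  have "{x - y | x y. x \<in> L \<and> y \<in> L} = {\<Sum>j\<in>F. s j *s cv (col j) | s. True}"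
  proof (intro equalityI subsetI)
    fix z assume "z \<in> {x - y | x y. x \<in> L \<and> y \<in> L}"
    then obtain s t where "z = (b + (\<Sum>j\<in>F. s j *s cv (col j))) - (b + (\<Sum>j\<in>F. t j *s cv (col j)))"
      unfolding L by auto
    then have "z = (\<Sum>j\<in>F. (s j - t j) *s cv (col j))"
      by (simp add: sum_subtractf[symmetric] vector_ssub_ldistrib vec_eq_iff left_diff_distrib)
    then show "z \<in> {\<Sum>j\<in>F. s j *s cv (col j) | s. True}" by (intro CollectI exI[of _ "\<lambda>j. s j - t j"]) simp
  next
    fix z assume "z \<in> {\<Sum>j\<in>F. s j *s cv (col j) | s. True}"
    then obtain s where z: "z = (\<Sum>j\<in>F. s j *s cv (col j))" by auto
    have "b + (\<Sum>j\<in>F. s j *s cv (col j)) \<in> L" unfolding L by (intro CollectI exI[of _ s]) simp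
    moreover have "b + (\<Sum>j\<in>F. 0 *s cv (col j)) \<in> L" unfolding L by (intro CollectI exI[of _ "\<lambda>_. 0"]) simp
    ultimately show "z \<in> {x - y | x y. x \<in> L \<and> y \<in> L}"
      unfolding z by (intro CollectI exI conjI[rotated]) (assumption+, simp)
  qed
  moreover have "vec.dim {\<Sum>j\<in>F. s j *s cv (col j) | s. True} = card F"
    by (rule dim_span_dual[OF finite l])
  ultimately have dim: "vec.dim {x - y | x y. x \<in> L \<and> y \<in> L} = CARD('n) - 4" by (simp only: card)
  have exc: "L \<subseteq> exceptional_set i0 A"
  proof
    fix \<beta> assume "\<beta> \<in> L"
    then obtain s where "\<beta> = b + (\<Sum>j\<in>F. s j *s cv (col j))" unfolding L by auto
    then show "\<beta> \<in> exceptional_set i0 A"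
      using gale_exceptional[OF assms(4,6,7,8-15) v, of s] unfolding b_def F_def by simp
  qed
  have "F \<noteq> {}" using card assms(17) by auto
  then obtain f where f: "f \<in> F" by auto
  have "infinite L" unfolding L by (rule infinite_line[OF finite f l[OF f]])
  then show ?thesis using dim exc infinite_super[OF exc] by simp
qed

end
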